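(* Let $\mu\le\lambda$ be regular cardinals, let $\mathcal{V}$ be locally $\lambda$-presentable as a symmetric monoidal closed category, with unit $I$, such that $\mathcal{V}_0(I,-):\mathcal{V}_0\to\mathbf{Set}$ preserves $\lambda$-presentable objects. Let $\mathcal{T}$ be a discrete $\lambda$-ary $\mathcal{V}$-theory, and assume that $(\mathit{Surj},\mathit{Inj})$ is a proper $\mu$-convenient factorization system in $\mathcal{V}_0$. Assume moreover that $\mathcal{V}_0$ is $\mathit{Inj}$-locally $\mu$-generated and strongly connected, and that the forgetful functor $U:\mathbf{Alg}(\mathcal{T})\to\mathcal{V}$ preserves $\mu$-directed colimits of injections. Let $\mathcal{L}$ be a full replete subcategory of $\mathbf{Alg}(\mathcal{T})$. Then $\mathcal{L}$ is a $\mu$-Birkhoff subcategory of $\mathbf{Alg}(\mathcal{T})$ if and only if $\mathcal{L}=\mathbf{Alg}(E)$ for some $\mathcal{T}$-equational theory $E$ such that all equations $p=q$ from $E$ have $p,q:FY\to FX$ with $X$ and $Y$ being $\mu$-generated with respect to $\mathit{Inj}$.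
   Context: $\mathcal{V}_0$ is the underlying category of $\mathcal{V}$. "Locally $\lambda$-presentable as a symmetric monoidal closed category" means: $\mathcal{V}_0$ is locally $\lambda$-presentable, $I$ is $\lambda$-presentable, and $X\otimes Y$ is $\lambda$-presentable whenever $X,Y$ are. $\mathcal{V}_\lambda$ is the (representative) small full subcategory of $\lambda$-presentable objects, with inclusion $K:\mathcal{V}_\lambda\to\mathcal{V}$. A category $\mathcal{K}$ is strongly connected if for every pair of objects $K,K'$ of $\mathcal{K}$ with $K'$ not initial there is a morphism $K\to K'$. Surjections and injections: a morphism $f$ of $\mathcal{V}_0$ is a surjection if $\mathcal{V}_0(I,f)$ is surjective; $\mathit{Surj}$ is the class of surjections, and $\mathit{Inj}$ (injections) is the class of morphisms of $\mathcal{V}_0$ having the unique right lifting property with respect to every surjection. A morphism $f$ of $\mathbf{Alg}(\mathcal{T})$ is called an injection if $U(f)$ is an injection. The factorization system $(\mathit{Surj},\mathit{Inj})$ is proper if surjections are epimorphisms and injections are monomorphisms. It is $\mu$-convenient if (1) every object of $\mathcal{V}_0$ has only a set of surjective quotients, and (2) $\mathit{Inj}$ is closed under $\mu$-directed colimits: for every $\mu$-directed diagram of injections, the colimit cocone consists of injections, and for every cocone of injections the factorizing morphism from the colimit is an injection. Generated objects: an object $V$ is $\mu$-generated with respect to $\mathit{Inj}$ if $\mathcal{V}_0(V,-):\mathcal{V}_0\to\mathbf{Set}$ preserves $\mu$-directed colimits of injections (colimits of $\mu$-directed diagrams whose connecting morphisms are injections). $\mathcal{V}_0$ is $\mathit{Inj}$-locally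 $\mu$-generated if it has a set $\mathcal{X}$ of $\mu$-generated objects such that every object of $\mathcal{V}_0$ is a $\mu$-directed colimit of objects from $\mathcal{X}$ and injections. A morphism $f:A\to B$ in $\mathcal{V}_0$ is a $\mu$-pure epimorphism if for every $\mu$-generated object $X$, every morphism $X\to B$ factors through $f$. Theories: a $\mathcal{V}_\lambda$-pretheory is an identity-on-objects $\mathcal{V}$-functor $J:\mathcal{V}_\lambda\to\mathcal{T}$. A $\mathcal{T}$-algebra is an object $A$ of $\mathcal{V}$ with a $\mathcal{V}$-functor $\hat A:\mathcal{T}^{\mathrm{op}}\to\mathcal{V}$ such that $\hat A J^{\mathrm{op}}=\mathcal{V}(K-,A)$; these form a $\mathcal{V}$-category $\mathbf{Alg}(\mathcal{T})$ (the pullback of $[\mathcal{T}^{\mathrm{op}},\mathcal{V}]\to[\mathcal{V}_\lambda^{\mathrm{op}},\mathcal{V}]$ along $A\mapsto\mathcal{V}(K-,A)$), with monadic forgetful $\mathcal{V}$-functor $U:\mathbf{Alg}(\mathcal{T})\to\mathcal{V}$ with left $\mathcal{V}$-adjoint $F$ and induced $\mathcal{V}$-monad $T=UF$. A $\mathcal{V}$-monad induces a pretheory given by the full subcategory of its algebras on free algebras on objects of $\mathcal{V}_\lambda$ together with the restricted free algebra functor. A pretheory is a $\lambda$-ary $\mathcal{V}$-theory if it is (up to isomorphism) the one induced by its induced monad. For an object $X$ let $X_0=\mathcal{V}_0(I,X)\cdot I$ (coproduct of $\mathcal{V}_0(I,X)$ copies of $I$) and let $\delta_X:X_0\to X$ be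 the canonical morphism. The theory is discrete if for each $X$ in $\mathcal{V}_\lambda$ every morphism $JI\to JX$ of $\mathcal{T}$ is a composite $J(\delta_X)f$ for some $f:JI\to JX_0$. Let $\mathbf{Alg}(\mathcal{T})_0$ be the underlying category and $U_0:\mathbf{Alg}(\mathcal{T})_0\to\mathcal{V}_0$ the underlying functor of $U$. A Birkhoff subcategory of $\mathbf{Alg}(\mathcal{T})$ is a full replete subcategory of $\mathbf{Alg}(\mathcal{T})_0$ closed under products, subalgebras (if $A\to B$ is a monomorphism in $\mathbf{Alg}(\mathcal{T})_0$ and $B$ is in the subcategory then so is $A$) and $U_0$-split quotients (if $g:A\to B$ is such that $U_0(g)$ is a split epimorphism and $A$ is in the subcategory then so is $B$). It is a $\mu$-Birkhoff subcategory if moreover it is closed under quotients $f:A\to B$ such that $Uf$ is a $\mu$-pure epimorphism. Equations: a $\mathcal{T}$-equation $p=q$ is a pair of morphisms $p,q:FY\to FX$ in $\mathbf{Alg}(\mathcal{T})$, with $X,Y$ objects of $\mathcal{V}$. A $\mathcal{T}$-equational theory $E$ is a set of $\mathcal{T}$-equations. A $\mathcal{T}$-algebra $A$ satisfies $p=q$ if $hp=hq$ for every morphism $h:FX\to A$; $\mathbf{Alg}(E)$ is the full subcategory of $\mathbf{Alg}(\mathcal{T})_0$ of the algebras satisfying all equations of $E$. *)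

theory Defs
  imports Main "HOL-Library.FuncSet"
begin

unbundle cardinal_syntax

section \<open>Size\<close>

text \<open>
  Smallness is relative to a universe, given by a strongly inaccessible cardinal \<open>\<kappa>\<close>: a set of any
  type is small if its cardinality is below \<open>\<kappa>\<close>. Every small set is in bijection with a subset of the
  type \<open>'u\<close> that carries \<open>\<kappa>\<close>, so indexing sets of small diagrams are taken inside \<open>'u\<close>.
\<close>

definition inaccessible :: "'u rel \<Rightarrow> bool" where
  "inaccessible \<kappa> \<longleftrightarrow> Card_order \<kappa> \<and> natLeq <o \<kappa> \<and> regularCard \<kappa> \<and>
     (\<forall>A :: 'u set. |A| <o \<kappa> \<longrightarrow> |Pow A| <o \<kappa>)"

definition small :: "'u rel \<Rightarrow> 'b set \<Rightarrow> bool" where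
  "small \<kappa> A \<longleftrightarrow> |A| <o \<kappa>"

definition regular_cardinal :: "'r rel \<Rightarrow> bool" where
  "regular_cardinal \<rho> \<longleftrightarrow> Card_order \<rho> \<and> cinfinite \<rho> \<and> regularCard \<rho>"

text \<open>The empty subset is included among the \<open>S\<close>, so directed posets are nonempty.\<close>

definition directed_poset :: "'u rel \<Rightarrow> 'r rel \<Rightarrow> 'u rel \<Rightarrow> bool" where
  "directed_poset \<kappa> \<rho> R \<longleftrightarrow> Partial_order R \<and> small \<kappa> (Field R) \<and>
     (\<forall>S \<subseteq> Field R. |S| <o \<rho> \<longrightarrow> (\<exists>b \<in> Field R. \<forall>s \<in> S. (s, b) \<in> R))"


section \<open>Ordinary categories\<close>

record ('o, 'a) cat =
  Obj :: "'o set"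
  Arr :: "'a set"
  Dom :: "'a \<Rightarrow> 'o"
  Cod :: "'a \<Rightarrow> 'o"
  Cmp :: "'a \<Rightarrow> 'a \<Rightarrow> 'a" (infixr \<open>\<cdot>\<index>\<close> 65)
  Idn :: "'o \<Rightarrow> 'a"

definition Hom :: "('o, 'a, 'z) cat_scheme \<Rightarrow> 'o \<Rightarrow> 'o \<Rightarrow> 'a set" where
  "Hom C X Y = {f \<in> Arr C. Dom C f = X \<and> Cod C f = Y}"

locale category =
  fixes C :: "('o, 'a, 'z) cat_scheme" (structure)
  assumes Dom_Obj: "f \<in> Arr C \<Longrightarrow> Dom C f \<in> Obj C"
    and Cod_Obj: "f \<in> Arr C \<Longrightarrow> Cod C f \<in> Obj C"
    and Idn_Hom: "X \<in> Obj C \<Longrightarrow> Idn C X \<in> Hom C X X"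
    and Cmp_Hom: "f \<in> Hom C X Y \<Longrightarrow> g \<in> Hom C Y Z \<Longrightarrow> g \<cdot> f \<in> Hom C X Z"
    and Cmp_Idn: "f \<in> Hom C X Y \<Longrightarrow> f \<cdot> Idn C X = f"
    and Idn_Cmp: "f \<in> Hom C X Y \<Longrightarrow> Idn C Y \<cdot> f = f"
    and Cmp_assoc: "f \<in> Hom C W X \<Longrightarrow> g \<in> Hom C X Y \<Longrightarrow> h \<in> Hom C Y Z \<Longrightarrow>
          (h \<cdot> g) \<cdot> f = h \<cdot> (g \<cdot> f)"

definition locally_small :: "'u rel \<Rightarrow> ('o, 'a, 'z) cat_scheme \<Rightarrow> bool" where
  "locally_small \<kappa> C \<longleftrightarrow> (\<forall>X \<in> Obj C. \<forall>Y \<in> Obj C. small \<kappa> (Hom C X Y))"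

definition inverse_arrows :: "('o, 'a, 'z) cat_scheme \<Rightarrow> 'a \<Rightarrow> 'a \<Rightarrow> bool" where
  "inverse_arrows C f g \<longleftrightarrow> f \<in> Arr C \<and> g \<in> Hom C (Cod C f) (Dom C f) \<and>
     g \<cdot>\<^bsub>C\<^esub> f = Idn C (Dom C f) \<and> f \<cdot>\<^bsub>C\<^esub> g = Idn C (Cod C f)"

definition iso_arrow :: "('o, 'a, 'z) cat_scheme \<Rightarrow> 'a \<Rightarrow> bool" where
  "iso_arrow C f \<longleftrightarrow> (\<exists>g. inverse_arrows C f g)"

definition inverse_of :: "('o, 'a, 'z) cat_scheme \<Rightarrow> 'a \<Rightarrow> 'a" where
  "inverse_of C f = (THE g. inverse_arrows C f g)"

definition isomorphic :: "('o, 'a, 'z) cat_scheme \<Rightarrow> 'o \<Rightarrow> 'o \<Rightarrow> bool" where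
  "isomorphic C X Y \<longleftrightarrow> (\<exists>f \<in> Hom C X Y. iso_arrow C f)"

definition mono_arrow :: "('o, 'a, 'z) cat_scheme \<Rightarrow> 'a \<Rightarrow> bool" where
  "mono_arrow C m \<longleftrightarrow> m \<in> Arr C \<and>
     (\<forall>W. \<forall>u \<in> Hom C W (Dom C m). \<forall>v \<in> Hom C W (Dom C m). m \<cdot>\<^bsub>C\<^esub> u = m \<cdot>\<^bsub>C\<^esub> v \<longrightarrow> u = v)"

definition epi_arrow :: "('o, 'a, 'z) cat_scheme \<Rightarrow> 'a \<Rightarrow> bool" where
  "epi_arrow C e \<longleftrightarrow> e \<in> Arr C \<and>
     (\<forall>W. \<forall>u \<in> Hom C (Cod C e) W. \<forall>v \<in> Hom C (Cod C e) W. u \<cdot>\<^bsub>C\<^esub> e = v \<cdot>\<^bsub>C\<^esub> e \<longrightarrow> u = v)"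

definition split_epi :: "('o, 'a, 'z) cat_scheme \<Rightarrow> 'a \<Rightarrow> bool" where
  "split_epi C e \<longleftrightarrow> e \<in> Arr C \<and> (\<exists>s \<in> Hom C (Cod C e) (Dom C e). e \<cdot>\<^bsub>C\<^esub> s = Idn C (Cod C e))"

definition initial_object :: "('o, 'a, 'z) cat_scheme \<Rightarrow> 'o \<Rightarrow> bool" where
  "initial_object C X \<longleftrightarrow> X \<in> Obj C \<and> (\<forall>Y \<in> Obj C. \<exists>!f. f \<in> Hom C X Y)"

definition strongly_connected :: "('o, 'a, 'z) cat_scheme \<Rightarrow> bool" where
  "strongly_connected C \<longleftrightarrow>
     (\<forall>K \<in> Obj C. \<forall>K' \<in> Obj C. \<not> initial_object C K' \<longrightarrow> Hom C K K' \<noteq> {})"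

record ('o, 'a, 'p, 'b) func =
  FOb :: "'o \<Rightarrow> 'p"
  FAr :: "'a \<Rightarrow> 'b"

definition is_functor ::
  "('o, 'a, 'y) cat_scheme \<Rightarrow> ('p, 'b, 'z) cat_scheme \<Rightarrow> ('o, 'a, 'p, 'b) func \<Rightarrow> bool" where
  "is_functor C D F \<longleftrightarrow> category C \<and> category D \<and>
     (\<forall>X \<in> Obj C. FOb F X \<in> Obj D \<and> FAr F (Idn C X) = Idn D (FOb F X)) \<and>
     (\<forall>f \<in> Arr C. FAr F f \<in> Hom D (FOb F (Dom C f)) (FOb F (Cod C f))) \<and>
     (\<forall>f \<in> Arr C. \<forall>g \<in> Arr C. Dom C g = Cod C f \<longrightarrow> FAr F (g \<cdot>\<^bsub>C\<^esub> f) = FAr F g \<cdot>\<^bsub>D\<^esub> FAr F f)"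

definition func_comp :: "('p, 'b, 'q, 'c) func \<Rightarrow> ('o, 'a, 'p, 'b) func \<Rightarrow> ('o, 'a, 'q, 'c) func" where
  "func_comp G F = \<lparr>FOb = FOb G \<circ> FOb F, FAr = FAr G \<circ> FAr F\<rparr>"

definition poset_cat :: "'u rel \<Rightarrow> ('u, 'u \<times> 'u) cat" where
  "poset_cat R = \<lparr>Obj = Field R, Arr = R, Dom = fst, Cod = snd,
     Cmp = (\<lambda>g f. (fst f, snd g)), Idn = (\<lambda>x. (x, x))\<rparr>"


subsection \<open>Limits and colimits\<close>

definition cocone :: "('o, 'a, 'z) cat_scheme \<Rightarrow> ('j, 'k) cat \<Rightarrow> ('j, 'k, 'o, 'a) func \<Rightarrow>
    'o \<Rightarrow> ('j \<Rightarrow> 'a) \<Rightarrow> bool" where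
  "cocone C D F Q \<iota> \<longleftrightarrow> Q \<in> Obj C \<and> (\<forall>j \<in> Obj D. \<iota> j \<in> Hom C (FOb F j) Q) \<and>
     (\<forall>f \<in> Arr D. \<iota> (Cod D f) \<cdot>\<^bsub>C\<^esub> FAr F f = \<iota> (Dom D f))"

definition is_colimit :: "('o, 'a, 'z) cat_scheme \<Rightarrow> ('j, 'k) cat \<Rightarrow> ('j, 'k, 'o, 'a) func \<Rightarrow>
    'o \<Rightarrow> ('j \<Rightarrow> 'a) \<Rightarrow> bool" where
  "is_colimit C D F Q \<iota> \<longleftrightarrow> cocone C D F Q \<iota> \<and>
     (\<forall>Q' \<iota>'. cocone C D F Q' \<iota>' \<longrightarrow>
        (\<exists>!h. h \<in> Hom C Q Q' \<and> (\<forall>j \<in> Obj D. h \<cdot>\<^bsub>C\<^esub> \<iota> j = \<iota>' j)))"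

definition preserves_colimits_of :: "('o, 'a, 'y) cat_scheme \<Rightarrow> ('p, 'b, 'z) cat_scheme \<Rightarrow>
    ('o, 'a, 'p, 'b) func \<Rightarrow> ('j, 'k) cat \<Rightarrow> ('j, 'k, 'o, 'a) func \<Rightarrow> bool" where
  "preserves_colimits_of C C' G D F \<longleftrightarrow>
     (\<forall>Q \<iota>. is_colimit C D F Q \<iota> \<longrightarrow> is_colimit C' D (func_comp G F) (FOb G Q) (\<lambda>j. FAr G (\<iota> j)))"

definition cocomplete :: "'u rel \<Rightarrow> ('o, 'a, 'z) cat_scheme \<Rightarrow> bool" where
  "cocomplete \<kappa> C \<longleftrightarrow>
     (\<forall>(D :: ('u, 'u) cat) F. small \<kappa> (Obj D) \<and> small \<kappa> (Arr D) \<and> is_functor D C F \<longrightarrow>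
        (\<exists>Q \<iota>. is_colimit C D F Q \<iota>))"

definition is_product :: "('o, 'a, 'z) cat_scheme \<Rightarrow> 'i set \<Rightarrow> ('i \<Rightarrow> 'o) \<Rightarrow>
    'o \<Rightarrow> ('i \<Rightarrow> 'a) \<Rightarrow> bool" where
  "is_product C I A Q p \<longleftrightarrow> Q \<in> Obj C \<and> (\<forall>i \<in> I. p i \<in> Hom C Q (A i)) \<and>
     (\<forall>Q' \<in> Obj C. \<forall>p'. (\<forall>i \<in> I. p' i \<in> Hom C Q' (A i)) \<longrightarrow>
        (\<exists>!h. h \<in> Hom C Q' Q \<and> (\<forall>i \<in> I. p i \<cdot>\<^bsub>C\<^esub> h = p' i)))"

definition is_coproduct :: "('o, 'a, 'z) cat_scheme \<Rightarrow> 'i set \<Rightarrow> ('i \<Rightarrow> 'o) \<Rightarrow>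
    'o \<Rightarrow> ('i \<Rightarrow> 'a) \<Rightarrow> bool" where
  "is_coproduct C I A Q \<iota> \<longleftrightarrow> Q \<in> Obj C \<and> (\<forall>i \<in> I. \<iota> i \<in> Hom C (A i) Q) \<and>
     (\<forall>Q' \<in> Obj C. \<forall>\<iota>'. (\<forall>i \<in> I. \<iota>' i \<in> Hom C (A i) Q') \<longrightarrow>
        (\<exists>!h. h \<in> Hom C Q Q' \<and> (\<forall>i \<in> I. h \<cdot>\<^bsub>C\<^esub> \<iota> i = \<iota>' i)))"

definition is_equalizer :: "('o, 'a, 'z) cat_scheme \<Rightarrow> 'a \<Rightarrow> 'a \<Rightarrow> 'a \<Rightarrow> bool" where
  "is_equalizer C f g e \<longleftrightarrow> e \<in> Arr C \<and> Cod C e = Dom C f \<and> f \<cdot>\<^bsub>C\<^esub> e = g \<cdot>\<^bsub>C\<^esub> e \<and>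
     (\<forall>W. \<forall>u \<in> Hom C W (Dom C f). f \<cdot>\<^bsub>C\<^esub> u = g \<cdot>\<^bsub>C\<^esub> u \<longrightarrow>
        (\<exists>!h. h \<in> Hom C W (Dom C e) \<and> e \<cdot>\<^bsub>C\<^esub> h = u))"

definition is_pullback :: "('o, 'a, 'z) cat_scheme \<Rightarrow> 'a \<Rightarrow> 'a \<Rightarrow> 'a \<Rightarrow> 'a \<Rightarrow> bool" where
  "is_pullback C f g p q \<longleftrightarrow>
     p \<in> Arr C \<and> q \<in> Arr C \<and> Dom C p = Dom C q \<and> Cod C p = Dom C f \<and> Cod C q = Dom C g \<and>
     f \<cdot>\<^bsub>C\<^esub> p = g \<cdot>\<^bsub>C\<^esub> q \<and>
     (\<forall>W. \<forall>u \<in> Hom C W (Dom C f). \<forall>v \<in> Hom C W (Dom C g). f \<cdot>\<^bsub>C\<^esub> u = g \<cdot>\<^bsub>C\<^esub> v \<longrightarrow>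
        (\<exists>!h. h \<in> Hom C W (Dom C p) \<and> p \<cdot>\<^bsub>C\<^esub> h = u \<and> q \<cdot>\<^bsub>C\<^esub> h = v))"


subsection \<open>The category of small sets; presentable and generated objects\<close>

text \<open>
  Small sets with elements in the type \<open>'e\<close>. This is equivalent to the category of all small sets
  whenever \<open>'e\<close> has at least \<open>\<kappa>\<close> elements, e.g. if \<open>'e\<close> is the type carrying \<open>\<kappa>\<close>, or a
  larger one.
\<close>

type_synonym 'e set_arrow = "'e set \<times> ('e \<Rightarrow> 'e) \<times> 'e set"

definition Set_cat :: "'u rel \<Rightarrow> ('e set, 'e set_arrow) cat" where
  "Set_cat \<kappa> = \<lparr>Obj = {A. small \<kappa> A},
     Arr = {(A, f, B). small \<kappa> A \<and> small \<kappa> B \<and> f \<in> A \<rightarrow>\<^sub>E B},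
     Dom = (\<lambda>(A, f, B). A), Cod = (\<lambda>(A, f, B). B),
     Cmp = (\<lambda>(B', g, D) (A, f, B). (A, compose A g f, D)),
     Idn = (\<lambda>A. (A, \<lambda>x \<in> A. x, A))\<rparr>"

definition hom_functor :: "('o, 'a, 'z) cat_scheme \<Rightarrow> 'o \<Rightarrow> ('o, 'a, 'a set, 'a set_arrow) func" where
  "hom_functor C X = \<lparr>FOb = Hom C X,
     FAr = (\<lambda>f. (Hom C X (Dom C f), \<lambda>u \<in> Hom C X (Dom C f). f \<cdot>\<^bsub>C\<^esub> u, Hom C X (Cod C f)))\<rparr>"

definition presentable_object ::
  "'u rel \<Rightarrow> 'r rel \<Rightarrow> ('o, 'a, 'z) cat_scheme \<Rightarrow> 'o \<Rightarrow> bool" where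
  "presentable_object \<kappa> \<rho> C X \<longleftrightarrow> X \<in> Obj C \<and>
     (\<forall>R F. directed_poset \<kappa> \<rho> R \<and> is_functor (poset_cat R) C F \<longrightarrow>
        preserves_colimits_of C (Set_cat \<kappa>) (hom_functor C X) (poset_cat R) F)"

definition locally_presentable :: "'u rel \<Rightarrow> 'r rel \<Rightarrow> ('o, 'a, 'z) cat_scheme \<Rightarrow> bool" where
  "locally_presentable \<kappa> \<rho> C \<longleftrightarrow> category C \<and> locally_small \<kappa> C \<and> cocomplete \<kappa> C \<and>
     (\<exists>\<X>. small \<kappa> \<X> \<and> (\<forall>X \<in> \<X>. presentable_object \<kappa> \<rho> C X) \<and>
        (\<forall>A \<in> Obj C. \<exists>R F \<iota>. directed_poset \<kappa> \<rho> R \<and> is_functor (poset_cat R) C F \<and>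
           (\<forall>j \<in> Field R. FOb F j \<in> \<X>) \<and> is_colimit C (poset_cat R) F A \<iota>))"

definition directed_diagram_in :: "'u rel \<Rightarrow> 'r rel \<Rightarrow> ('o, 'a, 'z) cat_scheme \<Rightarrow> 'a set \<Rightarrow>
    'u rel \<Rightarrow> ('u, 'u \<times> 'u, 'o, 'a) func \<Rightarrow> bool" where
  "directed_diagram_in \<kappa> \<rho> C M R F \<longleftrightarrow> directed_poset \<kappa> \<rho> R \<and> is_functor (poset_cat R) C F \<and>
     (\<forall>f \<in> R. FAr F f \<in> M)"

definition generated_object ::
  "'u rel \<Rightarrow> 'r rel \<Rightarrow> ('o, 'a, 'z) cat_scheme \<Rightarrow> 'a set \<Rightarrow> 'o \<Rightarrow> bool" where
  "generated_object \<kappa> \<rho> C M X \<longleftrightarrow> X \<in> Obj C \<and>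
     (\<forall>R F. directed_diagram_in \<kappa> \<rho> C M R F \<longrightarrow>
        preserves_colimits_of C (Set_cat \<kappa>) (hom_functor C X) (poset_cat R) F)"

definition locally_generated ::
  "'u rel \<Rightarrow> 'r rel \<Rightarrow> ('o, 'a, 'z) cat_scheme \<Rightarrow> 'a set \<Rightarrow> bool" where
  "locally_generated \<kappa> \<rho> C M \<longleftrightarrow>
     (\<exists>\<X>. small \<kappa> \<X> \<and> (\<forall>X \<in> \<X>. generated_object \<kappa> \<rho> C M X) \<and>
        (\<forall>A \<in> Obj C. \<exists>R F \<iota>. directed_diagram_in \<kappa> \<rho> C M R F \<and>
           (\<forall>j \<in> Field R. FOb F j \<in> \<X>) \<and> is_colimit C (poset_cat R) F A \<iota>))"

definition pure_epi ::
  "'u rel \<Rightarrow> 'r rel \<Rightarrow> ('o, 'a, 'z) cat_scheme \<Rightarrow> 'a set \<Rightarrow> 'a \<Rightarrow> bool" where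
  "pure_epi \<kappa> \<rho> C M f \<longleftrightarrow> f \<in> Arr C \<and>
     (\<forall>X. generated_object \<kappa> \<rho> C M X \<longrightarrow>
        (\<forall>g \<in> Hom C X (Cod C f). \<exists>h \<in> Hom C X (Dom C f). f \<cdot>\<^bsub>C\<^esub> h = g))"


subsection \<open>Factorization systems\<close>

definition unique_lifting :: "('o, 'a, 'z) cat_scheme \<Rightarrow> 'a \<Rightarrow> 'a \<Rightarrow> bool" where
  "unique_lifting C e m \<longleftrightarrow>
     (\<forall>u \<in> Hom C (Dom C e) (Dom C m). \<forall>v \<in> Hom C (Cod C e) (Cod C m).
        m \<cdot>\<^bsub>C\<^esub> u = v \<cdot>\<^bsub>C\<^esub> e \<longrightarrow>
        (\<exists>!d. d \<in> Hom C (Cod C e) (Dom C m) \<and> d \<cdot>\<^bsub>C\<^esub> e = u \<and> m \<cdot>\<^bsub>C\<^esub> d = v))"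

definition factorization_system :: "('o, 'a, 'z) cat_scheme \<Rightarrow> 'a set \<Rightarrow> 'a set \<Rightarrow> bool" where
  "factorization_system C E M \<longleftrightarrow> E \<subseteq> Arr C \<and> M \<subseteq> Arr C \<and>
     (\<forall>e \<in> E. \<forall>i \<in> Arr C. iso_arrow C i \<and> Dom C i = Cod C e \<longrightarrow> i \<cdot>\<^bsub>C\<^esub> e \<in> E) \<and>
     (\<forall>m \<in> M. \<forall>i \<in> Arr C. iso_arrow C i \<and> Cod C i = Dom C m \<longrightarrow> m \<cdot>\<^bsub>C\<^esub> i \<in> M) \<and>
     (\<forall>f \<in> Arr C. \<exists>e \<in> E. \<exists>m \<in> M. Dom C e = Dom C f \<and> Cod C e = Dom C m \<and> Cod C m = Cod C f \<and>
        f = m \<cdot>\<^bsub>C\<^esub> e) \<and>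
     (\<forall>e \<in> E. \<forall>m \<in> M. unique_lifting C e m)"

definition proper_system :: "('o, 'a, 'z) cat_scheme \<Rightarrow> 'a set \<Rightarrow> 'a set \<Rightarrow> bool" where
  "proper_system C E M \<longleftrightarrow> (\<forall>e \<in> E. epi_arrow C e) \<and> (\<forall>m \<in> M. mono_arrow C m)"

definition convenient_system ::
  "'u rel \<Rightarrow> 'r rel \<Rightarrow> ('o, 'a, 'z) cat_scheme \<Rightarrow> 'a set \<Rightarrow> 'a set \<Rightarrow> bool" where
  "convenient_system \<kappa> \<rho> C E M \<longleftrightarrow>
     (\<forall>A \<in> Obj C. \<exists>S. small \<kappa> S \<and> S \<subseteq> {e \<in> E. Dom C e = A} \<and>
        (\<forall>e \<in> E. Dom C e = A \<longrightarrow>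
           (\<exists>e' \<in> S. \<exists>i \<in> Hom C (Cod C e) (Cod C e'). iso_arrow C i \<and> i \<cdot>\<^bsub>C\<^esub> e = e'))) \<and>
     (\<forall>R F Q \<iota>. directed_diagram_in \<kappa> \<rho> C M R F \<and> is_colimit C (poset_cat R) F Q \<iota> \<longrightarrow>
        (\<forall>j \<in> Field R. \<iota> j \<in> M) \<and>
        (\<forall>Q' \<iota>' h. cocone C (poset_cat R) F Q' \<iota>' \<and> (\<forall>j \<in> Field R. \<iota>' j \<in> M) \<and>
           h \<in> Hom C Q Q' \<and> (\<forall>j \<in> Field R. h \<cdot>\<^bsub>C\<^esub> \<iota> j = \<iota>' j) \<longrightarrow> h \<in> M))"


section \<open>Symmetric monoidal closed categories\<close>

text \<open>
  \<open>X \<otimes> Y\<close> is the tensor product of objects, \<open>f \<odot> g\<close> that of morphisms; \<open>ihom X Y\<close> is the internal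
  hom \<open>[X, Y]\<close>. The record extends that of categories, so the underlying category of \<open>V\<close> is
  \<open>V\<close> itself.
\<close>

record ('o, 'a) smc = "('o, 'a) cat" +
  TOb :: "'o \<Rightarrow> 'o \<Rightarrow> 'o" (infixr \<open>\<otimes>\<index>\<close> 72)
  TAr :: "'a \<Rightarrow> 'a \<Rightarrow> 'a" (infixr \<open>\<odot>\<index>\<close> 72)
  One :: "'o"
  assoc :: "'o \<Rightarrow> 'o \<Rightarrow> 'o \<Rightarrow> 'a"
  lunit :: "'o \<Rightarrow> 'a"
  runit :: "'o \<Rightarrow> 'a"
  symm :: "'o \<Rightarrow> 'o \<Rightarrow> 'a"
  ihom :: "'o \<Rightarrow> 'o \<Rightarrow> 'o"
  eval_arrow :: "'o \<Rightarrow> 'o \<Rightarrow> 'a"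

locale sym_monoidal_closed = category V for V :: "('o, 'a) smc" (structure) +
  assumes One_Obj: "One V \<in> Obj V"
    and TOb_Obj: "X \<in> Obj V \<Longrightarrow> Y \<in> Obj V \<Longrightarrow> X \<otimes> Y \<in> Obj V"
    and TAr_Hom: "f \<in> Hom V X X' \<Longrightarrow> g \<in> Hom V Y Y' \<Longrightarrow> f \<odot> g \<in> Hom V (X \<otimes> Y) (X' \<otimes> Y')"
    and TAr_Idn: "X \<in> Obj V \<Longrightarrow> Y \<in> Obj V \<Longrightarrow> Idn V X \<odot> Idn V Y = Idn V (X \<otimes> Y)"
    and TAr_Cmp: "f \<in> Hom V X X' \<Longrightarrow> f' \<in> Hom V X' X'' \<Longrightarrow> g \<in> Hom V Y Y' \<Longrightarrow> g' \<in> Hom V Y' Y'' \<Longrightarrow>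
          (f' \<cdot> f) \<odot> (g' \<cdot> g) = (f' \<odot> g') \<cdot> (f \<odot> g)"
    and assoc_Hom: "X \<in> Obj V \<Longrightarrow> Y \<in> Obj V \<Longrightarrow> Z \<in> Obj V \<Longrightarrow>
          assoc V X Y Z \<in> Hom V ((X \<otimes> Y) \<otimes> Z) (X \<otimes> (Y \<otimes> Z)) \<and> iso_arrow V (assoc V X Y Z)"
    and assoc_natural: "f \<in> Hom V X X' \<Longrightarrow> g \<in> Hom V Y Y' \<Longrightarrow> h \<in> Hom V Z Z' \<Longrightarrow>
          assoc V X' Y' Z' \<cdot> ((f \<odot> g) \<odot> h) = (f \<odot> (g \<odot> h)) \<cdot> assoc V X Y Z"
    and lunit_Hom: "X \<in> Obj V \<Longrightarrow> lunit V X \<in> Hom V (One V \<otimes> X) X \<and> iso_arrow V (lunit V X)"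
    and lunit_natural: "f \<in> Hom V X X' \<Longrightarrow> lunit V X' \<cdot> (Idn V (One V) \<odot> f) = f \<cdot> lunit V X"
    and runit_Hom: "X \<in> Obj V \<Longrightarrow> runit V X \<in> Hom V (X \<otimes> One V) X \<and> iso_arrow V (runit V X)"
    and runit_natural: "f \<in> Hom V X X' \<Longrightarrow> runit V X' \<cdot> (f \<odot> Idn V (One V)) = f \<cdot> runit V X"
    and pentagon: "W \<in> Obj V \<Longrightarrow> X \<in> Obj V \<Longrightarrow> Y \<in> Obj V \<Longrightarrow> Z \<in> Obj V \<Longrightarrow>
          (Idn V W \<odot> assoc V X Y Z) \<cdot> assoc V W (X \<otimes> Y) Z \<cdot> (assoc V W X Y \<odot> Idn V Z)
          = assoc V W X (Y \<otimes> Z) \<cdot> assoc V (W \<otimes> X) Y Z"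
    and triangle: "X \<in> Obj V \<Longrightarrow> Y \<in> Obj V \<Longrightarrow>
          (Idn V X \<odot> lunit V Y) \<cdot> assoc V X (One V) Y = runit V X \<odot> Idn V Y"
    and symm_Hom: "X \<in> Obj V \<Longrightarrow> Y \<in> Obj V \<Longrightarrow> symm V X Y \<in> Hom V (X \<otimes> Y) (Y \<otimes> X)"
    and symm_natural: "f \<in> Hom V X X' \<Longrightarrow> g \<in> Hom V Y Y' \<Longrightarrow>
          symm V X' Y' \<cdot> (f \<odot> g) = (g \<odot> f) \<cdot> symm V X Y"
    and symm_symm: "X \<in> Obj V \<Longrightarrow> Y \<in> Obj V \<Longrightarrow> symm V Y X \<cdot> symm V X Y = Idn V (X \<otimes> Y)"
    and hexagon: "X \<in> Obj V \<Longrightarrow> Y \<in> Obj V \<Longrightarrow> Z \<in> Obj V \<Longrightarrow>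
          assoc V Y Z X \<cdot> symm V X (Y \<otimes> Z) \<cdot> assoc V X Y Z
          = (Idn V Y \<odot> symm V X Z) \<cdot> assoc V Y X Z \<cdot> (symm V X Y \<odot> Idn V Z)"
    and ihom_Obj: "X \<in> Obj V \<Longrightarrow> Y \<in> Obj V \<Longrightarrow> ihom V X Y \<in> Obj V"
    and eval_Hom: "X \<in> Obj V \<Longrightarrow> Y \<in> Obj V \<Longrightarrow> eval_arrow V X Y \<in> Hom V (ihom V X Y \<otimes> X) Y"
    and eval_universal: "X \<in> Obj V \<Longrightarrow> Y \<in> Obj V \<Longrightarrow> Z \<in> Obj V \<Longrightarrow> f \<in> Hom V (Z \<otimes> X) Y \<Longrightarrow>
          \<exists>!g. g \<in> Hom V Z (ihom V X Y) \<and> eval_arrow V X Y \<cdot> (g \<odot> Idn V X) = f"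

definition curry_arrow :: "('o, 'a) smc \<Rightarrow> 'o \<Rightarrow> 'o \<Rightarrow> 'o \<Rightarrow> 'a \<Rightarrow> 'a" where
  "curry_arrow V Z X Y f =
     (THE g. g \<in> Hom V Z (ihom V X Y) \<and> eval_arrow V X Y \<cdot>\<^bsub>V\<^esub> (g \<odot>\<^bsub>V\<^esub> Idn V X) = f)"

text \<open>The bijection between morphisms \<open>X \<rightarrow> Y\<close> and morphisms \<open>I \<rightarrow> [X, Y]\<close>.\<close>

definition name_of :: "('o, 'a) smc \<Rightarrow> 'o \<Rightarrow> 'o \<Rightarrow> 'a \<Rightarrow> 'a" where
  "name_of V X Y f = curry_arrow V (One V) X Y (f \<cdot>\<^bsub>V\<^esub> lunit V X)"

definition unname :: "('o, 'a) smc \<Rightarrow> 'o \<Rightarrow> 'o \<Rightarrow> 'a \<Rightarrow> 'a" where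
  "unname V X Y u =
     eval_arrow V X Y \<cdot>\<^bsub>V\<^esub> (u \<odot>\<^bsub>V\<^esub> Idn V X) \<cdot>\<^bsub>V\<^esub> inverse_of V (lunit V X)"

definition locally_presentable_smc :: "'u rel \<Rightarrow> 'r rel \<Rightarrow> ('o, 'a) smc \<Rightarrow> bool" where
  "locally_presentable_smc \<kappa> \<rho> V \<longleftrightarrow> sym_monoidal_closed V \<and> locally_presentable \<kappa> \<rho> V \<and>
     presentable_object \<kappa> \<rho> V (One V) \<and>
     (\<forall>X Y. presentable_object \<kappa> \<rho> V X \<and> presentable_object \<kappa> \<rho> V Y \<longrightarrow>
        presentable_object \<kappa> \<rho> V (X \<otimes>\<^bsub>V\<^esub> Y))"

definition preserves_presentable ::
  "'u rel \<Rightarrow> 'r rel \<Rightarrow> ('o, 'a, 'y) cat_scheme \<Rightarrow> ('p, 'b, 'z) cat_scheme \<Rightarrow>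
    ('o, 'a, 'p, 'b) func \<Rightarrow> bool" where
  "preserves_presentable \<kappa> \<rho> C D G \<longleftrightarrow>
     (\<forall>X. presentable_object \<kappa> \<rho> C X \<longrightarrow> presentable_object \<kappa> \<rho> D (FOb G X))"

text \<open>
  The objects of \<open>\<V>\<^sub>\<lambda>\<close>: a small set of \<open>\<lambda>\<close>-presentable objects representing all of them up to
  isomorphism, chosen so as to contain the unit.
\<close>

definition presentable_representatives ::
  "'u rel \<Rightarrow> 'r rel \<Rightarrow> ('o, 'a) smc \<Rightarrow> 'o set \<Rightarrow> bool" where
  "presentable_representatives \<kappa> \<rho> V P \<longleftrightarrow> small \<kappa> P \<and> One V \<in> P \<and>
     (\<forall>X \<in> P. presentable_object \<kappa> \<rho> V X) \<and>
     (\<forall>X. presentable_object \<kappa> \<rho> V X \<longrightarrow> (\<exists>Y \<in> P. isomorphic V X Y))"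

definition Surj :: "('o, 'a) smc \<Rightarrow> 'a set" where
  "Surj V = {f \<in> Arr V.
     \<forall>b \<in> Hom V (One V) (Cod V f). \<exists>a \<in> Hom V (One V) (Dom V f). f \<cdot>\<^bsub>V\<^esub> a = b}"

definition Inj :: "('o, 'a) smc \<Rightarrow> 'a set" where
  "Inj V = {m \<in> Arr V. \<forall>e \<in> Surj V. unique_lifting V e m}"


section \<open>Enriched categories\<close>

text \<open>The composition \<open>VCmp C X Y Z\<close> is a morphism \<open>C(Y, Z) \<otimes> C(X, Y) \<rightarrow> C(X, Z)\<close>.\<close>

record ('b, 'o, 'a) vcat =
  VObj :: "'b set"
  VHom :: "'b \<Rightarrow> 'b \<Rightarrow> 'o"
  VCmp :: "'b \<Rightarrow> 'b \<Rightarrow> 'b \<Rightarrow> 'a"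
  VIdn :: "'b \<Rightarrow> 'a"

record ('b, 'c, 'a) vfun =
  VOb :: "'b \<Rightarrow> 'c"
  VAr :: "'b \<Rightarrow> 'b \<Rightarrow> 'a"

locale V_category = sym_monoidal_closed V for V :: "('o, 'a) smc" (structure) +
  fixes C :: "('b, 'o, 'a) vcat"
  assumes VHom_Obj: "X \<in> VObj C \<Longrightarrow> Y \<in> VObj C \<Longrightarrow> VHom C X Y \<in> Obj V"
    and VIdn_Hom: "X \<in> VObj C \<Longrightarrow> VIdn C X \<in> Hom V (One V) (VHom C X X)"
    and VCmp_Hom: "X \<in> VObj C \<Longrightarrow> Y \<in> VObj C \<Longrightarrow> Z \<in> VObj C \<Longrightarrow>
          VCmp C X Y Z \<in> Hom V (VHom C Y Z \<otimes> VHom C X Y) (VHom C X Z)"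
    and VCmp_assoc: "W \<in> VObj C \<Longrightarrow> X \<in> VObj C \<Longrightarrow> Y \<in> VObj C \<Longrightarrow> Z \<in> VObj C \<Longrightarrow>
          VCmp C W X Z \<cdot> (VCmp C X Y Z \<odot> Idn V (VHom C W X))
          = VCmp C W Y Z \<cdot> (Idn V (VHom C Y Z) \<odot> VCmp C W X Y)
              \<cdot> assoc V (VHom C Y Z) (VHom C X Y) (VHom C W X)"
    and VIdn_VCmp: "X \<in> VObj C \<Longrightarrow> Y \<in> VObj C \<Longrightarrow>
          VCmp C X Y Y \<cdot> (VIdn C Y \<odot> Idn V (VHom C X Y)) = lunit V (VHom C X Y)"
    and VCmp_VIdn: "X \<in> VObj C \<Longrightarrow> Y \<in> VObj C \<Longrightarrow>
          VCmp C X X Y \<cdot> (Idn V (VHom C X Y) \<odot> VIdn C X) = runit V (VHom C X Y)"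

definition V_functor ::
  "('o, 'a) smc \<Rightarrow> ('b, 'o, 'a) vcat \<Rightarrow> ('c, 'o, 'a) vcat \<Rightarrow> ('b, 'c, 'a) vfun \<Rightarrow> bool" where
  "V_functor V C D G \<longleftrightarrow> V_category V C \<and> V_category V D \<and>
     (\<forall>X \<in> VObj C. VOb G X \<in> VObj D \<and> VAr G X X \<cdot>\<^bsub>V\<^esub> VIdn C X = VIdn D (VOb G X)) \<and>
     (\<forall>X \<in> VObj C. \<forall>Y \<in> VObj C. VAr G X Y \<in> Hom V (VHom C X Y) (VHom D (VOb G X) (VOb G Y))) \<and>
     (\<forall>X \<in> VObj C. \<forall>Y \<in> VObj C. \<forall>Z \<in> VObj C.
        VAr G X Z \<cdot>\<^bsub>V\<^esub> VCmp C X Y Z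
        = VCmp D (VOb G X) (VOb G Y) (VOb G Z) \<cdot>\<^bsub>V\<^esub> (VAr G Y Z \<odot>\<^bsub>V\<^esub> VAr G X Y))"

definition vfun_id :: "('o, 'a) smc \<Rightarrow> ('b, 'o, 'a) vcat \<Rightarrow> ('b, 'b, 'a) vfun" where
  "vfun_id V C = \<lparr>VOb = (\<lambda>X. X), VAr = (\<lambda>X Y. Idn V (VHom C X Y))\<rparr>"

definition vfun_comp ::
  "('o, 'a) smc \<Rightarrow> ('c, 'd, 'a) vfun \<Rightarrow> ('b, 'c, 'a) vfun \<Rightarrow> ('b, 'd, 'a) vfun" where
  "vfun_comp V H G = \<lparr>VOb = (\<lambda>X. VOb H (VOb G X)),
     VAr = (\<lambda>X Y. VAr H (VOb G X) (VOb G Y) \<cdot>\<^bsub>V\<^esub> VAr G X Y)\<rparr>"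

definition vfun_eq_on :: "'b set \<Rightarrow> ('b, 'c, 'a) vfun \<Rightarrow> ('b, 'c, 'a) vfun \<Rightarrow> bool" where
  "vfun_eq_on S G H \<longleftrightarrow> (\<forall>X \<in> S. VOb G X = VOb H X) \<and> (\<forall>X \<in> S. \<forall>Y \<in> S. VAr G X Y = VAr H X Y)"

definition vcat_op :: "('o, 'a) smc \<Rightarrow> ('b, 'o, 'a) vcat \<Rightarrow> ('b, 'o, 'a) vcat" where
  "vcat_op V C = \<lparr>VObj = VObj C, VHom = (\<lambda>X Y. VHom C Y X),
     VCmp = (\<lambda>X Y Z. VCmp C Z Y X \<cdot>\<^bsub>V\<^esub> symm V (VHom C Z Y) (VHom C Y X)),
     VIdn = VIdn C\<rparr>"

definition vfun_op :: "('b, 'c, 'a) vfun \<Rightarrow> ('b, 'c, 'a) vfun" where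
  "vfun_op G = \<lparr>VOb = VOb G, VAr = (\<lambda>X Y. VAr G Y X)\<rparr>"

definition full_vcat :: "('b, 'o, 'a) vcat \<Rightarrow> 'b set \<Rightarrow> ('b, 'o, 'a) vcat" where
  "full_vcat C S = C\<lparr>VObj := S\<rparr>"

text \<open>\<open>V\<close> as a category enriched in itself.\<close>

definition self_vcat :: "('o, 'a) smc \<Rightarrow> ('o, 'o, 'a) vcat" where
  "self_vcat V = \<lparr>VObj = Obj V, VHom = ihom V,
     VCmp = (\<lambda>X Y Z. curry_arrow V (ihom V Y Z \<otimes>\<^bsub>V\<^esub> ihom V X Y) X Z
               (eval_arrow V Y Z \<cdot>\<^bsub>V\<^esub> (Idn V (ihom V Y Z) \<odot>\<^bsub>V\<^esub> eval_arrow V X Y)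
                  \<cdot>\<^bsub>V\<^esub> assoc V (ihom V Y Z) (ihom V X Y) X)),
     VIdn = (\<lambda>X. curry_arrow V (One V) X X (lunit V X))\<rparr>"

text \<open>
  The representable functors \<open>C(X, -) : C \<rightarrow> V\<close> and \<open>C(-, A) : C\<^sup>o\<^sup>p \<rightarrow> V\<close>.
\<close>

definition hom_vfun :: "('o, 'a) smc \<Rightarrow> ('b, 'o, 'a) vcat \<Rightarrow> 'b \<Rightarrow> ('b, 'o, 'a) vfun" where
  "hom_vfun V C X = \<lparr>VOb = (\<lambda>A. VHom C X A),
     VAr = (\<lambda>A B. curry_arrow V (VHom C A B) (VHom C X A) (VHom C X B) (VCmp C X A B))\<rparr>"

definition cohom_vfun :: "('o, 'a) smc \<Rightarrow> ('b, 'o, 'a) vcat \<Rightarrow> 'b \<Rightarrow> ('b, 'o, 'a) vfun" where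
  "cohom_vfun V C A = \<lparr>VOb = (\<lambda>X. VHom C X A),
     VAr = (\<lambda>X Y. curry_arrow V (VHom C Y X) (VHom C X A) (VHom C Y A)
               (VCmp C Y X A \<cdot>\<^bsub>V\<^esub> symm V (VHom C Y X) (VHom C X A)))\<rparr>"

text \<open>
  For \<open>f : I \<rightarrow> C(X, Y)\<close> and \<open>g : I \<rightarrow> C(Y, Z)\<close>: their composite \<open>I \<rightarrow> C(X, Z)\<close>, and the morphisms
  \<open>C(X, g) : C(X, Y) \<rightarrow> C(X, Z)\<close> and \<open>C(f, Z) : C(Y, Z) \<rightarrow> C(X, Z)\<close>.
\<close>

definition elem_comp ::
  "('o, 'a) smc \<Rightarrow> ('b, 'o, 'a) vcat \<Rightarrow> 'b \<Rightarrow> 'b \<Rightarrow> 'b \<Rightarrow> 'a \<Rightarrow> 'a \<Rightarrow> 'a" where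
  "elem_comp V C X Y Z g f =
     VCmp C X Y Z \<cdot>\<^bsub>V\<^esub> (g \<odot>\<^bsub>V\<^esub> f) \<cdot>\<^bsub>V\<^esub> inverse_of V (lunit V (One V))"

definition post_comp ::
  "('o, 'a) smc \<Rightarrow> ('b, 'o, 'a) vcat \<Rightarrow> 'b \<Rightarrow> 'b \<Rightarrow> 'b \<Rightarrow> 'a \<Rightarrow> 'a" where
  "post_comp V C X Y Z g =
     VCmp C X Y Z \<cdot>\<^bsub>V\<^esub> (g \<odot>\<^bsub>V\<^esub> Idn V (VHom C X Y)) \<cdot>\<^bsub>V\<^esub> inverse_of V (lunit V (VHom C X Y))"

definition pre_comp ::
  "('o, 'a) smc \<Rightarrow> ('b, 'o, 'a) vcat \<Rightarrow> 'b \<Rightarrow> 'b \<Rightarrow> 'b \<Rightarrow> 'a \<Rightarrow> 'a" where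
  "pre_comp V C X Y Z f =
     VCmp C X Y Z \<cdot>\<^bsub>V\<^esub> (Idn V (VHom C Y Z) \<odot>\<^bsub>V\<^esub> f) \<cdot>\<^bsub>V\<^esub> inverse_of V (runit V (VHom C Y Z))"

definition underlying_cat :: "('o, 'a) smc \<Rightarrow> ('b, 'o, 'a) vcat \<Rightarrow> ('b, 'b \<times> 'b \<times> 'a) cat" where
  "underlying_cat V C = \<lparr>Obj = VObj C,
     Arr = {(X, Y, f). X \<in> VObj C \<and> Y \<in> VObj C \<and> f \<in> Hom V (One V) (VHom C X Y)},
     Dom = (\<lambda>(X, Y, f). X), Cod = (\<lambda>(X, Y, f). Y),
     Cmp = (\<lambda>(Y', Z, g) (X, Y, f). (X, Z, elem_comp V C X Y Z g f)),
     Idn = (\<lambda>X. (X, X, VIdn C X))\<rparr>"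

text \<open>
  The underlying functor \<open>C\<^sub>0 \<rightarrow> V\<^sub>0\<close> of a \<open>V\<close>-functor \<open>C \<rightarrow> V\<close>, the underlying category of
  \<^term>\<open>self_vcat V\<close> being identified with \<open>V\<^sub>0\<close>.
\<close>

definition underlying_to_V ::
  "('o, 'a) smc \<Rightarrow> ('b, 'o, 'a) vfun \<Rightarrow> ('b, 'b \<times> 'b \<times> 'a, 'o, 'a) func" where
  "underlying_to_V V G = \<lparr>FOb = VOb G,
     FAr = (\<lambda>(X, Y, f). unname V (VOb G X) (VOb G Y) (VAr G X Y \<cdot>\<^bsub>V\<^esub> f))\<rparr>"

definition V_natural :: "('o, 'a) smc \<Rightarrow> ('b, 'o, 'a) vcat \<Rightarrow> ('c, 'o, 'a) vcat \<Rightarrow>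
    ('b, 'c, 'a) vfun \<Rightarrow> ('b, 'c, 'a) vfun \<Rightarrow> ('b \<Rightarrow> 'a) \<Rightarrow> bool" where
  "V_natural V C D G H \<alpha> \<longleftrightarrow> V_functor V C D G \<and> V_functor V C D H \<and>
     (\<forall>X \<in> VObj C. \<alpha> X \<in> Hom V (One V) (VHom D (VOb G X) (VOb H X))) \<and>
     (\<forall>X \<in> VObj C. \<forall>Y \<in> VObj C.
        post_comp V D (VOb G X) (VOb G Y) (VOb H Y) (\<alpha> Y) \<cdot>\<^bsub>V\<^esub> VAr G X Y
        = pre_comp V D (VOb G X) (VOb H X) (VOb H Y) (\<alpha> X) \<cdot>\<^bsub>V\<^esub> VAr H X Y)"

definition V_adjunction :: "('o, 'a) smc \<Rightarrow> ('b, 'o, 'a) vcat \<Rightarrow> ('c, 'o, 'a) vcat \<Rightarrow>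
    ('b, 'c, 'a) vfun \<Rightarrow> ('c, 'b, 'a) vfun \<Rightarrow> ('b \<Rightarrow> 'a) \<Rightarrow> ('c \<Rightarrow> 'a) \<Rightarrow> bool" where
  "V_adjunction V C D F U \<eta> \<epsilon> \<longleftrightarrow> V_functor V C D F \<and> V_functor V D C U \<and>
     V_natural V C C (vfun_id V C) (vfun_comp V U F) \<eta> \<and>
     V_natural V D D (vfun_comp V F U) (vfun_id V D) \<epsilon> \<and>
     (\<forall>X \<in> VObj C. let FX = VOb F X; UFX = VOb U FX in
        elem_comp V D FX (VOb F UFX) FX (\<epsilon> FX) (VAr F X UFX \<cdot>\<^bsub>V\<^esub> \<eta> X) = VIdn D FX) \<and>
     (\<forall>A \<in> VObj D. let UA = VOb U A; FUA = VOb F UA in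
        elem_comp V C UA (VOb U FUA) UA (VAr U FUA A \<cdot>\<^bsub>V\<^esub> \<epsilon> A) (\<eta> UA) = VIdn C UA)"

text \<open>
  A \<open>V\<close>-category whose objects have underlying objects \<open>c X\<close> of \<open>V\<close> and whose hom-objects \<open>H X Y\<close> are
  subobjects \<open>\<pi> X Y\<close> of \<open>[c X, c Y]\<close>, with composition and identities inherited from \<open>V\<close>.
\<close>

definition concrete_vcat :: "('o, 'a) smc \<Rightarrow> 'b set \<Rightarrow> ('b \<Rightarrow> 'o) \<Rightarrow> ('b \<Rightarrow> 'b \<Rightarrow> 'o) \<Rightarrow>
    ('b \<Rightarrow> 'b \<Rightarrow> 'a) \<Rightarrow> ('b, 'o, 'a) vcat" where
  "concrete_vcat V S c H \<pi> = \<lparr>VObj = S, VHom = H,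
     VCmp = (\<lambda>X Y Z. THE k. k \<in> Hom V (H Y Z \<otimes>\<^bsub>V\<^esub> H X Y) (H X Z) \<and>
        \<pi> X Z \<cdot>\<^bsub>V\<^esub> k = VCmp (self_vcat V) (c X) (c Y) (c Z) \<cdot>\<^bsub>V\<^esub> (\<pi> Y Z \<odot>\<^bsub>V\<^esub> \<pi> X Y)),
     VIdn = (\<lambda>X. THE k. k \<in> Hom V (One V) (H X X) \<and> \<pi> X X \<cdot>\<^bsub>V\<^esub> k = VIdn (self_vcat V) (c X))\<rparr>"


subsection \<open>Enriched monads and their algebras\<close>

record ('o, 'a) vmonad =
  MFun :: "('o, 'o, 'a) vfun"
  MUnit :: "'o \<Rightarrow> 'a"
  MMult :: "'o \<Rightarrow> 'a"

definition adjunction_monad :: "('o, 'a) smc \<Rightarrow> ('o, 'c, 'a) vfun \<Rightarrow> ('c, 'o, 'a) vfun \<Rightarrow>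
    ('o \<Rightarrow> 'a) \<Rightarrow> ('c \<Rightarrow> 'a) \<Rightarrow> ('o, 'a) vmonad" where
  "adjunction_monad V F U \<eta> \<epsilon> = \<lparr>MFun = vfun_comp V U F, MUnit = \<eta>,
     MMult = (\<lambda>X. VAr U (VOb F (VOb U (VOb F X))) (VOb F X) \<cdot>\<^bsub>V\<^esub> \<epsilon> (VOb F X))\<rparr>"

text \<open>Structure maps \<open>TA \<rightarrow> A\<close> are given by their names \<open>I \<rightarrow> [TA, A]\<close>.\<close>

definition monad_algebras :: "('o, 'a) smc \<Rightarrow> ('o, 'a) vmonad \<Rightarrow> ('o \<times> 'a) set" where
  "monad_algebras V M =
     {(A, a). let S = self_vcat V; TA = VOb (MFun M) A; TTA = VOb (MFun M) TA in
        A \<in> Obj V \<and> a \<in> Hom V (One V) (ihom V TA A) \<and>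
        elem_comp V S A TA A a (MUnit M A) = VIdn S A \<and>
        elem_comp V S TTA TA A a (MMult M A)
        = elem_comp V S TTA TA A a (VAr (MFun M) TA A \<cdot>\<^bsub>V\<^esub> a)}"

text \<open>The hom-object of two algebras, as the chosen equalizer of two morphisms \<open>[A, B] \<rightarrow> [TA, B]\<close>.\<close>

definition monad_alg_equalizer :: "('o, 'a) smc \<Rightarrow> ('o, 'a) vmonad \<Rightarrow> 'o \<times> 'a \<Rightarrow> 'o \<times> 'a \<Rightarrow> 'a" where
  "monad_alg_equalizer V M = (\<lambda>(A, a) (B, b).
     let S = self_vcat V; TA = VOb (MFun M) A; TB = VOb (MFun M) B in
       SOME e. is_equalizer V (pre_comp V S TA A B a)
                              (post_comp V S TA TB B b \<cdot>\<^bsub>V\<^esub> VAr (MFun M) A B) e)"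

definition monad_alg_vcat :: "('o, 'a) smc \<Rightarrow> ('o, 'a) vmonad \<Rightarrow> ('o \<times> 'a, 'o, 'a) vcat" where
  "monad_alg_vcat V M = concrete_vcat V (monad_algebras V M) fst
     (\<lambda>A B. Dom V (monad_alg_equalizer V M A B)) (monad_alg_equalizer V M)"

definition free_monad_alg :: "('o, 'a) vmonad \<Rightarrow> 'o \<Rightarrow> 'o \<times> 'a" where
  "free_monad_alg M X = (VOb (MFun M) X, MMult M X)"


section \<open>Pretheories and their algebras\<close>

definition pretheory :: "('o, 'a) smc \<Rightarrow> 'o set \<Rightarrow> ('o, 'o, 'a) vcat \<Rightarrow> ('o, 'o, 'a) vfun \<Rightarrow> bool" where
  "pretheory V P T J \<longleftrightarrow> VObj T = P \<and> V_functor V (full_vcat (self_vcat V) P) T J \<and>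
     (\<forall>X \<in> P. VOb J X = X)"

definition pretheory_iso :: "('o, 'a) smc \<Rightarrow> 'o set \<Rightarrow> ('o, 'o, 'a) vcat \<Rightarrow> ('o, 'o, 'a) vfun \<Rightarrow>
    ('o, 'o, 'a) vcat \<Rightarrow> ('o, 'o, 'a) vfun \<Rightarrow> bool" where
  "pretheory_iso V P T J T' J' \<longleftrightarrow> (\<exists>G. V_functor V T T' G \<and>
     (\<forall>X \<in> P. VOb G X = X) \<and> (\<forall>X \<in> P. \<forall>Y \<in> P. iso_arrow V (VAr G X Y)) \<and>
     vfun_eq_on P (vfun_comp V G J) J')"

text \<open>
  The pretheory induced by a monad: the full subcategory of its algebras on the free algebras, with
  the free algebra on \<open>X\<close> renamed to \<open>X\<close>.
\<close>

definition monad_pretheory_cat ::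
  "('o, 'a) smc \<Rightarrow> 'o set \<Rightarrow> ('o, 'a) vmonad \<Rightarrow> ('o, 'o, 'a) vcat" where
  "monad_pretheory_cat V P M = (let E = monad_alg_vcat V M; f = free_monad_alg M in
     \<lparr>VObj = P, VHom = (\<lambda>X Y. VHom E (f X) (f Y)),
      VCmp = (\<lambda>X Y Z. VCmp E (f X) (f Y) (f Z)), VIdn = (\<lambda>X. VIdn E (f X))\<rparr>)"

definition monad_pretheory_fun :: "('o, 'a) smc \<Rightarrow> ('o, 'a) vmonad \<Rightarrow> ('o, 'o, 'a) vfun" where
  "monad_pretheory_fun V M = \<lparr>VOb = (\<lambda>X. X),
     VAr = (\<lambda>X Y. let e = monad_alg_equalizer V M (free_monad_alg M X) (free_monad_alg M Y) in
              THE k. k \<in> Hom V (ihom V X Y) (Dom V e) \<and> e \<cdot>\<^bsub>V\<^esub> k = VAr (MFun M) X Y)\<rparr>"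

text \<open>
  An algebra is a pair \<open>(A, G)\<close> of an object and a \<open>V\<close>-functor \<open>G : T\<^sup>o\<^sup>p \<rightarrow> V\<close> with
  \<open>G J\<^sup>o\<^sup>p = V(K -, A)\<close>. The values of \<open>G\<close> outside its domain are fixed, so that equal algebras are
  equal in HOL.
\<close>

type_synonym ('o, 'a) alg = "'o \<times> ('o, 'o, 'a) vfun"

definition is_algebra :: "('o, 'a) smc \<Rightarrow> 'o set \<Rightarrow> ('o, 'o, 'a) vcat \<Rightarrow> ('o, 'o, 'a) vfun \<Rightarrow>
    ('o, 'a) alg \<Rightarrow> bool" where
  "is_algebra V P T J = (\<lambda>(A, G). A \<in> Obj V \<and> V_functor V (vcat_op V T) (self_vcat V) G \<and>
     vfun_eq_on P (vfun_comp V G (vfun_op J)) (cohom_vfun V (self_vcat V) A) \<and>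
     (\<forall>X. X \<notin> P \<longrightarrow> VOb G X = undefined) \<and>
     (\<forall>X Y. X \<notin> P \<or> Y \<notin> P \<longrightarrow> VAr G X Y = undefined))"

text \<open>
  The hom-object \<open>[C, V](G, H)\<close> of the functor category, as the end of the \<open>[G X, H X]\<close>.
\<close>

definition vnat_wedge :: "('o, 'a) smc \<Rightarrow> ('b, 'o, 'a) vcat \<Rightarrow> ('b, 'o, 'a) vfun \<Rightarrow>
    ('b, 'o, 'a) vfun \<Rightarrow> 'o \<Rightarrow> ('b \<Rightarrow> 'a) \<Rightarrow> bool" where
  "vnat_wedge V C G H E \<omega> \<longleftrightarrow> E \<in> Obj V \<and>
     (\<forall>X \<in> VObj C. \<omega> X \<in> Hom V E (ihom V (VOb G X) (VOb H X))) \<and>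
     (\<forall>X \<in> VObj C. \<forall>Y \<in> VObj C.
        VCmp (self_vcat V) (VOb G X) (VOb G Y) (VOb H Y) \<cdot>\<^bsub>V\<^esub> (\<omega> Y \<odot>\<^bsub>V\<^esub> VAr G X Y)
        = VCmp (self_vcat V) (VOb G X) (VOb H X) (VOb H Y) \<cdot>\<^bsub>V\<^esub> (VAr H X Y \<odot>\<^bsub>V\<^esub> \<omega> X)
            \<cdot>\<^bsub>V\<^esub> symm V E (VHom C X Y))"

definition is_vnat_object :: "('o, 'a) smc \<Rightarrow> ('b, 'o, 'a) vcat \<Rightarrow> ('b, 'o, 'a) vfun \<Rightarrow>
    ('b, 'o, 'a) vfun \<Rightarrow> 'o \<Rightarrow> ('b \<Rightarrow> 'a) \<Rightarrow> bool" where
  "is_vnat_object V C G H E \<omega> \<longleftrightarrow> vnat_wedge V C G H E \<omega> \<and>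
     (\<forall>E' \<omega>'. vnat_wedge V C G H E' \<omega>' \<longrightarrow>
        (\<exists>!h. h \<in> Hom V E' E \<and> (\<forall>X \<in> VObj C. \<omega> X \<cdot>\<^bsub>V\<^esub> h = \<omega>' X)))"

definition vnat_object :: "('o, 'a) smc \<Rightarrow> ('b, 'o, 'a) vcat \<Rightarrow> ('b, 'o, 'a) vfun \<Rightarrow>
    ('b, 'o, 'a) vfun \<Rightarrow> 'o \<times> ('b \<Rightarrow> 'a)" where
  "vnat_object V C G H = (SOME (E, \<omega>). is_vnat_object V C G H E \<omega>)"

text \<open>
  The hom-object of two algebras \<open>(A, G)\<close> and \<open>(B, H)\<close> is the pullback of the restriction
  \<open>[T\<^sup>o\<^sup>p, V](G, H) \<rightarrow> [V\<^sub>\<lambda>\<^sup>o\<^sup>p, V](V(K -, A), V(K -, B))\<close> along the action of \<open>A \<mapsto> V(K -, A)\<close> on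
  \<open>[A, B]\<close>. The restriction is monic, hence so is the projection \<open>alg_proj\<close> of the pullback
  to \<open>[A, B]\<close>, and the composition of algebras is determined by that of \<open>V\<close>.
\<close>

definition alg_restriction :: "('o, 'a) smc \<Rightarrow> 'o set \<Rightarrow> ('o, 'o, 'a) vcat \<Rightarrow>
    ('o, 'a) alg \<Rightarrow> ('o, 'a) alg \<Rightarrow> 'a" where
  "alg_restriction V P T = (\<lambda>(A, G) (B, H).
     let S = self_vcat V;
         (E, \<omega>) = vnat_object V (vcat_op V T) G H;
         (E', \<omega>') = vnat_object V (vcat_op V (full_vcat S P)) (cohom_vfun V S A) (cohom_vfun V S B)
     in THE r. r \<in> Hom V E E' \<and> (\<forall>X \<in> P. \<omega>' X \<cdot>\<^bsub>V\<^esub> r = \<omega> X))"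

definition alg_nerve :: "('o, 'a) smc \<Rightarrow> 'o set \<Rightarrow> ('o, 'a) alg \<Rightarrow> ('o, 'a) alg \<Rightarrow> 'a" where
  "alg_nerve V P = (\<lambda>(A, G) (B, H).
     let S = self_vcat V;
         (E', \<omega>') = vnat_object V (vcat_op V (full_vcat S P)) (cohom_vfun V S A) (cohom_vfun V S B)
     in THE y. y \<in> Hom V (ihom V A B) E' \<and> (\<forall>X \<in> P. \<omega>' X \<cdot>\<^bsub>V\<^esub> y = VAr (hom_vfun V S X) A B))"

definition alg_proj :: "('o, 'a) smc \<Rightarrow> 'o set \<Rightarrow> ('o, 'o, 'a) vcat \<Rightarrow>
    ('o, 'a) alg \<Rightarrow> ('o, 'a) alg \<Rightarrow> 'a" where
  "alg_proj V P T X Y =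
     snd (SOME (p, q). is_pullback V (alg_restriction V P T X Y) (alg_nerve V P X Y) p q)"

definition Alg :: "('o, 'a) smc \<Rightarrow> 'o set \<Rightarrow> ('o, 'o, 'a) vcat \<Rightarrow> ('o, 'o, 'a) vfun \<Rightarrow>
    (('o, 'a) alg, 'o, 'a) vcat" where
  "Alg V P T J = concrete_vcat V {X. is_algebra V P T J X} fst
     (\<lambda>X Y. Dom V (alg_proj V P T X Y)) (alg_proj V P T)"

definition Alg\<^sub>0 :: "('o, 'a) smc \<Rightarrow> 'o set \<Rightarrow> ('o, 'o, 'a) vcat \<Rightarrow> ('o, 'o, 'a) vfun \<Rightarrow>
    (('o, 'a) alg, ('o, 'a) alg \<times> ('o, 'a) alg \<times> 'a) cat" where
  "Alg\<^sub>0 V P T J = underlying_cat V (Alg V P T J)"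

definition forget :: "('o, 'a) smc \<Rightarrow> 'o set \<Rightarrow> ('o, 'o, 'a) vcat \<Rightarrow> (('o, 'a) alg, 'o, 'a) vfun" where
  "forget V P T = \<lparr>VOb = fst, VAr = alg_proj V P T\<rparr>"

definition forget\<^sub>0 :: "('o, 'a) smc \<Rightarrow> 'o set \<Rightarrow> ('o, 'o, 'a) vcat \<Rightarrow>
    (('o, 'a) alg, ('o, 'a) alg \<times> ('o, 'a) alg \<times> 'a, 'o, 'a) func" where
  "forget\<^sub>0 V P T = underlying_to_V V (forget V P T)"

definition lambda_ary_theory ::
  "('o, 'a) smc \<Rightarrow> 'o set \<Rightarrow> ('o, 'o, 'a) vcat \<Rightarrow> ('o, 'o, 'a) vfun \<Rightarrow> bool" where
  "lambda_ary_theory V P T J \<longleftrightarrow> pretheory V P T J \<and>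
     (\<exists>F \<eta> \<epsilon>. V_adjunction V (self_vcat V) (Alg V P T J) F (forget V P T) \<eta> \<epsilon> \<and>
        (let M = adjunction_monad V F (forget V P T) \<eta> \<epsilon> in
           pretheory_iso V P T J (monad_pretheory_cat V P M) (monad_pretheory_fun V M)))"

text \<open>
  \<open>X\<^sub>0\<close> is a coproduct of \<open>V\<^sub>0(I, X)\<close> copies of \<open>I\<close>, represented in \<open>V\<^sub>\<lambda>\<close>, and \<open>\<delta>\<close> the canonical
  morphism, whose component at \<open>i : I \<rightarrow> X\<close> is \<open>i\<close>.
\<close>

definition discrete_theory ::
  "('o, 'a) smc \<Rightarrow> 'o set \<Rightarrow> ('o, 'o, 'a) vcat \<Rightarrow> ('o, 'o, 'a) vfun \<Rightarrow> bool" where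
  "discrete_theory V P T J \<longleftrightarrow> (\<forall>X \<in> P. \<exists>X\<^sub>0 \<in> P. \<exists>\<iota>. \<exists>\<delta> \<in> Hom V X\<^sub>0 X.
     is_coproduct V (Hom V (One V) X) (\<lambda>_. One V) X\<^sub>0 \<iota> \<and>
     (\<forall>i \<in> Hom V (One V) X. \<delta> \<cdot>\<^bsub>V\<^esub> \<iota> i = i) \<and>
     (\<forall>g \<in> Hom V (One V) (VHom T (One V) X). \<exists>f \<in> Hom V (One V) (VHom T (One V) X\<^sub>0).
        g = elem_comp V T (One V) X\<^sub>0 X (VAr J X\<^sub>0 X \<cdot>\<^bsub>V\<^esub> name_of V X\<^sub>0 X \<delta>) f))"


section \<open>Birkhoff subcategories and equational theories\<close>

text \<open>Full subcategories are given by their sets of objects.\<close>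

definition full_replete :: "('b, 'c, 'z) cat_scheme \<Rightarrow> 'b set \<Rightarrow> bool" where
  "full_replete C L \<longleftrightarrow> L \<subseteq> Obj C \<and> (\<forall>A \<in> L. \<forall>B \<in> Obj C. isomorphic C A B \<longrightarrow> B \<in> L)"

definition birkhoff_subcategory :: "'u rel \<Rightarrow> ('o, 'a) smc \<Rightarrow> 'o set \<Rightarrow> ('o, 'o, 'a) vcat \<Rightarrow>
    ('o, 'o, 'a) vfun \<Rightarrow> ('o, 'a) alg set \<Rightarrow> bool" where
  "birkhoff_subcategory \<kappa> V P T J L \<longleftrightarrow> full_replete (Alg\<^sub>0 V P T J) L \<and>
     (\<forall>(I :: 'u set) A Q p. small \<kappa> I \<and> (\<forall>i \<in> I. A i \<in> L) \<and> is_product (Alg\<^sub>0 V P T J) I A Q p \<longrightarrow>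
        Q \<in> L) \<and>
     (\<forall>A B. \<forall>f \<in> Hom (Alg\<^sub>0 V P T J) A B. mono_arrow (Alg\<^sub>0 V P T J) f \<and> B \<in> L \<longrightarrow> A \<in> L) \<and>
     (\<forall>A B. \<forall>g \<in> Hom (Alg\<^sub>0 V P T J) A B. split_epi V (FAr (forget\<^sub>0 V P T) g) \<and> A \<in> L \<longrightarrow> B \<in> L)"

definition mu_birkhoff_subcategory :: "'u rel \<Rightarrow> 'r rel \<Rightarrow> ('o, 'a) smc \<Rightarrow> 'o set \<Rightarrow>
    ('o, 'o, 'a) vcat \<Rightarrow> ('o, 'o, 'a) vfun \<Rightarrow> ('o, 'a) alg set \<Rightarrow> bool" where
  "mu_birkhoff_subcategory \<kappa> \<mu> V P T J L \<longleftrightarrow> birkhoff_subcategory \<kappa> V P T J L \<and>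
     (\<forall>A B. \<forall>f \<in> Hom (Alg\<^sub>0 V P T J) A B.
        pure_epi \<kappa> \<mu> V (Inj V) (FAr (forget\<^sub>0 V P T) f) \<and> A \<in> L \<longrightarrow> B \<in> L)"

definition forget_preserves_colimits_of_injections :: "'u rel \<Rightarrow> 'r rel \<Rightarrow> ('o, 'a) smc \<Rightarrow>
    'o set \<Rightarrow> ('o, 'o, 'a) vcat \<Rightarrow> ('o, 'o, 'a) vfun \<Rightarrow> bool" where
  "forget_preserves_colimits_of_injections \<kappa> \<mu> V P T J \<longleftrightarrow>
     (\<forall>R F. directed_diagram_in \<kappa> \<mu> (Alg\<^sub>0 V P T J)
              {f \<in> Arr (Alg\<^sub>0 V P T J). FAr (forget\<^sub>0 V P T) f \<in> Inj V} R F \<longrightarrow>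
        preserves_colimits_of (Alg\<^sub>0 V P T J) V (forget\<^sub>0 V P T) (poset_cat R) F)"

text \<open>
  An equation \<open>p = q\<close> between morphisms \<open>p, q : F Y \<rightarrow> F X\<close> is recorded as \<open>(Y, X, p, q)\<close>.
\<close>

type_synonym ('o, 'a) equation =
  "'o \<times> 'o \<times> (('o, 'a) alg \<times> ('o, 'a) alg \<times> 'a) \<times> (('o, 'a) alg \<times> ('o, 'a) alg \<times> 'a)"

definition equational_theory :: "'u rel \<Rightarrow> ('o, 'a) smc \<Rightarrow> 'o set \<Rightarrow> ('o, 'o, 'a) vcat \<Rightarrow>
    ('o, 'o, 'a) vfun \<Rightarrow> ('o, ('o, 'a) alg, 'a) vfun \<Rightarrow> ('o, 'a) equation set \<Rightarrow> bool" where
  "equational_theory \<kappa> V P T J F E \<longleftrightarrow> small \<kappa> E \<and>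
     (\<forall>(Y, X, p, q) \<in> E. X \<in> Obj V \<and> Y \<in> Obj V \<and>
        p \<in> Hom (Alg\<^sub>0 V P T J) (VOb F Y) (VOb F X) \<and> q \<in> Hom (Alg\<^sub>0 V P T J) (VOb F Y) (VOb F X))"

definition equational_class :: "('o, 'a) smc \<Rightarrow> 'o set \<Rightarrow> ('o, 'o, 'a) vcat \<Rightarrow>
    ('o, 'o, 'a) vfun \<Rightarrow> ('o, ('o, 'a) alg, 'a) vfun \<Rightarrow> ('o, 'a) equation set \<Rightarrow> ('o, 'a) alg set" where
  "equational_class V P T J F E = {A \<in> Obj (Alg\<^sub>0 V P T J). \<forall>(Y, X, p, q) \<in> E.
     \<forall>h \<in> Hom (Alg\<^sub>0 V P T J) (VOb F X) A. h \<cdot>\<^bsub>Alg\<^sub>0 V P T J\<^esub> p = h \<cdot>\<^bsub>Alg\<^sub>0 V P T J\<^esub> q}"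

end

theory Submission
  imports Defs
begin

text \<open>
  As \<open>(Surj, Inj)\<close> is proper, the surjection onto \<open>X\<close> from the coproduct of its points \<open>I \<rightarrow> X\<close> is an
  epimorphism. So points are jointly epic, and algebras and their homomorphisms can be described by operations
  on elements. By discreteness the monad preserves surjections, hence the factorization system lifts to algebras.

  Let \<open>L\<close> be a \<open>\<mu>\<close>-Birkhoff subcategory and \<open>A\<close> an algebra that satisfies all equations between generated
  objects valid in \<open>L\<close>. Write \<open>U A\<close> as a \<open>\<mu>\<close>-directed colimit of generated objects \<open>X\<^sub>i\<close> and injections, and
  let \<open>B\<^sub>i \<in> L\<close> be the largest quotient of \<open>F X\<^sub>i\<close> in \<open>L\<close>. Since \<open>I\<close> is itself a colimit of generated objects, the
  equations force \<open>F X\<^sub>i \<rightarrow> A\<close> to factor through \<open>B\<^sub>i\<close>. The \<open>B\<^sub>i\<close> form a directed diagram, but not one of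
  injections; strong connectedness allows one to replace them by products \<open>D\<^sub>i\<close> of \<open>B\<^sub>i\<close> with other \<open>B\<^sub>k\<close>, which
  embed into the product of all \<open>B\<^sub>k\<close>. The colimit of the \<open>D\<^sub>i\<close> is a subalgebra of that product, so it lies
  in \<open>L\<close>, and it maps to \<open>A\<close> by a \<open>\<mu>\<close>-pure epimorphism.
\<close>

section \<open>Categories\<close>

text \<open>Surjections are only known to be epimorphisms, so an inclusion of kernels does not by
  itself give a factorization through a quotient. The map from \<open>F X\<close> to \<AA> is
  factored through the largest quotient \<BB> in \<open>L\<close> by another route: the image of the
  pairing into the product of \<BB> and \<AA> is injective on points over \<BB>, hence a subalgebra
  of \<BB>, hence in \<open>L\<close>, and maximality of \<BB> yields a homomorphism from \<BB> back
  to this image. Discreteness gives preservation of surjections because a point of the free algebra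
  on a presentable object comes from the free algebra on a coproduct of copies of the unit, and a
  morphism out of such a coproduct lifts along a surjection one copy at a time. In the last step the
  projections from \<DD> i to \<BB> i are split by morphisms of the base, filled in arbitrarily, and
  not by homomorphisms. This is enough, since purity asks only for lifts of morphisms of the
  base.\<close>

lemma Hom_iff [simp]: "f \<in> Hom C X Y \<longleftrightarrow> f \<in> Arr C \<and> Dom C f = X \<and> Cod C f = Y"
  by (auto simp: Hom_def)

context category
begin

declare Dom_Obj [simp] Cod_Obj [simp]

lemma Arr_Hom: "f \<in> Arr C \<Longrightarrow> f \<in> Hom C (Dom C f) (Cod C f)"
  by simp

lemma Cmp_Arr [simp]: "f \<in> Arr C \<Longrightarrow> g \<in> Arr C \<Longrightarrow> Dom C g = Cod C f \<Longrightarrow> g \<cdot> f \<in> Arr C"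
  and Dom_Cmp [simp]: "f \<in> Arr C \<Longrightarrow> g \<in> Arr C \<Longrightarrow> Dom C g = Cod C f \<Longrightarrow> Dom C (g \<cdot> f) = Dom C f"
  and Cod_Cmp [simp]: "f \<in> Arr C \<Longrightarrow> g \<in> Arr C \<Longrightarrow> Dom C g = Cod C f \<Longrightarrow> Cod C (g \<cdot> f) = Cod C g"
  using Cmp_Hom[of f "Dom C f" "Cod C f" g "Cod C g"] by auto

lemma Cmp_assoc' [simp]:
  "f \<in> Arr C \<Longrightarrow> g \<in> Arr C \<Longrightarrow> h \<in> Arr C \<Longrightarrow> Dom C g = Cod C f \<Longrightarrow> Dom C h = Cod C g \<Longrightarrow>
   (h \<cdot> g) \<cdot> f = h \<cdot> (g \<cdot> f)"
  by (rule Cmp_assoc) auto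

lemma Idn_simps [simp]:
  "X \<in> Obj C \<Longrightarrow> Idn C X \<in> Arr C" "X \<in> Obj C \<Longrightarrow> Dom C (Idn C X) = X"
  "X \<in> Obj C \<Longrightarrow> Cod C (Idn C X) = X"
  using Idn_Hom[of X] by auto

lemma Cmp_Idn' [simp]: "f \<in> Arr C \<Longrightarrow> Dom C f = X \<Longrightarrow> f \<cdot> Idn C X = f"
  by (rule Cmp_Idn) auto

lemma Idn_Cmp' [simp]: "f \<in> Arr C \<Longrightarrow> Cod C f = X \<Longrightarrow> Idn C X \<cdot> f = f"
  by (rule Idn_Cmp) auto

lemma Hom_Obj: "f \<in> Hom C X Y \<Longrightarrow> X \<in> Obj C" "f \<in> Hom C X Y \<Longrightarrow> Y \<in> Obj C"
  by auto

text \<open>Composites are kept bracketed to the right, where an equation for \<open>g\<close> after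
  \<open>f\<close> is met with a further arrow \<open>x\<close> behind it; this is the equation in
  that position.\<close>

lemma Cmp_reduce:
  "g \<cdot> f = h \<Longrightarrow> f \<in> Arr C \<Longrightarrow> g \<in> Arr C \<Longrightarrow> Dom C g = Cod C f \<Longrightarrow> x \<in> Arr C \<Longrightarrow> Cod C x = Dom C f \<Longrightarrow>
   g \<cdot> (f \<cdot> x) = h \<cdot> x"
  using Cmp_assoc'[of x f g] by simp

lemma inverse_arrows_unique:
  assumes "inverse_arrows C f g" "inverse_arrows C f g'" shows "g = g'"
proof -
  have *: "f \<in> Arr C" "g \<in> Arr C" "Dom C g = Cod C f" "Cod C g = Dom C f"
    "g' \<in> Arr C" "Dom C g' = Cod C f" "Cod C g' = Dom C f"
    "g \<cdot> f = Idn C (Dom C f)" "f \<cdot> g' = Idn C (Cod C f)"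
    using assms by (auto simp: inverse_arrows_def Hom_iff)
  have "g = g \<cdot> (f \<cdot> g')" using * by simp
  also have "\<dots> = g'" using Cmp_reduce[OF *(8), of g'] * by simp
  finally show ?thesis .
qed

lemma inverse_of:
  assumes "iso_arrow C f"
  shows "inverse_arrows C f (inverse_of C f)"
proof -
  from assms obtain g where "inverse_arrows C f g" by (auto simp: iso_arrow_def)
  thus ?thesis unfolding inverse_of_def
    by (metis theI inverse_arrows_unique)
qed

lemma inverse_of_simps:
  assumes "iso_arrow C f"
  shows "f \<in> Arr C" "inverse_of C f \<in> Arr C" "Dom C (inverse_of C f) = Cod C f"
    "Cod C (inverse_of C f) = Dom C f"
    "inverse_of C f \<cdot> f = Idn C (Dom C f)" "f \<cdot> inverse_of C f = Idn C (Cod C f)"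
  using inverse_of[OF assms] by (auto simp: inverse_arrows_def Hom_iff)

lemma iso_arrow_inverse:
  assumes "iso_arrow C f"
  shows "iso_arrow C (inverse_of C f)"
  using inverse_of_simps[OF assms]
  by (auto simp: iso_arrow_def inverse_arrows_def Hom_iff intro!: exI[of _ f])

lemma iso_arrowI:
  assumes "f \<in> Hom C X Y" "g \<in> Hom C Y X" "g \<cdot> f = Idn C X" "f \<cdot> g = Idn C Y"
  shows "iso_arrow C f"
  using assms by (auto simp: iso_arrow_def inverse_arrows_def Hom_iff intro!: exI[of _ g])

lemma iso_cancel_left:
  assumes "iso_arrow C i" "i \<cdot> f = i \<cdot> g" "f \<in> Arr C" "g \<in> Arr C" "Cod C f = Dom C i" "Cod C g = Dom C i"
  shows "f = g"
proof -
  have *: "inverse_of C i \<cdot> (i \<cdot> h) = h" if "h \<in> Arr C" "Cod C h = Dom C i" for h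
    using that inverse_of_simps[OF assms(1)]
    by (subst Cmp_reduce[OF inverse_of_simps(5)[OF assms(1)]]) simp_all
  show ?thesis using *[of f] *[of g] assms by metis
qed

lemma iso_cancel_right:
  assumes "iso_arrow C i" "f \<cdot> i = g \<cdot> i" "f \<in> Arr C" "g \<in> Arr C" "Dom C f = Cod C i" "Dom C g = Cod C i"
  shows "f = g"
proof -
  have *: "(h \<cdot> i) \<cdot> inverse_of C i = h" if "h \<in> Arr C" "Dom C h = Cod C i" for h
    using that inverse_of_simps[OF assms(1)] by simp
  show ?thesis using *[of f] *[of g] assms by metis
qed

lemma mono_arrow_cancel:
  "mono_arrow C m \<Longrightarrow> m \<cdot> u = m \<cdot> v \<Longrightarrow> u \<in> Hom C W (Dom C m) \<Longrightarrow> v \<in> Hom C W (Dom C m) \<Longrightarrow> u = v"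
  by (auto simp: mono_arrow_def)

lemma epi_arrow_cancel:
  "epi_arrow C m \<Longrightarrow> u \<cdot> m = v \<cdot> m \<Longrightarrow> u \<in> Hom C (Cod C m) W \<Longrightarrow> v \<in> Hom C (Cod C m) W \<Longrightarrow> u = v"
  by (auto simp: epi_arrow_def)

end

section \<open>Symmetric monoidal closed categories with a generating unit\<close>

context sym_monoidal_closed
begin

abbreviation "II \<equiv> One V"

declare One_Obj [simp] TOb_Obj [simp] ihom_Obj [simp]

lemma TAr_simps [simp]:
  assumes "f \<in> Arr V" "g \<in> Arr V"
  shows "f \<odot> g \<in> Arr V" "Dom V (f \<odot> g) = Dom V f \<otimes> Dom V g" "Cod V (f \<odot> g) = Cod V f \<otimes> Cod V g"
  using TAr_Hom[OF Arr_Hom Arr_Hom, OF assms] by auto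

lemma TAr_Cmp' [simp]:
  "f \<in> Arr V \<Longrightarrow> f' \<in> Arr V \<Longrightarrow> g \<in> Arr V \<Longrightarrow> g' \<in> Arr V \<Longrightarrow> Dom V f' = Cod V f \<Longrightarrow> Dom V g' = Cod V g \<Longrightarrow>
   (f' \<odot> g') \<cdot> (f \<odot> g) = (f' \<cdot> f) \<odot> (g' \<cdot> g)"
  by (rule TAr_Cmp[symmetric]) auto

lemma TAr_Cmp'' [simp]:
  "f \<in> Arr V \<Longrightarrow> f' \<in> Arr V \<Longrightarrow> g \<in> Arr V \<Longrightarrow> g' \<in> Arr V \<Longrightarrow> Dom V f' = Cod V f \<Longrightarrow> Dom V g' = Cod V g \<Longrightarrow>
   h \<in> Arr V \<Longrightarrow> Cod V h = Dom V f \<otimes> Dom V g \<Longrightarrow>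
   (f' \<odot> g') \<cdot> ((f \<odot> g) \<cdot> h) = ((f' \<cdot> f) \<odot> (g' \<cdot> g)) \<cdot> h"
  by (rule Cmp_reduce) auto

declare TAr_Idn [simp]

lemma lunit_simps [simp]:
  assumes "X \<in> Obj V"
  shows "lunit V X \<in> Arr V" "Dom V (lunit V X) = II \<otimes> X" "Cod V (lunit V X) = X" "iso_arrow V (lunit V X)"
  using lunit_Hom[OF assms] by auto

lemma runit_simps [simp]:
  assumes "X \<in> Obj V"
  shows "runit V X \<in> Arr V" "Dom V (runit V X) = X \<otimes> II" "Cod V (runit V X) = X" "iso_arrow V (runit V X)"
  using runit_Hom[OF assms] by auto

lemma assoc_simps [simp]:
  assumes "X \<in> Obj V" "Y \<in> Obj V" "Z \<in> Obj V"
  shows "assoc V X Y Z \<in> Arr V" "Dom V (assoc V X Y Z) = (X \<otimes> Y) \<otimes> Z"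
    "Cod V (assoc V X Y Z) = X \<otimes> (Y \<otimes> Z)" "iso_arrow V (assoc V X Y Z)"
  using assoc_Hom[OF assms] by auto

lemma symm_simps [simp]:
  assumes "X \<in> Obj V" "Y \<in> Obj V"
  shows "symm V X Y \<in> Arr V" "Dom V (symm V X Y) = X \<otimes> Y" "Cod V (symm V X Y) = Y \<otimes> X"
  using symm_Hom[OF assms] by auto

lemma eval_simps [simp]:
  assumes "X \<in> Obj V" "Y \<in> Obj V"
  shows "eval_arrow V X Y \<in> Arr V" "Dom V (eval_arrow V X Y) = ihom V X Y \<otimes> X" "Cod V (eval_arrow V X Y) = Y"
  using eval_Hom[OF assms] by auto

abbreviation "linv X \<equiv> inverse_of V (lunit V X)"
abbreviation "rinv X \<equiv> inverse_of V (runit V X)"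

lemma linv_simps [simp]:
  assumes "X \<in> Obj V"
  shows "linv X \<in> Arr V" "Dom V (linv X) = X" "Cod V (linv X) = II \<otimes> X"
    "linv X \<cdot> lunit V X = Idn V (II \<otimes> X)" "lunit V X \<cdot> linv X = Idn V X"
  using inverse_of_simps[OF lunit_simps(4)[OF assms]] assms by auto

lemma iso_TAr_Idn:
  assumes "iso_arrow V i" "X \<in> Obj V"
  shows "iso_arrow V (i \<odot> Idn V X)"
  using inverse_of_simps[OF assms(1)] assms(2)
  by (intro iso_arrowI[of _ "Dom V i \<otimes> X" "Cod V i \<otimes> X" "inverse_of V i \<odot> Idn V X"]) auto

section \<open>Coherence of the unit\<close>

lemma tensor_left_faithful:
  assumes "f \<in> Hom V X Y" "g \<in> Hom V X Y" "Idn V II \<odot> f = Idn V II \<odot> g"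
  shows "f = g"
proof -
  have o: "X \<in> Obj V" "Y \<in> Obj V" using Hom_Obj[OF assms(1)] by auto
  have eq: "f \<cdot> lunit V X = g \<cdot> lunit V X"
    using lunit_natural[OF assms(1)] lunit_natural[OF assms(2)] assms(3) by simp
  show ?thesis by (rule iso_cancel_right[OF _ eq]) (use o assms(1,2) in \<open>simp_all add: Hom_iff\<close>)
qed

lemma tensor_right_faithful:
  assumes "f \<in> Hom V X Y" "g \<in> Hom V X Y" "f \<odot> Idn V II = g \<odot> Idn V II"
  shows "f = g"
proof -
  have o: "X \<in> Obj V" "Y \<in> Obj V" using Hom_Obj[OF assms(1)] by auto
  have eq: "f \<cdot> runit V X = g \<cdot> runit V X"
    using runit_natural[OF assms(1)] runit_natural[OF assms(2)] assms(3) by simp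
  show ?thesis by (rule iso_cancel_right[OF _ eq]) (use o assms(1,2) in \<open>simp_all add: Hom_iff\<close>)
qed

text \<open>Kelly's argument. Both sides are tensored with the unit on the left and precomposed with
  the invertible arrows \<open>?a\<close> and \<open>?b\<close>; there the pentagon for
  \<open>II, II, X, Y\<close>, two instances of the triangle and naturality of \<open>assoc\<close>
  give equality. Then \<open>?b\<close>, \<open>?a\<close> and the tensored unit are cancelled in
  turn.\<close>

lemma lunit_tensor:
  assumes X: "X \<in> Obj V" and Y: "Y \<in> Obj V"
  shows "lunit V (X \<otimes> Y) \<cdot> assoc V II X Y = lunit V X \<odot> Idn V Y"
proof (rule tensor_left_faithful[of _ "(II \<otimes> X) \<otimes> Y" "X \<otimes> Y"])
  let ?a = "assoc V II (II \<otimes> X) Y" and ?b = "assoc V II II X \<odot> Idn V Y"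
  have 1: "(Idn V II \<odot> (lunit V (X \<otimes> Y) \<cdot> assoc V II X Y)) \<cdot> ?a \<cdot> ?b
    = (Idn V II \<odot> lunit V (X \<otimes> Y)) \<cdot> ((Idn V II \<odot> assoc V II X Y) \<cdot> ?a \<cdot> ?b)"
    using X Y by simp
  also have "\<dots> = (Idn V II \<odot> lunit V (X \<otimes> Y)) \<cdot> assoc V II II (X \<otimes> Y) \<cdot> assoc V (II \<otimes> II) X Y"
    using pentagon[of II II X Y] X Y by simp
  also have "\<dots> = (runit V II \<odot> Idn V (X \<otimes> Y)) \<cdot> assoc V (II \<otimes> II) X Y"
    using X Y by (subst Cmp_reduce[OF triangle[of II "X \<otimes> Y"]]) (simp_all add: Hom_iff)
  also have "\<dots> = assoc V II X Y \<cdot> ((runit V II \<odot> Idn V X) \<odot> Idn V Y)"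
    using assoc_natural[of "runit V II" "II \<otimes> II" II "Idn V X" X X "Idn V Y" Y Y] X Y by simp
  also have "\<dots> = assoc V II X Y \<cdot> (((Idn V II \<odot> lunit V X) \<cdot> assoc V II II X) \<odot> Idn V Y)"
    using triangle[of II X] X by simp
  also have "\<dots> = (assoc V II X Y \<cdot> ((Idn V II \<odot> lunit V X) \<odot> Idn V Y)) \<cdot> ?b"
    using X Y by simp
  also have "\<dots> = ((Idn V II \<odot> (lunit V X \<odot> Idn V Y)) \<cdot> ?a) \<cdot> ?b"
    using assoc_natural[of "Idn V II" II II "lunit V X" "II \<otimes> X" X "Idn V Y" Y Y] X Y by simp
  also have "\<dots> = (Idn V II \<odot> (lunit V X \<odot> Idn V Y)) \<cdot> ?a \<cdot> ?b"
    using X Y by simp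
  finally have e: "((Idn V II \<odot> (lunit V (X \<otimes> Y) \<cdot> assoc V II X Y)) \<cdot> ?a) \<cdot> ?b =
    ((Idn V II \<odot> (lunit V X \<odot> Idn V Y)) \<cdot> ?a) \<cdot> ?b" using X Y by simp
  have i: "iso_arrow V ?b" using X Y by (simp add: iso_TAr_Idn)
  have e': "(Idn V II \<odot> (lunit V (X \<otimes> Y) \<cdot> assoc V II X Y)) \<cdot> ?a = (Idn V II \<odot> (lunit V X \<odot> Idn V Y)) \<cdot> ?a"
    by (rule iso_cancel_right[OF i e]) (use X Y in simp_all)
  have i': "iso_arrow V ?a" using X Y by simp
  show "Idn V II \<odot> (lunit V (X \<otimes> Y) \<cdot> assoc V II X Y) = Idn V II \<odot> (lunit V X \<odot> Idn V Y)"
    by (rule iso_cancel_right[OF i' e']) (use X Y in simp_all)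
qed (use X Y in \<open>auto simp: Hom_iff\<close>)

text \<open>Naturality of \<open>lunit\<close> at the arrow \<open>lunit V X\<close> itself, after
  which the invertible \<open>lunit V X\<close> is cancelled.\<close>

lemma lunit_lunit:
  assumes X: "X \<in> Obj V"
  shows "lunit V (II \<otimes> X) = Idn V II \<odot> lunit V X"
proof -
  have eq: "lunit V X \<cdot> (Idn V II \<odot> lunit V X) = lunit V X \<cdot> lunit V (II \<otimes> X)"
    by (rule lunit_natural) (use X in \<open>simp add: Hom_iff\<close>)
  show ?thesis
    by (rule iso_cancel_left[OF lunit_simps(4) eq[symmetric]]) (use X in simp_all)
qed

text \<open>After tensoring with the unit on the right, the left side is computed by
  \<open>lunit_tensor\<close> and the right side by the triangle; \<open>lunit_lunit\<close> makes
  the results equal.\<close>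

lemma lunit_One: "lunit V II = runit V II"
proof (rule tensor_right_faithful[of _ "II \<otimes> II" II])
  have "lunit V II \<odot> Idn V II = lunit V (II \<otimes> II) \<cdot> assoc V II II II"
    by (simp add: lunit_tensor)
  also have "\<dots> = (Idn V II \<odot> lunit V II) \<cdot> assoc V II II II"
    by (simp add: lunit_lunit)
  also have "\<dots> = runit V II \<odot> Idn V II"
    by (simp add: triangle)
  finally show "lunit V II \<odot> Idn V II = runit V II \<odot> Idn V II" .
qed auto

lemma symm_symm' [simp]: "X \<in> Obj V \<Longrightarrow> Y \<in> Obj V \<Longrightarrow> symm V Y X \<cdot> symm V X Y = Idn V (X \<otimes> Y)"
  by (rule symm_symm)

lemma iso_symm: "X \<in> Obj V \<Longrightarrow> Y \<in> Obj V \<Longrightarrow> iso_arrow V (symm V X Y)"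
  by (intro iso_arrowI[of _ "X \<otimes> Y" "Y \<otimes> X" "symm V Y X"]) auto

text \<open>The hexagon with two unit arguments, followed by
  \<open>lunit V (II \<otimes> X)\<close>. One side collapses to \<open>?s\<close> after the
  tensored \<open>runit V X\<close>, the other to \<open>?s\<close> after the tensored composite in
  question; \<open>?s\<close> is invertible and tensoring with the unit is faithful.\<close>

lemma lunit_symm:
  assumes X: "X \<in> Obj V"
  shows "lunit V X \<cdot> symm V X II = runit V X"
proof (rule tensor_right_faithful[of _ "X \<otimes> II" X])
  let ?s = "symm V X II"
  have "lunit V (II \<otimes> X) \<cdot> (assoc V II II X \<cdot> symm V X (II \<otimes> II) \<cdot> assoc V X II II)
    = lunit V (II \<otimes> X) \<cdot> ((Idn V II \<odot> ?s) \<cdot> assoc V II X II \<cdot> (?s \<odot> Idn V II))"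
    using hexagon[of X II II] X by simp
  moreover have "lunit V (II \<otimes> X) \<cdot> (assoc V II II X \<cdot> symm V X (II \<otimes> II) \<cdot> assoc V X II II)
    = ?s \<cdot> (runit V X \<odot> Idn V II)"
  proof -
    have "lunit V (II \<otimes> X) \<cdot> (assoc V II II X \<cdot> symm V X (II \<otimes> II) \<cdot> assoc V X II II)
      = (lunit V II \<odot> Idn V X) \<cdot> (symm V X (II \<otimes> II) \<cdot> assoc V X II II)"
      using X by (subst Cmp_reduce[OF lunit_tensor[of II X]]) (simp_all add: Hom_iff)
    also have "\<dots> = ((lunit V II \<odot> Idn V X) \<cdot> symm V X (II \<otimes> II)) \<cdot> assoc V X II II"
      using X by simp
    also have "\<dots> = (?s \<cdot> (Idn V X \<odot> lunit V II)) \<cdot> assoc V X II II"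
      using symm_natural[of "Idn V X" X X "lunit V II" "II \<otimes> II" II] X by simp
    also have "\<dots> = ?s \<cdot> (runit V X \<odot> Idn V II)"
      using triangle[of X II] X by simp
    finally show ?thesis .
  qed
  moreover have "lunit V (II \<otimes> X) \<cdot> ((Idn V II \<odot> ?s) \<cdot> assoc V II X II \<cdot> (?s \<odot> Idn V II))
    = ?s \<cdot> ((lunit V X \<cdot> ?s) \<odot> Idn V II)"
  proof -
    have "lunit V (II \<otimes> X) \<cdot> ((Idn V II \<odot> ?s) \<cdot> assoc V II X II \<cdot> (?s \<odot> Idn V II))
      = (?s \<cdot> lunit V (X \<otimes> II)) \<cdot> (assoc V II X II \<cdot> (?s \<odot> Idn V II))"
      using X by (subst Cmp_reduce[OF lunit_natural[of ?s "X \<otimes> II" "II \<otimes> X"]]) (simp_all add: Hom_iff)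
    also have "\<dots> = ?s \<cdot> (lunit V (X \<otimes> II) \<cdot> (assoc V II X II \<cdot> (?s \<odot> Idn V II)))"
      using X by simp
    also have "\<dots> = ?s \<cdot> ((lunit V X \<odot> Idn V II) \<cdot> (?s \<odot> Idn V II))"
      using X by (subst Cmp_reduce[OF lunit_tensor[of X II]]) (simp_all add: Hom_iff)
    also have "\<dots> = ?s \<cdot> ((lunit V X \<cdot> ?s) \<odot> Idn V II)" using X by simp
    finally show ?thesis .
  qed
  ultimately have eq: "?s \<cdot> ((lunit V X \<cdot> ?s) \<odot> Idn V II) = ?s \<cdot> (runit V X \<odot> Idn V II)" by simp
  show "(lunit V X \<cdot> ?s) \<odot> Idn V II = runit V X \<odot> Idn V II"
    by (rule iso_cancel_left[OF iso_symm eq]) (use X in simp_all)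
qed (use X in \<open>auto simp: Hom_iff\<close>)

lemma symm_One: "symm V II II = Idn V (II \<otimes> II)"
proof -
  have eq: "lunit V II \<cdot> symm V II II = lunit V II \<cdot> Idn V (II \<otimes> II)"
    using lunit_symm[of II] lunit_One by simp
  show ?thesis
    by (rule iso_cancel_left[OF lunit_simps(4) eq]) simp_all
qed

end

section \<open>Points of tensor products and of internal homs\<close>

context sym_monoidal_closed
begin

lemma linv_cancel [simp]:
  assumes "f \<in> Arr V" "X \<in> Obj V"
  shows "Cod V f = X \<Longrightarrow> lunit V X \<cdot> (linv X \<cdot> f) = f"
    "Cod V f = II \<otimes> X \<Longrightarrow> linv X \<cdot> (lunit V X \<cdot> f) = f"
  using Cmp_reduce[OF linv_simps(5)[OF assms(2)], of f] Cmp_reduce[OF linv_simps(4)[OF assms(2)], of f] assms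
  by auto

lemma linv_natural:
  assumes "f \<in> Hom V X Y"
  shows "linv Y \<cdot> f = (Idn V II \<odot> f) \<cdot> linv X"
proof -
  have o: "X \<in> Obj V" "Y \<in> Obj V" using Hom_Obj[OF assms] by auto
  have "lunit V Y \<cdot> ((Idn V II \<odot> f) \<cdot> linv X) = (lunit V Y \<cdot> (Idn V II \<odot> f)) \<cdot> linv X"
    using o assms by simp
  also have "\<dots> = f" unfolding lunit_natural[OF assms] using o assms by simp
  also have "\<dots> = lunit V Y \<cdot> (linv Y \<cdot> f)" using o assms by simp
  finally have "lunit V Y \<cdot> (linv Y \<cdot> f) = lunit V Y \<cdot> ((Idn V II \<odot> f) \<cdot> linv X)"
    using o assms by simp
  from lunit_simps(4)[OF o(2)] this show ?thesis
    by (rule iso_cancel_left) (use o assms in simp_all)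
qed

text \<open>The point of \<open>Z \<otimes> X\<close> formed from a point of each factor. A tensor
  product may have further points, but by \<open>tensor_ext\<close> these are enough to separate
  arrows.\<close>

definition pr :: "'a \<Rightarrow> 'a \<Rightarrow> 'a" where
  "pr z x = (z \<odot> x) \<cdot> linv II"

lemma pr_simps [simp]:
  assumes "z \<in> Arr V" "x \<in> Arr V" "Dom V z = II" "Dom V x = II"
  shows "pr z x \<in> Arr V" "Dom V (pr z x) = II" "Cod V (pr z x) = Cod V z \<otimes> Cod V x"
  using assms by (simp_all add: pr_def)

lemma TAr_pr [simp]:
  assumes "f \<in> Arr V" "g \<in> Arr V" "z \<in> Arr V" "x \<in> Arr V" "Dom V z = II" "Dom V x = II"
    "Cod V z = Dom V f" "Cod V x = Dom V g"
  shows "(f \<odot> g) \<cdot> pr z x = pr (f \<cdot> z) (g \<cdot> x)"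
  using assms by (simp add: pr_def)

lemma symm_pr:
  assumes "x \<in> Hom V II X" "y \<in> Hom V II Y"
  shows "symm V X Y \<cdot> pr x y = pr y x"
proof -
  have o: "X \<in> Obj V" "Y \<in> Obj V" using Hom_Obj[OF assms(1)] Hom_Obj[OF assms(2)] by auto
  have "symm V X Y \<cdot> pr x y = (symm V X Y \<cdot> (x \<odot> y)) \<cdot> linv II"
    using o assms by (simp add: pr_def)
  also have "\<dots> = pr y x" unfolding symm_natural[OF assms] using o assms by (simp add: symm_One pr_def)
  finally show ?thesis .
qed

text \<open>The triangle at the unit, with \<open>runit V II\<close> replaced by
  \<open>lunit V II\<close> and then inverted.\<close>

lemma assoc_linv: "assoc V II II II \<cdot> (linv II \<odot> Idn V II) = Idn V II \<odot> linv II"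
proof -
  have "(Idn V II \<odot> lunit V II) \<cdot> (assoc V II II II \<cdot> (linv II \<odot> Idn V II))
     = ((Idn V II \<odot> lunit V II) \<cdot> assoc V II II II) \<cdot> (linv II \<odot> Idn V II)" by simp
  also have "\<dots> = (lunit V II \<odot> Idn V II) \<cdot> (linv II \<odot> Idn V II)"
    by (simp only: triangle[of II II, OF One_Obj One_Obj] lunit_One[symmetric])
  also have "\<dots> = Idn V (II \<otimes> II)" by simp
  finally have "(Idn V II \<odot> linv II) \<cdot> ((Idn V II \<odot> lunit V II) \<cdot> (assoc V II II II \<cdot> (linv II \<odot> Idn V II)))
     = Idn V II \<odot> linv II" by simp
  thus ?thesis by simp
qed

lemma assoc_pr:
  assumes "x \<in> Hom V II X" "y \<in> Hom V II Y" "z \<in> Hom V II Z"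
  shows "assoc V X Y Z \<cdot> pr (pr x y) z = pr x (pr y z)"
proof -
  have o: "X \<in> Obj V" "Y \<in> Obj V" "Z \<in> Obj V"
    using Hom_Obj[OF assms(1)] Hom_Obj[OF assms(2)] Hom_Obj[OF assms(3)] by auto
  have "pr (pr x y) z = ((x \<odot> y) \<odot> z) \<cdot> ((linv II \<odot> Idn V II) \<cdot> linv II)"
    using o assms by (simp add: pr_def)
  hence "assoc V X Y Z \<cdot> pr (pr x y) z = (assoc V X Y Z \<cdot> ((x \<odot> y) \<odot> z)) \<cdot> ((linv II \<odot> Idn V II) \<cdot> linv II)"
    using o assms by simp
  also have "\<dots> = (x \<odot> (y \<odot> z)) \<cdot> ((assoc V II II II \<cdot> (linv II \<odot> Idn V II)) \<cdot> linv II)"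
    unfolding assoc_natural[OF assms] using o assms by simp
  also have "\<dots> = pr x (pr y z)" unfolding assoc_linv using o assms by (simp add: pr_def)
  finally show ?thesis .
qed

lemma curry_arrow:
  assumes "f \<in> Hom V (Z \<otimes> X) Y" "X \<in> Obj V" "Z \<in> Obj V"
  shows "curry_arrow V Z X Y f \<in> Hom V Z (ihom V X Y)"
    and "eval_arrow V X Y \<cdot> (curry_arrow V Z X Y f \<odot> Idn V X) = f"
proof -
  have "\<exists>!g. g \<in> Hom V Z (ihom V X Y) \<and> eval_arrow V X Y \<cdot> (g \<odot> Idn V X) = f"
    using eval_universal[OF assms(2) _ assms(3,1)] Hom_Obj[OF assms(1)] by auto
  from theI'[OF this] show "curry_arrow V Z X Y f \<in> Hom V Z (ihom V X Y)"
    and "eval_arrow V X Y \<cdot> (curry_arrow V Z X Y f \<odot> Idn V X) = f"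
    by (auto simp: curry_arrow_def)
qed

lemma ihom_cancel:
  assumes "g \<in> Hom V Z (ihom V X Y)" "h \<in> Hom V Z (ihom V X Y)" "X \<in> Obj V" "Y \<in> Obj V"
    "eval_arrow V X Y \<cdot> (g \<odot> Idn V X) = eval_arrow V X Y \<cdot> (h \<odot> Idn V X)"
  shows "g = h"
proof -
  have Z: "Z \<in> Obj V" using Hom_Obj[OF assms(1)] by auto
  have "eval_arrow V X Y \<cdot> (h \<odot> Idn V X) \<in> Hom V (Z \<otimes> X) Y" using assms Z by simp
  from eval_universal[OF assms(3,4) Z this] assms show ?thesis by blast
qed

lemma unname:
  assumes "u \<in> Hom V II (ihom V X Y)" "X \<in> Obj V" "Y \<in> Obj V"
  shows "unname V X Y u \<in> Hom V X Y"
  using assms by (simp add: unname_def)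

lemma unname_simps [simp]:
  assumes "u \<in> Arr V" "Dom V u = II" "Cod V u = ihom V X Y" "X \<in> Obj V" "Y \<in> Obj V"
  shows "unname V X Y u \<in> Arr V" "Dom V (unname V X Y u) = X" "Cod V (unname V X Y u) = Y"
  using unname[of u X Y] assms by simp_all

lemma eval_pr [simp]:
  assumes "u \<in> Arr V" "Dom V u = II" "Cod V u = ihom V X Y" "x \<in> Arr V" "Dom V x = II" "Cod V x = X" "Y \<in> Obj V"
  shows "eval_arrow V X Y \<cdot> pr u x = unname V X Y u \<cdot> x"
proof -
  have o: "X \<in> Obj V" using assms Cod_Obj by blast
  have "unname V X Y u \<cdot> x = eval_arrow V X Y \<cdot> ((u \<odot> Idn V X) \<cdot> (linv X \<cdot> x))"
    using o assms by (simp add: unname_def)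
  also have "linv X \<cdot> x = (Idn V II \<odot> x) \<cdot> linv II"
    by (rule linv_natural) (use assms in simp)
  finally show ?thesis using o assms by (simp add: pr_def)
qed

lemma name_of:
  assumes "f \<in> Hom V X Y"
  shows "name_of V X Y f \<in> Hom V II (ihom V X Y)" "unname V X Y (name_of V X Y f) = f"
proof -
  have o: "X \<in> Obj V" "Y \<in> Obj V" using Hom_Obj[OF assms] by auto
  have *: "f \<cdot> lunit V X \<in> Hom V (II \<otimes> X) Y" using assms o by simp
  note c = curry_arrow[OF * o(1) One_Obj]
  show "name_of V X Y f \<in> Hom V II (ihom V X Y)" unfolding name_of_def by (rule c(1))
  have "unname V X Y (name_of V X Y f) = (eval_arrow V X Y \<cdot> (curry_arrow V II X Y (f \<cdot> lunit V X) \<odot> Idn V X)) \<cdot> linv X"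
    using c(1) o by (simp add: unname_def name_of_def)
  also have "\<dots> = f" unfolding c(2) using assms o by simp
  finally show "unname V X Y (name_of V X Y f) = f" .
qed

lemma name_of_simps [simp]:
  assumes "f \<in> Arr V" "Dom V f = X" "Cod V f = Y"
  shows "name_of V X Y f \<in> Arr V" "Dom V (name_of V X Y f) = II" "Cod V (name_of V X Y f) = ihom V X Y"
    "unname V X Y (name_of V X Y f) = f"
  using name_of[of f X Y] assms by simp_all

lemma unname_inject:
  assumes "u \<in> Hom V II (ihom V X Y)" "v \<in> Hom V II (ihom V X Y)" "X \<in> Obj V" "Y \<in> Obj V"
    "unname V X Y u = unname V X Y v"
  shows "u = v"
proof (rule ihom_cancel[OF assms(1-4)])
  have e: "(eval_arrow V X Y \<cdot> (u \<odot> Idn V X)) \<cdot> linv X = (eval_arrow V X Y \<cdot> (v \<odot> Idn V X)) \<cdot> linv X"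
    using assms by (simp add: unname_def)
  have i: "iso_arrow V (linv X)" using assms by (simp add: iso_arrow_inverse)
  show "eval_arrow V X Y \<cdot> (u \<odot> Idn V X) = eval_arrow V X Y \<cdot> (v \<odot> Idn V X)"
    by (rule iso_cancel_right[OF i e]) (use assms(1-4) in simp_all)
qed

lemma name_unname [simp]:
  assumes "u \<in> Arr V" "Dom V u = II" "Cod V u = ihom V X Y" "X \<in> Obj V" "Y \<in> Obj V"
  shows "name_of V X Y (unname V X Y u) = u"
  by (rule unname_inject[of _ X Y]) (use assms in simp_all)

lemma curry_simps [simp]:
  assumes "f \<in> Arr V" "Dom V f = Z \<otimes> X" "Cod V f = Y" "X \<in> Obj V" "Z \<in> Obj V"
  shows "curry_arrow V Z X Y f \<in> Arr V" "Dom V (curry_arrow V Z X Y f) = Z"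
    "Cod V (curry_arrow V Z X Y f) = ihom V X Y"
  using curry_arrow(1)[of f Z X Y] assms by simp_all

text \<open>Evaluation of a transpose at a pair of points. Composition in \<open>V\<close> and the
  representable functors are defined as transposes, so this is how they are computed on
  points.\<close>

lemma unname_curry [simp]:
  assumes "f \<in> Arr V" "Dom V f = Z \<otimes> X" "Cod V f = Y"
    "z \<in> Arr V" "Dom V z = II" "Cod V z = Z" "x \<in> Arr V" "Dom V x = II" "Cod V x = X"
  shows "unname V X Y (curry_arrow V Z X Y f \<cdot> z) \<cdot> x = f \<cdot> pr z x"
proof -
  have o: "X \<in> Obj V" "Y \<in> Obj V" "Z \<in> Obj V" using assms Cod_Obj by blast+
  have "unname V X Y (curry_arrow V Z X Y f \<cdot> z) \<cdot> x = eval_arrow V X Y \<cdot> pr (curry_arrow V Z X Y f \<cdot> z) x"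
    using assms o by simp
  also have "\<dots> = (eval_arrow V X Y \<cdot> (curry_arrow V Z X Y f \<odot> Idn V X)) \<cdot> pr z x"
    using assms o by simp
  also have "\<dots> = f \<cdot> pr z x" using curry_arrow(2)[of f Z X Y] assms o by simp
  finally show ?thesis .
qed

lemma elem_comp_pr: "elem_comp V C X Y Z g f = VCmp C X Y Z \<cdot> pr g f"
  by (simp add: elem_comp_def pr_def)

lemma self_simps [simp]: "VObj (self_vcat V) = Obj V" "VHom (self_vcat V) = ihom V"
  by (simp_all add: self_vcat_def)

lemma self_VCmp_simps [simp]:
  assumes "X \<in> Obj V" "Y \<in> Obj V" "Z \<in> Obj V"
  shows "VCmp (self_vcat V) X Y Z \<in> Arr V" "Dom V (VCmp (self_vcat V) X Y Z) = ihom V Y Z \<otimes> ihom V X Y"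
    "Cod V (VCmp (self_vcat V) X Y Z) = ihom V X Z"
  using assms by (simp_all add: self_vcat_def)

lemma self_VIdn:
  assumes "X \<in> Obj V"
  shows "VIdn (self_vcat V) X = name_of V X X (Idn V X)"
  using assms by (simp add: self_vcat_def name_of_def)

lemma vcat_op_simps [simp]: "VObj (vcat_op V C) = VObj C" "VHom (vcat_op V C) X Y = VHom C Y X"
  "VIdn (vcat_op V C) = VIdn C"
  by (simp_all add: vcat_op_def)

lemma full_vcat_simps [simp]: "VObj (full_vcat C S) = S" "VHom (full_vcat C S) = VHom C"
  "VIdn (full_vcat C S) = VIdn C" "VCmp (full_vcat C S) = VCmp C"
  by (simp_all add: full_vcat_def)

end

section \<open>The closed structure computed on points\<close>

locale pointed_smc = sym_monoidal_closed V for V :: "('o, 'a) smc" (structure) +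
  assumes pt_ext: "f \<in> Hom V X Y \<Longrightarrow> g \<in> Hom V X Y \<Longrightarrow> (\<And>x. x \<in> Hom V (One V) X \<Longrightarrow> f \<cdot> x = g \<cdot> x) \<Longrightarrow> f = g"
begin

lemma ihom_pt_ext:
  assumes "u \<in> Hom V II (ihom V X Y)" "v \<in> Hom V II (ihom V X Y)" "X \<in> Obj V" "Y \<in> Obj V"
    "\<And>x. x \<in> Hom V II X \<Longrightarrow> unname V X Y u \<cdot> x = unname V X Y v \<cdot> x"
  shows "u = v"
  by (rule unname_inject[OF assms(1-4)], rule pt_ext[of _ X Y]) (use assms in simp_all)

text \<open>Currying turns the claim into two uses of \<open>pt_ext\<close>, one for the points of
  \<open>Z\<close> and one, through \<open>ihom_pt_ext\<close>, for the points of
  \<open>X\<close>.\<close>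

lemma tensor_ext:
  assumes "f \<in> Hom V (Z \<otimes> X) Y" "g \<in> Hom V (Z \<otimes> X) Y" "X \<in> Obj V" "Z \<in> Obj V"
    "\<And>z x. z \<in> Hom V II Z \<Longrightarrow> x \<in> Hom V II X \<Longrightarrow> f \<cdot> pr z x = g \<cdot> pr z x"
  shows "f = g"
proof -
  have Y: "Y \<in> Obj V" using Hom_Obj[OF assms(1)] by simp
  have "curry_arrow V Z X Y f = curry_arrow V Z X Y g"
  proof (rule pt_ext[of _ Z "ihom V X Y"])
    fix z assume z: "z \<in> Hom V II Z"
    show "curry_arrow V Z X Y f \<cdot> z = curry_arrow V Z X Y g \<cdot> z"
      by (rule ihom_pt_ext[of _ X Y]) (use assms z Y in simp_all)
  qed (use assms in simp_all)
  thus ?thesis using curry_arrow(2)[OF assms(1,3,4)] curry_arrow(2)[OF assms(2,3,4)] by metis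
qed

lemma self_VCmp_pr [simp]:
  assumes "f \<in> Arr V" "Dom V f = II" "Cod V f = ihom V X Y" "g \<in> Arr V" "Dom V g = II" "Cod V g = ihom V Y Z"
    "X \<in> Obj V" "Y \<in> Obj V" "Z \<in> Obj V"
  shows "unname V X Z (VCmp (self_vcat V) X Y Z \<cdot> pr g f) = unname V Y Z g \<cdot> unname V X Y f"
proof (rule pt_ext[of _ X Z])
  fix x assume x: "x \<in> Hom V II X"
  have "unname V X Z (VCmp (self_vcat V) X Y Z \<cdot> pr g f) \<cdot> x
     = (eval_arrow V Y Z \<cdot> (Idn V (ihom V Y Z) \<odot> eval_arrow V X Y) \<cdot> assoc V (ihom V Y Z) (ihom V X Y) X) \<cdot> pr (pr g f) x"
    using assms x by (simp add: self_vcat_def)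
  also have "\<dots> = eval_arrow V Y Z \<cdot> ((Idn V (ihom V Y Z) \<odot> eval_arrow V X Y) \<cdot> pr g (pr f x))"
    using assms x by (simp add: assoc_pr)
  also have "\<dots> = (unname V Y Z g \<cdot> unname V X Y f) \<cdot> x"
    using assms x by simp
  finally show "unname V X Z (VCmp (self_vcat V) X Y Z \<cdot> pr g f) \<cdot> x = (unname V Y Z g \<cdot> unname V X Y f) \<cdot> x" .
qed (use assms in simp_all)

lemma self_VCmp_pr':
  assumes "f \<in> Hom V II (ihom V X Y)" "g \<in> Hom V II (ihom V Y Z)" "X \<in> Obj V" "Y \<in> Obj V" "Z \<in> Obj V"
  shows "VCmp (self_vcat V) X Y Z \<cdot> pr g f = name_of V X Z (unname V Y Z g \<cdot> unname V X Y f)"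
  by (rule unname_inject[of _ X Z]) (use assms in simp_all)

text \<open>The functoriality of the internal hom: \<open>pst X f\<close> is the arrow [X, f], and
  \<open>pre f Y\<close> below is [f, Y].\<close>

definition pst :: "'o \<Rightarrow> 'a \<Rightarrow> 'a" where
  "pst X f = curry_arrow V (ihom V X (Dom V f)) X (Cod V f) (f \<cdot> eval_arrow V X (Dom V f))"

definition pre :: "'a \<Rightarrow> 'o \<Rightarrow> 'a" where
  "pre f Y = curry_arrow V (ihom V (Cod V f) Y) (Dom V f) Y (eval_arrow V (Cod V f) Y \<cdot> (Idn V (ihom V (Cod V f) Y) \<odot> f))"

lemma pst_simps [simp]:
  assumes "X \<in> Obj V" "f \<in> Arr V"
  shows "pst X f \<in> Arr V" "Dom V (pst X f) = ihom V X (Dom V f)" "Cod V (pst X f) = ihom V X (Cod V f)"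
  using assms by (simp_all add: pst_def)

lemma pre_simps [simp]:
  assumes "Y \<in> Obj V" "f \<in> Arr V"
  shows "pre f Y \<in> Arr V" "Dom V (pre f Y) = ihom V (Cod V f) Y" "Cod V (pre f Y) = ihom V (Dom V f) Y"
  using assms by (simp_all add: pre_def)

lemma unname_pst [simp]:
  assumes "X \<in> Obj V" "f \<in> Arr V" "u \<in> Arr V" "Dom V u = II" "Cod V u = ihom V X (Dom V f)" "Cod V f = Z"
  shows "unname V X Z (pst X f \<cdot> u) = f \<cdot> unname V X (Dom V f) u"
proof (rule pt_ext[of _ X Z])
  fix x assume x: "x \<in> Hom V II X"
  show "unname V X Z (pst X f \<cdot> u) \<cdot> x = (f \<cdot> unname V X (Dom V f) u) \<cdot> x"
    using assms(1-5) x unfolding assms(6)[symmetric] by (simp add: pst_def)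
qed (use assms in auto)

lemma unname_pre [simp]:
  assumes "Y \<in> Obj V" "f \<in> Arr V" "u \<in> Arr V" "Dom V u = II" "Cod V u = ihom V (Cod V f) Y" "Dom V f = X"
  shows "unname V X Y (pre f Y \<cdot> u) = unname V (Cod V f) Y u \<cdot> f"
proof (rule pt_ext[of _ X Y])
  fix x assume x: "x \<in> Hom V II X"
  show "unname V X Y (pre f Y \<cdot> u) \<cdot> x = (unname V (Cod V f) Y u \<cdot> f) \<cdot> x"
    using assms(1-5) x unfolding assms(6)[symmetric] by (simp add: pre_def)
qed (use assms in auto)

lemma post_comp_pt:
  assumes "VCmp C X Y Z \<in> Hom V (VHom C Y Z \<otimes> VHom C X Y) (VHom C X Z)"
    "g \<in> Hom V II (VHom C Y Z)" "f \<in> Hom V II (VHom C X Y)"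
  shows "post_comp V C X Y Z g \<cdot> f = VCmp C X Y Z \<cdot> pr g f"
proof -
  have "linv (VHom C X Y) \<cdot> f = (Idn V II \<odot> f) \<cdot> linv II" by (rule linv_natural[OF assms(3)])
  thus ?thesis using assms Hom_Obj[OF assms(3)] by (simp add: post_comp_def pr_def)
qed

lemma pre_comp_pt:
  assumes "VCmp C X Y Z \<in> Hom V (VHom C Y Z \<otimes> VHom C X Y) (VHom C X Z)"
    "g \<in> Hom V II (VHom C Y Z)" "f \<in> Hom V II (VHom C X Y)"
  shows "pre_comp V C X Y Z f \<cdot> g = VCmp C X Y Z \<cdot> pr g f"
proof -
  let ?H = "VHom C Y Z"
  have o: "?H \<in> Obj V" using Hom_Obj[OF assms(2)] by simp
  note r = inverse_of_simps[OF runit_simps(4)[OF o]]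
  have eq: "runit V ?H \<cdot> (rinv ?H \<cdot> g) = runit V ?H \<cdot> ((g \<odot> Idn V II) \<cdot> linv II)"
  proof -
    have "runit V ?H \<cdot> (rinv ?H \<cdot> g) = g"
      by (subst Cmp_reduce[OF r(6)]) (use r(2,3,4) o assms(2) in simp_all)
    also have "\<dots> = (g \<cdot> runit V II) \<cdot> linv II" using assms o by (simp flip: lunit_One)
    also have "\<dots> = (runit V ?H \<cdot> (g \<odot> Idn V II)) \<cdot> linv II" unfolding runit_natural[OF assms(2)] ..
    also have "\<dots> = runit V ?H \<cdot> ((g \<odot> Idn V II) \<cdot> linv II)" using assms o by simp
    finally show ?thesis .
  qed
  have "rinv ?H \<cdot> g = (g \<odot> Idn V II) \<cdot> linv II"
    by (rule iso_cancel_left[OF _ eq]) (use o assms r in simp_all)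
  thus ?thesis using assms Hom_Obj[OF assms(3)] o r by (simp add: pre_comp_def pr_def)
qed

lemma vcat_op_VCmp_pr:
  assumes "f \<in> Hom V II (VHom C Y X)" "g \<in> Hom V II (VHom C Z Y)"
    "VCmp C Z Y X \<in> Hom V (VHom C Y X \<otimes> VHom C Z Y) (VHom C Z X)"
  shows "VCmp (vcat_op V C) X Y Z \<cdot> pr g f = VCmp C Z Y X \<cdot> pr f g"
  using assms Hom_Obj[OF assms(1)] Hom_Obj[OF assms(2)] symm_pr[OF assms(2,1)]
  by (simp add: vcat_op_def)

lemma hom_vfun_simps [simp]:
  assumes "X \<in> Obj V" "A \<in> Obj V" "B \<in> Obj V"
  shows "VOb (hom_vfun V (self_vcat V) X) A = ihom V X A"
    "VAr (hom_vfun V (self_vcat V) X) A B \<in> Arr V"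
    "Dom V (VAr (hom_vfun V (self_vcat V) X) A B) = ihom V A B"
    "Cod V (VAr (hom_vfun V (self_vcat V) X) A B) = ihom V (ihom V X A) (ihom V X B)"
  using assms by (simp_all add: hom_vfun_def)

lemma hom_vfun_pt:
  assumes "X \<in> Obj V" "A \<in> Obj V" "B \<in> Obj V" "f \<in> Hom V II (ihom V A B)" "a \<in> Hom V II (ihom V X A)"
  shows "unname V X B (unname V (ihom V X A) (ihom V X B) (VAr (hom_vfun V (self_vcat V) X) A B \<cdot> f) \<cdot> a)
    = unname V A B f \<cdot> unname V X A a"
  using assms by (simp add: hom_vfun_def)

lemma cohom_vfun_simps [simp]:
  assumes "X \<in> Obj V" "Y \<in> Obj V" "A \<in> Obj V"
  shows "VOb (cohom_vfun V (self_vcat V) A) X = ihom V X A"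
    "VAr (cohom_vfun V (self_vcat V) A) X Y \<in> Arr V"
    "Dom V (VAr (cohom_vfun V (self_vcat V) A) X Y) = ihom V Y X"
    "Cod V (VAr (cohom_vfun V (self_vcat V) A) X Y) = ihom V (ihom V X A) (ihom V Y A)"
  using assms by (simp_all add: cohom_vfun_def)

lemma cohom_vfun_pt:
  assumes "X \<in> Obj V" "Y \<in> Obj V" "A \<in> Obj V" "x \<in> Hom V II (ihom V Y X)" "a \<in> Hom V II (ihom V X A)"
  shows "unname V Y A (unname V (ihom V X A) (ihom V Y A) (VAr (cohom_vfun V (self_vcat V) A) X Y \<cdot> x) \<cdot> a)
    = unname V X A a \<cdot> unname V Y X x"
proof -
  have "symm V (ihom V Y X) (ihom V X A) \<cdot> pr x a = pr a x"
    by (rule symm_pr) (use assms in simp_all)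
  thus ?thesis using assms by (simp add: cohom_vfun_def)
qed

end

section \<open>Small sets\<close>

lemma inaccessibleD:
  assumes "inaccessible \<kappa>"
  shows "Card_order \<kappa>" "natLeq <o \<kappa>" "regularCard \<kappa>" "Cinfinite \<kappa>" "infinite (Field \<kappa>)"
proof -
  show *: "Card_order \<kappa>" "natLeq <o \<kappa>" "regularCard \<kappa>"
    using assms by (auto simp: inaccessible_def)
  have "natLeq \<le>o \<kappa>" using *(2) by (rule ordLess_imp_ordLeq)
  hence "cinfinite \<kappa>" by (meson *(1) cinfinite_mono natLeq_cinfinite)
  thus "Cinfinite \<kappa>" "infinite (Field \<kappa>)" using * by (auto simp: cinfinite_def)
qed

lemma small_mono: "small \<kappa> B \<Longrightarrow> A \<subseteq> B \<Longrightarrow> small \<kappa> A"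
  unfolding small_def by (meson card_of_mono1 ordLeq_ordLess_trans)

lemma small_image: "small \<kappa> A \<Longrightarrow> small \<kappa> (f ` A)"
  unfolding small_def by (meson card_of_image ordLeq_ordLess_trans)

lemma small_inj_on: "small \<kappa> B \<Longrightarrow> inj_on f A \<Longrightarrow> f ` A \<subseteq> B \<Longrightarrow> small \<kappa> A"
  unfolding small_def by (meson card_of_ordLeqI image_subset_iff ordLeq_ordLess_trans)

lemma small_finite:
  assumes "inaccessible \<kappa>" "finite A"
  shows "small \<kappa> A"
  unfolding small_def using assms(2) inaccessibleD(2)[OF assms(1)]
  by (meson finite_iff_ordLess_natLeq ordLess_transitive)

lemma small_UN:
  assumes "inaccessible \<kappa>" "small \<kappa> I" "\<And>i. i \<in> I \<Longrightarrow> small \<kappa> (A i)"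
  shows "small \<kappa> (\<Union>i\<in>I. A i)"
  unfolding small_def
  by (rule card_of_UNION_ordLess_infinite_Field_regularCard[OF inaccessibleD(3,4)[OF assms(1)]])
    (use assms(2,3) in \<open>auto simp: small_def\<close>)

lemma small_Un:
  assumes "inaccessible \<kappa>" "small \<kappa> A" "small \<kappa> B"
  shows "small \<kappa> (A \<union> B)"
proof -
  have "small \<kappa> (\<Union>b\<in>UNIV. if b then A else B)"
    by (rule small_UN[OF assms(1) small_finite[OF assms(1)]]) (use assms in auto)
  moreover have "A \<union> B \<subseteq> (\<Union>b\<in>UNIV. if b then A else B)"
    by (auto intro: exI[of _ True] exI[of _ False])
  ultimately show ?thesis by (rule small_mono)
qed

lemma small_Sigma:
  assumes "inaccessible \<kappa>" "small \<kappa> I" "\<And>i. i \<in> I \<Longrightarrow> small \<kappa> (A i)"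
  shows "small \<kappa> (Sigma I A)"
proof -
  have "Sigma I A = (\<Union>i\<in>I. Pair i ` A i)" by auto
  thus ?thesis using assms by (auto intro!: small_UN small_image)
qed

lemma small_embed:
  assumes "inaccessible \<kappa>" "small \<kappa> A"
  obtains g where "inj_on g A" "g ` A \<subseteq> Field \<kappa>"
proof -
  have "|A| \<le>o |Field \<kappa>|"
    using assms inaccessibleD(1)[OF assms(1)] unfolding small_def
    by (meson card_of_Field_ordIso ordIso_symmetric ordLess_imp_ordLeq ordLess_ordIso_trans)
  thus ?thesis using that card_of_ordLeq by metis
qed

text \<open>\<open>inaccessible\<close> speaks only of subsets of the type that carries \<kappa>, so
  \<open>A\<close> is first copied into \<open>Field \<kappa>\<close>.\<close>

lemma small_Pow:
  fixes A :: "'b set"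
  assumes "inaccessible \<kappa>" "small \<kappa> A"
  shows "small \<kappa> (Pow A)"
proof -
  obtain g where g: "inj_on g A" "g ` A \<subseteq> Field \<kappa>" using small_embed[OF assms] .
  have "small \<kappa> (Pow (g ` A))"
    using assms(1) small_image[OF assms(2), of g] by (simp add: inaccessible_def small_def)
  moreover have "inj_on (image g) (Pow A)"
    using g(1) by (auto simp: inj_on_def dest: inj_on_image_eq_iff[OF g(1), THEN iffD1, rotated 2])
  ultimately show ?thesis by (rule small_inj_on) auto
qed

text \<open>A function is counted through its graph, a subset of the small set
  \<open>Sigma I B\<close>.\<close>

lemma small_extensional:
  assumes "inaccessible \<kappa>" "small \<kappa> I" "\<And>i. i \<in> I \<Longrightarrow> small \<kappa> (B i)"
  shows "small \<kappa> (PiE I B)"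
proof -
  have "small \<kappa> (Pow (Sigma I B))" by (intro small_Pow small_Sigma assms)
  moreover have "inj_on (\<lambda>f. (\<lambda>i. (i, f i)) ` I) (PiE I B)"
  proof (rule inj_onI)
    fix f g assume fg: "f \<in> PiE I B" "g \<in> PiE I B" "(\<lambda>i. (i, f i)) ` I = (\<lambda>i. (i, g i)) ` I"
    have "f i = g i" if "i \<in> I" for i using fg(3) that by (auto simp: set_eq_iff image_iff)
    thus "f = g" using fg(1,2) by (metis PiE_ext)
  qed
  ultimately show ?thesis by (rule small_inj_on) auto
qed

lemma directed_poset_bound:
  assumes "directed_poset \<kappa> \<rho> R" "regular_cardinal \<rho>" "i \<in> Field R" "j \<in> Field R"
  obtains k where "k \<in> Field R" "(i, k) \<in> R" "(j, k) \<in> R"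
proof -
  have "natLeq \<le>o \<rho>" using assms(2) by (auto simp: regular_cardinal_def natLeq_ordLeq_cinfinite)
  hence "|{i, j}| <o \<rho>"
    by (meson finite.intros finite_iff_ordLess_natLeq ordLess_ordLeq_trans)
  moreover have "{i, j} \<subseteq> Field R" using assms by auto
  ultimately obtain k where "k \<in> Field R" "\<forall>s\<in>{i, j}. (s, k) \<in> R"
    using assms(1) unfolding directed_poset_def by meson
  thus ?thesis using that by auto
qed

lemma directed_poset_nonempty:
  assumes "directed_poset \<kappa> \<rho> R" "regular_cardinal \<rho>"
  shows "Field R \<noteq> {}"
proof -
  have "natLeq \<le>o \<rho>" using assms(2) by (auto simp: regular_cardinal_def natLeq_ordLeq_cinfinite)
  hence "|{} :: 'a set| <o \<rho>"
    by (meson finite.intros finite_iff_ordLess_natLeq ordLess_ordLeq_trans)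
  thus ?thesis using assms(1) unfolding directed_poset_def by (metis empty_iff empty_subsetI)
qed

lemma directed_posetD:
  assumes "directed_poset \<kappa> \<rho> R"
  shows "i \<in> Field R \<Longrightarrow> (i, i) \<in> R" "(i, j) \<in> R \<Longrightarrow> (j, k) \<in> R \<Longrightarrow> (i, k) \<in> R"
    "small \<kappa> (Field R)" "(i, j) \<in> R \<Longrightarrow> (j, i) \<in> R \<Longrightarrow> i = j"
  using assms unfolding directed_poset_def
  by (auto simp: partial_order_on_def preorder_on_def refl_on_def antisym_def dest: transD)

lemma Field_pair: "x \<in> R \<Longrightarrow> fst x \<in> Field R" "x \<in> R \<Longrightarrow> snd x \<in> Field R"
  by (cases x; auto intro: FieldI1 FieldI2)+

lemma poset_cat_simps [simp]:
  "Obj (poset_cat R) = Field R" "Arr (poset_cat R) = R" "Dom (poset_cat R) = fst" "Cod (poset_cat R) = snd"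
  "Cmp (poset_cat R) g f = (fst f, snd g)" "Idn (poset_cat R) x = (x, x)"
  by (simp_all add: poset_cat_def)

lemma poset_cat_category:
  assumes "Partial_order R"
  shows "category (poset_cat R)"
  using assms unfolding partial_order_on_def preorder_on_def
  by unfold_locales (auto simp: Field_def refl_on_def dest: transD)

lemma directed_poset_category:
  "directed_poset \<kappa> \<rho> R \<Longrightarrow> category (poset_cat R)"
  by (rule poset_cat_category) (simp add: directed_poset_def)

section \<open>Colimits\<close>

lemma colimit_Obj: "is_colimit C D F Q \<iota> \<Longrightarrow> Q \<in> Obj C"
  by (simp add: is_colimit_def cocone_def)

lemma colimit_in: "is_colimit C D F Q \<iota> \<Longrightarrow> j \<in> Obj D \<Longrightarrow> \<iota> j \<in> Hom C (FOb F j) Q"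
  by (simp add: is_colimit_def cocone_def)

lemma colimit_nat: "is_colimit C D F Q \<iota> \<Longrightarrow> f \<in> Arr D \<Longrightarrow> \<iota> (Cod D f) \<cdot>\<^bsub>C\<^esub> FAr F f = \<iota> (Dom D f)"
  by (simp add: is_colimit_def cocone_def)

lemma colimit_ex:
  assumes "is_colimit C D F Q \<iota>" "cocone C D F Q' \<iota>'"
  obtains h where "h \<in> Hom C Q Q'" "\<And>j. j \<in> Obj D \<Longrightarrow> h \<cdot>\<^bsub>C\<^esub> \<iota> j = \<iota>' j"
  using assms unfolding is_colimit_def by metis

lemma (in category) colimit_ext:
  assumes "is_colimit C D F Q \<iota>" "u \<in> Hom C Q Q'" "v \<in> Hom C Q Q'" "is_functor D C F"
    "\<And>j. j \<in> Obj D \<Longrightarrow> u \<cdot> \<iota> j = v \<cdot> \<iota> j"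
  shows "u = v"
proof -
  note F = assms(4)[unfolded is_functor_def]
  have "cocone C D F Q' (\<lambda>j. u \<cdot> \<iota> j)"
    unfolding cocone_def
  proof (intro conjI ballI)
    show "Q' \<in> Obj C" using assms(2) Hom_Obj by blast
    fix j assume "j \<in> Obj D" thus "u \<cdot> \<iota> j \<in> Hom C (FOb F j) Q'"
      using colimit_in[OF assms(1)] assms(2) by simp
  next
    fix f assume f: "f \<in> Arr D"
    have D: "Dom D f \<in> Obj D" "Cod D f \<in> Obj D"
      using F f category.Dom_Obj category.Cod_Obj by metis+
    have "FAr F f \<in> Hom C (FOb F (Dom D f)) (FOb F (Cod D f))" using F f by blast
    hence "(u \<cdot> \<iota> (Cod D f)) \<cdot> FAr F f = u \<cdot> (\<iota> (Cod D f) \<cdot> FAr F f)"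
      using colimit_in[OF assms(1) D(2)] assms(2) by simp
    thus "(u \<cdot> \<iota> (Cod D f)) \<cdot> FAr F f = u \<cdot> \<iota> (Dom D f)"
      using colimit_nat[OF assms(1) f] by simp
  qed
  with assms(1) have "\<exists>!h. h \<in> Hom C Q Q' \<and> (\<forall>j \<in> Obj D. h \<cdot> \<iota> j = u \<cdot> \<iota> j)"
    by (simp add: is_colimit_def)
  thus ?thesis using assms(2,3,5) by metis
qed

lemma functorD:
  assumes "is_functor C D F"
  shows "category C" "category D" "X \<in> Obj C \<Longrightarrow> FOb F X \<in> Obj D"
    "X \<in> Obj C \<Longrightarrow> FAr F (Idn C X) = Idn D (FOb F X)"
    "f \<in> Arr C \<Longrightarrow> FAr F f \<in> Hom D (FOb F (Dom C f)) (FOb F (Cod C f))"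
    "f \<in> Arr C \<Longrightarrow> g \<in> Arr C \<Longrightarrow> Dom C g = Cod C f \<Longrightarrow> FAr F (g \<cdot>\<^bsub>C\<^esub> f) = FAr F g \<cdot>\<^bsub>D\<^esub> FAr F f"
  using assms unfolding is_functor_def by blast+

text \<open>Cocompleteness only quantifies over diagrams whose objects and arrows lie in the type of the
  universe; other small diagrams are copied there.\<close>

lemma cocomplete_small:
  fixes D :: "('j, 'k) cat" and F :: "('j, 'k, 'o, 'a) func" and \<kappa> :: "'u rel"
  assumes \<kappa>: "inaccessible \<kappa>" and "cocomplete \<kappa> C" "small \<kappa> (Obj D)" "small \<kappa> (Arr D)" and F: "is_functor D C F"
  obtains Q \<iota> where "is_colimit C D F Q \<iota>"
proof -
  obtain g :: "'j \<Rightarrow> 'u" where g: "inj_on g (Obj D)" using small_embed[OF \<kappa> assms(3)] by metis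
  obtain h :: "'k \<Rightarrow> 'u" where h: "inj_on h (Arr D)" using small_embed[OF \<kappa> assms(4)] by metis
  define g' h' where "g' = inv_into (Obj D) g" and "h' = inv_into (Arr D) h"
  have g': "g' (g X) = X" if "X \<in> Obj D" for X using that g by (simp add: g'_def)
  have h': "h' (h f) = f" if "f \<in> Arr D" for f using that h by (simp add: h'_def)
  define D' :: "('u, 'u) cat" where "D' = \<lparr>Obj = g ` Obj D, Arr = h ` Arr D, Dom = g \<circ> Dom D \<circ> h', Cod = g \<circ> Cod D \<circ> h',
    Cmp = (\<lambda>y x. h (Cmp D (h' y) (h' x))), Idn = h \<circ> Idn D \<circ> g'\<rparr>"
  define F' where "F' = \<lparr>FOb = FOb F \<circ> g', FAr = FAr F \<circ> h'\<rparr>"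
  interpret D: category D using F by (rule functorD)
  have geq: "g X = g Y \<longleftrightarrow> X = Y" if "X \<in> Obj D" "Y \<in> Obj D" for X Y using that g by (auto simp: inj_on_def)
  have D': "category D'"
    by unfold_locales (auto simp: D'_def g' h' geq)
  have F': "is_functor D' C F'"
    unfolding is_functor_def
    using D' functorD[OF F] by (auto simp: D'_def F'_def g' h' geq)
  have "small \<kappa> (Obj D')" "small \<kappa> (Arr D')" using assms by (auto simp: D'_def intro: small_image)
  with F' assms(2) obtain Q \<iota> where Q: "is_colimit C D' F' Q \<iota>" unfolding cocomplete_def by metis
  have coc: "cocone C D' F' Q' \<iota>' \<longleftrightarrow> cocone C D F Q' (\<iota>' \<circ> g)" for Q' \<iota>'
    by (auto simp: cocone_def D'_def F'_def g' h')
  have coc': "cocone C D' F' Q' (\<iota>' \<circ> g') \<longleftrightarrow> cocone C D F Q' \<iota>'" for Q' \<iota>'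
    by (auto simp: cocone_def D'_def F'_def g' h')
  have "is_colimit C D F Q (\<iota> \<circ> g)"
    unfolding is_colimit_def
  proof (intro conjI allI impI)
    show "cocone C D F Q (\<iota> \<circ> g)" using Q coc by (simp add: is_colimit_def)
    fix Q' \<iota>' assume "cocone C D F Q' \<iota>'"
    hence "cocone C D' F' Q' (\<iota>' \<circ> g')" by (simp add: coc')
    with Q have "\<exists>!h. h \<in> Hom C Q Q' \<and> (\<forall>j \<in> Obj D'. h \<cdot>\<^bsub>C\<^esub> \<iota> j = (\<iota>' \<circ> g') j)"
      unfolding is_colimit_def by blast
    moreover have "(\<forall>j \<in> Obj D'. h \<cdot>\<^bsub>C\<^esub> \<iota> j = (\<iota>' \<circ> g') j) \<longleftrightarrow> (\<forall>j \<in> Obj D. h \<cdot>\<^bsub>C\<^esub> (\<iota> \<circ> g) j = \<iota>' j)" for h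
      by (simp add: D'_def g')
    ultimately show "\<exists>!h. h \<in> Hom C Q Q' \<and> (\<forall>j \<in> Obj D. h \<cdot>\<^bsub>C\<^esub> (\<iota> \<circ> g) j = \<iota>' j)" by simp
  qed
  thus ?thesis by (rule that)
qed

section \<open>Coequalizers and coproducts\<close>

locale cocomplete_category = category C for C :: "('o, 'a, 'z) cat_scheme" (structure) +
  fixes \<kappa> :: "'u rel"
  assumes inacc: "inaccessible \<kappa>" and cocomplete: "cocomplete \<kappa> C" and loc_small: "locally_small \<kappa> C"
begin

lemma small_Hom: "small \<kappa> (Hom C X Y)"
proof (cases "Hom C X Y = {}")
  case True
  thus ?thesis using inacc by (simp add: small_finite)
next
  case False
  then obtain f where "f \<in> Hom C X Y" by blast
  thus ?thesis using loc_small Hom_Obj unfolding locally_small_def by blast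
qed

text \<open>A whole set of arrows is coequalized at once, because the construction of limits applies
  this to a set of endomorphisms. Uniqueness of factorizations is expressed by the last clause,
  which says that \<open>q\<close> is epic.\<close>

lemma multi_coequalizer:
  assumes "S \<subseteq> Hom C A B" "S \<noteq> {}"
  obtains Q q where "q \<in> Hom C B Q" "\<forall>s\<in>S. \<forall>t\<in>S. q \<cdot> s = q \<cdot> t"
    "\<forall>Q'. \<forall>q' \<in> Hom C B Q'. (\<forall>s\<in>S. \<forall>t\<in>S. q' \<cdot> s = q' \<cdot> t) \<longrightarrow> (\<exists>h. h \<in> Hom C Q Q' \<and> h \<cdot> q = q')"
    "\<And>W u v. u \<in> Hom C Q W \<Longrightarrow> v \<in> Hom C Q W \<Longrightarrow> u \<cdot> q = v \<cdot> q \<Longrightarrow> u = v"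
proof -
  obtain s0 where s0: "s0 \<in> S" using assms by blast
  have S: "s \<in> Arr C \<and> Dom C s = A \<and> Cod C s = B" if "s \<in> S" for s using assms(1) that by auto
  have AB: "A \<in> Obj C" "B \<in> Obj C" using Hom_Obj s0 assms(1) by blast+
  \<comment> \<open>\<open>False\<close> is sent to \<open>A\<close> and \<open>True\<close> to
    \<open>B\<close>. In every composable pair at least one factor is an identity
    \<open>Inl b\<close>, and these are the cases that \<open>Cmp\<close> distinguishes.\<close>
  define D :: "(bool, bool + 'a) cat" where "D = \<lparr>Obj = UNIV, Arr = range Inl \<union> Inr ` S,
    Dom = (\<lambda>f. case f of Inl b \<Rightarrow> b | Inr _ \<Rightarrow> False), Cod = (\<lambda>f. case f of Inl b \<Rightarrow> b | Inr _ \<Rightarrow> True),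
    Cmp = (\<lambda>g f. case f of Inl b \<Rightarrow> g | Inr s \<Rightarrow> f), Idn = Inl\<rparr>"
  define F where "F = \<lparr>FOb = (\<lambda>b. if b then B else A),
    FAr = (\<lambda>f. case f of Inl b \<Rightarrow> Idn C (if b then B else A) | Inr s \<Rightarrow> s)\<rparr>"
  have D: "category D"
    by unfold_locales (auto simp: D_def split: sum.splits)
  have F: "is_functor D C F"
    unfolding is_functor_def using D AB S category_axioms
    by (auto simp: D_def F_def split: sum.splits)
  have "small \<kappa> (Arr D)"
    unfolding D_def cat.select_convs
    by (rule small_Un[OF inacc small_finite[OF inacc] small_image[OF small_mono[OF small_Hom assms(1)]]]) simp
  moreover have "small \<kappa> (Obj D)" using inacc by (simp add: small_finite)
  ultimately obtain Q \<iota> where Q: "is_colimit C D F Q \<iota>" using cocomplete_small[OF inacc cocomplete _ _ F] by metis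
  have q: "\<iota> True \<in> Hom C B Q" using colimit_in[OF Q, of True] by (simp add: D_def F_def)
  have qs: "\<iota> True \<cdot> s = \<iota> False" if "s \<in> S" for s
    using colimit_nat[OF Q, of "Inr s"] that by (simp add: D_def F_def)
  show ?thesis
  proof (rule that[OF q])
    show "\<forall>s\<in>S. \<forall>t\<in>S. \<iota> True \<cdot> s = \<iota> True \<cdot> t" using qs by simp
    show "\<forall>Q'. \<forall>q' \<in> Hom C B Q'. (\<forall>s\<in>S. \<forall>t\<in>S. q' \<cdot> s = q' \<cdot> t) \<longrightarrow> (\<exists>h. h \<in> Hom C Q Q' \<and> h \<cdot> \<iota> True = q')"
    proof (intro allI ballI impI)
      fix Q' q' assume q': "q' \<in> Hom C B Q'" "\<forall>s\<in>S. \<forall>t\<in>S. q' \<cdot> s = q' \<cdot> t"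
      define w where "w = q' \<cdot> s0"
      have w: "w \<in> Hom C A Q'" unfolding w_def using q'(1) S[OF s0] by simp
      have "q' \<cdot> s = w" if "s \<in> S" for s unfolding w_def using q'(2) that s0 by blast
      hence "cocone C D F Q' (\<lambda>b. if b then q' else w)"
        unfolding cocone_def using S q'(1) AB Hom_Obj(2)[OF q'(1)] w
        by (auto simp: D_def F_def split: sum.splits)
      from colimit_ex[OF Q this] obtain h where "h \<in> Hom C Q Q'"
        "\<And>j. j \<in> Obj D \<Longrightarrow> h \<cdot> \<iota> j = (if j then q' else w)" by blast
      from this(1) this(2)[of True] show "\<exists>h. h \<in> Hom C Q Q' \<and> h \<cdot> \<iota> True = q'" by (auto simp: D_def)
    qed
    show "u = v" if uv: "u \<in> Hom C Q W" "v \<in> Hom C Q W" "u \<cdot> \<iota> True = v \<cdot> \<iota> True" for W u v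
    proof (rule colimit_ext[OF Q uv(1,2) F])
      fix j assume "j \<in> Obj D"
      have "u \<cdot> \<iota> False = (u \<cdot> \<iota> True) \<cdot> s0" "v \<cdot> \<iota> False = (v \<cdot> \<iota> True) \<cdot> s0"
        using uv(1,2) q S[OF s0] qs[OF s0] by simp_all
      thus "u \<cdot> \<iota> j = v \<cdot> \<iota> j" using uv(3) by (cases j) simp_all
    qed
  qed
qed

lemma coproduct:
  fixes I :: "'i set"
  assumes "small \<kappa> I" "\<And>i. i \<in> I \<Longrightarrow> A i \<in> Obj C"
  obtains Q \<iota> where "Q \<in> Obj C" "\<And>i. i \<in> I \<Longrightarrow> \<iota> i \<in> Hom C (A i) Q"
    "\<And>Q' \<iota>'. Q' \<in> Obj C \<Longrightarrow> (\<And>i. i \<in> I \<Longrightarrow> \<iota>' i \<in> Hom C (A i) Q') \<Longrightarrow>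
      \<exists>h. h \<in> Hom C Q Q' \<and> (\<forall>i\<in>I. h \<cdot> \<iota> i = \<iota>' i)"
    "\<And>W u v. u \<in> Hom C Q W \<Longrightarrow> v \<in> Hom C Q W \<Longrightarrow> (\<And>i. i \<in> I \<Longrightarrow> u \<cdot> \<iota> i = v \<cdot> \<iota> i) \<Longrightarrow> u = v"
proof -
  define D :: "('i, 'i) cat" where "D = \<lparr>Obj = I, Arr = I, Dom = (\<lambda>i. i), Cod = (\<lambda>i. i),
    Cmp = (\<lambda>g f. f), Idn = (\<lambda>i. i)\<rparr>"
  define F where "F = \<lparr>FOb = A, FAr = (\<lambda>i. Idn C (A i))\<rparr>"
  have D: "category D" by unfold_locales (auto simp: D_def)
  have F: "is_functor D C F"
    unfolding is_functor_def using D assms(2) category_axioms by (auto simp: D_def F_def)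
  have "small \<kappa> (Arr D)" "small \<kappa> (Obj D)" using assms(1) by (simp_all add: D_def)
  then obtain Q \<iota> where Q: "is_colimit C D F Q \<iota>" using cocomplete_small[OF inacc cocomplete _ _ F] by metis
  show ?thesis
  proof (rule that)
    show "Q \<in> Obj C" by (rule colimit_Obj[OF Q])
    show "\<And>i. i \<in> I \<Longrightarrow> \<iota> i \<in> Hom C (A i) Q" using colimit_in[OF Q] by (simp add: D_def F_def)
    show "\<exists>h. h \<in> Hom C Q Q' \<and> (\<forall>i\<in>I. h \<cdot> \<iota> i = \<iota>' i)"
      if "Q' \<in> Obj C" "\<And>i. i \<in> I \<Longrightarrow> \<iota>' i \<in> Hom C (A i) Q'" for Q' \<iota>'
    proof -
      have "cocone C D F Q' \<iota>'" unfolding cocone_def using that assms(2) by (auto simp: D_def F_def)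
      from colimit_ex[OF Q this] obtain h where "h \<in> Hom C Q Q'"
        "\<And>j. j \<in> Obj D \<Longrightarrow> h \<cdot> \<iota> j = \<iota>' j" by blast
      thus ?thesis by (auto simp: D_def)
    qed
    show "u = v" if "u \<in> Hom C Q W" "v \<in> Hom C Q W" "\<And>i. i \<in> I \<Longrightarrow> u \<cdot> \<iota> i = v \<cdot> \<iota> i" for W u v
      using colimit_ext[OF Q that(1,2) F] that(3) by (simp add: D_def)
  qed
qed

end

section \<open>Limits from a set that generates under colimits\<close>

locale colimit_generated = cocomplete_category C \<kappa> for C :: "('o, 'a, 'z) cat_scheme" (structure) and \<kappa> :: "'u rel" +
  fixes \<X> :: "'o set"
  assumes small_gen: "small \<kappa> \<X>" and gen_Obj: "\<X> \<subseteq> Obj C"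
    and gen_colimit: "A \<in> Obj C \<Longrightarrow> \<exists>(R :: 'u rel) F \<iota>. is_functor (poset_cat R) C F \<and> (\<forall>j \<in> Field R. FOb F j \<in> \<X>) \<and>
          is_colimit C (poset_cat R) F A \<iota>"
begin

lemma gen_ext:
  assumes "u \<in> Hom C A B" "v \<in> Hom C A B" "\<And>Z z. Z \<in> \<X> \<Longrightarrow> z \<in> Hom C Z A \<Longrightarrow> u \<cdot> z = v \<cdot> z"
  shows "u = v"
proof -
  obtain R :: "'u rel" and F \<iota> where R: "is_functor (poset_cat R) C F" "\<forall>j \<in> Field R. FOb F j \<in> \<X>"
    "is_colimit C (poset_cat R) F A \<iota>" using gen_colimit Hom_Obj(1)[OF assms(1)] by metis
  show ?thesis
    by (rule colimit_ext[OF R(3) assms(1,2) R(1)]) (use assms(3) R(2) colimit_in[OF R(3)] in auto)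
qed

text \<open>\<open>B\<close> is a colimit of generators, and each of its coprojections lifts along
  \<open>f\<close>. Injectivity of \<open>f\<close> on generators makes the lifts a cocone, and the
  arrow induced by this cocone is inverse to \<open>f\<close>.\<close>

lemma iso_if_bij_on_gen:
  assumes f: "f \<in> Hom C A B"
    and inj: "\<And>Z u v. Z \<in> \<X> \<Longrightarrow> u \<in> Hom C Z A \<Longrightarrow> v \<in> Hom C Z A \<Longrightarrow> f \<cdot> u = f \<cdot> v \<Longrightarrow> u = v"
    and surj: "\<And>Z v. Z \<in> \<X> \<Longrightarrow> v \<in> Hom C Z B \<Longrightarrow> \<exists>u \<in> Hom C Z A. f \<cdot> u = v"
  shows "iso_arrow C f"
proof -
  obtain R :: "'u rel" and F \<iota> where R: "is_functor (poset_cat R) C F" "\<forall>j \<in> Field R. FOb F j \<in> \<X>"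
    "is_colimit C (poset_cat R) F B \<iota>" using gen_colimit Hom_Obj(2)[OF f] by metis
  note F = functorD[OF R(1), simplified]
  have "\<forall>j \<in> Field R. \<exists>u. u \<in> Hom C (FOb F j) A \<and> f \<cdot> u = \<iota> j"
  proof
    fix j assume j: "j \<in> Field R"
    show "\<exists>u. u \<in> Hom C (FOb F j) A \<and> f \<cdot> u = \<iota> j"
      using surj[OF R(2)[rule_format, OF j] colimit_in[OF R(3)]] j by (auto simp del: Hom_iff)
  qed
  then obtain u where u: "\<And>j. j \<in> Field R \<Longrightarrow> u j \<in> Hom C (FOb F j) A" "\<And>j. j \<in> Field R \<Longrightarrow> f \<cdot> u j = \<iota> j"
    by metis
  have "cocone C (poset_cat R) F A u"
    unfolding cocone_def
  proof (intro conjI ballI)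
    show "A \<in> Obj C" using Hom_Obj(1)[OF f] .
    fix x assume x: "x \<in> Arr (poset_cat R)"
    hence x': "fst x \<in> Field R" "snd x \<in> Field R" by (simp_all add: Field_pair)
    have Fx: "FAr F x \<in> Hom C (FOb F (fst x)) (FOb F (snd x))" using F(5)[of x] x by simp
    show "u (Cod (poset_cat R) x) \<cdot> FAr F x = u (Dom (poset_cat R) x)"
    proof (rule inj[of "FOb F (fst x)"])
      show "FOb F (fst x) \<in> \<X>" using R(2) x' by blast
      have "f \<cdot> (u (snd x) \<cdot> FAr F x) = (f \<cdot> u (snd x)) \<cdot> FAr F x"
        using f u(1)[OF x'(2)] Fx by simp
      also have "\<dots> = f \<cdot> u (fst x)" using colimit_nat[OF R(3) x] u(2)[OF x'(1)] u(2)[OF x'(2)] by simp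
      finally show "f \<cdot> u (Cod (poset_cat R) x) \<cdot> FAr F x = f \<cdot> u (Dom (poset_cat R) x)" by simp
    qed (use u(1)[OF x'(1)] u(1)[OF x'(2)] Fx in auto)
  qed (use u(1) in simp)
  from colimit_ex[OF R(3) this] obtain g where g: "g \<in> Hom C B A" "\<And>j. j \<in> Field R \<Longrightarrow> g \<cdot> \<iota> j = u j"
    by auto
  have fg: "f \<cdot> g = Idn C B"
  proof (rule colimit_ext[OF R(3) _ _ R(1)])
    fix j assume j: "j \<in> Obj (poset_cat R)"
    have "(f \<cdot> g) \<cdot> \<iota> j = f \<cdot> (g \<cdot> \<iota> j)" using f g(1) colimit_in[OF R(3) j] by simp
    also have "\<dots> = \<iota> j" using g(2) u(2) j by simp
    finally show "(f \<cdot> g) \<cdot> \<iota> j = Idn C B \<cdot> \<iota> j" using colimit_in[OF R(3) j] by simp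
  qed (use f g(1) Hom_Obj(2)[OF f] in simp_all)
  have "g \<cdot> f = Idn C A"
  proof (rule gen_ext[of _ A A])
    fix Z z assume z: "Z \<in> \<X>" "z \<in> Hom C Z A"
    have "f \<cdot> ((g \<cdot> f) \<cdot> z) = (f \<cdot> g) \<cdot> (f \<cdot> z)" using f g(1) z by simp
    also have "\<dots> = f \<cdot> z" unfolding fg using f z Hom_Obj(2)[OF f] by simp
    finally have e: "f \<cdot> ((g \<cdot> f) \<cdot> z) = f \<cdot> z" .
    have "(g \<cdot> f) \<cdot> z = z" by (rule inj[OF z(1) _ z(2) e]) (use f g(1) z in simp)
    thus "(g \<cdot> f) \<cdot> z = Idn C A \<cdot> z" using z by simp
  qed (use f g(1) Hom_Obj[OF f] in simp_all)
  from f g(1) this fg show ?thesis by (rule iso_arrowI)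
qed

text \<open>Limits of arbitrary systems of equations: the colimit \<open>Q\<close> of all cones with vertex in the
  generating set is a weakly terminal cone, and the joint coequalizer of its endomorphisms is terminal.\<close>

lemma limit:
  fixes D :: "'i \<Rightarrow> 'o" and K :: "'k set"
  assumes I: "small \<kappa> I" and D: "\<And>i. i \<in> I \<Longrightarrow> D i \<in> Obj C"
    and K: "\<And>k. k \<in> K \<Longrightarrow> s k \<in> I" "\<And>k. k \<in> K \<Longrightarrow> r k \<in> I"
    "\<And>k. k \<in> K \<Longrightarrow> u k \<in> Hom C (D (s k)) (W k)" "\<And>k. k \<in> K \<Longrightarrow> v k \<in> Hom C (D (r k)) (W k)"
  obtains L \<pi> where "L \<in> Obj C" "\<And>i. i \<in> I \<Longrightarrow> \<pi> i \<in> Hom C L (D i)" "\<And>k. k \<in> K \<Longrightarrow> u k \<cdot> \<pi> (s k) = v k \<cdot> \<pi> (r k)"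
    "\<And>Z \<phi>. Z \<in> Obj C \<Longrightarrow> (\<And>i. i \<in> I \<Longrightarrow> \<phi> i \<in> Hom C Z (D i)) \<Longrightarrow> (\<And>k. k \<in> K \<Longrightarrow> u k \<cdot> \<phi> (s k) = v k \<cdot> \<phi> (r k)) \<Longrightarrow>
      \<exists>!h. h \<in> Hom C Z L \<and> (\<forall>i\<in>I. \<pi> i \<cdot> h = \<phi> i)"
proof -
  define cone where "cone Z \<phi> \<longleftrightarrow> Z \<in> Obj C \<and> (\<forall>i\<in>I. \<phi> i \<in> Hom C Z (D i)) \<and> (\<forall>k\<in>K. u k \<cdot> \<phi> (s k) = v k \<cdot> \<phi> (r k))" for Z \<phi>
  have cone_comp: "cone Z (\<lambda>i. \<phi> i \<cdot> h)" if c: "cone Z' \<phi>" and h: "h \<in> Hom C Z Z'" for Z Z' \<phi> h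
    unfolding cone_def
  proof (intro conjI ballI)
    show "Z \<in> Obj C" using Hom_Obj(1)[OF h] .
    show "\<phi> i \<cdot> h \<in> Hom C Z (D i)" if "i \<in> I" for i using c h that by (simp add: cone_def)
    fix k assume k: "k \<in> K"
    have "u k \<cdot> (\<phi> (s k) \<cdot> h) = (u k \<cdot> \<phi> (s k)) \<cdot> h" "v k \<cdot> (\<phi> (r k) \<cdot> h) = (v k \<cdot> \<phi> (r k)) \<cdot> h"
      using K[OF k] c h by (simp_all add: cone_def)
    moreover have "u k \<cdot> \<phi> (s k) = v k \<cdot> \<phi> (r k)" using c k by (simp add: cone_def)
    ultimately show "u k \<cdot> (\<phi> (s k) \<cdot> h) = v k \<cdot> (\<phi> (r k) \<cdot> h)" by metis
  qed
  have cone_res: "cone Z (restrict \<phi> I) \<longleftrightarrow> cone Z \<phi>" for Z \<phi>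
    using K by (auto simp: cone_def)

  \<comment> \<open>The cones with vertex in the generating set. Their legs are taken extensional on
    \<open>I\<close>, so that a cone is a single function there and \<open>El\<close> is
    small.\<close>
  define El where "El = {x. fst x \<in> \<X> \<and> cone (fst x) (snd x) \<and> snd x \<in> extensional I}"
  define Ar where "Ar = {(x, y, f). x \<in> El \<and> y \<in> El \<and> f \<in> Hom C (fst x) (fst y) \<and> (\<forall>i\<in>I. snd y i \<cdot> f = snd x i)}"
  define E :: "('o \<times> ('i \<Rightarrow> 'a), ('o \<times> ('i \<Rightarrow> 'a)) \<times> ('o \<times> ('i \<Rightarrow> 'a)) \<times> 'a) cat" where
    "E = \<lparr>Obj = El, Arr = Ar, Dom = fst, Cod = (\<lambda>x. fst (snd x)),
      Cmp = (\<lambda>g f. (fst f, fst (snd g), snd (snd g) \<cdot> snd (snd f))), Idn = (\<lambda>x. (x, x, Idn C (fst x)))\<rparr>"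
  define F :: "('o \<times> ('i \<Rightarrow> 'a), ('o \<times> ('i \<Rightarrow> 'a)) \<times> ('o \<times> ('i \<Rightarrow> 'a)) \<times> 'a, 'o, 'a) func" where
    "F = \<lparr>FOb = fst, FAr = (\<lambda>x. snd (snd x))\<rparr>"
  have El1: "Z \<in> Obj C" if "(Z, \<phi>) \<in> El" for Z \<phi>
    using that by (auto simp: El_def cone_def)
  have El2: "\<phi> i \<in> Hom C Z (D i)" if "i \<in> I" "(Z, \<phi>) \<in> El" for Z \<phi> i
    using that by (auto simp: El_def cone_def)
  have E: "category E"
  proof (unfold_locales, goal_cases)
    case (4 f X Y g Z)
    then obtain f' g' where f: "f = (X, Y, f')" "(X, Y, f') \<in> Ar" and g: "g = (Y, Z, g')" "(Y, Z, g') \<in> Ar"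
      by (cases f; cases g) (auto simp: E_def)
    have "snd Z i \<cdot> (g' \<cdot> f') = snd X i" if "i \<in> I" for i
    proof -
      have "(fst Z, snd Z) \<in> El" using g by (simp add: Ar_def)
      from El2[OF that this] have "snd Z i \<cdot> (g' \<cdot> f') = (snd Z i \<cdot> g') \<cdot> f'" using f g by (simp add: Ar_def)
      thus ?thesis using f g that by (simp add: Ar_def)
    qed
    thus ?case using f g by (simp add: E_def Ar_def)
  next
    case (3 X)
    hence X: "(fst X, snd X) \<in> El" by (simp add: E_def)
    show ?case using El1[OF X] El2[OF _ X] X by (simp add: E_def Ar_def)
  next
    case (7 f W X g Y h Z)
    thus ?case by (auto simp: E_def Ar_def)
  qed (auto simp: E_def Ar_def)
  have F: "is_functor E C F"
    unfolding is_functor_def using E category_axioms El1 by (auto simp: E_def F_def Ar_def)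
  have sE: "small \<kappa> (Obj E)"
  proof -
    have "Obj E \<subseteq> Sigma \<X> (\<lambda>Z. PiE I (\<lambda>i. Hom C Z (D i)))"
      by (auto simp: E_def El_def cone_def PiE_def)
    moreover have "small \<kappa> (Sigma \<X> (\<lambda>Z. PiE I (\<lambda>i. Hom C Z (D i))))"
      by (intro small_Sigma small_extensional inacc small_gen I small_Hom)
    ultimately show ?thesis using small_mono by blast
  qed
  have sA: "small \<kappa> (Arr E)"
  proof -
    have "Arr E \<subseteq> Sigma (Obj E) (\<lambda>x. Sigma (Obj E) (\<lambda>y. Hom C (fst x) (fst y)))"
      by (auto simp: E_def Ar_def)
    moreover have "small \<kappa> (Sigma (Obj E) (\<lambda>x. Sigma (Obj E) (\<lambda>y. Hom C (fst x) (fst y))))"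
      by (intro small_Sigma inacc sE small_Hom)
    ultimately show ?thesis using small_mono by blast
  qed
  obtain Q \<iota> where Q: "is_colimit C E F Q \<iota>" using cocomplete_small[OF inacc cocomplete sE sA F] by metis
  have QO: "Q \<in> Obj C" using colimit_Obj[OF Q] .
  have \<iota>: "\<iota> x \<in> Hom C (fst x) Q" if "x \<in> El" for x
    using colimit_in[OF Q, of x] that by (simp add: E_def F_def)
  have \<iota>_nat: "\<iota> y \<cdot> f = \<iota> x" if "(x, y, f) \<in> Ar" for x y f
    using colimit_nat[OF Q, of "(x, y, f)"] that by (simp add: E_def F_def)
  have "\<exists>p. p \<in> Hom C Q (D i) \<and> (\<forall>x\<in>El. p \<cdot> \<iota> x = snd x i)" if "i \<in> I" for i
  proof -
    have "cocone C E F (D i) (\<lambda>x. snd x i)"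
      unfolding cocone_def using El2[OF that] that D by (auto simp: E_def F_def Ar_def)
    from colimit_ex[OF Q this] obtain h where "h \<in> Hom C Q (D i)" "\<And>x. x \<in> Obj E \<Longrightarrow> h \<cdot> \<iota> x = snd x i" by blast
    thus ?thesis by (intro exI[of _ h]) (simp add: E_def)
  qed
  then obtain p where p: "\<And>i. i \<in> I \<Longrightarrow> p i \<in> Hom C Q (D i)" "\<And>i x. i \<in> I \<Longrightarrow> x \<in> El \<Longrightarrow> p i \<cdot> \<iota> x = snd x i"
    by metis
  have pcone: "cone Q p"
    unfolding cone_def
  proof (intro conjI ballI)
    fix k assume k: "k \<in> K"
    show "u k \<cdot> p (s k) = v k \<cdot> p (r k)"
    proof (rule colimit_ext[OF Q _ _ F])
      fix x assume "x \<in> Obj E" hence x: "x \<in> El" by (simp add: E_def)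
      have "(u k \<cdot> p (s k)) \<cdot> \<iota> x = u k \<cdot> snd x (s k)" "(v k \<cdot> p (r k)) \<cdot> \<iota> x = v k \<cdot> snd x (r k)"
        using K[OF k] p \<iota>[OF x] x by simp_all
      thus "(u k \<cdot> p (s k)) \<cdot> \<iota> x = (v k \<cdot> p (r k)) \<cdot> \<iota> x"
        using x k by (simp add: El_def cone_def)
    qed (use K[OF k] p in simp_all)
  qed (use QO p in simp_all)
  \<comment> \<open>The vertex \<open>A\<close> is a colimit of generators. Restricting the cone to
    each piece gives an element of \<open>El\<close>, and the coprojections of \<open>Q\<close> at
    these elements form a cocone on the pieces.\<close>
  have weak: "\<exists>h. h \<in> Hom C A Q \<and> (\<forall>i\<in>I. p i \<cdot> h = a i)" if a: "cone A a" for A a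
  proof -
    obtain R :: "'u rel" and G g where R: "is_functor (poset_cat R) C G" "\<And>j. j \<in> Field R \<Longrightarrow> FOb G j \<in> \<X>"
      "is_colimit C (poset_cat R) G A g" using gen_colimit[of A] a unfolding cone_def by metis
    note G = functorD[OF R(1), simplified]
    define x where "x j = (FOb G j, restrict (\<lambda>i. a i \<cdot> g j) I)" for j
    have g: "g j \<in> Hom C (FOb G j) A" if "j \<in> Field R" for j using colimit_in[OF R(3)] that by simp
    have x: "x j \<in> El" if "j \<in> Field R" for j
      using R(2)[OF that] cone_comp[OF a g[OF that]] by (simp add: x_def El_def cone_res)
    have "cocone C (poset_cat R) G Q (\<lambda>j. \<iota> (x j))"
      unfolding cocone_def
    proof (intro conjI ballI)
      fix f assume f: "f \<in> Arr (poset_cat R)"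
      hence j: "fst f \<in> Field R" "snd f \<in> Field R" by (simp_all add: Field_pair)
      have Gf: "FAr G f \<in> Hom C (FOb G (fst f)) (FOb G (snd f))" using G(5)[of f] f by simp
      have "g (snd f) \<cdot> FAr G f = g (fst f)" using colimit_nat[OF R(3) f] by simp
      hence "(a i \<cdot> g (snd f)) \<cdot> FAr G f = a i \<cdot> g (fst f)" if "i \<in> I" for i
        using a that g j Gf by (simp add: cone_def)
      hence "(x (fst f), x (snd f), FAr G f) \<in> Ar"
        using x j Gf by (simp add: Ar_def x_def)
      thus "\<iota> (x (Cod (poset_cat R) f)) \<cdot> FAr G f = \<iota> (x (Dom (poset_cat R) f))"
        using \<iota>_nat by simp
    qed (use QO \<iota>[OF x] in \<open>simp_all add: x_def\<close>)
    from colimit_ex[OF R(3) this] obtain h where h: "h \<in> Hom C A Q" "\<And>j. j \<in> Field R \<Longrightarrow> h \<cdot> g j = \<iota> (x j)"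
      by auto
    have "p i \<cdot> h = a i" if i: "i \<in> I" for i
    proof (rule colimit_ext[OF R(3) _ _ R(1)])
      fix j assume "j \<in> Obj (poset_cat R)"
      hence j: "j \<in> Field R" by simp
      have "(p i \<cdot> h) \<cdot> g j = p i \<cdot> \<iota> (x j)" using p(1)[OF i] h g[OF j] j by simp
      also have "\<dots> = a i \<cdot> g j" using p(2)[OF i x[OF j]] i by (simp add: x_def)
      finally show "(p i \<cdot> h) \<cdot> g j = a i \<cdot> g j" .
    qed (use p(1)[OF i] h(1) a i in \<open>auto simp: cone_def\<close>)
    with h(1) show ?thesis by blast
  qed
  define S where "S = {e \<in> Hom C Q Q. \<forall>i\<in>I. p i \<cdot> e = p i}"
  have idS: "Idn C Q \<in> S" using QO p by (simp add: S_def)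
  have S: "S \<subseteq> Hom C Q Q" "S \<noteq> {}" using idS by (auto simp: S_def)
  obtain L q where q: "q \<in> Hom C Q L"
    and qS: "\<forall>s\<in>S. \<forall>t\<in>S. q \<cdot> s = q \<cdot> t"
    and q_ex: "\<forall>Q'. \<forall>q' \<in> Hom C Q Q'. (\<forall>s\<in>S. \<forall>t\<in>S. q' \<cdot> s = q' \<cdot> t) \<longrightarrow> (\<exists>h. h \<in> Hom C L Q' \<and> h \<cdot> q = q')"
    and q_epi: "\<And>W u v. u \<in> Hom C L W \<Longrightarrow> v \<in> Hom C L W \<Longrightarrow> u \<cdot> q = v \<cdot> q \<Longrightarrow> u = v"
    by (rule multi_coequalizer[OF S]) (rule that; assumption)
  have LO: "L \<in> Obj C" using Hom_Obj(2)[OF q] .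
  have "\<forall>i\<in>I. \<exists>h. h \<in> Hom C L (D i) \<and> h \<cdot> q = p i"
  proof
    fix i assume "i \<in> I"
    thus "\<exists>h. h \<in> Hom C L (D i) \<and> h \<cdot> q = p i" using p(1) q_ex by (simp add: S_def del: Hom_iff)
  qed
  then obtain \<pi> where \<pi>: "\<And>i. i \<in> I \<Longrightarrow> \<pi> i \<in> Hom C L (D i)" "\<And>i. i \<in> I \<Longrightarrow> \<pi> i \<cdot> q = p i" by metis
  have \<pi>cone: "u k \<cdot> \<pi> (s k) = v k \<cdot> \<pi> (r k)" if k: "k \<in> K" for k
  proof (rule q_epi)
    have "(u k \<cdot> \<pi> (s k)) \<cdot> q = u k \<cdot> p (s k)" "(v k \<cdot> \<pi> (r k)) \<cdot> q = v k \<cdot> p (r k)"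
      using K[OF k] \<pi> q by simp_all
    thus "(u k \<cdot> \<pi> (s k)) \<cdot> q = (v k \<cdot> \<pi> (r k)) \<cdot> q" using pcone k by (simp add: cone_def)
  qed (use K[OF k] \<pi> in simp_all)
  have uniq: "f = g" if fg: "f \<in> Hom C A L" "g \<in> Hom C A L" "\<And>i. i \<in> I \<Longrightarrow> \<pi> i \<cdot> f = \<pi> i \<cdot> g" for A f g
  proof -
    have fgS: "{f, g} \<subseteq> Hom C A L" "{f, g} \<noteq> {}" using fg by auto
    obtain M c where c: "c \<in> Hom C L M"
      and cfg: "\<forall>s\<in>{f, g}. \<forall>t\<in>{f, g}. c \<cdot> s = c \<cdot> t"
      and c_ex: "\<forall>Q'. \<forall>q' \<in> Hom C L Q'. (\<forall>s\<in>{f, g}. \<forall>t\<in>{f, g}. q' \<cdot> s = q' \<cdot> t) \<longrightarrow> (\<exists>h. h \<in> Hom C M Q' \<and> h \<cdot> c = q')"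
      and c_epi: "\<And>W u v. u \<in> Hom C M W \<Longrightarrow> v \<in> Hom C M W \<Longrightarrow> u \<cdot> c = v \<cdot> c \<Longrightarrow> u = v"
      by (rule multi_coequalizer[OF fgS]) (rule that; assumption)
    have "\<forall>i\<in>I. \<exists>h. h \<in> Hom C M (D i) \<and> h \<cdot> c = \<pi> i"
    proof
      fix i assume i: "i \<in> I"
      have "\<forall>s\<in>{f, g}. \<forall>t\<in>{f, g}. \<pi> i \<cdot> s = \<pi> i \<cdot> t" using fg(3)[OF i] by auto
      with \<pi>(1)[OF i] show "\<exists>h. h \<in> Hom C M (D i) \<and> h \<cdot> c = \<pi> i" using c_ex by blast
    qed
    then obtain p' where p': "\<And>i. i \<in> I \<Longrightarrow> p' i \<in> Hom C M (D i)" "\<And>i. i \<in> I \<Longrightarrow> p' i \<cdot> c = \<pi> i" by metis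
    have "cone M p'"
      unfolding cone_def
    proof (intro conjI ballI)
      fix k assume k: "k \<in> K"
      show "u k \<cdot> p' (s k) = v k \<cdot> p' (r k)"
      proof (rule c_epi)
        have "(u k \<cdot> p' (s k)) \<cdot> c = u k \<cdot> \<pi> (s k)" "(v k \<cdot> p' (r k)) \<cdot> c = v k \<cdot> \<pi> (r k)"
          using K[OF k] p' c by simp_all
        thus "(u k \<cdot> p' (s k)) \<cdot> c = (v k \<cdot> p' (r k)) \<cdot> c" using \<pi>cone[OF k] by simp
      qed (use K[OF k] p' in simp_all)
    qed (use Hom_Obj(2)[OF c] p' in simp_all)
    from weak[OF this] obtain h where h: "h \<in> Hom C M Q" "\<And>i. i \<in> I \<Longrightarrow> p i \<cdot> h = p' i" by auto
    \<comment> \<open>With \<open>c\<close> the coequalizer of \<open>f\<close> and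
      \<open>g\<close>, the way from \<open>Q\<close> through \<open>L\<close> and \<open>M\<close>
      back to \<open>Q\<close> is an endomorphism of the cone \<open>Q\<close>, so \<open>q\<close>
      does not distinguish it from the identity. As \<open>q\<close> is epic,
      \<open>q \<cdot> h\<close> is a left inverse of \<open>c\<close>, and \<open>f = g\<close>
      follows.\<close>
    have "h \<cdot> (c \<cdot> q) \<in> S"
    proof -
      have "p i \<cdot> (h \<cdot> (c \<cdot> q)) = p i" if i: "i \<in> I" for i
      proof -
        have "p i \<cdot> (h \<cdot> (c \<cdot> q)) = ((p i \<cdot> h) \<cdot> c) \<cdot> q" using p(1)[OF i] h(1) c q by simp
        thus ?thesis using h(2)[OF i] p'(2)[OF i] \<pi>(2)[OF i] by simp
      qed
      thus ?thesis using h c q by (simp add: S_def)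
    qed
    from qS[rule_format, OF this idS] have e: "((q \<cdot> h) \<cdot> c) \<cdot> q = Idn C L \<cdot> q" using h c q by simp
    have e: "(q \<cdot> h) \<cdot> c = Idn C L" by (rule q_epi[OF _ _ e]) (use h c q LO in simp_all)
    have "f = ((q \<cdot> h) \<cdot> c) \<cdot> f" unfolding e using fg by simp
    also have "\<dots> = (q \<cdot> h) \<cdot> (c \<cdot> f)" using fg h c q by simp
    also have "\<dots> = (q \<cdot> h) \<cdot> (c \<cdot> g)" using cfg by (metis insertCI)
    also have "\<dots> = ((q \<cdot> h) \<cdot> c) \<cdot> g" using fg h c q by simp
    also have "\<dots> = g" unfolding e using fg by simp
    finally show ?thesis .
  qed
  show ?thesis
  proof (rule that[OF LO])
    show "\<And>i. i \<in> I \<Longrightarrow> \<pi> i \<in> Hom C L (D i)" by (rule \<pi>(1))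
    show "\<And>k. k \<in> K \<Longrightarrow> u k \<cdot> \<pi> (s k) = v k \<cdot> \<pi> (r k)" by (rule \<pi>cone)
    fix Z \<phi> assume "Z \<in> Obj C" "\<And>i. i \<in> I \<Longrightarrow> \<phi> i \<in> Hom C Z (D i)" "\<And>k. k \<in> K \<Longrightarrow> u k \<cdot> \<phi> (s k) = v k \<cdot> \<phi> (r k)"
    hence "cone Z \<phi>" unfolding cone_def by blast
    from weak[OF this] obtain h where h: "h \<in> Hom C Z Q" "\<And>i. i \<in> I \<Longrightarrow> p i \<cdot> h = \<phi> i" by auto
    have *: "\<pi> i \<cdot> (q \<cdot> h) = \<phi> i" if i: "i \<in> I" for i
    proof -
      have "\<pi> i \<cdot> (q \<cdot> h) = (\<pi> i \<cdot> q) \<cdot> h" using \<pi>(1)[OF i] q h by simp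
      thus ?thesis using \<pi>(2)[OF i] h(2)[OF i] by simp
    qed
    show "\<exists>!h. h \<in> Hom C Z L \<and> (\<forall>i\<in>I. \<pi> i \<cdot> h = \<phi> i)"
    proof (rule ex1I[of _ "q \<cdot> h"])
      show "q \<cdot> h \<in> Hom C Z L \<and> (\<forall>i\<in>I. \<pi> i \<cdot> (q \<cdot> h) = \<phi> i)" using * q h by simp
      fix h' assume h': "h' \<in> Hom C Z L \<and> (\<forall>i\<in>I. \<pi> i \<cdot> h' = \<phi> i)"
      show "h' = q \<cdot> h" by (rule uniq[of _ Z]) (use h' * q h in simp_all)
    qed
  qed
qed

end

section \<open>Elements of directed colimits\<close>

lemma Set_cat_simps [simp]:
  "Obj (Set_cat \<kappa>) = {A. small \<kappa> A}"
  "(A, f, B) \<in> Arr (Set_cat \<kappa>) \<longleftrightarrow> small \<kappa> A \<and> small \<kappa> B \<and> f \<in> A \<rightarrow>\<^sub>E B"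
  "Dom (Set_cat \<kappa>) (A, f, B) = A" "Cod (Set_cat \<kappa>) (A, f, B) = B"
  "Cmp (Set_cat \<kappa>) (B', g, D) (A, f, B) = (A, compose A g f, D)"
  "Idn (Set_cat \<kappa>) A = (A, \<lambda>x \<in> A. x, A)"
  by (simp_all add: Set_cat_def)

lemma category_Set_cat: "category (Set_cat \<kappa>)"
proof (unfold_locales, goal_cases)
  case (4 f X Y g Z)
  thus ?case by (cases f; cases g) (auto simp: compose_def)
next
  case (5 f X Y)
  thus ?case by (cases f) (auto simp: compose_def fun_eq_iff PiE_def extensional_def)
next
  case (6 f X Y)
  thus ?case by (cases f) (auto simp: compose_def fun_eq_iff PiE_def extensional_def)
next
  case (7 f W X g Y h Z)
  thus ?case by (cases f; cases g; cases h) (auto simp: compose_def fun_eq_iff)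
qed auto

text \<open>Functions into a two-element set suffice to recognize the elements of a colimit of sets.\<close>

lemma Set_colimit_pred:
  fixes \<kappa> :: "'e rel" and G :: "('j, 'k, 'e set, 'e set_arrow) func"
  assumes \<kappa>: "inaccessible \<kappa>" and col: "is_colimit (Set_cat \<kappa>) D G Q \<iota>" and G: "is_functor D (Set_cat \<kappa>) G"
  shows "(\<And>j v. j \<in> Obj D \<Longrightarrow> v \<in> FOb G j \<Longrightarrow> p1 (fst (snd (\<iota> j)) v) \<longleftrightarrow> p2 (fst (snd (\<iota> j)) v)) \<Longrightarrow> q \<in> Q \<Longrightarrow> p1 q \<longleftrightarrow> p2 q"
    and "(\<And>f v. f \<in> Arr D \<Longrightarrow> v \<in> fst (FAr G f) \<Longrightarrow> p (Cod D f) (fst (snd (FAr G f)) v) \<longleftrightarrow> p (Dom D f) v) \<Longrightarrow>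
      \<exists>P. \<forall>j \<in> Obj D. \<forall>v \<in> FOb G j. P (fst (snd (\<iota> j)) v) \<longleftrightarrow> p j v"
proof -
  interpret S: category "Set_cat \<kappa>" by (rule category_Set_cat)
  have "infinite (Field \<kappa>)" using inaccessibleD[OF \<kappa>] by simp
  then obtain a b :: 'e where ab: "a \<noteq> b" by (metis finite.emptyI finite.insertI finite_subset insert_iff subsetI)
  let ?B = "{a, b}"
  have sB: "small \<kappa> ?B" by (rule small_finite[OF \<kappa>]) simp
  have sQ: "small \<kappa> Q" using colimit_Obj[OF col] by simp
  have arr: "small \<kappa> A \<and> f = (A, fst (snd f), B) \<and> fst (snd f) \<in> A \<rightarrow>\<^sub>E B" if "f \<in> Hom (Set_cat \<kappa>) A B"
    for f :: "'e set_arrow" and A B using that by (cases f) auto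
  define c where "c A P = (A, (\<lambda>x \<in> A. if P x then a else b), ?B)" for A :: "'e set" and P
  have c: "c A P \<in> Hom (Set_cat \<kappa>) A ?B" if "small \<kappa> A" for A P
    using that sB by (auto simp: c_def)
  have c_eq: "c A P = c A P' \<longleftrightarrow> (\<forall>x\<in>A. P x = P' x)" for A P P'
    using ab by (auto simp: c_def fun_eq_iff restrict_def)
  have c_comp: "c A P \<cdot>\<^bsub>Set_cat \<kappa>\<^esub> f = c A' (\<lambda>v. P (fst (snd f) v))" if "f \<in> Hom (Set_cat \<kappa>) A' A" for P f A A'
    using arr[OF that] by (cases f) (auto simp: c_def compose_def restrict_def fun_eq_iff)
  show "p1 q \<longleftrightarrow> p2 q" if *: "\<And>j v. j \<in> Obj D \<Longrightarrow> v \<in> FOb G j \<Longrightarrow> p1 (fst (snd (\<iota> j)) v) \<longleftrightarrow> p2 (fst (snd (\<iota> j)) v)" and q: "q \<in> Q"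
  proof -
    have "c Q p1 = c Q p2"
    proof (rule S.colimit_ext[OF col c[OF sQ] c[OF sQ] G])
      fix j assume j: "j \<in> Obj D"
      show "c Q p1 \<cdot>\<^bsub>Set_cat \<kappa>\<^esub> \<iota> j = c Q p2 \<cdot>\<^bsub>Set_cat \<kappa>\<^esub> \<iota> j"
        unfolding c_comp[OF colimit_in[OF col j]] c_eq using *[OF j] by blast
    qed
    thus ?thesis using q unfolding c_eq by blast
  qed
  show "\<exists>P. \<forall>j \<in> Obj D. \<forall>v \<in> FOb G j. P (fst (snd (\<iota> j)) v) \<longleftrightarrow> p j v"
    if *: "\<And>f v. f \<in> Arr D \<Longrightarrow> v \<in> fst (FAr G f) \<Longrightarrow> p (Cod D f) (fst (snd (FAr G f)) v) \<longleftrightarrow> p (Dom D f) v"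
  proof -
    have "cocone (Set_cat \<kappa>) D G ?B (\<lambda>j. c (FOb G j) (p j))"
      unfolding cocone_def
    proof (intro conjI ballI)
      show "?B \<in> Obj (Set_cat \<kappa>)" using sB by simp
      show "c (FOb G j) (p j) \<in> Hom (Set_cat \<kappa>) (FOb G j) ?B" if "j \<in> Obj D" for j
        by (rule c) (use functorD(3)[OF G that] in simp)
      fix f assume f: "f \<in> Arr D"
      have "fst (FAr G f) = FOb G (Dom D f)" using arr[OF functorD(5)[OF G f]] by (metis fst_conv)
      thus "c (FOb G (Cod D f)) (p (Cod D f)) \<cdot>\<^bsub>Set_cat \<kappa>\<^esub> FAr G f = c (FOb G (Dom D f)) (p (Dom D f))"
        unfolding c_comp[OF functorD(5)[OF G f]] c_eq using *[OF f] by blast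
    qed
    from colimit_ex[OF col this] obtain h where h: "h \<in> Hom (Set_cat \<kappa>) Q ?B"
      "\<And>j. j \<in> Obj D \<Longrightarrow> h \<cdot>\<^bsub>Set_cat \<kappa>\<^esub> \<iota> j = c (FOb G j) (p j)" by blast
    have hc: "h = c Q (\<lambda>x. fst (snd h) x = a)"
      using arr[OF h(1)] ab by (cases h) (auto simp: c_def fun_eq_iff restrict_def PiE_iff extensional_def)
    have "c (FOb G j) (\<lambda>v. fst (snd h) (fst (snd (\<iota> j)) v) = a) = c (FOb G j) (p j)" if "j \<in> Obj D" for j
      using c_comp[OF colimit_in[OF col that], of "\<lambda>x. fst (snd h) x = a"] h(2)[OF that]
      by (simp flip: hc)
    thus ?thesis unfolding c_eq by (intro exI[of _ "\<lambda>x. fst (snd h) x = a"]) blast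
  qed
qed

context cocomplete_category
begin

lemma hom_functor_functor:
  assumes "X \<in> Obj C"
  shows "is_functor C (Set_cat \<kappa>) (hom_functor C X)"
  unfolding is_functor_def
proof (intro conjI ballI impI)
  fix f g assume fg: "f \<in> Arr C" "g \<in> Arr C" "Dom C g = Cod C f"
  show "FAr (hom_functor C X) (g \<cdot> f) = FAr (hom_functor C X) g \<cdot>\<^bsub>Set_cat \<kappa>\<^esub> FAr (hom_functor C X) f"
    using fg by (auto simp: hom_functor_def compose_def restrict_def fun_eq_iff)
next
  fix Y assume "Y \<in> Obj C"
  thus "FAr (hom_functor C X) (Idn C Y) = Idn (Set_cat \<kappa>) (FOb (hom_functor C X) Y)"
    using assms by (auto simp: hom_functor_def restrict_def fun_eq_iff)
qed (use category_axioms category_Set_cat small_Hom in \<open>auto simp: hom_functor_def simp del: Hom_iff\<close>,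
  auto simp: hom_functor_def small_Hom)

lemma func_comp_functor:
  assumes "is_functor D C F" "is_functor C B G"
  shows "is_functor D B (func_comp G F)"
  unfolding is_functor_def func_comp_def
  using functorD[OF assms(1)] functorD[OF assms(2)]
  by (auto simp: category.Dom_Obj category.Cod_Obj)

end

text \<open>Hom-sets are sets of arrows. With \<kappa> carried by the type of arrows that type is
  infinite, which provides the two-element test set used to recognize elements in a colimit of
  hom-sets.\<close>

locale universe_category = cocomplete_category C \<kappa> for C :: "('o, 'a, 'z) cat_scheme" (structure) and \<kappa> :: "'a rel"
begin

lemma hom_colimit_factor:
  assumes "preserves_colimits_of C (Set_cat \<kappa>) (hom_functor C X) D F" "is_colimit C D F Q \<iota>"
    "is_functor D C F" "u \<in> Hom C X Q"
  obtains j v where "j \<in> Obj D" "v \<in> Hom C X (FOb F j)" "\<iota> j \<cdot> v = u"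
proof -
  let ?G = "func_comp (hom_functor C X) F"
  have X: "X \<in> Obj C" using Hom_Obj(1)[OF assms(4)] .
  have col: "is_colimit (Set_cat \<kappa>) D ?G (FOb (hom_functor C X) Q) (\<lambda>j. FAr (hom_functor C X) (\<iota> j))"
    using assms(1,2) unfolding preserves_colimits_of_def by blast
  have G: "is_functor D (Set_cat \<kappa>) ?G" by (rule func_comp_functor[OF assms(3) hom_functor_functor[OF X]])
  \<comment> \<open>Membership in \<open>?S\<close> is true on the image of every coprojection, as
    is the constant predicate \<open>True\<close>; two predicates on the colimit that agree there
    agree everywhere.\<close>
  let ?S = "{\<iota> j \<cdot> v |j v. j \<in> Obj D \<and> v \<in> Hom C X (FOb F j)}"
  have "u \<in> ?S \<longleftrightarrow> True"
  proof (rule Set_colimit_pred(1)[OF inacc col G])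
    fix j v assume jv: "j \<in> Obj D" "v \<in> FOb ?G j"
    hence "v \<in> Hom C X (FOb F j)" by (simp add: func_comp_def hom_functor_def)
    moreover from this have "fst (snd (FAr (hom_functor C X) (\<iota> j))) v = \<iota> j \<cdot> v"
      using colimit_in[OF assms(2) jv(1)] by (simp add: hom_functor_def)
    ultimately show "fst (snd (FAr (hom_functor C X) (\<iota> j))) v \<in> ?S \<longleftrightarrow> True"
      using jv(1) by auto
  next
    show "u \<in> FOb (hom_functor C X) Q" using assms(4) by (simp add: hom_functor_def)
  qed
  thus ?thesis using that by blast
qed

lemma hom_colimit_eventually_eq:
  assumes "preserves_colimits_of C (Set_cat \<kappa>) (hom_functor C X) (poset_cat R) F" "is_colimit C (poset_cat R) F Q \<iota>"
    "is_functor (poset_cat R) C F" "directed_poset \<kappa>' \<rho> R" "regular_cardinal \<rho>"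
    "j \<in> Field R" "u \<in> Hom C X (FOb F j)" "v \<in> Hom C X (FOb F j)" "\<iota> j \<cdot> u = \<iota> j \<cdot> v"
  obtains k where "(j, k) \<in> R" "FAr F (j, k) \<cdot> u = FAr F (j, k) \<cdot> v"
proof -
  let ?G = "func_comp (hom_functor C X) F"
  note F = functorD[OF assms(3), simplified]
  note R = directed_posetD[OF assms(4)]
  have X: "X \<in> Obj C" using Hom_Obj(1)[OF assms(7)] .
  have col: "is_colimit (Set_cat \<kappa>) (poset_cat R) ?G (FOb (hom_functor C X) Q) (\<lambda>j. FAr (hom_functor C X) (\<iota> j))"
    using assms(1,2) unfolding preserves_colimits_of_def by blast
  have G: "is_functor (poset_cat R) (Set_cat \<kappa>) ?G" by (rule func_comp_functor[OF assms(3) hom_functor_functor[OF X]])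
  have FA: "FAr F (k, l) \<in> Arr C" "Dom C (FAr F (k, l)) = FOb F k" "Cod C (FAr F (k, l)) = FOb F l" if "(k, l) \<in> R" for k l
    using F(5)[OF that] by auto
  have FC: "FAr F (l, m) \<cdot> FAr F (k, l) = FAr F (k, m)" if "(k, l) \<in> R" "(l, m) \<in> R" for k l m
    using F(6)[OF that] by simp
  have G_ap: "fst (snd (FAr ?G (k, l))) w = FAr F (k, l) \<cdot> w" if "(k, l) \<in> R" "w \<in> Hom C X (FOb F k)" for k l w
    using that FA[OF that(1)] by (simp add: func_comp_def hom_functor_def)
  have \<iota>_ap: "fst (snd (FAr (hom_functor C X) (\<iota> k))) w = \<iota> k \<cdot> w" if "k \<in> Field R" "w \<in> Hom C X (FOb F k)" for k w
    using that colimit_in[OF assms(2), of k] by (simp add: hom_functor_def)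
  \<comment> \<open>\<open>p k w\<close> says that \<open>w\<close> and \<open>u\<close> become
    equal at a common later stage. This is invariant under the transition maps, so it descends to a
    predicate on the colimit, where \<open>u\<close> and \<open>v\<close> have the same
    image.\<close>
  define p where "p k w \<longleftrightarrow> (\<exists>l. (k, l) \<in> R \<and> (j, l) \<in> R \<and> FAr F (k, l) \<cdot> w = FAr F (j, l) \<cdot> u)" for k w
  have "\<exists>P. \<forall>k \<in> Obj (poset_cat R). \<forall>w \<in> FOb ?G k. P (fst (snd (FAr (hom_functor C X) (\<iota> k))) w) \<longleftrightarrow> p k w"
  proof (rule Set_colimit_pred(2)[OF inacc col G])
    fix f w assume f: "f \<in> Arr (poset_cat R)" and w: "w \<in> fst (FAr ?G f)"
    obtain k l where f': "f = (k, l)" "(k, l) \<in> R" using f by (cases f) simp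
    have w': "w \<in> Hom C X (FOb F k)" using w FA[OF f'(2)] by (simp add: f' func_comp_def hom_functor_def)
    have "p l (FAr F (k, l) \<cdot> w) \<longleftrightarrow> p k w"
    proof
      assume "p l (FAr F (k, l) \<cdot> w)"
      then obtain m where m: "(l, m) \<in> R" "(j, m) \<in> R" "FAr F (l, m) \<cdot> (FAr F (k, l) \<cdot> w) = FAr F (j, m) \<cdot> u"
        unfolding p_def by blast
      have "FAr F (l, m) \<cdot> (FAr F (k, l) \<cdot> w) = FAr F (k, m) \<cdot> w"
        by (rule Cmp_reduce[OF FC[OF f'(2) m(1)]]) (use FA[OF f'(2)] FA[OF m(1)] w' in simp_all)
      with m R(2)[OF f'(2) m(1)] show "p k w" unfolding p_def by auto
    next
      assume "p k w"
      then obtain m where m: "(k, m) \<in> R" "(j, m) \<in> R" "FAr F (k, m) \<cdot> w = FAr F (j, m) \<cdot> u"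
        unfolding p_def by blast
      obtain n where n: "(l, n) \<in> R" "(m, n) \<in> R"
        using directed_poset_bound[OF assms(4,5)] f'(2) m(1) by (metis FieldI2)
      have "FAr F (l, n) \<cdot> (FAr F (k, l) \<cdot> w) = FAr F (k, n) \<cdot> w"
        by (rule Cmp_reduce[OF FC[OF f'(2) n(1)]]) (use FA[OF f'(2)] FA[OF n(1)] w' in simp_all)
      also have "\<dots> = FAr F (m, n) \<cdot> (FAr F (k, m) \<cdot> w)"
        by (rule Cmp_reduce[OF FC[OF m(1) n(2)], symmetric]) (use FA[OF m(1)] FA[OF n(2)] w' in simp_all)
      also have "\<dots> = FAr F (m, n) \<cdot> (FAr F (j, m) \<cdot> u)" unfolding m(3) ..
      also have "\<dots> = FAr F (j, n) \<cdot> u"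
        by (rule Cmp_reduce[OF FC[OF m(2) n(2)]]) (use FA[OF m(2)] FA[OF n(2)] assms(7) in simp_all)
      finally show "p l (FAr F (k, l) \<cdot> w)" unfolding p_def using n R(2)[OF m(2) n(2)] by blast
    qed
    thus "p (Cod (poset_cat R) f) (fst (snd (FAr ?G f)) w) \<longleftrightarrow> p (Dom (poset_cat R) f) w"
      using G_ap[OF f'(2) w'] f' by simp
  qed
  then obtain P where P0: "\<And>k w. k \<in> Field R \<Longrightarrow> w \<in> FOb ?G k \<Longrightarrow> P (fst (snd (FAr (hom_functor C X) (\<iota> k))) w) \<longleftrightarrow> p k w"
    by auto
  have P: "P (\<iota> k \<cdot> w) \<longleftrightarrow> p k w" if "k \<in> Field R" "w \<in> Hom C X (FOb F k)" for k w
    using P0[of k w] that unfolding \<iota>_ap[OF that] by (simp add: func_comp_def hom_functor_def)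
  have "p j u" unfolding p_def using R(1)[OF assms(6)] by blast
  hence "p j v" using P[OF assms(6,7)] P[OF assms(6,8)] assms(9) by simp
  thus ?thesis unfolding p_def using that by (metis)
qed

end

section \<open>Limits in the base of enrichment\<close>

locale enriched_base = pointed_smc V + colimit_generated V \<kappa> \<X> + universe_category V \<kappa>
  for V :: "('o, 'a) smc" (structure) and \<kappa> :: "'a rel" and \<X> :: "'o set"
begin

lemma product:
  assumes "small \<kappa> I" "\<And>i. i \<in> I \<Longrightarrow> A i \<in> Obj V"
  obtains Q p where "is_product V I A Q p"
proof (rule limit[where I = I and D = A and K = "{}" and s = undefined and r = undefined
      and u = "undefined :: 'a \<Rightarrow> 'a" and v = undefined and W = undefined])
  fix L \<pi> assume L: "L \<in> Obj V" "\<And>i. i \<in> I \<Longrightarrow> \<pi> i \<in> Hom V L (A i)"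
    "\<And>Z \<phi>. Z \<in> Obj V \<Longrightarrow> (\<And>i. i \<in> I \<Longrightarrow> \<phi> i \<in> Hom V Z (A i)) \<Longrightarrow>
      (\<And>k. k \<in> {} \<Longrightarrow> undefined k \<cdot> \<phi> (undefined k) = undefined k \<cdot> \<phi> (undefined k)) \<Longrightarrow>
      \<exists>!h. h \<in> Hom V Z L \<and> (\<forall>i\<in>I. \<pi> i \<cdot> h = \<phi> i)"
  show thesis
  proof (rule that)
    show "is_product V I A L \<pi>"
      unfolding is_product_def
    proof (intro conjI ballI allI impI)
      show "L \<in> Obj V" by fact
      show "\<pi> i \<in> Hom V L (A i)" if "i \<in> I" for i using L(2) that by blast
      fix Q p assume "Q \<in> Obj V" "\<forall>i\<in>I. p i \<in> Hom V Q (A i)"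
      thus "\<exists>!h. h \<in> Hom V Q L \<and> (\<forall>i\<in>I. \<pi> i \<cdot> h = p i)" by (intro L(3)) blast+
    qed
  qed
qed (use assms in auto)

lemma equalizer:
  assumes "f \<in> Hom V A B" "g \<in> Hom V A B"
  obtains e where "is_equalizer V f g e"
proof (rule limit[where I = "{()}" and D = "\<lambda>_. A" and K = "{()}" and s = "\<lambda>_. ()" and r = "\<lambda>_. ()"
      and u = "\<lambda>_. f" and v = "\<lambda>_. g" and W = "\<lambda>_. B"])
  fix L \<pi> assume L: "L \<in> Obj V" "\<And>i. i \<in> {()} \<Longrightarrow> \<pi> i \<in> Hom V L A" "\<And>k. k \<in> {()} \<Longrightarrow> f \<cdot> \<pi> () = g \<cdot> \<pi> ()"
    "\<And>Z \<phi>. Z \<in> Obj V \<Longrightarrow> (\<And>i. i \<in> {()} \<Longrightarrow> \<phi> i \<in> Hom V Z A) \<Longrightarrow>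
      (\<And>k. k \<in> {()} \<Longrightarrow> f \<cdot> \<phi> () = g \<cdot> \<phi> ()) \<Longrightarrow>
      \<exists>!h. h \<in> Hom V Z L \<and> (\<forall>i\<in>{()}. \<pi> i \<cdot> h = \<phi> i)"
  show thesis
  proof (rule that)
    show "is_equalizer V f g (\<pi> ())"
      unfolding is_equalizer_def
    proof (intro conjI ballI allI impI)
      fix W w assume w: "w \<in> Hom V W (Dom V f)" "f \<cdot> w = g \<cdot> w"
      have "\<exists>!h. h \<in> Hom V W L \<and> (\<forall>i\<in>{()}. \<pi> i \<cdot> h = w)"
        by (rule L(4)) (use w assms(1) Hom_Obj(1)[OF w(1)] in auto)
      thus "\<exists>!h. h \<in> Hom V W (Dom V (\<pi> ())) \<and> \<pi> () \<cdot> h = w" using L(2) by simp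
    qed (use L assms in auto)
  qed
qed (use assms Hom_Obj[OF assms(1)] in \<open>auto intro: small_finite[OF inacc]\<close>)

lemma pullback:
  assumes "f \<in> Hom V A C" "g \<in> Hom V B C"
  obtains p q where "is_pullback V f g p q"
proof (rule limit[where I = "UNIV :: bool set" and D = "\<lambda>b. if b then A else B" and K = "{()}"
      and s = "\<lambda>_. True" and r = "\<lambda>_. False" and u = "\<lambda>_. f" and v = "\<lambda>_. g" and W = "\<lambda>_. C"])
  fix L \<pi> assume L: "L \<in> Obj V" "\<And>b. b \<in> UNIV \<Longrightarrow> \<pi> b \<in> Hom V L (if b then A else B)"
    "\<And>k. k \<in> {()} \<Longrightarrow> f \<cdot> \<pi> True = g \<cdot> \<pi> False"
    "\<And>Z \<phi>. Z \<in> Obj V \<Longrightarrow> (\<And>b. b \<in> UNIV \<Longrightarrow> \<phi> b \<in> Hom V Z (if b then A else B)) \<Longrightarrow>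
      (\<And>k. k \<in> {()} \<Longrightarrow> f \<cdot> \<phi> True = g \<cdot> \<phi> False) \<Longrightarrow>
      \<exists>!h. h \<in> Hom V Z L \<and> (\<forall>b\<in>UNIV. \<pi> b \<cdot> h = \<phi> b)"
  show thesis
  proof (rule that)
    show "is_pullback V f g (\<pi> True) (\<pi> False)"
      unfolding is_pullback_def
    proof (intro conjI ballI allI impI)
      fix W w x assume w: "w \<in> Hom V W (Dom V f)" "x \<in> Hom V W (Dom V g)" "f \<cdot> w = g \<cdot> x"
      have "\<exists>!h. h \<in> Hom V W L \<and> (\<forall>b\<in>UNIV. \<pi> b \<cdot> h = (if b then w else x))"
        by (rule L(4)) (use w assms Hom_Obj(1)[OF w(1)] in auto)
      thus "\<exists>!h. h \<in> Hom V W (Dom V (\<pi> True)) \<and> \<pi> True \<cdot> h = w \<and> \<pi> False \<cdot> h = x"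
        using L(2)[of True] by (simp add: all_bool_eq)
    qed (use L(3) L(2)[of True] L(2)[of False] assms in auto)
  qed
qed (use assms Hom_Obj[OF assms(1)] Hom_Obj[OF assms(2)] in \<open>auto intro: small_finite[OF inacc]\<close>)

text \<open>Arrows out of the tensor product of \<open>E\<close> with a hom-object of
  \<open>C\<close> are compared on pairs of points. Enriched naturality thereby splits into one
  equation of arrows out of \<open>E\<close> for each point of a hom-object, and the end becomes an
  ordinary limit.\<close>

lemma vnat_wedge_iff:
  assumes "\<And>X. X \<in> VObj C \<Longrightarrow> VOb G X \<in> Obj V" "\<And>X. X \<in> VObj C \<Longrightarrow> VOb H X \<in> Obj V"
    "\<And>X Y. X \<in> VObj C \<Longrightarrow> Y \<in> VObj C \<Longrightarrow> VAr G X Y \<in> Hom V (VHom C X Y) (ihom V (VOb G X) (VOb G Y))"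
    "\<And>X Y. X \<in> VObj C \<Longrightarrow> Y \<in> VObj C \<Longrightarrow> VAr H X Y \<in> Hom V (VHom C X Y) (ihom V (VOb H X) (VOb H Y))"
  shows "vnat_wedge V C G H E \<omega> \<longleftrightarrow> E \<in> Obj V \<and>
    (\<forall>X \<in> VObj C. \<omega> X \<in> Hom V E (ihom V (VOb G X) (VOb H X))) \<and>
    (\<forall>X \<in> VObj C. \<forall>Y \<in> VObj C. \<forall>t \<in> Hom V II (VHom C X Y).
      pre (unname V (VOb G X) (VOb G Y) (VAr G X Y \<cdot> t)) (VOb H Y) \<cdot> \<omega> Y
      = pst (VOb G X) (unname V (VOb H X) (VOb H Y) (VAr H X Y \<cdot> t)) \<cdot> \<omega> X)"
proof -
  have "(VCmp (self_vcat V) (VOb G X) (VOb G Y) (VOb H Y) \<cdot> (\<omega> Y \<odot> VAr G X Y)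
        = VCmp (self_vcat V) (VOb G X) (VOb H X) (VOb H Y) \<cdot> (VAr H X Y \<odot> \<omega> X) \<cdot> symm V E (VHom C X Y)) \<longleftrightarrow>
      (\<forall>t \<in> Hom V II (VHom C X Y). pre (unname V (VOb G X) (VOb G Y) (VAr G X Y \<cdot> t)) (VOb H Y) \<cdot> \<omega> Y
      = pst (VOb G X) (unname V (VOb H X) (VOb H Y) (VAr H X Y \<cdot> t)) \<cdot> \<omega> X)" (is "?l = ?r \<longleftrightarrow> _")
    if E: "E \<in> Obj V" and \<omega>: "\<And>X. X \<in> VObj C \<Longrightarrow> \<omega> X \<in> Hom V E (ihom V (VOb G X) (VOb H X))"
      and X: "X \<in> VObj C" and Y: "Y \<in> VObj C" for X Y
  proof -
    note o = assms(1)[OF X] assms(1)[OF Y] assms(2)[OF X] assms(2)[OF Y] Hom_Obj(1)[OF assms(3)[OF X Y]]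
    note h = assms(3)[OF X Y] assms(4)[OF X Y] \<omega>[OF X] \<omega>[OF Y] E
    have l: "?l \<cdot> pr e t = name_of V (VOb G X) (VOb H Y) (unname V (VOb G Y) (VOb H Y) (\<omega> Y \<cdot> e) \<cdot> unname V (VOb G X) (VOb G Y) (VAr G X Y \<cdot> t))"
      if "e \<in> Hom V II E" "t \<in> Hom V II (VHom C X Y)" for e t
    proof -
      have "?l \<cdot> pr e t = VCmp (self_vcat V) (VOb G X) (VOb G Y) (VOb H Y) \<cdot> pr (\<omega> Y \<cdot> e) (VAr G X Y \<cdot> t)"
        using that o h by simp
      also have "\<dots> = name_of V (VOb G X) (VOb H Y) (unname V (VOb G Y) (VOb H Y) (\<omega> Y \<cdot> e) \<cdot> unname V (VOb G X) (VOb G Y) (VAr G X Y \<cdot> t))"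
        by (rule self_VCmp_pr') (use that o h in simp_all)
      finally show ?thesis .
    qed
    have r: "?r \<cdot> pr e t = name_of V (VOb G X) (VOb H Y) (unname V (VOb H X) (VOb H Y) (VAr H X Y \<cdot> t) \<cdot> unname V (VOb G X) (VOb H X) (\<omega> X \<cdot> e))"
      if "e \<in> Hom V II E" "t \<in> Hom V II (VHom C X Y)" for e t
    proof -
      have "?r \<cdot> pr e t = VCmp (self_vcat V) (VOb G X) (VOb H X) (VOb H Y) \<cdot> pr (VAr H X Y \<cdot> t) (\<omega> X \<cdot> e)"
        using that o h symm_pr[OF that] by simp
      also have "\<dots> = name_of V (VOb G X) (VOb H Y) (unname V (VOb H X) (VOb H Y) (VAr H X Y \<cdot> t) \<cdot> unname V (VOb G X) (VOb H X) (\<omega> X \<cdot> e))"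
        by (rule self_VCmp_pr') (use that o h in simp_all)
      finally show ?thesis .
    qed
    show ?thesis
    proof
      assume lr: "?l = ?r"
      show "\<forall>t \<in> Hom V II (VHom C X Y). pre (unname V (VOb G X) (VOb G Y) (VAr G X Y \<cdot> t)) (VOb H Y) \<cdot> \<omega> Y
        = pst (VOb G X) (unname V (VOb H X) (VOb H Y) (VAr H X Y \<cdot> t)) \<cdot> \<omega> X"
      proof
        fix t assume t: "t \<in> Hom V II (VHom C X Y)"
        show "pre (unname V (VOb G X) (VOb G Y) (VAr G X Y \<cdot> t)) (VOb H Y) \<cdot> \<omega> Y
          = pst (VOb G X) (unname V (VOb H X) (VOb H Y) (VAr H X Y \<cdot> t)) \<cdot> \<omega> X" (is "?a = ?b")
        proof (rule pt_ext[of _ E "ihom V (VOb G X) (VOb H Y)"])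
          fix e assume e: "e \<in> Hom V II E"
          have eq: "unname V (VOb G Y) (VOb H Y) (\<omega> Y \<cdot> e) \<cdot> unname V (VOb G X) (VOb G Y) (VAr G X Y \<cdot> t)
            = unname V (VOb H X) (VOb H Y) (VAr H X Y \<cdot> t) \<cdot> unname V (VOb G X) (VOb H X) (\<omega> X \<cdot> e)"
          proof -
            have "name_of V (VOb G X) (VOb H Y) (unname V (VOb G Y) (VOb H Y) (\<omega> Y \<cdot> e) \<cdot> unname V (VOb G X) (VOb G Y) (VAr G X Y \<cdot> t))
              = name_of V (VOb G X) (VOb H Y) (unname V (VOb H X) (VOb H Y) (VAr H X Y \<cdot> t) \<cdot> unname V (VOb G X) (VOb H X) (\<omega> X \<cdot> e))"
              using l[OF e t] r[OF e t] lr by simp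
            from arg_cong[OF this, of "unname V (VOb G X) (VOb H Y)"] show ?thesis using o h e t by simp
          qed
          show "?a \<cdot> e = ?b \<cdot> e"
            by (rule unname_inject[of _ "VOb G X" "VOb H Y"]) (use o h e t eq in simp_all)
        qed (use o h t in simp_all)
      qed
    next
      assume *: "\<forall>t \<in> Hom V II (VHom C X Y). pre (unname V (VOb G X) (VOb G Y) (VAr G X Y \<cdot> t)) (VOb H Y) \<cdot> \<omega> Y
        = pst (VOb G X) (unname V (VOb H X) (VOb H Y) (VAr H X Y \<cdot> t)) \<cdot> \<omega> X"
      show "?l = ?r"
      proof (rule tensor_ext[of _ E "VHom C X Y" "ihom V (VOb G X) (VOb H Y)"])
        fix e t assume e: "e \<in> Hom V II E" and t: "t \<in> Hom V II (VHom C X Y)"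
        let ?g = "unname V (VOb G X) (VOb G Y) (VAr G X Y \<cdot> t)" and ?h = "unname V (VOb H X) (VOb H Y) (VAr H X Y \<cdot> t)"
        have "unname V (VOb G X) (VOb H Y) ((pre ?g (VOb H Y) \<cdot> \<omega> Y) \<cdot> e) = unname V (VOb G X) (VOb H Y) ((pst (VOb G X) ?h \<cdot> \<omega> X) \<cdot> e)"
          using * t by metis
        hence "unname V (VOb G Y) (VOb H Y) (\<omega> Y \<cdot> e) \<cdot> ?g = ?h \<cdot> unname V (VOb G X) (VOb H X) (\<omega> X \<cdot> e)"
          using o h e t by simp
        thus "?l \<cdot> pr e t = ?r \<cdot> pr e t" using l[OF e t] r[OF e t] by simp
      qed (use o h in simp_all)
    qed
  qed
  thus ?thesis unfolding vnat_wedge_def by blast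
qed

text \<open>The end is the limit of the objects [G X, H X] cut out by the equations of
  \<open>vnat_wedge_iff\<close>, which are indexed by \<open>?K\<close>.\<close>

lemma vnat_object_exists:
  assumes C: "small \<kappa> (VObj C)" and GH: "\<And>X. X \<in> VObj C \<Longrightarrow> VOb G X \<in> Obj V" "\<And>X. X \<in> VObj C \<Longrightarrow> VOb H X \<in> Obj V"
    "\<And>X Y. X \<in> VObj C \<Longrightarrow> Y \<in> VObj C \<Longrightarrow> VAr G X Y \<in> Hom V (VHom C X Y) (ihom V (VOb G X) (VOb G Y))"
    "\<And>X Y. X \<in> VObj C \<Longrightarrow> Y \<in> VObj C \<Longrightarrow> VAr H X Y \<in> Hom V (VHom C X Y) (ihom V (VOb H X) (VOb H Y))"
  shows "\<exists>E \<omega>. is_vnat_object V C G H E \<omega>"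
proof -
  let ?K = "{(X, Y, t). X \<in> VObj C \<and> Y \<in> VObj C \<and> t \<in> Hom V II (VHom C X Y)}"
  let ?u = "\<lambda>(X, Y, t). pre (unname V (VOb G X) (VOb G Y) (VAr G X Y \<cdot> t)) (VOb H Y)"
  let ?v = "\<lambda>(X, Y, t). pst (VOb G X) (unname V (VOb H X) (VOb H Y) (VAr H X Y \<cdot> t))"
  have w: "vnat_wedge V C G H E \<omega> \<longleftrightarrow> E \<in> Obj V \<and>
    (\<forall>X \<in> VObj C. \<omega> X \<in> Hom V E (ihom V (VOb G X) (VOb H X))) \<and>
    (\<forall>X \<in> VObj C. \<forall>Y \<in> VObj C. \<forall>t \<in> Hom V II (VHom C X Y).
      pre (unname V (VOb G X) (VOb G Y) (VAr G X Y \<cdot> t)) (VOb H Y) \<cdot> \<omega> Y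
      = pst (VOb G X) (unname V (VOb H X) (VOb H Y) (VAr H X Y \<cdot> t)) \<cdot> \<omega> X)" for E \<omega>
    by (rule vnat_wedge_iff; rule GH)
  show ?thesis
  proof (rule limit[where I = "VObj C" and D = "\<lambda>X. ihom V (VOb G X) (VOb H X)" and K = ?K
        and s = "\<lambda>(X, Y, t). Y" and r = "\<lambda>(X, Y, t). X" and u = ?u and v = ?v and W = "\<lambda>(X, Y, t). ihom V (VOb G X) (VOb H Y)"])
    show "small \<kappa> (VObj C)" by fact
    show "ihom V (VOb G X) (VOb H X) \<in> Obj V" if "X \<in> VObj C" for X using GH that by simp
    fix k assume "k \<in> ?K"
    then obtain X Y t where k: "k = (X, Y, t)" "X \<in> VObj C" "Y \<in> VObj C" "t \<in> Hom V II (VHom C X Y)" by blast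
    note h = GH(1)[OF k(2)] GH(1)[OF k(3)] GH(2)[OF k(2)] GH(2)[OF k(3)] GH(3)[OF k(2,3)] GH(4)[OF k(2,3)]
    show "(\<lambda>(X, Y, t). Y) k \<in> VObj C" "(\<lambda>(X, Y, t). X) k \<in> VObj C" using k by simp_all
    show "?u k \<in> Hom V (ihom V (VOb G ((\<lambda>(X, Y, t). Y) k)) (VOb H ((\<lambda>(X, Y, t). Y) k))) ((\<lambda>(X, Y, t). ihom V (VOb G X) (VOb H Y)) k)"
      using k h by simp
    show "?v k \<in> Hom V (ihom V (VOb G ((\<lambda>(X, Y, t). X) k)) (VOb H ((\<lambda>(X, Y, t). X) k))) ((\<lambda>(X, Y, t). ihom V (VOb G X) (VOb H Y)) k)"
      using k h by simp
  next
    fix L \<pi> assume L: "L \<in> Obj V" "\<And>X. X \<in> VObj C \<Longrightarrow> \<pi> X \<in> Hom V L (ihom V (VOb G X) (VOb H X))"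
      "\<And>k. k \<in> ?K \<Longrightarrow> ?u k \<cdot> \<pi> ((\<lambda>(X, Y, t). Y) k) = ?v k \<cdot> \<pi> ((\<lambda>(X, Y, t). X) k)"
      "\<And>Z \<phi>. Z \<in> Obj V \<Longrightarrow> (\<And>X. X \<in> VObj C \<Longrightarrow> \<phi> X \<in> Hom V Z (ihom V (VOb G X) (VOb H X))) \<Longrightarrow>
        (\<And>k. k \<in> ?K \<Longrightarrow> ?u k \<cdot> \<phi> ((\<lambda>(X, Y, t). Y) k) = ?v k \<cdot> \<phi> ((\<lambda>(X, Y, t). X) k)) \<Longrightarrow>
        \<exists>!h. h \<in> Hom V Z L \<and> (\<forall>X\<in>VObj C. \<pi> X \<cdot> h = \<phi> X)"
    have "is_vnat_object V C G H L \<pi>"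
      unfolding is_vnat_object_def w
    proof (intro conjI ballI allI impI)
      show "L \<in> Obj V" by fact
      show "\<pi> X \<in> Hom V L (ihom V (VOb G X) (VOb H X))" if "X \<in> VObj C" for X using L(2) that by blast
      show "pre (unname V (VOb G X) (VOb G Y) (VAr G X Y \<cdot> t)) (VOb H Y) \<cdot> \<pi> Y
        = pst (VOb G X) (unname V (VOb H X) (VOb H Y) (VAr H X Y \<cdot> t)) \<cdot> \<pi> X"
        if "X \<in> VObj C" "Y \<in> VObj C" "t \<in> Hom V II (VHom C X Y)" for X Y t
        using L(3)[of "(X, Y, t)"] that by simp
      fix E' \<omega>' assume *: "E' \<in> Obj V \<and>
        (\<forall>X \<in> VObj C. \<omega>' X \<in> Hom V E' (ihom V (VOb G X) (VOb H X))) \<and>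
        (\<forall>X \<in> VObj C. \<forall>Y \<in> VObj C. \<forall>t \<in> Hom V II (VHom C X Y).
          pre (unname V (VOb G X) (VOb G Y) (VAr G X Y \<cdot> t)) (VOb H Y) \<cdot> \<omega>' Y
          = pst (VOb G X) (unname V (VOb H X) (VOb H Y) (VAr H X Y \<cdot> t)) \<cdot> \<omega>' X)"
      show "\<exists>!h. h \<in> Hom V E' L \<and> (\<forall>X\<in>VObj C. \<pi> X \<cdot> h = \<omega>' X)"
        by (rule L(4)) (use * in auto)
    qed
    thus ?thesis by blast
  qed
qed

lemma vnat_object:
  assumes "small \<kappa> (VObj C)" "\<And>X. X \<in> VObj C \<Longrightarrow> VOb G X \<in> Obj V" "\<And>X. X \<in> VObj C \<Longrightarrow> VOb H X \<in> Obj V"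
    "\<And>X Y. X \<in> VObj C \<Longrightarrow> Y \<in> VObj C \<Longrightarrow> VAr G X Y \<in> Hom V (VHom C X Y) (ihom V (VOb G X) (VOb G Y))"
    "\<And>X Y. X \<in> VObj C \<Longrightarrow> Y \<in> VObj C \<Longrightarrow> VAr H X Y \<in> Hom V (VHom C X Y) (ihom V (VOb H X) (VOb H Y))"
  shows "is_vnat_object V C G H (fst (vnat_object V C G H)) (snd (vnat_object V C G H))"
proof -
  have "\<exists>x. case x of (E, \<omega>) \<Rightarrow> is_vnat_object V C G H E \<omega>" using vnat_object_exists[OF assms] by simp
  from someI_ex[OF this] show ?thesis unfolding vnat_object_def case_prod_unfold .
qed

end

section \<open>Algebras of a pretheory in terms of elements\<close>

lemma V_functorD:
  assumes "V_functor V C D G"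
  shows "V_category V C" "V_category V D" "X \<in> VObj C \<Longrightarrow> VOb G X \<in> VObj D"
    "X \<in> VObj C \<Longrightarrow> VAr G X X \<cdot>\<^bsub>V\<^esub> VIdn C X = VIdn D (VOb G X)"
    "X \<in> VObj C \<Longrightarrow> Y \<in> VObj C \<Longrightarrow> VAr G X Y \<in> Hom V (VHom C X Y) (VHom D (VOb G X) (VOb G Y))"
    "X \<in> VObj C \<Longrightarrow> Y \<in> VObj C \<Longrightarrow> Z \<in> VObj C \<Longrightarrow> VAr G X Z \<cdot>\<^bsub>V\<^esub> VCmp C X Y Z
        = VCmp D (VOb G X) (VOb G Y) (VOb G Z) \<cdot>\<^bsub>V\<^esub> (VAr G Y Z \<odot>\<^bsub>V\<^esub> VAr G X Y)"
  using assms unfolding V_functor_def by blast+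

text \<open>That the opposite theory and \<open>V\<close> itself are \<open>V\<close>-categories and
  that the forgetful functor is a \<open>V\<close>-functor is assumed here, because the definitions
  of algebras and of adjunctions contain these facts.\<close>

locale pretheory_base = enriched_base V \<kappa> \<X> for V :: "('o, 'a) smc" (structure) and \<kappa> :: "'a rel" and \<X> :: "'o set" +
  fixes P :: "'o set" and T :: "('o, 'o, 'a) vcat" and J :: "('o, 'o, 'a) vfun"
  assumes P_Obj: "P \<subseteq> Obj V" and small_P: "small \<kappa> P" and One_P: "II \<in> P"
    and pretheory: "pretheory V P T J"
    and T_op: "V_category V (vcat_op V T)" and self_cat: "V_category V (self_vcat V)"
    and forget_functor: "V_functor V (Alg V P T J) (self_vcat V) (forget V P T)"
begin

lemma P_Obj' [simp]: "X \<in> P \<Longrightarrow> X \<in> Obj V"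
  using P_Obj by blast

lemma T_cat: "V_category V T" and VObj_T [simp]: "VObj T = P" and VOb_J [simp]: "X \<in> P \<Longrightarrow> VOb J X = X"
  and J_functor: "V_functor V (full_vcat (self_vcat V) P) T J"
  using pretheory unfolding pretheory_def V_functor_def by auto

lemma VHom_T [simp]: "X \<in> P \<Longrightarrow> Y \<in> P \<Longrightarrow> VHom T X Y \<in> Obj V"
  using V_category.VHom_Obj[OF T_cat, of X Y] by simp

lemma VIdn_T [simp]:
  assumes "X \<in> P"
  shows "VIdn T X \<in> Arr V" "Dom V (VIdn T X) = II" "Cod V (VIdn T X) = VHom T X X"
  using V_category.VIdn_Hom[OF T_cat, of X] assms by auto

lemma VCmp_T [simp]:
  assumes "X \<in> P" "Y \<in> P" "Z \<in> P"
  shows "VCmp T X Y Z \<in> Arr V" "Dom V (VCmp T X Y Z) = VHom T Y Z \<otimes> VHom T X Y" "Cod V (VCmp T X Y Z) = VHom T X Z"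
  using V_category.VCmp_Hom[OF T_cat, of X Y Z] assms by auto

lemma VAr_J [simp]:
  assumes "X \<in> P" "Y \<in> P"
  shows "VAr J X Y \<in> Arr V" "Dom V (VAr J X Y) = ihom V X Y" "Cod V (VAr J X Y) = VHom T X Y"
  using J_functor assms unfolding V_functor_def by auto

abbreviation "alg \<equiv> is_algebra V P T J"

text \<open>Arrows \<open>a : X \<rightarrow> A\<close> are regarded as elements of \<open>A\<close>
  of shape \<open>X\<close>; they are the points of \<open>V(X, A)\<close>. The functor of an
  algebra is contravariant, so an arrow \<open>t : Y \<rightarrow> X\<close> of the theory takes an
  element of shape \<open>X\<close> to one of shape \<open>Y\<close>.\<close>

definition ap :: "('o, 'a) alg \<Rightarrow> 'o \<Rightarrow> 'o \<Rightarrow> 'a \<Rightarrow> 'a \<Rightarrow> 'a" where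
  "ap \<AA> X Y t a = unname V Y (fst \<AA>)
     (unname V (ihom V X (fst \<AA>)) (ihom V Y (fst \<AA>)) (VAr (snd \<AA>) X Y \<cdot> t) \<cdot> name_of V X (fst \<AA>) a)"

lemma algD:
  assumes "alg \<AA>"
  shows "fst \<AA> \<in> Obj V" "X \<in> P \<Longrightarrow> VOb (snd \<AA>) X = ihom V X (fst \<AA>)"
    "X \<in> P \<Longrightarrow> Y \<in> P \<Longrightarrow> VAr (snd \<AA>) X Y \<in> Hom V (VHom T Y X) (ihom V (ihom V X (fst \<AA>)) (ihom V Y (fst \<AA>)))"
    "X \<in> P \<Longrightarrow> VAr (snd \<AA>) X X \<cdot> VIdn T X = VIdn (self_vcat V) (ihom V X (fst \<AA>))"
    "X \<in> P \<Longrightarrow> Y \<in> P \<Longrightarrow> Z \<in> P \<Longrightarrow> VAr (snd \<AA>) X Z \<cdot> VCmp (vcat_op V T) X Y Z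
        = VCmp (self_vcat V) (ihom V X (fst \<AA>)) (ihom V Y (fst \<AA>)) (ihom V Z (fst \<AA>)) \<cdot> (VAr (snd \<AA>) Y Z \<odot> VAr (snd \<AA>) X Y)"
    "X \<in> P \<Longrightarrow> Y \<in> P \<Longrightarrow> VAr (snd \<AA>) X Y \<cdot> VAr J Y X = VAr (cohom_vfun V (self_vcat V) (fst \<AA>)) X Y"
proof -
  obtain A G where A: "\<AA> = (A, G)" by (cases \<AA>)
  have a: "A \<in> Obj V" "V_functor V (vcat_op V T) (self_vcat V) G"
     "vfun_eq_on P (vfun_comp V G (vfun_op J)) (cohom_vfun V (self_vcat V) A)"
    using assms by (auto simp: is_algebra_def A)
  have o: "VOb G X = ihom V X A" if "X \<in> P" for X
    using a(1,3) that by (simp add: vfun_eq_on_def vfun_comp_def vfun_op_def cohom_vfun_def)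
  show "fst \<AA> \<in> Obj V" "X \<in> P \<Longrightarrow> VOb (snd \<AA>) X = ihom V X (fst \<AA>)" for X using a o by (simp_all add: A)
  show "X \<in> P \<Longrightarrow> Y \<in> P \<Longrightarrow> VAr (snd \<AA>) X Y \<in> Hom V (VHom T Y X) (ihom V (ihom V X (fst \<AA>)) (ihom V Y (fst \<AA>)))" for X Y
    using a(2) o unfolding V_functor_def A by auto
  show "X \<in> P \<Longrightarrow> VAr (snd \<AA>) X X \<cdot> VIdn T X = VIdn (self_vcat V) (ihom V X (fst \<AA>))" for X
    using a(2) o unfolding V_functor_def A by auto
  show "X \<in> P \<Longrightarrow> Y \<in> P \<Longrightarrow> Z \<in> P \<Longrightarrow> VAr (snd \<AA>) X Z \<cdot> VCmp (vcat_op V T) X Y Z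
        = VCmp (self_vcat V) (ihom V X (fst \<AA>)) (ihom V Y (fst \<AA>)) (ihom V Z (fst \<AA>)) \<cdot> (VAr (snd \<AA>) Y Z \<odot> VAr (snd \<AA>) X Y)" for X Y Z
    using a(2) o unfolding V_functor_def A by auto
  show "X \<in> P \<Longrightarrow> Y \<in> P \<Longrightarrow> VAr (snd \<AA>) X Y \<cdot> VAr J Y X = VAr (cohom_vfun V (self_vcat V) (fst \<AA>)) X Y" for X Y
    using a(3) unfolding vfun_eq_on_def A by (simp add: vfun_comp_def vfun_op_def)
qed

lemma VAr_alg [simp]:
  assumes "alg \<AA>" "X \<in> P" "Y \<in> P"
  shows "VAr (snd \<AA>) X Y \<in> Arr V" "Dom V (VAr (snd \<AA>) X Y) = VHom T Y X"
    "Cod V (VAr (snd \<AA>) X Y) = ihom V (ihom V X (fst \<AA>)) (ihom V Y (fst \<AA>))"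
  using algD(3)[OF assms] by auto

lemma alg_Obj [simp]: "alg \<AA> \<Longrightarrow> fst \<AA> \<in> Obj V"
  by (rule algD)

lemma ap_simps [simp]:
  assumes "alg \<AA>" "X \<in> P" "Y \<in> P" "t \<in> Arr V" "Dom V t = II" "Cod V t = VHom T Y X"
    "a \<in> Arr V" "Dom V a = X" "Cod V a = fst \<AA>"
  shows "ap \<AA> X Y t a \<in> Arr V" "Dom V (ap \<AA> X Y t a) = Y" "Cod V (ap \<AA> X Y t a) = fst \<AA>"
  using assms by (simp_all add: ap_def)

lemma ap_unit:
  assumes "alg \<AA>" "X \<in> P" "a \<in> Hom V X (fst \<AA>)"
  shows "ap \<AA> X X (VIdn T X) a = a"
  using assms by (simp add: ap_def algD(4) self_VIdn)

lemma ap_comp: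
  assumes A: "alg \<AA>" "X \<in> P" "Y \<in> P" "Z \<in> P" and t: "t \<in> Hom V II (VHom T Y X)" and s: "s \<in> Hom V II (VHom T Z Y)"
    and a: "a \<in> Hom V X (fst \<AA>)"
  shows "ap \<AA> X Z (VCmp T Z Y X \<cdot> pr t s) a = ap \<AA> Y Z s (ap \<AA> X Y t a)"
proof -
  let ?H = "\<lambda>X. ihom V X (fst \<AA>)"
  have "VAr (snd \<AA>) X Z \<cdot> (VCmp T Z Y X \<cdot> pr t s) = (VAr (snd \<AA>) X Z \<cdot> VCmp (vcat_op V T) X Y Z) \<cdot> pr s t"
  proof -
    have "VCmp (vcat_op V T) X Y Z \<in> Hom V (VHom T Z Y \<otimes> VHom T Y X) (VHom T Z X)"
      using V_category.VCmp_Hom[OF T_op, of X Y Z] A by simp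
    thus ?thesis using A t s vcat_op_VCmp_pr[OF t s] by simp
  qed
  also have "\<dots> = VCmp (self_vcat V) (?H X) (?H Y) (?H Z) \<cdot> pr (VAr (snd \<AA>) Y Z \<cdot> s) (VAr (snd \<AA>) X Y \<cdot> t)"
    unfolding algD(5)[OF A] using A t s by simp
  finally have "unname V (?H X) (?H Z) (VAr (snd \<AA>) X Z \<cdot> (VCmp T Z Y X \<cdot> pr t s))
    = unname V (?H Y) (?H Z) (VAr (snd \<AA>) Y Z \<cdot> s) \<cdot> unname V (?H X) (?H Y) (VAr (snd \<AA>) X Y \<cdot> t)"
    using A t s by simp
  thus ?thesis using A t s a by (simp add: ap_def)
qed

lemma ap_J:
  assumes "alg \<AA>" "X \<in> P" "Y \<in> P" "x \<in> Hom V Y X" "a \<in> Hom V X (fst \<AA>)"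
  shows "ap \<AA> X Y (VAr J Y X \<cdot> name_of V Y X x) a = a \<cdot> x"
proof -
  have "VAr (snd \<AA>) X Y \<cdot> (VAr J Y X \<cdot> name_of V Y X x) = VAr (cohom_vfun V (self_vcat V) (fst \<AA>)) X Y \<cdot> name_of V Y X x"
    by (rule Cmp_reduce[OF algD(6)]) (use assms in simp_all)
  thus ?thesis unfolding ap_def using assms cohom_vfun_pt[of X Y "fst \<AA>" "name_of V Y X x" "name_of V X (fst \<AA>) a"]
    by simp
qed

text \<open>All operations from shape \<open>X\<close> to shape \<open>Y\<close> gathered into one
  arrow of \<open>V\<close>, by evaluating the action of the functor twice. It records that the
  operations come from an enriched functor and not merely from maps of sets.\<close>

definition ap_arrow :: "('o, 'a) alg \<Rightarrow> 'o \<Rightarrow> 'o \<Rightarrow> 'a" where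
  "ap_arrow \<AA> X Y = eval_arrow V Y (fst \<AA>) \<cdot>
     ((eval_arrow V (ihom V X (fst \<AA>)) (ihom V Y (fst \<AA>)) \<cdot> (VAr (snd \<AA>) X Y \<odot> Idn V (ihom V X (fst \<AA>)))) \<odot> Idn V Y)"

lemma ap_arrow_simps [simp]:
  assumes "alg \<AA>" "X \<in> P" "Y \<in> P"
  shows "ap_arrow \<AA> X Y \<in> Arr V" "Dom V (ap_arrow \<AA> X Y) = (VHom T Y X \<otimes> ihom V X (fst \<AA>)) \<otimes> Y"
    "Cod V (ap_arrow \<AA> X Y) = fst \<AA>"
  using assms by (simp_all add: ap_arrow_def)

lemma ap_arrow_pr:
  assumes "alg \<AA>" "X \<in> P" "Y \<in> P" "t \<in> Hom V II (VHom T Y X)" "a \<in> Hom V X (fst \<AA>)" "y \<in> Hom V II Y"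
  shows "ap_arrow \<AA> X Y \<cdot> pr (pr t (name_of V X (fst \<AA>) a)) y = ap \<AA> X Y t a \<cdot> y"
  using assms by (simp add: ap_arrow_def ap_def)

text \<open>Operations on elements form an algebra as soon as arrows \<beta> of \<open>V\<close>
  represent them. The functor is a double transpose of \<beta>; its laws are equations between
  arrows into iterated internal homs, hence decided by points, where they become the laws assumed of
  \<open>op\<close>.\<close>

lemma mk_algebra:
  assumes A: "A \<in> Obj V"
    and \<beta>: "\<And>X Y. X \<in> P \<Longrightarrow> Y \<in> P \<Longrightarrow> \<beta> X Y \<in> Hom V ((VHom T Y X \<otimes> ihom V X A) \<otimes> Y) A"
    and op: "\<And>X Y t a. X \<in> P \<Longrightarrow> Y \<in> P \<Longrightarrow> t \<in> Hom V II (VHom T Y X) \<Longrightarrow> a \<in> Hom V X A \<Longrightarrow> op X Y t a \<in> Hom V Y A"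
    and op_\<beta>: "\<And>X Y t a y. X \<in> P \<Longrightarrow> Y \<in> P \<Longrightarrow> t \<in> Hom V II (VHom T Y X) \<Longrightarrow> a \<in> Hom V X A \<Longrightarrow> y \<in> Hom V II Y \<Longrightarrow>
      \<beta> X Y \<cdot> pr (pr t (name_of V X A a)) y = op X Y t a \<cdot> y"
    and op_unit: "\<And>X a. X \<in> P \<Longrightarrow> a \<in> Hom V X A \<Longrightarrow> op X X (VIdn T X) a = a"
    and op_comp: "\<And>X Y Z t s a. X \<in> P \<Longrightarrow> Y \<in> P \<Longrightarrow> Z \<in> P \<Longrightarrow> t \<in> Hom V II (VHom T Y X) \<Longrightarrow> s \<in> Hom V II (VHom T Z Y) \<Longrightarrow>
      a \<in> Hom V X A \<Longrightarrow> op X Z (VCmp T Z Y X \<cdot> pr t s) a = op Y Z s (op X Y t a)"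
    and op_J: "\<And>X Y x a. X \<in> P \<Longrightarrow> Y \<in> P \<Longrightarrow> x \<in> Hom V Y X \<Longrightarrow> a \<in> Hom V X A \<Longrightarrow> op X Y (VAr J Y X \<cdot> name_of V Y X x) a = a \<cdot> x"
  obtains G where "alg (A, G)"
    "\<And>X Y t a. X \<in> P \<Longrightarrow> Y \<in> P \<Longrightarrow> t \<in> Hom V II (VHom T Y X) \<Longrightarrow> a \<in> Hom V X A \<Longrightarrow> ap (A, G) X Y t a = op X Y t a"
proof -
  define \<alpha> where "\<alpha> X Y = curry_arrow V (VHom T Y X) (ihom V X A) (ihom V Y A)
    (curry_arrow V (VHom T Y X \<otimes> ihom V X A) Y A (\<beta> X Y))" for X Y
  \<comment> \<open>\<open>is_algebra\<close> prescribes \<open>undefined\<close> outside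
    \<open>P\<close>.\<close>
  define G where "G = \<lparr>VOb = (\<lambda>X. if X \<in> P then ihom V X A else undefined),
    VAr = (\<lambda>X Y. if X \<in> P \<and> Y \<in> P then \<alpha> X Y else undefined)\<rparr>"
  have \<beta>' [simp]: "\<beta> X Y \<in> Arr V" "Dom V (\<beta> X Y) = (VHom T Y X \<otimes> ihom V X A) \<otimes> Y" "Cod V (\<beta> X Y) = A" if "X \<in> P" "Y \<in> P" for X Y
    using \<beta>[OF that] by auto
  have \<alpha>_simps [simp]: "\<alpha> X Y \<in> Arr V" "Dom V (\<alpha> X Y) = VHom T Y X" "Cod V (\<alpha> X Y) = ihom V (ihom V X A) (ihom V Y A)" if "X \<in> P" "Y \<in> P" for X Y
    using that A by (simp_all add: \<alpha>_def)
  have \<alpha>_op: "unname V Y A (unname V (ihom V X A) (ihom V Y A) (\<alpha> X Y \<cdot> t) \<cdot> u) = op X Y t (unname V X A u)"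
    if "X \<in> P" "Y \<in> P" "t \<in> Hom V II (VHom T Y X)" "u \<in> Hom V II (ihom V X A)" for X Y t u
  proof (rule pt_ext[of _ Y A])
    have a: "unname V X A u \<in> Hom V X A" using that A by simp
    show "op X Y t (unname V X A u) \<in> Hom V Y A" by (rule op[OF that(1-3) a])
    fix y assume y: "y \<in> Hom V II Y"
    have "unname V Y A (unname V (ihom V X A) (ihom V Y A) (\<alpha> X Y \<cdot> t) \<cdot> u) \<cdot> y = \<beta> X Y \<cdot> pr (pr t u) y"
      using that A y by (simp add: \<alpha>_def)
    also have "\<dots> = op X Y t (unname V X A u) \<cdot> y"
      using op_\<beta>[OF that(1-3) a y] that A by simp
    finally show "unname V Y A (unname V (ihom V X A) (ihom V Y A) (\<alpha> X Y \<cdot> t) \<cdot> u) \<cdot> y = op X Y t (unname V X A u) \<cdot> y" .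
  qed (use that A in simp_all)
  have ext: "f = g" if "f \<in> Hom V II (ihom V (ihom V X A) (ihom V Y A))" "g \<in> Hom V II (ihom V (ihom V X A) (ihom V Y A))" "X \<in> P" "Y \<in> P"
      "\<And>u. u \<in> Hom V II (ihom V X A) \<Longrightarrow> unname V Y A (unname V (ihom V X A) (ihom V Y A) f \<cdot> u)
          = unname V Y A (unname V (ihom V X A) (ihom V Y A) g \<cdot> u)" for f g X Y
  proof (rule ihom_pt_ext[OF that(1,2)])
    fix u assume u: "u \<in> Hom V II (ihom V X A)"
    show "unname V (ihom V X A) (ihom V Y A) f \<cdot> u = unname V (ihom V X A) (ihom V Y A) g \<cdot> u"
      by (rule unname_inject[of _ Y A]) (use that u A that(5)[OF u] in simp_all)
  qed (use that A in simp_all)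
  have G_functor: "V_functor V (vcat_op V T) (self_vcat V) G"
    unfolding V_functor_def
  proof (intro conjI ballI)
    fix X assume X: "X \<in> VObj (vcat_op V T)"
    hence P: "X \<in> P" by simp
    have "\<alpha> X X \<cdot> VIdn T X = name_of V (ihom V X A) (ihom V X A) (Idn V (ihom V X A))"
    proof (rule ext[of _ X X])
      fix u assume u: "u \<in> Hom V II (ihom V X A)"
      have a: "unname V X A u \<in> Hom V X A" using P A u by simp
      show "unname V X A (unname V (ihom V X A) (ihom V X A) (\<alpha> X X \<cdot> VIdn T X) \<cdot> u)
        = unname V X A (unname V (ihom V X A) (ihom V X A) (name_of V (ihom V X A) (ihom V X A) (Idn V (ihom V X A))) \<cdot> u)"
        using \<alpha>_op[OF P P, of "VIdn T X" u] op_unit[OF P a] P A u by simp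
    qed (use P A in simp_all)
    thus "VAr G X X \<cdot> VIdn (vcat_op V T) X = VIdn (self_vcat V) (VOb G X)"
      using P A by (simp add: G_def self_VIdn)
  next
    fix X Y Z assume XYZ: "X \<in> VObj (vcat_op V T)" "Y \<in> VObj (vcat_op V T)" "Z \<in> VObj (vcat_op V T)"
    hence P: "X \<in> P" "Y \<in> P" "Z \<in> P" by auto
    have c: "VCmp (vcat_op V T) X Y Z \<in> Hom V (VHom T Z Y \<otimes> VHom T Y X) (VHom T Z X)"
      using V_category.VCmp_Hom[OF T_op, of X Y Z] P by simp
    have "\<alpha> X Z \<cdot> VCmp (vcat_op V T) X Y Z = VCmp (self_vcat V) (ihom V X A) (ihom V Y A) (ihom V Z A) \<cdot> (\<alpha> Y Z \<odot> \<alpha> X Y)"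
      (is "?l = ?r")
    proof (rule tensor_ext[of _ "VHom T Z Y" "VHom T Y X" "ihom V (ihom V X A) (ihom V Z A)"])
      fix s t assume s: "s \<in> Hom V II (VHom T Z Y)" and t: "t \<in> Hom V II (VHom T Y X)"
      have l: "?l \<cdot> pr s t = \<alpha> X Z \<cdot> (VCmp T Z Y X \<cdot> pr t s)"
        using vcat_op_VCmp_pr[OF t s] P s t c A by simp
      have r: "?r \<cdot> pr s t = VCmp (self_vcat V) (ihom V X A) (ihom V Y A) (ihom V Z A) \<cdot> pr (\<alpha> Y Z \<cdot> s) (\<alpha> X Y \<cdot> t)"
        using P s t A by simp
      show "?l \<cdot> pr s t = ?r \<cdot> pr s t"
        unfolding l r
      proof (rule ext[of _ X Z])
        fix u assume u: "u \<in> Hom V II (ihom V X A)"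
        let ?v = "unname V (ihom V X A) (ihom V Y A) (\<alpha> X Y \<cdot> t) \<cdot> u"
        have v: "?v \<in> Hom V II (ihom V Y A)" using P s t A u by simp
        have a: "unname V X A u \<in> Hom V X A" using P A u by simp
        have ts: "VCmp T Z Y X \<cdot> pr t s \<in> Hom V II (VHom T Z X)" using P s t by simp
        have "unname V Z A (unname V (ihom V X A) (ihom V Z A)
            (VCmp (self_vcat V) (ihom V X A) (ihom V Y A) (ihom V Z A) \<cdot> pr (\<alpha> Y Z \<cdot> s) (\<alpha> X Y \<cdot> t)) \<cdot> u)
          = unname V Z A (unname V (ihom V Y A) (ihom V Z A) (\<alpha> Y Z \<cdot> s) \<cdot> ?v)"
          using P s t A u by simp
        also have "\<dots> = op Y Z s (op X Y t (unname V X A u))"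
          unfolding \<alpha>_op[OF P(2,3) s v] \<alpha>_op[OF P(1,2) t u] ..
        finally show "unname V Z A (unname V (ihom V X A) (ihom V Z A) (\<alpha> X Z \<cdot> (VCmp T Z Y X \<cdot> pr t s)) \<cdot> u)
          = unname V Z A (unname V (ihom V X A) (ihom V Z A)
            (VCmp (self_vcat V) (ihom V X A) (ihom V Y A) (ihom V Z A) \<cdot> pr (\<alpha> Y Z \<cdot> s) (\<alpha> X Y \<cdot> t)) \<cdot> u)"
          unfolding \<alpha>_op[OF P(1,3) ts u] op_comp[OF P t s a] by simp
      qed (use P s t A in simp_all)
    qed (use P c A in simp_all)
    thus "VAr G X Z \<cdot> VCmp (vcat_op V T) X Y Z = VCmp (self_vcat V) (VOb G X) (VOb G Y) (VOb G Z) \<cdot> (VAr G Y Z \<odot> VAr G X Y)"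
      using P by (simp add: G_def)
  qed (use T_op self_cat A in \<open>auto simp: G_def\<close>)
  have G_J: "vfun_eq_on P (vfun_comp V G (vfun_op J)) (cohom_vfun V (self_vcat V) A)"
    unfolding vfun_eq_on_def
  proof (intro conjI ballI)
    fix X assume X: "X \<in> P"
    thus "VOb (vfun_comp V G (vfun_op J)) X = VOb (cohom_vfun V (self_vcat V) A) X"
      using A by (simp add: vfun_comp_def vfun_op_def G_def)
    fix Y assume Y: "Y \<in> P"
    have "\<alpha> X Y \<cdot> VAr J Y X = VAr (cohom_vfun V (self_vcat V) A) X Y"
    proof (rule pt_ext[of _ "ihom V Y X" "ihom V (ihom V X A) (ihom V Y A)"])
      fix x assume x: "x \<in> Hom V II (ihom V Y X)"
      show "(\<alpha> X Y \<cdot> VAr J Y X) \<cdot> x = VAr (cohom_vfun V (self_vcat V) A) X Y \<cdot> x"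
      proof (rule ext[of _ X Y])
        fix u assume u: "u \<in> Hom V II (ihom V X A)"
        have Jx: "VAr J Y X \<cdot> x \<in> Hom V II (VHom T Y X)" using X Y x by simp
        have a: "unname V X A u \<in> Hom V X A" "unname V Y X x \<in> Hom V Y X" using X Y A u x by simp_all
        have "unname V Y A (unname V (ihom V X A) (ihom V Y A) ((\<alpha> X Y \<cdot> VAr J Y X) \<cdot> x) \<cdot> u) = op X Y (VAr J Y X \<cdot> x) (unname V X A u)"
          using \<alpha>_op[OF X Y Jx u] X Y x by simp
        also have "\<dots> = unname V X A u \<cdot> unname V Y X x"
          using op_J[OF X Y a(2,1)] x X Y by simp
        also have "\<dots> = unname V Y A (unname V (ihom V X A) (ihom V Y A) (VAr (cohom_vfun V (self_vcat V) A) X Y \<cdot> x) \<cdot> u)"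
          by (rule cohom_vfun_pt[symmetric]) (use X Y A x u in simp_all)
        finally show "unname V Y A (unname V (ihom V X A) (ihom V Y A) ((\<alpha> X Y \<cdot> VAr J Y X) \<cdot> x) \<cdot> u)
          = unname V Y A (unname V (ihom V X A) (ihom V Y A) (VAr (cohom_vfun V (self_vcat V) A) X Y \<cdot> x) \<cdot> u)" .
      qed (use X Y A x in simp_all)
    qed (use X Y A in simp_all)
    thus "VAr (vfun_comp V G (vfun_op J)) X Y = VAr (cohom_vfun V (self_vcat V) A) X Y"
      using X Y by (simp add: vfun_comp_def vfun_op_def G_def)
  qed
  have "alg (A, G)" using A G_functor G_J by (auto simp: is_algebra_def G_def)
  moreover have "ap (A, G) X Y t a = op X Y t a" if "X \<in> P" "Y \<in> P" "t \<in> Hom V II (VHom T Y X)" "a \<in> Hom V X A" for X Y t a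
    using \<alpha>_op[OF that(1-3), of "name_of V X A a"] that by (simp add: ap_def G_def)
  ultimately show ?thesis by (rule that)
qed

section \<open>Homomorphisms and the points of the hom-objects\<close>

definition ahom :: "('o, 'a) alg \<Rightarrow> ('o, 'a) alg \<Rightarrow> 'a \<Rightarrow> bool" where
  "ahom \<AA> \<BB> f \<longleftrightarrow> f \<in> Hom V (fst \<AA>) (fst \<BB>) \<and>
     (\<forall>X \<in> P. \<forall>Y \<in> P. \<forall>t \<in> Hom V II (VHom T Y X). \<forall>a \<in> Hom V X (fst \<AA>).
        f \<cdot> ap \<AA> X Y t a = ap \<BB> X Y t (f \<cdot> a))"

lemma ahom_Hom: "ahom \<AA> \<BB> f \<Longrightarrow> f \<in> Hom V (fst \<AA>) (fst \<BB>)"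
  by (simp add: ahom_def)

lemma ahom_simps: "ahom \<AA> \<BB> f \<Longrightarrow> f \<in> Arr V" "ahom \<AA> \<BB> f \<Longrightarrow> Dom V f = fst \<AA>" "ahom \<AA> \<BB> f \<Longrightarrow> Cod V f = fst \<BB>"
  by (simp_all add: ahom_def)

lemma ahom_ap:
  "ahom \<AA> \<BB> f \<Longrightarrow> X \<in> P \<Longrightarrow> Y \<in> P \<Longrightarrow> t \<in> Hom V II (VHom T Y X) \<Longrightarrow> a \<in> Hom V X (fst \<AA>) \<Longrightarrow>
    f \<cdot> ap \<AA> X Y t a = ap \<BB> X Y t (f \<cdot> a)"
  unfolding ahom_def by blast

lemma vnat_T:
  assumes "alg \<AA>" "alg \<BB>"
  shows "vnat_wedge V (vcat_op V T) (snd \<AA>) (snd \<BB>) E \<omega> \<longleftrightarrow> E \<in> Obj V \<and>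
    (\<forall>X \<in> P. \<omega> X \<in> Hom V E (ihom V (ihom V X (fst \<AA>)) (ihom V X (fst \<BB>)))) \<and>
    (\<forall>X \<in> P. \<forall>Y \<in> P. \<forall>t \<in> Hom V II (VHom T Y X).
      pre (unname V (ihom V X (fst \<AA>)) (ihom V Y (fst \<AA>)) (VAr (snd \<AA>) X Y \<cdot> t)) (ihom V Y (fst \<BB>)) \<cdot> \<omega> Y
      = pst (ihom V X (fst \<AA>)) (unname V (ihom V X (fst \<BB>)) (ihom V Y (fst \<BB>)) (VAr (snd \<BB>) X Y \<cdot> t)) \<cdot> \<omega> X)"
  and "is_vnat_object V (vcat_op V T) (snd \<AA>) (snd \<BB>) (fst (vnat_object V (vcat_op V T) (snd \<AA>) (snd \<BB>)))
    (snd (vnat_object V (vcat_op V T) (snd \<AA>) (snd \<BB>)))"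
proof -
  note o = algD(2)[OF assms(1)] algD(2)[OF assms(2)]
  show "is_vnat_object V (vcat_op V T) (snd \<AA>) (snd \<BB>) (fst (vnat_object V (vcat_op V T) (snd \<AA>) (snd \<BB>)))
    (snd (vnat_object V (vcat_op V T) (snd \<AA>) (snd \<BB>)))"
    by (rule vnat_object) (use assms small_P o in simp_all)
  show "vnat_wedge V (vcat_op V T) (snd \<AA>) (snd \<BB>) E \<omega> \<longleftrightarrow> E \<in> Obj V \<and>
    (\<forall>X \<in> P. \<omega> X \<in> Hom V E (ihom V (ihom V X (fst \<AA>)) (ihom V X (fst \<BB>)))) \<and>
    (\<forall>X \<in> P. \<forall>Y \<in> P. \<forall>t \<in> Hom V II (VHom T Y X).
      pre (unname V (ihom V X (fst \<AA>)) (ihom V Y (fst \<AA>)) (VAr (snd \<AA>) X Y \<cdot> t)) (ihom V Y (fst \<BB>)) \<cdot> \<omega> Y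
      = pst (ihom V X (fst \<AA>)) (unname V (ihom V X (fst \<BB>)) (ihom V Y (fst \<BB>)) (VAr (snd \<BB>) X Y \<cdot> t)) \<cdot> \<omega> X)"
    by (subst vnat_wedge_iff) (use assms o in simp_all)
qed

lemma vnat_P:
  assumes "A \<in> Obj V" "B \<in> Obj V"
  defines "D \<equiv> vcat_op V (full_vcat (self_vcat V) P)" and "G \<equiv> cohom_vfun V (self_vcat V) A" and "H \<equiv> cohom_vfun V (self_vcat V) B"
  shows "vnat_wedge V D G H E \<omega> \<longleftrightarrow> E \<in> Obj V \<and>
    (\<forall>X \<in> P. \<omega> X \<in> Hom V E (ihom V (ihom V X A) (ihom V X B))) \<and>
    (\<forall>X \<in> P. \<forall>Y \<in> P. \<forall>x \<in> Hom V II (ihom V Y X).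
      pre (unname V (ihom V X A) (ihom V Y A) (VAr G X Y \<cdot> x)) (ihom V Y B) \<cdot> \<omega> Y
      = pst (ihom V X A) (unname V (ihom V X B) (ihom V Y B) (VAr H X Y \<cdot> x)) \<cdot> \<omega> X)"
  and "is_vnat_object V D G H (fst (vnat_object V D G H)) (snd (vnat_object V D G H))"
  unfolding D_def G_def H_def
   apply (subst vnat_wedge_iff; use assms(1,2) in simp)
  by (rule vnat_object) (use assms(1,2) small_P in simp_all)

lemma vnat_object_pt_eq:
  assumes "is_vnat_object V C G H E \<omega>" "h \<in> Hom V W E" "h' \<in> Hom V W E" "\<And>X. X \<in> VObj C \<Longrightarrow> \<omega> X \<cdot> h = \<omega> X \<cdot> h'"
    "vnat_wedge V C G H W (\<lambda>X. \<omega> X \<cdot> h)"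
  shows "h = h'"
proof -
  have "\<exists>!k. k \<in> Hom V W E \<and> (\<forall>X \<in> VObj C. \<omega> X \<cdot> k = \<omega> X \<cdot> h)"
    using assms(1,5) unfolding is_vnat_object_def by blast
  thus ?thesis using assms(2-4) by metis
qed

lemma VAr_hom_name:
  assumes "X \<in> P" "f \<in> Hom V A B"
  shows "VAr (hom_vfun V (self_vcat V) X) A B \<cdot> name_of V A B f = name_of V (ihom V X A) (ihom V X B) (pst X f)"
proof -
  have o: "A \<in> Obj V" "B \<in> Obj V" using Hom_Obj[OF assms(2)] by auto
  show ?thesis
  proof (rule ihom_pt_ext[of _ "ihom V X A" "ihom V X B"])
    fix u assume u: "u \<in> Hom V II (ihom V X A)"
    show "unname V (ihom V X A) (ihom V X B) (VAr (hom_vfun V (self_vcat V) X) A B \<cdot> name_of V A B f) \<cdot> u =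
      unname V (ihom V X A) (ihom V X B) (name_of V (ihom V X A) (ihom V X B) (pst X f)) \<cdot> u"
      by (rule unname_inject[of _ X B])
        (use assms o u hom_vfun_pt[of X A B "name_of V A B f" u] in simp_all)
  qed (use assms o in simp_all)
qed

text \<open>The elements of shape \<open>X\<close> are the points of [X, A], so compatibility with
  \<open>t\<close> on all of them is an equation of arrows between internal homs.\<close>

lemma ahom_iff_arrows:
  assumes "alg \<AA>" "alg \<BB>" "f \<in> Hom V (fst \<AA>) (fst \<BB>)"
  shows "ahom \<AA> \<BB> f \<longleftrightarrow> (\<forall>X \<in> P. \<forall>Y \<in> P. \<forall>t \<in> Hom V II (VHom T Y X).
     pst Y f \<cdot> unname V (ihom V X (fst \<AA>)) (ihom V Y (fst \<AA>)) (VAr (snd \<AA>) X Y \<cdot> t)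
     = unname V (ihom V X (fst \<BB>)) (ihom V Y (fst \<BB>)) (VAr (snd \<BB>) X Y \<cdot> t) \<cdot> pst X f)"
proof -
  have "pst Y f \<cdot> unname V (ihom V X (fst \<AA>)) (ihom V Y (fst \<AA>)) (VAr (snd \<AA>) X Y \<cdot> t)
     = unname V (ihom V X (fst \<BB>)) (ihom V Y (fst \<BB>)) (VAr (snd \<BB>) X Y \<cdot> t) \<cdot> pst X f
    \<longleftrightarrow> (\<forall>a \<in> Hom V X (fst \<AA>). f \<cdot> ap \<AA> X Y t a = ap \<BB> X Y t (f \<cdot> a))" (is "?l = ?r \<longleftrightarrow> _")
    if X: "X \<in> P" and Y: "Y \<in> P" and t: "t \<in> Hom V II (VHom T Y X)" for X Y t
  proof -
    have h: "f \<in> Arr V" "Dom V f = fst \<AA>" "Cod V f = fst \<BB>" using assms(3) by auto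
    have l: "unname V Y (fst \<BB>) (?l \<cdot> name_of V X (fst \<AA>) a) = f \<cdot> ap \<AA> X Y t a" if "a \<in> Hom V X (fst \<AA>)" for a
      using that X Y t assms(1,2) h by (simp add: ap_def)
    have r: "unname V Y (fst \<BB>) (?r \<cdot> name_of V X (fst \<AA>) a) = ap \<BB> X Y t (f \<cdot> a)" if "a \<in> Hom V X (fst \<AA>)" for a
    proof -
      have "pst X f \<cdot> name_of V X (fst \<AA>) a = name_of V X (fst \<BB>) (f \<cdot> a)"
        by (rule unname_inject[of _ X "fst \<BB>"]) (use that X assms(1,2) h in simp_all)
      thus ?thesis using that X Y t assms(1,2) h by (simp add: ap_def)
    qed
    show ?thesis
    proof
      assume "?l = ?r"
      thus "\<forall>a \<in> Hom V X (fst \<AA>). f \<cdot> ap \<AA> X Y t a = ap \<BB> X Y t (f \<cdot> a)" using l r by metis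
    next
      assume *: "\<forall>a \<in> Hom V X (fst \<AA>). f \<cdot> ap \<AA> X Y t a = ap \<BB> X Y t (f \<cdot> a)"
      show "?l = ?r"
      proof (rule pt_ext[of _ "ihom V X (fst \<AA>)" "ihom V Y (fst \<BB>)"])
        fix u assume u: "u \<in> Hom V II (ihom V X (fst \<AA>))"
        let ?a = "unname V X (fst \<AA>) u"
        have a: "?a \<in> Hom V X (fst \<AA>)" and u': "name_of V X (fst \<AA>) ?a = u" using u X assms(1) by simp_all
        have "unname V Y (fst \<BB>) (?l \<cdot> u) = unname V Y (fst \<BB>) (?r \<cdot> u)"
          using l[OF a] r[OF a] * a unfolding u' by metis
        thus "?l \<cdot> u = ?r \<cdot> u"
          by (rule unname_inject[of _ Y "fst \<BB>", rotated 4]) (use X Y t u assms(1,2) h in simp_all)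
      qed (use X Y t assms(1,2) h in simp_all)
    qed
  qed
  thus ?thesis using assms(3) unfolding ahom_def by blast
qed

text \<open>Describes the points of the end over the theory whose components are all induced by one
  arrow \<open>f\<close> of \<open>V\<close>. The pullback that defines the hom-object of algebras
  selects precisely components of this form.\<close>

lemma wedge_pt_iff_ahom:
  assumes "alg \<AA>" "alg \<BB>" "f \<in> Hom V (fst \<AA>) (fst \<BB>)"
    "\<And>X. X \<in> P \<Longrightarrow> \<omega> X = name_of V (ihom V X (fst \<AA>)) (ihom V X (fst \<BB>)) (pst X f)"
  shows "vnat_wedge V (vcat_op V T) (snd \<AA>) (snd \<BB>) II \<omega> \<longleftrightarrow> ahom \<AA> \<BB> f"
proof -
  have h: "f \<in> Arr V" "Dom V f = fst \<AA>" "Cod V f = fst \<BB>" using assms(3) by auto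
  have "pre (unname V (ihom V X (fst \<AA>)) (ihom V Y (fst \<AA>)) (VAr (snd \<AA>) X Y \<cdot> t)) (ihom V Y (fst \<BB>)) \<cdot> \<omega> Y
      = pst (ihom V X (fst \<AA>)) (unname V (ihom V X (fst \<BB>)) (ihom V Y (fst \<BB>)) (VAr (snd \<BB>) X Y \<cdot> t)) \<cdot> \<omega> X
    \<longleftrightarrow> pst Y f \<cdot> unname V (ihom V X (fst \<AA>)) (ihom V Y (fst \<AA>)) (VAr (snd \<AA>) X Y \<cdot> t)
     = unname V (ihom V X (fst \<BB>)) (ihom V Y (fst \<BB>)) (VAr (snd \<BB>) X Y \<cdot> t) \<cdot> pst X f" (is "?l = ?r \<longleftrightarrow> ?l' = ?r'")
    if X: "X \<in> P" and Y: "Y \<in> P" and t: "t \<in> Hom V II (VHom T Y X)" for X Y t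
  proof -
    let ?H = "ihom V X (fst \<AA>)" and ?K = "ihom V Y (fst \<BB>)"
    have l: "unname V ?H ?K ?l = ?l'" "?l \<in> Hom V II (ihom V ?H ?K)"
      using X Y t assms(1,2) h by (simp_all add: assms(4))
    have r: "unname V ?H ?K ?r = ?r'" "?r \<in> Hom V II (ihom V ?H ?K)"
      using X Y t assms(1,2) h by (simp_all add: assms(4))
    show ?thesis
    proof
      assume "?l = ?r" thus "?l' = ?r'" using l r by metis
    next
      assume "?l' = ?r'" thus "?l = ?r" using l r
        by (intro unname_inject[of ?l ?H ?K ?r]) (use X Y assms(1,2) in simp_all)
    qed
  qed
  thus ?thesis
    unfolding vnat_T[OF assms(1,2)] ahom_iff_arrows[OF assms(1-3)]
    using assms(1,2) h by (simp add: assms(4))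
qed

text \<open>The hom-object is a chosen pullback of chosen ends and is accessible only through
  universal properties. A point of it is a transformation over the theory together with an arrow of
  \<open>V\<close> that agree over the presentable objects; the arrow determines the transformation,
  and the arrows that occur are the homomorphisms.\<close>

lemma alg_proj:
  assumes A: "alg \<AA>" and B: "alg \<BB>"
  defines "q \<equiv> alg_proj V P T \<AA> \<BB>"
  shows "q \<in> Arr V" "Cod V q = ihom V (fst \<AA>) (fst \<BB>)"
    "h \<in> Hom V II (Dom V q) \<Longrightarrow> ahom \<AA> \<BB> (unname V (fst \<AA>) (fst \<BB>) (q \<cdot> h))"
    "ahom \<AA> \<BB> f \<Longrightarrow> \<exists>h. h \<in> Hom V II (Dom V q) \<and> q \<cdot> h = name_of V (fst \<AA>) (fst \<BB>) f"
    "h \<in> Hom V II (Dom V q) \<Longrightarrow> h' \<in> Hom V II (Dom V q) \<Longrightarrow> q \<cdot> h = q \<cdot> h' \<Longrightarrow> h = h'"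
proof -
  let ?S = "self_vcat V"
  define D where "D = vcat_op V (full_vcat ?S P)"
  define G where "G = cohom_vfun V ?S (fst \<AA>)"
  define H where "H = cohom_vfun V ?S (fst \<BB>)"
  define E \<omega> where "E = fst (vnat_object V (vcat_op V T) (snd \<AA>) (snd \<BB>))" and "\<omega> = snd (vnat_object V (vcat_op V T) (snd \<AA>) (snd \<BB>))"
  define E' \<omega>' where "E' = fst (vnat_object V D G H)" and "\<omega>' = snd (vnat_object V D G H)"
  have o [simp]: "fst \<AA> \<in> Obj V" "fst \<BB> \<in> Obj V" using A B by simp_all
  note vP = vnat_P[OF o, folded D_def G_def H_def]
  have E: "is_vnat_object V (vcat_op V T) (snd \<AA>) (snd \<BB>) E \<omega>" unfolding E_def \<omega>_def by (rule vnat_T(2)[OF A B])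
  have E': "is_vnat_object V D G H E' \<omega>'" unfolding E'_def \<omega>'_def by (rule vP(2))
  have VObj_D: "VObj D = P" by (simp add: D_def)
  have EO: "E \<in> Obj V" and \<omega>: "X \<in> P \<Longrightarrow> \<omega> X \<in> Hom V E (ihom V (ihom V X (fst \<AA>)) (ihom V X (fst \<BB>)))" for X
    using E unfolding is_vnat_object_def vnat_T(1)[OF A B] by blast+
  have E'O: "E' \<in> Obj V" and \<omega>': "X \<in> P \<Longrightarrow> \<omega>' X \<in> Hom V E' (ihom V (ihom V X (fst \<AA>)) (ihom V X (fst \<BB>)))" for X
    using E' unfolding is_vnat_object_def vP by blast+
  have GJ: "VAr (snd \<AA>) X Y \<cdot> (VAr J Y X \<cdot> x) = VAr G X Y \<cdot> x" and HJ: "VAr (snd \<BB>) X Y \<cdot> (VAr J Y X \<cdot> x) = VAr H X Y \<cdot> x"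
    if "X \<in> P" "Y \<in> P" "x \<in> Hom V II (ihom V Y X)" for X Y x
    unfolding G_def H_def by (rule Cmp_reduce[OF algD(6)]; use A B that in simp)+
  \<comment> \<open>Naturality over the theory, used at the points that come from \<open>V\<close>
    along \<open>J\<close>; \<open>GJ\<close> and \<open>HJ\<close> identify the actions of these
    points.\<close>
  have restr: "vnat_wedge V D G H E \<omega>"
    unfolding vP
  proof (intro conjI ballI)
    fix X Y x assume *: "X \<in> P" "Y \<in> P" "x \<in> Hom V II (ihom V Y X)"
    have "VAr J Y X \<cdot> x \<in> Hom V II (VHom T Y X)" using * by simp
    with E * show "pre (unname V (ihom V X (fst \<AA>)) (ihom V Y (fst \<AA>)) (VAr G X Y \<cdot> x)) (ihom V Y (fst \<BB>)) \<cdot> \<omega> Y =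
       pst (ihom V X (fst \<AA>)) (unname V (ihom V X (fst \<BB>)) (ihom V Y (fst \<BB>)) (VAr H X Y \<cdot> x)) \<cdot> \<omega> X"
      unfolding is_vnat_object_def vnat_T(1)[OF A B] GJ[OF *, symmetric] HJ[OF *, symmetric] by blast
  qed (use EO \<omega> in auto)
  define r where "r = alg_restriction V P T \<AA> \<BB>"
  have r: "r \<in> Hom V E E' \<and> (\<forall>X \<in> P. \<omega>' X \<cdot> r = \<omega> X)"
  proof -
    have "\<exists>!r. r \<in> Hom V E E' \<and> (\<forall>X \<in> P. \<omega>' X \<cdot> r = \<omega> X)"
      using E' restr unfolding is_vnat_object_def VObj_D by blast
    from theI'[OF this] show ?thesis
      unfolding r_def alg_restriction_def
      by (simp add: case_prod_unfold Let_def flip: D_def G_def H_def E_def \<omega>_def E'_def \<omega>'_def)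
  qed
  let ?AB = "ihom V (fst \<AA>) (fst \<BB>)"
  \<comment> \<open>Postcomposition with an arrow named by \<open>u\<close> commutes with
    precomposition with \<open>x\<close>. The two sides are compared first at a point
    \<open>u\<close> of [A, B] and then at a point \<open>v\<close> of [X, A].\<close>
  have nerve: "vnat_wedge V D G H ?AB (\<lambda>X. VAr (hom_vfun V ?S X) (fst \<AA>) (fst \<BB>))"
    unfolding vP
  proof (intro conjI ballI)
    fix X Y x assume X: "X \<in> P" and Y: "Y \<in> P" and x: "x \<in> Hom V II (ihom V Y X)"
    let ?H = "ihom V X (fst \<AA>)" and ?K = "ihom V Y (fst \<BB>)"
    let ?l = "pre (unname V (ihom V X (fst \<AA>)) (ihom V Y (fst \<AA>)) (VAr G X Y \<cdot> x)) (ihom V Y (fst \<BB>))"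
    let ?r = "pst (ihom V X (fst \<AA>)) (unname V (ihom V X (fst \<BB>)) (ihom V Y (fst \<BB>)) (VAr H X Y \<cdot> x))"
    have GH [simp]: "VAr G X Y \<in> Arr V" "Dom V (VAr G X Y) = ihom V Y X" "Cod V (VAr G X Y) = ihom V (ihom V X (fst \<AA>)) (ihom V Y (fst \<AA>))"
      "VAr H X Y \<in> Arr V" "Dom V (VAr H X Y) = ihom V Y X" "Cod V (VAr H X Y) = ihom V (ihom V X (fst \<BB>)) (ihom V Y (fst \<BB>))"
      using X Y by (simp_all add: G_def H_def)
    show "?l \<cdot> VAr (hom_vfun V ?S Y) (fst \<AA>) (fst \<BB>) = ?r \<cdot> VAr (hom_vfun V ?S X) (fst \<AA>) (fst \<BB>)"
    proof (rule pt_ext[of _ ?AB "ihom V ?H ?K"])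
      fix u assume u: "u \<in> Hom V II ?AB"
      define f where "f = unname V (fst \<AA>) (fst \<BB>) u"
      have f: "f \<in> Hom V (fst \<AA>) (fst \<BB>)" and u': "u = name_of V (fst \<AA>) (fst \<BB>) f"
        using u by (simp_all add: f_def)
      show "(?l \<cdot> VAr (hom_vfun V ?S Y) (fst \<AA>) (fst \<BB>)) \<cdot> u = (?r \<cdot> VAr (hom_vfun V ?S X) (fst \<AA>) (fst \<BB>)) \<cdot> u"
      proof (rule ihom_pt_ext[of _ ?H ?K])
        fix v assume v: "v \<in> Hom V II ?H"
        show "unname V ?H ?K ((?l \<cdot> VAr (hom_vfun V ?S Y) (fst \<AA>) (fst \<BB>)) \<cdot> u) \<cdot> v =
          unname V ?H ?K ((?r \<cdot> VAr (hom_vfun V ?S X) (fst \<AA>) (fst \<BB>)) \<cdot> u) \<cdot> v"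
        proof (rule unname_inject[of _ Y "fst \<BB>"])
          have c: "unname V Y (fst \<AA>) (unname V (ihom V X (fst \<AA>)) (ihom V Y (fst \<AA>)) (VAr G X Y \<cdot> x) \<cdot> v) = unname V X (fst \<AA>) v \<cdot> unname V Y X x"
            unfolding G_def by (rule cohom_vfun_pt) (use X Y x v in simp_all)
          have d: "unname V Y (fst \<BB>) (unname V (ihom V X (fst \<BB>)) (ihom V Y (fst \<BB>)) (VAr H X Y \<cdot> x) \<cdot> (pst X f \<cdot> v))
             = unname V X (fst \<BB>) (pst X f \<cdot> v) \<cdot> unname V Y X x"
            unfolding H_def by (rule cohom_vfun_pt) (use X Y x v f in simp_all)
          show "unname V Y (fst \<BB>) (unname V ?H ?K ((?l \<cdot> VAr (hom_vfun V ?S Y) (fst \<AA>) (fst \<BB>)) \<cdot> u) \<cdot> v) =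
            unname V Y (fst \<BB>) (unname V ?H ?K ((?r \<cdot> VAr (hom_vfun V ?S X) (fst \<AA>) (fst \<BB>)) \<cdot> u) \<cdot> v)"
            using X Y x v f c d by (simp add: u' VAr_hom_name)
        qed (use X Y x v u in simp_all)
      qed (use X Y x u in simp_all)
    qed (use X Y x in simp_all)
  qed (use o in simp_all)
  define y where "y = alg_nerve V P \<AA> \<BB>"
  have y: "y \<in> Hom V ?AB E' \<and> (\<forall>X \<in> P. \<omega>' X \<cdot> y = VAr (hom_vfun V ?S X) (fst \<AA>) (fst \<BB>))"
  proof -
    have "\<exists>!y. y \<in> Hom V ?AB E' \<and> (\<forall>X \<in> P. \<omega>' X \<cdot> y = VAr (hom_vfun V ?S X) (fst \<AA>) (fst \<BB>))"
      using E' nerve unfolding is_vnat_object_def VObj_D by blast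
    from theI'[OF this] show ?thesis
      unfolding y_def alg_nerve_def
      by (simp add: case_prod_unfold Let_def flip: D_def G_def H_def E'_def \<omega>'_def)
  qed
  obtain p0 q0 where "is_pullback V r y p0 q0" using r y pullback by blast
  hence "\<exists>x. case x of (p, q) \<Rightarrow> is_pullback V r y p q" by auto
  from someI_ex[OF this] obtain p where pb: "is_pullback V r y p q"
    unfolding q_def alg_proj_def r_def y_def by (auto simp: case_prod_unfold)
  have p: "p \<in> Hom V (Dom V q) E" and q: "q \<in> Hom V (Dom V q) ?AB" and rp: "r \<cdot> p = y \<cdot> q"
    using pb r y by (auto simp: is_pullback_def)
  show "q \<in> Arr V" "Cod V q = ihom V (fst \<AA>) (fst \<BB>)" using q by auto
  have uniq: "h = h'" if "h \<in> Hom V W (Dom V q)" "h' \<in> Hom V W (Dom V q)" "p \<cdot> h = p \<cdot> h'" "q \<cdot> h = q \<cdot> h'" for h h' W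
  proof -
    have eq: "r \<cdot> (p \<cdot> h) = y \<cdot> (q \<cdot> h)"
    proof -
      have "r \<cdot> (p \<cdot> h) = (r \<cdot> p) \<cdot> h" using r p that(1) by simp
      thus ?thesis unfolding rp using y q that(1) by simp
    qed
    have "p \<cdot> h \<in> Hom V W (Dom V r)" "q \<cdot> h \<in> Hom V W (Dom V y)" using p q r y that(1) by simp_all
    hence "\<exists>!k. k \<in> Hom V W (Dom V p) \<and> p \<cdot> k = p \<cdot> h \<and> q \<cdot> k = q \<cdot> h"
      using pb eq unfolding is_pullback_def by blast
    moreover have "Dom V p = Dom V q" using p by simp
    ultimately show ?thesis using that by metis
  qed
  \<comment> \<open>The pullback square forces the transformation to have the components [X, f],
    where \<open>f\<close> is the arrow named by \<open>q \<cdot> h\<close>.\<close>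
  have ph: "\<omega> X \<cdot> (p \<cdot> h) = name_of V (ihom V X (fst \<AA>)) (ihom V X (fst \<BB>)) (pst X (unname V (fst \<AA>) (fst \<BB>) (q \<cdot> h)))"
    if h: "h \<in> Hom V II (Dom V q)" and X: "X \<in> P" for h X
  proof -
    have "\<omega> X \<cdot> (p \<cdot> h) = (\<omega>' X \<cdot> r) \<cdot> (p \<cdot> h)" using r X by simp
    also have "\<dots> = \<omega>' X \<cdot> ((r \<cdot> p) \<cdot> h)" using r p h \<omega>'[OF X] by simp
    also have "\<dots> = (\<omega>' X \<cdot> y) \<cdot> (q \<cdot> h)" unfolding rp using y q h \<omega>'[OF X] by simp
    also have "\<dots> = VAr (hom_vfun V ?S X) (fst \<AA>) (fst \<BB>) \<cdot> name_of V (fst \<AA>) (fst \<BB>) (unname V (fst \<AA>) (fst \<BB>) (q \<cdot> h))"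
      using y X q h by simp
    also have "\<dots> = name_of V (ihom V X (fst \<AA>)) (ihom V X (fst \<BB>)) (pst X (unname V (fst \<AA>) (fst \<BB>) (q \<cdot> h)))"
      by (rule VAr_hom_name) (use X q h in simp_all)
    finally show ?thesis .
  qed
  have wedge_comp: "vnat_wedge V (vcat_op V T) (snd \<AA>) (snd \<BB>) II (\<lambda>X. \<omega> X \<cdot> k)" if k: "k \<in> Hom V II E" for k
    unfolding vnat_T[OF A B]
  proof (intro conjI ballI)
    fix X Y t assume *: "X \<in> P" "Y \<in> P" "t \<in> Hom V II (VHom T Y X)"
    let ?l = "pre (unname V (ihom V X (fst \<AA>)) (ihom V Y (fst \<AA>)) (VAr (snd \<AA>) X Y \<cdot> t)) (ihom V Y (fst \<BB>))"
    let ?r = "pst (ihom V X (fst \<AA>)) (unname V (ihom V X (fst \<BB>)) (ihom V Y (fst \<BB>)) (VAr (snd \<BB>) X Y \<cdot> t))"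
    have "?l \<cdot> \<omega> Y = ?r \<cdot> \<omega> X" using E * unfolding is_vnat_object_def vnat_T(1)[OF A B] by blast
    hence "(?l \<cdot> \<omega> Y) \<cdot> k = (?r \<cdot> \<omega> X) \<cdot> k" by simp
    thus "?l \<cdot> (\<omega> Y \<cdot> k) = ?r \<cdot> (\<omega> X \<cdot> k)" using A B * k \<omega>[OF *(1)] \<omega>[OF *(2)] by simp
  qed (use \<omega> k in simp_all)
  show "ahom \<AA> \<BB> (unname V (fst \<AA>) (fst \<BB>) (q \<cdot> h))" if h: "h \<in> Hom V II (Dom V q)"
  proof -
    have "vnat_wedge V (vcat_op V T) (snd \<AA>) (snd \<BB>) II (\<lambda>X. \<omega> X \<cdot> (p \<cdot> h))"
      by (rule wedge_comp) (use p h in simp)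
    moreover have "unname V (fst \<AA>) (fst \<BB>) (q \<cdot> h) \<in> Hom V (fst \<AA>) (fst \<BB>)" using q h by simp
    ultimately show ?thesis using wedge_pt_iff_ahom[OF A B _ ph[OF h]] by blast
  qed
  show "\<exists>h. h \<in> Hom V II (Dom V q) \<and> q \<cdot> h = name_of V (fst \<AA>) (fst \<BB>) f" if f: "ahom \<AA> \<BB> f"
  proof -
    let ?n = "\<lambda>X. name_of V (ihom V X (fst \<AA>)) (ihom V X (fst \<BB>)) (pst X f)"
    note fH = ahom_Hom[OF f]
    have "vnat_wedge V (vcat_op V T) (snd \<AA>) (snd \<BB>) II ?n"
      using wedge_pt_iff_ahom[OF A B fH, of ?n] f by blast
    hence "\<exists>!e. e \<in> Hom V II E \<and> (\<forall>X \<in> P. \<omega> X \<cdot> e = ?n X)"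
      using E unfolding is_vnat_object_def vcat_op_simps VObj_T by blast
    then obtain e where e: "e \<in> Hom V II E" "\<And>X. X \<in> P \<Longrightarrow> \<omega> X \<cdot> e = ?n X" by blast
    \<comment> \<open>Both are points of the end over the presentable objects with components
      \<open>?n X\<close>, hence equal; the pullback then supplies the required point
      \<open>h\<close>.\<close>
    have "r \<cdot> e = y \<cdot> name_of V (fst \<AA>) (fst \<BB>) f"
    proof (rule vnat_object_pt_eq[OF E'])
      have re: "\<omega>' X \<cdot> (r \<cdot> e) = ?n X" if X: "X \<in> P" for X
      proof -
        have "\<omega>' X \<cdot> (r \<cdot> e) = (\<omega>' X \<cdot> r) \<cdot> e" using r e(1) \<omega>'[OF X] by simp
        thus ?thesis using r X e(2) by simp
      qed
      have ye: "\<omega>' X \<cdot> (y \<cdot> name_of V (fst \<AA>) (fst \<BB>) f) = ?n X" if X: "X \<in> P" for X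
      proof -
        have "\<omega>' X \<cdot> (y \<cdot> name_of V (fst \<AA>) (fst \<BB>) f) = (\<omega>' X \<cdot> y) \<cdot> name_of V (fst \<AA>) (fst \<BB>) f"
          using y \<omega>'[OF X] fH by simp
        thus ?thesis using y X VAr_hom_name[OF X fH] by simp
      qed
      show "\<omega>' X \<cdot> (r \<cdot> e) = \<omega>' X \<cdot> (y \<cdot> name_of V (fst \<AA>) (fst \<BB>) f)" if "X \<in> VObj D" for X
        using re ye that by (simp add: VObj_D)
      show "vnat_wedge V D G H II (\<lambda>X. \<omega>' X \<cdot> (r \<cdot> e))"
        unfolding vP
      proof (intro conjI ballI)
        fix X Y x assume *: "X \<in> P" "Y \<in> P" "x \<in> Hom V II (ihom V Y X)"
        let ?l = "pre (unname V (ihom V X (fst \<AA>)) (ihom V Y (fst \<AA>)) (VAr G X Y \<cdot> x)) (ihom V Y (fst \<BB>))"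
        let ?r = "pst (ihom V X (fst \<AA>)) (unname V (ihom V X (fst \<BB>)) (ihom V Y (fst \<BB>)) (VAr H X Y \<cdot> x))"
        have "?l \<cdot> \<omega>' Y = ?r \<cdot> \<omega>' X" using E' * unfolding is_vnat_object_def vP by blast
        hence "(?l \<cdot> \<omega>' Y) \<cdot> (r \<cdot> e) = (?r \<cdot> \<omega>' X) \<cdot> (r \<cdot> e)" by simp
        thus "?l \<cdot> (\<omega>' Y \<cdot> (r \<cdot> e)) = ?r \<cdot> (\<omega>' X \<cdot> (r \<cdot> e))" using * e(1) r \<omega>'[OF *(1)] \<omega>'[OF *(2)]
          by (simp add: G_def H_def)
      qed (use \<omega>' r e(1) in simp_all)
    qed (use r y e(1) fH in simp_all)
    moreover have "e \<in> Hom V II (Dom V r)" "name_of V (fst \<AA>) (fst \<BB>) f \<in> Hom V II (Dom V y)"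
      using e(1) r y fH by simp_all
    ultimately obtain h where "h \<in> Hom V II (Dom V p)" "q \<cdot> h = name_of V (fst \<AA>) (fst \<BB>) f"
      using pb unfolding is_pullback_def by metis
    thus ?thesis using p by auto
  qed
  show "h = h'" if h: "h \<in> Hom V II (Dom V q)" "h' \<in> Hom V II (Dom V q)" "q \<cdot> h = q \<cdot> h'"
  proof (rule uniq[OF h(1,2) _ h(3)])
    show "p \<cdot> h = p \<cdot> h'"
    proof (rule vnat_object_pt_eq[OF E])
      show "vnat_wedge V (vcat_op V T) (snd \<AA>) (snd \<BB>) II (\<lambda>X. \<omega> X \<cdot> (p \<cdot> h))"
        by (rule wedge_comp) (use p h(1) in simp)
      show "\<omega> X \<cdot> (p \<cdot> h) = \<omega> X \<cdot> (p \<cdot> h')" if "X \<in> VObj (vcat_op V T)" for X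
        using ph[OF h(1)] ph[OF h(2)] h(3) that by simp
    qed (use p h in simp_all)
  qed
qed

subsection \<open>The ordinary category of algebras\<close>

abbreviation "\<A> \<equiv> Alg\<^sub>0 V P T J"
abbreviation "U \<equiv> FAr (forget\<^sub>0 V P T)"

lemma Alg_simps [simp]: "VObj (Alg V P T J) = {\<AA>. alg \<AA>}" "VHom (Alg V P T J) \<AA> \<BB> = Dom V (alg_proj V P T \<AA> \<BB>)"
  by (simp_all add: Alg_def concrete_vcat_def)

lemma forget_simps [simp]: "VOb (forget V P T) = fst" "VAr (forget V P T) = alg_proj V P T"
  by (simp_all add: forget_def)

lemma Obj_A [simp]: "Obj \<A> = {\<AA>. alg \<AA>}"
  by (simp add: Alg\<^sub>0_def underlying_cat_def)

lemma Hom_A: "Hom \<A> \<AA> \<BB> = {(\<AA>, \<BB>, h) |h. alg \<AA> \<and> alg \<BB> \<and> h \<in> Hom V II (Dom V (alg_proj V P T \<AA> \<BB>))}"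
  by (auto simp: Alg\<^sub>0_def underlying_cat_def Hom_def)

lemma FOb_U [simp]: "FOb (forget\<^sub>0 V P T) = fst"
  by (simp add: forget\<^sub>0_def underlying_to_V_def)

lemma U_def: "U (\<AA>, \<BB>, h) = unname V (fst \<AA>) (fst \<BB>) (alg_proj V P T \<AA> \<BB> \<cdot> h)"
  by (simp add: forget\<^sub>0_def underlying_to_V_def)

lemma Hom_A_alg: "\<phi> \<in> Hom \<A> \<AA> \<BB> \<Longrightarrow> alg \<AA>" "\<phi> \<in> Hom \<A> \<AA> \<BB> \<Longrightarrow> alg \<BB>"
  unfolding Hom_A by blast+

lemma U_ahom: "\<phi> \<in> Hom \<A> \<AA> \<BB> \<Longrightarrow> ahom \<AA> \<BB> (U \<phi>)"
proof -
  assume "\<phi> \<in> Hom \<A> \<AA> \<BB>"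
  then obtain h where "\<phi> = (\<AA>, \<BB>, h)" "alg \<AA>" "alg \<BB>" "h \<in> Hom V II (Dom V (alg_proj V P T \<AA> \<BB>))"
    unfolding Hom_A by blast
  thus "ahom \<AA> \<BB> (U \<phi>)" using alg_proj(3)[of \<AA> \<BB> h] U_def by simp
qed

lemma U_Hom: "\<phi> \<in> Hom \<A> \<AA> \<BB> \<Longrightarrow> U \<phi> \<in> Hom V (fst \<AA>) (fst \<BB>)"
  by (rule ahom_Hom[OF U_ahom])

lemma U_faithful:
  assumes "\<phi> \<in> Hom \<A> \<AA> \<BB>" "\<psi> \<in> Hom \<A> \<AA> \<BB>" "U \<phi> = U \<psi>"
  shows "\<phi> = \<psi>"
proof -
  obtain h k where h: "\<phi> = (\<AA>, \<BB>, h)" "alg \<AA>" "alg \<BB>" "h \<in> Hom V II (Dom V (alg_proj V P T \<AA> \<BB>))"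
    and k: "\<psi> = (\<AA>, \<BB>, k)" "k \<in> Hom V II (Dom V (alg_proj V P T \<AA> \<BB>))"
    using assms(1,2) unfolding Hom_A by blast
  note q = alg_proj(1,2)[OF h(2,3)]
  have "alg_proj V P T \<AA> \<BB> \<cdot> h = alg_proj V P T \<AA> \<BB> \<cdot> k"
    by (rule unname_inject[of _ "fst \<AA>" "fst \<BB>"]) (use assms(3) h k q in \<open>simp_all add: U_def\<close>)
  from alg_proj(5)[OF h(2,3,4) k(2) this] show ?thesis using h k by simp
qed

lemma U_full:
  assumes "alg \<AA>" "alg \<BB>" "ahom \<AA> \<BB> f"
  obtains \<phi> where "\<phi> \<in> Hom \<A> \<AA> \<BB>" "U \<phi> = f"
proof -
  obtain h where h: "h \<in> Hom V II (Dom V (alg_proj V P T \<AA> \<BB>))" "alg_proj V P T \<AA> \<BB> \<cdot> h = name_of V (fst \<AA>) (fst \<BB>) f"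
    using alg_proj(4)[OF assms] by blast
  have "U (\<AA>, \<BB>, h) = f" using h(2) ahom_Hom[OF assms(3)] by (simp add: U_def)
  moreover have "(\<AA>, \<BB>, h) \<in> Hom \<A> \<AA> \<BB>" using h assms by (simp add: Hom_A del: Hom_iff)
  ultimately show ?thesis using that by blast
qed

lemma Alg_cat: "V_category V (Alg V P T J)"
  using forget_functor by (simp add: V_functor_def)

lemma Cmp_A:
  assumes "\<phi> \<in> Hom \<A> \<AA> \<BB>" "\<psi> \<in> Hom \<A> \<BB> \<CC>"
  shows "\<psi> \<cdot>\<^bsub>\<A>\<^esub> \<phi> \<in> Hom \<A> \<AA> \<CC>" "U (\<psi> \<cdot>\<^bsub>\<A>\<^esub> \<phi>) = U \<psi> \<cdot> U \<phi>"
proof -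
  obtain h k where h: "\<phi> = (\<AA>, \<BB>, h)" "alg \<AA>" "alg \<BB>" "h \<in> Hom V II (Dom V (alg_proj V P T \<AA> \<BB>))"
    and k: "\<psi> = (\<BB>, \<CC>, k)" "alg \<CC>" "k \<in> Hom V II (Dom V (alg_proj V P T \<BB> \<CC>))"
    using assms unfolding Hom_A by blast
  let ?m = "VCmp (Alg V P T J) \<AA> \<BB> \<CC>"
  have m: "?m \<in> Hom V (Dom V (alg_proj V P T \<BB> \<CC>) \<otimes> Dom V (alg_proj V P T \<AA> \<BB>)) (Dom V (alg_proj V P T \<AA> \<CC>))"
    using V_category.VCmp_Hom[OF Alg_cat, of \<AA> \<BB> \<CC>] h k by simp
  have c: "\<psi> \<cdot>\<^bsub>\<A>\<^esub> \<phi> = (\<AA>, \<CC>, ?m \<cdot> pr k h)"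
    by (simp add: h k Alg\<^sub>0_def underlying_cat_def elem_comp_pr)
  have mk: "?m \<cdot> pr k h \<in> Hom V II (Dom V (alg_proj V P T \<AA> \<CC>))" using m h k by simp
  thus "\<psi> \<cdot>\<^bsub>\<A>\<^esub> \<phi> \<in> Hom \<A> \<AA> \<CC>" using h k unfolding c by (simp add: Hom_A del: Hom_iff)
  note q = alg_proj(1,2)[OF h(2,3)] alg_proj(1,2)[OF h(3) k(2)] alg_proj(1,2)[OF h(2) k(2)]
  have e: "alg_proj V P T \<AA> \<CC> \<cdot> ?m = VCmp (self_vcat V) (fst \<AA>) (fst \<BB>) (fst \<CC>) \<cdot> (alg_proj V P T \<BB> \<CC> \<odot> alg_proj V P T \<AA> \<BB>)"
    using V_functorD(6)[OF forget_functor, of \<AA> \<BB> \<CC>] h k by simp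
  have "alg_proj V P T \<AA> \<CC> \<cdot> (?m \<cdot> pr k h) = (VCmp (self_vcat V) (fst \<AA>) (fst \<BB>) (fst \<CC>) \<cdot> (alg_proj V P T \<BB> \<CC> \<odot> alg_proj V P T \<AA> \<BB>)) \<cdot> pr k h"
    by (rule Cmp_reduce[OF e]) (use m q h k in simp_all)
  thus "U (\<psi> \<cdot>\<^bsub>\<A>\<^esub> \<phi>) = U \<psi> \<cdot> U \<phi>"
    unfolding c using q h k by (simp add: U_def)
qed

lemma Idn_A:
  assumes "alg \<AA>"
  shows "Idn \<A> \<AA> \<in> Hom \<A> \<AA> \<AA>" "U (Idn \<A> \<AA>) = Idn V (fst \<AA>)"
proof -
  have c: "Idn \<A> \<AA> = (\<AA>, \<AA>, VIdn (Alg V P T J) \<AA>)" by (simp add: Alg\<^sub>0_def underlying_cat_def)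
  have i: "VIdn (Alg V P T J) \<AA> \<in> Hom V II (Dom V (alg_proj V P T \<AA> \<AA>))"
    using V_category.VIdn_Hom[OF Alg_cat, of \<AA>] assms by simp
  show "Idn \<A> \<AA> \<in> Hom \<A> \<AA> \<AA>" using i assms unfolding c by (simp add: Hom_A del: Hom_iff)
  have "alg_proj V P T \<AA> \<AA> \<cdot> VIdn (Alg V P T J) \<AA> = VIdn (self_vcat V) (fst \<AA>)"
    using V_functorD(4)[OF forget_functor, of \<AA>] assms by simp
  thus "U (Idn \<A> \<AA>) = Idn V (fst \<AA>)" unfolding c using assms by (simp add: U_def self_VIdn)
qed

lemma Arr_A: "\<phi> \<in> Arr \<A> \<Longrightarrow> alg (Dom \<A> \<phi>) \<and> alg (Cod \<A> \<phi>)"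
  by (auto simp: Alg\<^sub>0_def underlying_cat_def)

lemma category_A: "category \<A>"
proof
  fix f assume "f \<in> Arr \<A>"
  thus "Dom \<A> f \<in> Obj \<A>" "Cod \<A> f \<in> Obj \<A>" using Arr_A by auto
next
  fix \<AA> assume "\<AA> \<in> Obj \<A>"
  thus "Idn \<A> \<AA> \<in> Hom \<A> \<AA> \<AA>" using Idn_A by simp
next
  fix f g \<AA> \<BB> \<CC> assume "f \<in> Hom \<A> \<AA> \<BB>" "g \<in> Hom \<A> \<BB> \<CC>"
  thus "g \<cdot>\<^bsub>\<A>\<^esub> f \<in> Hom \<A> \<AA> \<CC>" by (rule Cmp_A)
next
  fix f \<AA> \<BB> assume f: "f \<in> Hom \<A> \<AA> \<BB>"
  note a = Hom_A_alg[OF f]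
  show "f \<cdot>\<^bsub>\<A>\<^esub> Idn \<A> \<AA> = f"
    by (rule U_faithful[OF Cmp_A(1)[OF Idn_A(1)[OF a(1)] f] f]) (use U_Hom[OF f] Cmp_A(2)[OF Idn_A(1)[OF a(1)] f] Idn_A(2)[OF a(1)] in simp)
  show "Idn \<A> \<BB> \<cdot>\<^bsub>\<A>\<^esub> f = f"
    by (rule U_faithful[OF Cmp_A(1)[OF f Idn_A(1)[OF a(2)]] f]) (use U_Hom[OF f] Cmp_A(2)[OF f Idn_A(1)[OF a(2)]] Idn_A(2)[OF a(2)] in simp)
next
  fix f g h \<AA> \<BB> \<CC> \<DD> assume f: "f \<in> Hom \<A> \<AA> \<BB>" and g: "g \<in> Hom \<A> \<BB> \<CC>" and h: "h \<in> Hom \<A> \<CC> \<DD>"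
  note gf = Cmp_A[OF f g] and hg = Cmp_A[OF g h]
  note l = Cmp_A[OF f hg(1)] and r = Cmp_A[OF gf(1) h]
  show "(h \<cdot>\<^bsub>\<A>\<^esub> g) \<cdot>\<^bsub>\<A>\<^esub> f = h \<cdot>\<^bsub>\<A>\<^esub> (g \<cdot>\<^bsub>\<A>\<^esub> f)"
    by (rule U_faithful[OF l(1) r(1)]) (use l(2) r(2) gf(2) hg(2) U_Hom[OF f] U_Hom[OF g] U_Hom[OF h] in simp)
qed

lemma ahom_comp:
  assumes "ahom \<AA> \<BB> f" "ahom \<BB> \<CC> g" "alg \<AA>"
  shows "ahom \<AA> \<CC> (g \<cdot> f)"
  unfolding ahom_def
proof (intro conjI ballI)
  show "g \<cdot> f \<in> Hom V (fst \<AA>) (fst \<CC>)" using ahom_simps[OF assms(1)] ahom_simps[OF assms(2)] by simp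
  fix X Y t a assume *: "X \<in> P" "Y \<in> P" "t \<in> Hom V II (VHom T Y X)" "a \<in> Hom V X (fst \<AA>)"
  have fa: "f \<cdot> a \<in> Hom V X (fst \<BB>)" using * ahom_simps[OF assms(1)] by simp
  have "(g \<cdot> f) \<cdot> ap \<AA> X Y t a = g \<cdot> (f \<cdot> ap \<AA> X Y t a)"
    using ahom_simps[OF assms(1)] ahom_simps[OF assms(2)] * assms(3) by simp
  also have "\<dots> = ap \<CC> X Y t (g \<cdot> (f \<cdot> a))"
    using ahom_ap[OF assms(1) *] ahom_ap[OF assms(2) *(1-3) fa] by simp
  also have "g \<cdot> (f \<cdot> a) = (g \<cdot> f) \<cdot> a"
    using ahom_simps[OF assms(1)] ahom_simps[OF assms(2)] * by simp
  finally show "(g \<cdot> f) \<cdot> ap \<AA> X Y t a = ap \<CC> X Y t ((g \<cdot> f) \<cdot> a)" .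
qed

lemma ahom_Idn: "alg \<AA> \<Longrightarrow> ahom \<AA> \<AA> (Idn V (fst \<AA>))"
  unfolding ahom_def by simp

lemma ahom_cancel_mono:
  assumes "alg \<AA>" "alg \<BB>" "alg \<CC>" "ahom \<BB> \<CC> m" "mono_arrow V m" "f \<in> Hom V (fst \<AA>) (fst \<BB>)" "ahom \<AA> \<CC> (m \<cdot> f)"
  shows "ahom \<AA> \<BB> f"
  unfolding ahom_def
proof (intro conjI ballI)
  note m = ahom_simps[OF assms(4)]
  fix X Y t a assume *: "X \<in> P" "Y \<in> P" "t \<in> Hom V II (VHom T Y X)" "a \<in> Hom V X (fst \<AA>)"
  have fa: "f \<cdot> a \<in> Hom V X (fst \<BB>)" using * assms(6) by simp
  have eq: "m \<cdot> (f \<cdot> ap \<AA> X Y t a) = m \<cdot> ap \<BB> X Y t (f \<cdot> a)"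
    using ahom_ap[OF assms(7) *] ahom_ap[OF assms(4) *(1-3) fa] * assms m by simp
  show "f \<cdot> ap \<AA> X Y t a = ap \<BB> X Y t (f \<cdot> a)"
    by (rule mono_arrow_cancel[OF assms(5) eq, of Y]) (use * m assms fa in simp_all)
qed fact

end

section \<open>Free algebras\<close>

locale adjunction_base = pretheory_base V \<kappa> \<X> P T J
  for V :: "('o, 'a) smc" (structure) and \<kappa> :: "'a rel" and \<X> :: "'o set" and P :: "'o set"
    and T :: "('o, 'o, 'a) vcat" and J :: "('o, 'o, 'a) vfun" +
  fixes F :: "('o, ('o, 'a) alg, 'a) vfun" and \<eta> :: "'o \<Rightarrow> 'a" and \<epsilon> :: "('o, 'a) alg \<Rightarrow> 'a"
  assumes adjunction: "V_adjunction V (self_vcat V) (Alg V P T J) F (forget V P T) \<eta> \<epsilon>"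
begin

abbreviation "Fo \<equiv> VOb F"
abbreviation "TT X \<equiv> fst (VOb F X)"
text \<open>\<open>et\<close>, \<open>ep\<close> and \<open>Fm\<close> are the unit, the counit and
  the action of \<open>F\<close> on arrows, read as ordinary morphisms of \<open>V\<close>.\<close>

definition "et X = unname V X (TT X) (\<eta> X)"
definition "ep \<AA> = U (Fo (fst \<AA>), \<AA>, \<epsilon> \<AA>)"
definition "Fm X Y f = U (Fo X, Fo Y, VAr F X Y \<cdot> name_of V X Y f)"

lemma F_functor: "V_functor V (self_vcat V) (Alg V P T J) F"
  and \<eta>_nat: "V_natural V (self_vcat V) (self_vcat V) (vfun_id V (self_vcat V)) (vfun_comp V (forget V P T) F) \<eta>"
  and \<epsilon>_nat: "V_natural V (Alg V P T J) (Alg V P T J) (vfun_comp V F (forget V P T)) (vfun_id V (Alg V P T J)) \<epsilon>"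
  using adjunction by (simp_all add: V_adjunction_def)

lemma Fo_alg [simp]: "X \<in> Obj V \<Longrightarrow> alg (Fo X)"
  using V_functorD(3)[OF F_functor, of X] by simp

lemma VAr_F [simp]:
  assumes "X \<in> Obj V" "Y \<in> Obj V"
  shows "VAr F X Y \<in> Arr V" "Dom V (VAr F X Y) = ihom V X Y" "Cod V (VAr F X Y) = Dom V (alg_proj V P T (Fo X) (Fo Y))"
  using V_functorD(5)[OF F_functor, of X Y] assms by simp_all

lemma alg_proj_simps [simp]:
  assumes "alg \<AA>" "alg \<BB>"
  shows "alg_proj V P T \<AA> \<BB> \<in> Arr V" "Cod V (alg_proj V P T \<AA> \<BB>) = ihom V (fst \<AA>) (fst \<BB>)"
  using alg_proj(1,2)[OF assms] by simp_all

lemma \<eta>_simps [simp]: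
  assumes "X \<in> Obj V"
  shows "\<eta> X \<in> Arr V" "Dom V (\<eta> X) = II" "Cod V (\<eta> X) = ihom V X (TT X)"
  using \<eta>_nat assms unfolding V_natural_def by (simp_all add: vfun_id_def vfun_comp_def)

lemma \<epsilon>_simps [simp]:
  assumes "alg \<AA>"
  shows "\<epsilon> \<AA> \<in> Arr V" "Dom V (\<epsilon> \<AA>) = II" "Cod V (\<epsilon> \<AA>) = Dom V (alg_proj V P T (Fo (fst \<AA>)) \<AA>)"
proof -
  have "\<forall>X\<in>VObj (Alg V P T J). \<epsilon> X \<in> Hom V II (VHom (Alg V P T J) (VOb (vfun_comp V F (forget V P T)) X) (VOb (vfun_id V (Alg V P T J)) X))"
    using \<epsilon>_nat unfolding V_natural_def by blast
  from this[rule_format, of \<AA>] assms show "\<epsilon> \<AA> \<in> Arr V" "Dom V (\<epsilon> \<AA>) = II" "Cod V (\<epsilon> \<AA>) = Dom V (alg_proj V P T (Fo (fst \<AA>)) \<AA>)"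
    by (simp_all add: vfun_id_def vfun_comp_def)
qed

lemma et_Hom: "X \<in> Obj V \<Longrightarrow> et X \<in> Hom V X (TT X)"
  by (simp add: et_def)

lemma et_simps [simp]: "X \<in> Obj V \<Longrightarrow> et X \<in> Arr V" "X \<in> Obj V \<Longrightarrow> Dom V (et X) = X" "X \<in> Obj V \<Longrightarrow> Cod V (et X) = TT X"
  by (simp_all add: et_def)

lemma ep_arrow: "alg \<AA> \<Longrightarrow> (Fo (fst \<AA>), \<AA>, \<epsilon> \<AA>) \<in> Hom \<A> (Fo (fst \<AA>)) \<AA>"
  by (simp add: Hom_A del: Hom_iff, simp)

lemma ep_ahom: "alg \<AA> \<Longrightarrow> ahom (Fo (fst \<AA>)) \<AA> (ep \<AA>)"
  unfolding ep_def by (rule U_ahom[OF ep_arrow])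

lemma ep_simps [simp]: "alg \<AA> \<Longrightarrow> ep \<AA> \<in> Arr V" "alg \<AA> \<Longrightarrow> Dom V (ep \<AA>) = TT (fst \<AA>)" "alg \<AA> \<Longrightarrow> Cod V (ep \<AA>) = fst \<AA>"
  by (simp_all add: ahom_simps[OF ep_ahom])

lemma Fm_arrow: "f \<in> Hom V X Y \<Longrightarrow> (Fo X, Fo Y, VAr F X Y \<cdot> name_of V X Y f) \<in> Hom \<A> (Fo X) (Fo Y)"
  using Hom_Obj[of f X Y] by (simp add: Hom_A del: Hom_iff, simp)

lemma Fm_ahom: "f \<in> Hom V X Y \<Longrightarrow> ahom (Fo X) (Fo Y) (Fm X Y f)"
  unfolding Fm_def by (rule U_ahom[OF Fm_arrow])

lemma Fm_simps [simp]:
  assumes "f \<in> Arr V" "Dom V f = X" "Cod V f = Y"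
  shows "Fm X Y f \<in> Arr V" "Dom V (Fm X Y f) = TT X" "Cod V (Fm X Y f) = TT Y"
  using ahom_simps[OF Fm_ahom, of f X Y] assms by simp_all

lemma comp_A_pr: "(\<BB>, \<CC>, k) \<cdot>\<^bsub>\<A>\<^esub> (\<AA>, \<BB>', h) = (\<AA>, \<CC>, VCmp (Alg V P T J) \<AA> \<BB>' \<CC> \<cdot> pr k h)"
  by (simp add: Alg\<^sub>0_def underlying_cat_def elem_comp_pr)

lemma Fm_comp:
  assumes "f \<in> Hom V X Y" "g \<in> Hom V Y Z"
  shows "Fm X Z (g \<cdot> f) = Fm Y Z g \<cdot> Fm X Y f"
proof -
  have o: "X \<in> Obj V" "Y \<in> Obj V" "Z \<in> Obj V" using Hom_Obj assms by blast+
  note c = V_functorD(6)[OF F_functor, of X Y Z, simplified, OF o]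
  have m: "VCmp (Alg V P T J) (Fo X) (Fo Y) (Fo Z) \<in> Hom V (Dom V (alg_proj V P T (Fo Y) (Fo Z)) \<otimes> Dom V (alg_proj V P T (Fo X) (Fo Y))) (Dom V (alg_proj V P T (Fo X) (Fo Z)))"
    using V_category.VCmp_Hom[OF Alg_cat, of "Fo X" "Fo Y" "Fo Z"] o by simp
  have n: "name_of V X Z (g \<cdot> f) = VCmp (self_vcat V) X Y Z \<cdot> pr (name_of V Y Z g) (name_of V X Y f)"
    by (subst self_VCmp_pr') (use assms o in simp_all)
  have "VAr F X Z \<cdot> name_of V X Z (g \<cdot> f) = (VCmp (Alg V P T J) (Fo X) (Fo Y) (Fo Z) \<cdot> (VAr F Y Z \<odot> VAr F X Y)) \<cdot> pr (name_of V Y Z g) (name_of V X Y f)"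
    unfolding n by (rule Cmp_reduce[OF c]) (use assms o in simp_all)
  also have "\<dots> = VCmp (Alg V P T J) (Fo X) (Fo Y) (Fo Z) \<cdot> pr (VAr F Y Z \<cdot> name_of V Y Z g) (VAr F X Y \<cdot> name_of V X Y f)"
    using assms o m by simp
  finally have "(Fo X, Fo Z, VAr F X Z \<cdot> name_of V X Z (g \<cdot> f)) =
    (Fo Y, Fo Z, VAr F Y Z \<cdot> name_of V Y Z g) \<cdot>\<^bsub>\<A>\<^esub> (Fo X, Fo Y, VAr F X Y \<cdot> name_of V X Y f)"
    by (simp add: comp_A_pr)
  thus ?thesis unfolding Fm_def using Cmp_A(2)[OF Fm_arrow[OF assms(1)] Fm_arrow[OF assms(2)]] by simp
qed

lemma post_comp_simps [simp]:
  assumes "VCmp C X Y Z \<in> Hom V (VHom C Y Z \<otimes> VHom C X Y) (VHom C X Z)" "VHom C X Y \<in> Obj V" "g \<in> Hom V II (VHom C Y Z)"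
  shows "post_comp V C X Y Z g \<in> Arr V" "Dom V (post_comp V C X Y Z g) = VHom C X Y" "Cod V (post_comp V C X Y Z g) = VHom C X Z"
  using assms by (simp_all add: post_comp_def)

lemma pre_comp_simps [simp]:
  assumes "VCmp C X Y Z \<in> Hom V (VHom C Y Z \<otimes> VHom C X Y) (VHom C X Z)" "VHom C Y Z \<in> Obj V" "f \<in> Hom V II (VHom C X Y)"
  shows "pre_comp V C X Y Z f \<in> Arr V" "Dom V (pre_comp V C X Y Z f) = VHom C Y Z" "Cod V (pre_comp V C X Y Z f) = VHom C X Z"
  using assms inverse_of_simps[OF runit_simps(4)[OF assms(2)]] by (simp_all add: pre_comp_def)

text \<open>Enriched naturality is an equation of arrows out of [X, Y]; at the point that names
  \<open>f\<close> it becomes ordinary naturality.\<close>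

lemma et_natural:
  assumes "f \<in> Hom V X Y"
  shows "Fm X Y f \<cdot> et X = et Y \<cdot> f"
proof -
  have o: "X \<in> Obj V" "Y \<in> Obj V" using Hom_Obj assms by blast+
  let ?S = "self_vcat V" and ?n = "name_of V X Y f"
  let ?l = "post_comp V ?S X Y (TT Y) (\<eta> Y)" and ?r = "pre_comp V ?S X (TT X) (TT Y) (\<eta> X)"
  have VC: "VCmp ?S X Y (TT Y) \<in> Hom V (VHom ?S Y (TT Y) \<otimes> VHom ?S X Y) (VHom ?S X (TT Y))"
    "VCmp ?S X (TT X) (TT Y) \<in> Hom V (VHom ?S (TT X) (TT Y) \<otimes> VHom ?S X (TT X)) (VHom ?S X (TT Y))"
    using o by simp_all
  have l: "?l \<in> Hom V (ihom V X Y) (ihom V X (TT Y))" using post_comp_simps[OF VC(1)] o by simp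
  have r: "?r \<in> Hom V (ihom V (TT X) (TT Y)) (ihom V X (TT Y))" using pre_comp_simps[OF VC(2)] o by simp
  have "?l \<cdot> Idn V (ihom V X Y) = ?r \<cdot> (alg_proj V P T (Fo X) (Fo Y) \<cdot> VAr F X Y)"
    using \<eta>_nat o unfolding V_natural_def by (simp add: vfun_id_def vfun_comp_def)
  hence "(?l \<cdot> Idn V (ihom V X Y)) \<cdot> ?n = (?r \<cdot> (alg_proj V P T (Fo X) (Fo Y) \<cdot> VAr F X Y)) \<cdot> ?n" by simp
  hence e: "?l \<cdot> ?n = ?r \<cdot> (alg_proj V P T (Fo X) (Fo Y) \<cdot> (VAr F X Y \<cdot> ?n))"
    using l r o assms by simp
  have "?l \<cdot> ?n = VCmp ?S X Y (TT Y) \<cdot> pr (\<eta> Y) ?n"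
    by (rule post_comp_pt[OF VC(1)]) (use o assms in simp_all)
  moreover have "?r \<cdot> (alg_proj V P T (Fo X) (Fo Y) \<cdot> (VAr F X Y \<cdot> ?n)) = VCmp ?S X (TT X) (TT Y) \<cdot> pr (alg_proj V P T (Fo X) (Fo Y) \<cdot> (VAr F X Y \<cdot> ?n)) (\<eta> X)"
    by (rule pre_comp_pt[OF VC(2)]) (use o assms in simp_all)
  ultimately have "unname V X (TT Y) (VCmp ?S X Y (TT Y) \<cdot> pr (\<eta> Y) ?n) =
    unname V X (TT Y) (VCmp ?S X (TT X) (TT Y) \<cdot> pr (alg_proj V P T (Fo X) (Fo Y) \<cdot> (VAr F X Y \<cdot> ?n)) (\<eta> X))" using e by simp
  thus ?thesis using o assms by (simp add: Fm_def U_def et_def)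
qed

text \<open>Enriched naturality of the counit, evaluated at the point of the hom-object of algebras
  that corresponds to the homomorphism \<open>f\<close>.\<close>

lemma ep_natural:
  assumes A: "alg \<AA>" "alg \<BB>" and f: "ahom \<AA> \<BB> f"
  shows "ep \<BB> \<cdot> Fm (fst \<AA>) (fst \<BB>) f = f \<cdot> ep \<AA>"
proof -
  obtain \<phi> where \<phi>: "\<phi> \<in> Hom \<A> \<AA> \<BB>" "U \<phi> = f" using U_full[OF assms] by blast
  then obtain h where h: "\<phi> = (\<AA>, \<BB>, h)" "h \<in> Hom V II (Dom V (alg_proj V P T \<AA> \<BB>))" unfolding Hom_A by blast
  let ?A = "Alg V P T J" and ?FA = "Fo (fst \<AA>)" and ?FB = "Fo (fst \<BB>)"
  have FA: "alg ?FA" "alg ?FB" using A by simp_all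
  have VC: "VCmp ?A ?FA ?FB \<BB> \<in> Hom V (VHom ?A ?FB \<BB> \<otimes> VHom ?A ?FA ?FB) (VHom ?A ?FA \<BB>)"
    "VCmp ?A ?FA \<AA> \<BB> \<in> Hom V (VHom ?A \<AA> \<BB> \<otimes> VHom ?A ?FA \<AA>) (VHom ?A ?FA \<BB>)"
    using V_category.VCmp_Hom[OF Alg_cat] A FA by (simp_all del: Hom_iff Alg_simps(2))
  let ?l = "post_comp V ?A ?FA ?FB \<BB> (\<epsilon> \<BB>)" and ?r = "pre_comp V ?A ?FA \<AA> \<BB> (\<epsilon> \<AA>)"
  have l: "?l \<in> Hom V (Dom V (alg_proj V P T ?FA ?FB)) (Dom V (alg_proj V P T ?FA \<BB>))"
    using post_comp_simps[OF VC(1), of "\<epsilon> \<BB>"] A FA by simp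
  have r: "?r \<in> Hom V (Dom V (alg_proj V P T \<AA> \<BB>)) (Dom V (alg_proj V P T ?FA \<BB>))"
    using pre_comp_simps[OF VC(2), of "\<epsilon> \<AA>"] A FA by simp
  have "\<forall>X\<in>VObj ?A. \<forall>Y\<in>VObj ?A.
      post_comp V ?A (VOb (vfun_comp V F (forget V P T)) X) (VOb (vfun_comp V F (forget V P T)) Y) (VOb (vfun_id V ?A) Y) (\<epsilon> Y) \<cdot> VAr (vfun_comp V F (forget V P T)) X Y =
      pre_comp V ?A (VOb (vfun_comp V F (forget V P T)) X) (VOb (vfun_id V ?A) X) (VOb (vfun_id V ?A) Y) (\<epsilon> X) \<cdot> VAr (vfun_id V ?A) X Y"
    using \<epsilon>_nat unfolding V_natural_def by blast
  from this[rule_format, of \<AA> \<BB>] A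
  have "?l \<cdot> (VAr F (fst \<AA>) (fst \<BB>) \<cdot> alg_proj V P T \<AA> \<BB>) = ?r \<cdot> Idn V (Dom V (alg_proj V P T \<AA> \<BB>))"
    by (simp add: vfun_id_def vfun_comp_def)
  hence "(?l \<cdot> (VAr F (fst \<AA>) (fst \<BB>) \<cdot> alg_proj V P T \<AA> \<BB>)) \<cdot> h = (?r \<cdot> Idn V (Dom V (alg_proj V P T \<AA> \<BB>))) \<cdot> h" by simp
  hence e: "?l \<cdot> (VAr F (fst \<AA>) (fst \<BB>) \<cdot> (alg_proj V P T \<AA> \<BB> \<cdot> h)) = ?r \<cdot> h"
    using l r A h by simp
  have n: "alg_proj V P T \<AA> \<BB> \<cdot> h = name_of V (fst \<AA>) (fst \<BB>) f"
  proof -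
    have "f = unname V (fst \<AA>) (fst \<BB>) (alg_proj V P T \<AA> \<BB> \<cdot> h)" using \<phi>(2) by (simp add: h U_def)
    thus ?thesis using A h by simp
  qed
  have fH: "f \<in> Hom V (fst \<AA>) (fst \<BB>)" using ahom_Hom[OF f] .
  have "?l \<cdot> (VAr F (fst \<AA>) (fst \<BB>) \<cdot> name_of V (fst \<AA>) (fst \<BB>) f) = VCmp ?A ?FA ?FB \<BB> \<cdot> pr (\<epsilon> \<BB>) (VAr F (fst \<AA>) (fst \<BB>) \<cdot> name_of V (fst \<AA>) (fst \<BB>) f)"
    by (rule post_comp_pt[OF VC(1)]) (use A FA fH in simp_all)
  moreover have "?r \<cdot> h = VCmp ?A ?FA \<AA> \<BB> \<cdot> pr h (\<epsilon> \<AA>)"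
    by (rule pre_comp_pt[OF VC(2)]) (use A FA h in simp_all)
  ultimately have "(?FB, \<BB>, \<epsilon> \<BB>) \<cdot>\<^bsub>\<A>\<^esub> (?FA, ?FB, VAr F (fst \<AA>) (fst \<BB>) \<cdot> name_of V (fst \<AA>) (fst \<BB>) f) = \<phi> \<cdot>\<^bsub>\<A>\<^esub> (?FA, \<AA>, \<epsilon> \<AA>)"
    using e unfolding n h(1) comp_A_pr by simp
  hence "U ((?FB, \<BB>, \<epsilon> \<BB>) \<cdot>\<^bsub>\<A>\<^esub> (?FA, ?FB, VAr F (fst \<AA>) (fst \<BB>) \<cdot> name_of V (fst \<AA>) (fst \<BB>) f)) = U (\<phi> \<cdot>\<^bsub>\<A>\<^esub> (?FA, \<AA>, \<epsilon> \<AA>))" by simp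
  thus ?thesis
    unfolding Cmp_A(2)[OF Fm_arrow[OF fH] ep_arrow[OF A(2)]] Cmp_A(2)[OF ep_arrow[OF A(1)] \<phi>(1)] \<phi>(2)
    by (simp add: ep_def Fm_def)
qed

lemma ep_Fm_et:
  assumes "X \<in> Obj V"
  shows "ep (Fo X) \<cdot> Fm X (TT X) (et X) = Idn V (TT X)"
proof -
  have e: "elem_comp V (Alg V P T J) (Fo X) (Fo (TT X)) (Fo X) (\<epsilon> (Fo X)) (VAr F X (TT X) \<cdot> \<eta> X) = VIdn (Alg V P T J) (Fo X)"
    using adjunction assms unfolding V_adjunction_def Let_def by simp
  have n: "name_of V X (TT X) (et X) = \<eta> X" using assms by (simp add: et_def)
  note a = Fm_arrow[OF et_Hom[OF assms]] ep_arrow[OF Fo_alg[OF assms]]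
  have "(Fo (TT X), Fo X, \<epsilon> (Fo X)) \<cdot>\<^bsub>\<A>\<^esub> (Fo X, Fo (TT X), VAr F X (TT X) \<cdot> name_of V X (TT X) (et X)) = Idn \<A> (Fo X)"
    unfolding comp_A_pr n using e by (simp add: elem_comp_pr Alg\<^sub>0_def underlying_cat_def)
  hence "U ((Fo (TT X), Fo X, \<epsilon> (Fo X)) \<cdot>\<^bsub>\<A>\<^esub> (Fo X, Fo (TT X), VAr F X (TT X) \<cdot> name_of V X (TT X) (et X))) = Idn V (TT X)"
    using Idn_A(2)[OF Fo_alg[OF assms]] by simp
  thus ?thesis unfolding Cmp_A(2)[OF a] by (simp add: ep_def Fm_def)
qed

lemma ep_et:
  assumes "alg \<AA>"
  shows "ep \<AA> \<cdot> et (fst \<AA>) = Idn V (fst \<AA>)"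
proof -
  let ?A = "fst \<AA>"
  have "\<forall>A \<in> VObj (Alg V P T J). elem_comp V (self_vcat V) (VOb (forget V P T) A) (VOb (forget V P T) (Fo (VOb (forget V P T) A))) (VOb (forget V P T) A)
      (VAr (forget V P T) (Fo (VOb (forget V P T) A)) A \<cdot> \<epsilon> A) (\<eta> (VOb (forget V P T) A)) = VIdn (self_vcat V) (VOb (forget V P T) A)"
    using adjunction unfolding V_adjunction_def Let_def by blast
  from this[rule_format, of \<AA>] assms
  have e: "VCmp (self_vcat V) ?A (TT ?A) ?A \<cdot> pr (alg_proj V P T (Fo ?A) \<AA> \<cdot> \<epsilon> \<AA>) (\<eta> ?A) = VIdn (self_vcat V) ?A"
    by (simp add: elem_comp_pr)
  have "unname V ?A ?A (VCmp (self_vcat V) ?A (TT ?A) ?A \<cdot> pr (alg_proj V P T (Fo ?A) \<AA> \<cdot> \<epsilon> \<AA>) (\<eta> ?A)) = Idn V ?A"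
    unfolding e using assms by (simp add: self_VIdn)
  thus ?thesis using assms by (simp add: ep_def U_def et_def)
qed

section \<open>The universal property of free algebras\<close>

lemma free_extension:
  assumes "alg \<AA>" "f \<in> Hom V X (fst \<AA>)"
  shows "ahom (Fo X) \<AA> (ep \<AA> \<cdot> Fm X (fst \<AA>) f)" "(ep \<AA> \<cdot> Fm X (fst \<AA>) f) \<cdot> et X = f"
proof -
  have o: "X \<in> Obj V" using Hom_Obj assms by blast
  show "ahom (Fo X) \<AA> (ep \<AA> \<cdot> Fm X (fst \<AA>) f)"
    by (rule ahom_comp[OF Fm_ahom[OF assms(2)] ep_ahom[OF assms(1)]]) (use o in simp)
  have "(ep \<AA> \<cdot> Fm X (fst \<AA>) f) \<cdot> et X = ep \<AA> \<cdot> (et (fst \<AA>) \<cdot> f)"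
    using assms o et_natural[OF assms(2)] by simp
  also have "\<dots> = Idn V (fst \<AA>) \<cdot> f" by (rule Cmp_reduce[OF ep_et]) (use assms in simp_all)
  finally show "(ep \<AA> \<cdot> Fm X (fst \<AA>) f) \<cdot> et X = f" using assms by simp
qed

text \<open>Naturality of the counit and a triangle identity recover a homomorphism out of
  \<open>Fo X\<close> from its composite with \<open>et X\<close>.\<close>

lemma free_unique:
  assumes "alg \<AA>" "X \<in> Obj V" "ahom (Fo X) \<AA> f" "ahom (Fo X) \<AA> g" "f \<cdot> et X = g \<cdot> et X"
  shows "f = g"
proof -
  have *: "h = ep \<AA> \<cdot> Fm X (fst \<AA>) (h \<cdot> et X)" if h: "ahom (Fo X) \<AA> h" for h
  proof -
    note s = ahom_simps[OF h]
    have "ep \<AA> \<cdot> Fm X (fst \<AA>) (h \<cdot> et X) = ep \<AA> \<cdot> (Fm (TT X) (fst \<AA>) h \<cdot> Fm X (TT X) (et X))"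
      by (subst Fm_comp[of "et X" X "TT X" h "fst \<AA>"]) (use s assms in simp_all)
    also have "\<dots> = (h \<cdot> ep (Fo X)) \<cdot> Fm X (TT X) (et X)"
      by (rule Cmp_reduce[OF ep_natural[OF Fo_alg assms(1) h]]) (use s assms in simp_all)
    also have "\<dots> = h" using ep_Fm_et[OF assms(2)] s assms by simp
    finally show ?thesis ..
  qed
  show ?thesis using *[OF assms(3)] *[OF assms(4)] assms(5) by simp
qed

subsection \<open>Algebras of the induced monad\<close>

abbreviation "M \<equiv> adjunction_monad V F (forget V P T) \<eta> \<epsilon>"
abbreviation "free \<equiv> free_monad_alg M"
abbreviation "eqz X Y \<equiv> monad_alg_equalizer V M (free X) (free Y)"

lemma M_simps [simp]: "VOb (MFun M) X = TT X" "VAr (MFun M) X Y = alg_proj V P T (Fo X) (Fo Y) \<cdot> VAr F X Y"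
  "MMult M X = alg_proj V P T (Fo (TT X)) (Fo X) \<cdot> \<epsilon> (Fo X)"
  by (simp_all add: adjunction_monad_def vfun_comp_def)

lemma free_simps [simp]: "free X = (TT X, MMult M X)"
  by (simp add: free_monad_alg_def)

lemma MMult_name:
  assumes "X \<in> Obj V"
  shows "MMult M X = name_of V (TT (TT X)) (TT X) (ep (Fo X))"
  using assms by (simp add: ep_def U_def)

lemma VAr_M_name:
  assumes "f \<in> Hom V X Y"
  shows "VAr (MFun M) X Y \<cdot> name_of V X Y f = name_of V (TT X) (TT Y) (Fm X Y f)"
  using assms Hom_Obj[OF assms] by (simp add: Fm_def U_def)

text \<open>Points of the hom-object of two free monad algebras are the arrows compatible with the
  structure maps. The last clause allows compatibility to be tested on any jointly epic set
  \<open>S\<close> of points; for a tensor product, \<open>S\<close> will be the set of the points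
  \<open>pr g f\<close>.\<close>

lemma eqz:
  assumes X: "X \<in> Obj V" and Y: "Y \<in> Obj V"
  shows "eqz X Y \<in> Arr V" "Cod V (eqz X Y) = ihom V (TT X) (TT Y)"
    "w \<in> Hom V II (Dom V (eqz X Y)) \<Longrightarrow> unname V (TT X) (TT Y) (eqz X Y \<cdot> w) \<cdot> ep (Fo X) = ep (Fo Y) \<cdot> Fm (TT X) (TT Y) (unname V (TT X) (TT Y) (eqz X Y \<cdot> w))"
    "S \<subseteq> Hom V II W \<Longrightarrow> (\<And>Z p q. p \<in> Hom V W Z \<Longrightarrow> q \<in> Hom V W Z \<Longrightarrow> (\<And>w. w \<in> S \<Longrightarrow> p \<cdot> w = q \<cdot> w) \<Longrightarrow> p = q) \<Longrightarrow>
      u \<in> Hom V W (ihom V (TT X) (TT Y)) \<Longrightarrow>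
      (\<And>w. w \<in> S \<Longrightarrow> unname V (TT X) (TT Y) (u \<cdot> w) \<cdot> ep (Fo X) = ep (Fo Y) \<cdot> Fm (TT X) (TT Y) (unname V (TT X) (TT Y) (u \<cdot> w))) \<Longrightarrow>
      \<exists>!k. k \<in> Hom V W (Dom V (eqz X Y)) \<and> eqz X Y \<cdot> k = u"
proof -
  let ?S = "self_vcat V"
  let ?A = "TT X" and ?B = "TT Y"
  let ?f = "pre_comp V ?S (TT ?A) ?A ?B (MMult M X)"
  let ?g = "post_comp V ?S (TT ?A) (TT ?B) ?B (MMult M Y) \<cdot> VAr (MFun M) ?A ?B"
  have VC: "VCmp ?S (TT ?A) ?A ?B \<in> Hom V (VHom ?S ?A ?B \<otimes> VHom ?S (TT ?A) ?A) (VHom ?S (TT ?A) ?B)"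
    "VCmp ?S (TT ?A) (TT ?B) ?B \<in> Hom V (VHom ?S (TT ?B) ?B \<otimes> VHom ?S (TT ?A) (TT ?B)) (VHom ?S (TT ?A) ?B)"
    using X Y by simp_all
  have f: "?f \<in> Hom V (ihom V ?A ?B) (ihom V (TT ?A) ?B)" using pre_comp_simps[OF VC(1), of "MMult M X"] X Y by simp
  have p: "post_comp V ?S (TT ?A) (TT ?B) ?B (MMult M Y) \<in> Hom V (ihom V (TT ?A) (TT ?B)) (ihom V (TT ?A) ?B)"
    using post_comp_simps[OF VC(2), of "MMult M Y"] X Y by simp
  have g: "?g \<in> Hom V (ihom V ?A ?B) (ihom V (TT ?A) ?B)" using p X Y by simp
  have fn: "?f \<cdot> u = name_of V (TT ?A) ?B (unname V ?A ?B u \<cdot> ep (Fo X))" if u: "u \<in> Hom V II (ihom V ?A ?B)" for u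
  proof -
    have "?f \<cdot> u = VCmp ?S (TT ?A) ?A ?B \<cdot> pr u (MMult M X)"
      by (rule pre_comp_pt[OF VC(1)]) (use X Y u in simp_all)
    also have "\<dots> = name_of V (TT ?A) ?B (unname V ?A ?B u \<cdot> unname V (TT ?A) ?A (MMult M X))"
      by (rule self_VCmp_pr') (use X Y u in simp_all)
    also have "unname V (TT ?A) ?A (MMult M X) = ep (Fo X)" unfolding MMult_name[OF X] using X by simp
    finally show ?thesis .
  qed
  have gn: "?g \<cdot> u = name_of V (TT ?A) ?B (ep (Fo Y) \<cdot> Fm ?A ?B (unname V ?A ?B u))" if u: "u \<in> Hom V II (ihom V ?A ?B)" for u
  proof -
    have "?g \<cdot> u = post_comp V ?S (TT ?A) (TT ?B) ?B (MMult M Y) \<cdot> (VAr (MFun M) ?A ?B \<cdot> name_of V ?A ?B (unname V ?A ?B u))"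
      using p X Y u by simp
    also have "\<dots> = post_comp V ?S (TT ?A) (TT ?B) ?B (MMult M Y) \<cdot> name_of V (TT ?A) (TT ?B) (Fm ?A ?B (unname V ?A ?B u))"
      by (subst VAr_M_name) (use X Y u in simp_all)
    also have "\<dots> = VCmp ?S (TT ?A) (TT ?B) ?B \<cdot> pr (MMult M Y) (name_of V (TT ?A) (TT ?B) (Fm ?A ?B (unname V ?A ?B u)))"
      by (rule post_comp_pt[OF VC(2)]) (use X Y u in simp_all)
    also have "\<dots> = name_of V (TT ?A) ?B (unname V (TT ?B) ?B (MMult M Y) \<cdot> unname V (TT ?A) (TT ?B) (name_of V (TT ?A) (TT ?B) (Fm ?A ?B (unname V ?A ?B u))))"
      by (rule self_VCmp_pr') (use X Y u in simp_all)
    also have "\<dots> = name_of V (TT ?A) ?B (ep (Fo Y) \<cdot> Fm ?A ?B (unname V ?A ?B u))" unfolding MMult_name[OF Y] using X Y u by simp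
    finally show ?thesis .
  qed
  have eq_iff: "?f \<cdot> u = ?g \<cdot> u \<longleftrightarrow> unname V ?A ?B u \<cdot> ep (Fo X) = ep (Fo Y) \<cdot> Fm ?A ?B (unname V ?A ?B u)"
    if u: "u \<in> Hom V II (ihom V ?A ?B)" for u
  proof
    assume "?f \<cdot> u = ?g \<cdot> u"
    hence "unname V (TT ?A) ?B (name_of V (TT ?A) ?B (unname V ?A ?B u \<cdot> ep (Fo X)))
      = unname V (TT ?A) ?B (name_of V (TT ?A) ?B (ep (Fo Y) \<cdot> Fm ?A ?B (unname V ?A ?B u)))"
      unfolding fn[OF u] gn[OF u] by simp
    thus "unname V ?A ?B u \<cdot> ep (Fo X) = ep (Fo Y) \<cdot> Fm ?A ?B (unname V ?A ?B u)" using X Y u by simp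
  qed (simp only: fn[OF u] gn[OF u])
  obtain e where "is_equalizer V ?f ?g e" using f g equalizer by blast
  from someI[of "is_equalizer V ?f ?g", OF this] have E: "is_equalizer V ?f ?g (eqz X Y)"
    unfolding monad_alg_equalizer_def Let_def free_simps case_prod_conv M_simps(1) .
  show e: "eqz X Y \<in> Arr V" "Cod V (eqz X Y) = ihom V ?A ?B" using E f by (auto simp: is_equalizer_def)
  show "unname V ?A ?B (eqz X Y \<cdot> w) \<cdot> ep (Fo X) = ep (Fo Y) \<cdot> Fm ?A ?B (unname V ?A ?B (eqz X Y \<cdot> w))"
    if w: "w \<in> Hom V II (Dom V (eqz X Y))"
  proof -
    have "?f \<cdot> eqz X Y = ?g \<cdot> eqz X Y" using E by (simp add: is_equalizer_def)
    hence "(?f \<cdot> eqz X Y) \<cdot> w = (?g \<cdot> eqz X Y) \<cdot> w" by (rule arg_cong)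
    moreover have "(?f \<cdot> eqz X Y) \<cdot> w = ?f \<cdot> (eqz X Y \<cdot> w)" by (rule Cmp_assoc[where W = II]) (use f e w in simp_all)
    moreover have "(?g \<cdot> eqz X Y) \<cdot> w = ?g \<cdot> (eqz X Y \<cdot> w)" by (rule Cmp_assoc[where W = II]) (use g e w in simp_all)
    ultimately have "?f \<cdot> (eqz X Y \<cdot> w) = ?g \<cdot> (eqz X Y \<cdot> w)" by simp
    thus ?thesis by (subst (asm) eq_iff) (use e w in simp_all)
  qed
  show "\<exists>!k. k \<in> Hom V W (Dom V (eqz X Y)) \<and> eqz X Y \<cdot> k = u"
    if S: "S \<subseteq> Hom V II W" and sep: "\<And>Z p q. p \<in> Hom V W Z \<Longrightarrow> q \<in> Hom V W Z \<Longrightarrow> (\<And>w. w \<in> S \<Longrightarrow> p \<cdot> w = q \<cdot> w) \<Longrightarrow> p = q"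
      and u: "u \<in> Hom V W (ihom V ?A ?B)"
      and *: "\<And>w. w \<in> S \<Longrightarrow> unname V ?A ?B (u \<cdot> w) \<cdot> ep (Fo X) = ep (Fo Y) \<cdot> Fm ?A ?B (unname V ?A ?B (u \<cdot> w))"
  proof -
    have "?f \<cdot> u = ?g \<cdot> u"
    proof (rule sep[of _ "ihom V (TT ?A) ?B"])
      fix w assume "w \<in> S"
      note * = *[OF this]
      have w: "w \<in> Hom V II W" using S \<open>w \<in> S\<close> by blast
      have "?f \<cdot> (u \<cdot> w) = ?g \<cdot> (u \<cdot> w)" by (subst eq_iff) (use u w * in simp_all)
      moreover have "(?f \<cdot> u) \<cdot> w = ?f \<cdot> (u \<cdot> w)" by (rule Cmp_assoc[where W = II]) (use f u w in simp_all)
      moreover have "(?g \<cdot> u) \<cdot> w = ?g \<cdot> (u \<cdot> w)" by (rule Cmp_assoc[where W = II]) (use g u w in simp_all)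
      ultimately show "(?f \<cdot> u) \<cdot> w = (?g \<cdot> u) \<cdot> w" by simp
    qed (use Cmp_Hom[OF u f] Cmp_Hom[OF u g] in simp_all)
    moreover have "u \<in> Hom V W (Dom V ?f)" using u f by simp
    ultimately show ?thesis using E unfolding is_equalizer_def by blast
  qed
qed

abbreviation "T' \<equiv> monad_pretheory_cat V P M"
abbreviation "J' \<equiv> monad_pretheory_fun V M"

lemma T'_simps [simp]: "VObj T' = P" "VHom T' X Y = Dom V (eqz X Y)"
  by (simp_all add: monad_pretheory_cat_def Let_def monad_alg_vcat_def concrete_vcat_def)

text \<open>Justifies the definite description by which \<open>concrete_vcat\<close> defines
  composition: the composite of two homomorphisms of monad algebras is again one, which has to be
  tested only on the points \<open>pr g f\<close>.\<close>

lemma T'_VCmp: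
  assumes "X \<in> Obj V" "Y \<in> Obj V" "Z \<in> Obj V"
  shows "VCmp T' X Y Z \<in> Hom V (Dom V (eqz Y Z) \<otimes> Dom V (eqz X Y)) (Dom V (eqz X Z))"
    "eqz X Z \<cdot> VCmp T' X Y Z = VCmp (self_vcat V) (TT X) (TT Y) (TT Z) \<cdot> (eqz Y Z \<odot> eqz X Y)"
proof -
  let ?u = "VCmp (self_vcat V) (TT X) (TT Y) (TT Z) \<cdot> (eqz Y Z \<odot> eqz X Y)"
  note e = eqz(1,2)[OF assms(1,2)] eqz(1,2)[OF assms(2,3)] eqz(1,2)[OF assms(1,3)]
  let ?W = "Dom V (eqz Y Z) \<otimes> Dom V (eqz X Y)"
  have u: "?u \<in> Hom V ?W (ihom V (TT X) (TT Z))" using e assms by simp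
  have "\<exists>!k. k \<in> Hom V ?W (Dom V (eqz X Z)) \<and> eqz X Z \<cdot> k = ?u"
  proof (rule eqz(4)[OF assms(1,3) _ _ u, where S = "{pr g f |g f. g \<in> Hom V II (Dom V (eqz Y Z)) \<and> f \<in> Hom V II (Dom V (eqz X Y))}"])
    fix Z' p q assume "p \<in> Hom V ?W Z'" "q \<in> Hom V ?W Z'"
      "\<And>w. w \<in> {pr g f |g f. g \<in> Hom V II (Dom V (eqz Y Z)) \<and> f \<in> Hom V II (Dom V (eqz X Y))} \<Longrightarrow> p \<cdot> w = q \<cdot> w"
    thus "p = q" by (intro tensor_ext[of p "Dom V (eqz Y Z)" "Dom V (eqz X Y)" Z' q]) (use e in auto)
  next
    fix w assume "w \<in> {pr g f |g f. g \<in> Hom V II (Dom V (eqz Y Z)) \<and> f \<in> Hom V II (Dom V (eqz X Y))}"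
    then obtain g f where w: "w = pr g f" and g: "g \<in> Hom V II (Dom V (eqz Y Z))" and f: "f \<in> Hom V II (Dom V (eqz X Y))" by blast
    define g' f' where "g' = unname V (TT Y) (TT Z) (eqz Y Z \<cdot> g)" and "f' = unname V (TT X) (TT Y) (eqz X Y \<cdot> f)"
    have g': "g' \<in> Hom V (TT Y) (TT Z)" "g' \<cdot> ep (Fo Y) = ep (Fo Z) \<cdot> Fm (TT Y) (TT Z) g'"
      using g eqz(3)[OF assms(2,3) g] e assms by (simp_all add: g'_def)
    have f': "f' \<in> Hom V (TT X) (TT Y)" "f' \<cdot> ep (Fo X) = ep (Fo Y) \<cdot> Fm (TT X) (TT Y) f'"
      using f eqz(3)[OF assms(1,2) f] e assms by (simp_all add: f'_def)
    have gf: "unname V (TT X) (TT Z) (?u \<cdot> w) = g' \<cdot> f'"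
      using e assms g f by (simp add: w g'_def f'_def)
    have "(g' \<cdot> f') \<cdot> ep (Fo X) = g' \<cdot> (ep (Fo Y) \<cdot> Fm (TT X) (TT Y) f')" using f' g'(1) assms by simp
    also have "\<dots> = (ep (Fo Z) \<cdot> Fm (TT Y) (TT Z) g') \<cdot> Fm (TT X) (TT Y) f'"
      by (rule Cmp_reduce[OF g'(2)]) (use f'(1) g'(1) assms in simp_all)
    also have "\<dots> = ep (Fo Z) \<cdot> Fm (TT X) (TT Z) (g' \<cdot> f')"
      using Fm_comp[OF f'(1) g'(1)] f'(1) g'(1) assms by simp
    finally show "unname V (TT X) (TT Z) (?u \<cdot> w) \<cdot> ep (Fo X) = ep (Fo Z) \<cdot> Fm (TT X) (TT Z) (unname V (TT X) (TT Z) (?u \<cdot> w))"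
      unfolding gf .
  qed (use e in auto)
  from theI'[OF this] show "VCmp T' X Y Z \<in> Hom V (Dom V (eqz Y Z) \<otimes> Dom V (eqz X Y)) (Dom V (eqz X Z))"
    "eqz X Z \<cdot> VCmp T' X Y Z = VCmp (self_vcat V) (TT X) (TT Y) (TT Z) \<cdot> (eqz Y Z \<odot> eqz X Y)"
    by (simp_all add: monad_pretheory_cat_def Let_def monad_alg_vcat_def concrete_vcat_def free_monad_alg_def del: Hom_iff)
qed

text \<open>The definite description is justified because \<open>Fm X Y f\<close> is compatible with
  the structure maps, by naturality of \<open>ep\<close>.\<close>

lemma J':
  assumes "X \<in> Obj V" "Y \<in> Obj V"
  shows "VAr J' X Y \<in> Hom V (ihom V X Y) (Dom V (eqz X Y))" "eqz X Y \<cdot> VAr J' X Y = VAr (MFun M) X Y"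
proof -
  have "\<exists>!k. k \<in> Hom V (ihom V X Y) (Dom V (eqz X Y)) \<and> eqz X Y \<cdot> k = VAr (MFun M) X Y"
  proof (rule eqz(4)[OF assms, where S = "Hom V II (ihom V X Y)"])
    show "p = q" if "p \<in> Hom V (ihom V X Y) Z" "q \<in> Hom V (ihom V X Y) Z" "\<And>w. w \<in> Hom V II (ihom V X Y) \<Longrightarrow> p \<cdot> w = q \<cdot> w" for Z p q
      using that by (rule pt_ext)
    fix w assume w: "w \<in> Hom V II (ihom V X Y)"
    define f where "f = unname V X Y w"
    have f: "f \<in> Hom V X Y" "w = name_of V X Y f" using w assms by (simp_all add: f_def)
    have e: "unname V (TT X) (TT Y) (VAr (MFun M) X Y \<cdot> w) = Fm X Y f"
      unfolding f(2) VAr_M_name[OF f(1)] using f(1) by simp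
    show "unname V (TT X) (TT Y) (VAr (MFun M) X Y \<cdot> w) \<cdot> ep (Fo X) = ep (Fo Y) \<cdot> Fm (TT X) (TT Y) (unname V (TT X) (TT Y) (VAr (MFun M) X Y \<cdot> w))"
      unfolding e using ep_natural[OF _ _ Fm_ahom[OF f(1)]] assms by simp
  qed (use assms in simp_all)
  from theI'[OF this] show "VAr J' X Y \<in> Hom V (ihom V X Y) (Dom V (eqz X Y))" "eqz X Y \<cdot> VAr J' X Y = VAr (MFun M) X Y"
    unfolding monad_pretheory_fun_def Let_def vfun.select_convs by (simp_all only:)
qed

text \<open>Points of \<open>T(I, X)\<close> are the points of the free algebra on \<open>X\<close>; so discreteness lifts the latter
  along \<open>\<delta>\<close>.\<close>

lemma discrete_point:
  assumes iso: "pretheory_iso V P T J T' J'" and discrete: "discrete_theory V P T J"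
    and X: "X \<in> P" and b: "b \<in> Hom V II (TT X)"
  obtains X0 \<iota> \<delta> c where "X0 \<in> Obj V" "\<delta> \<in> Hom V X0 X" "is_coproduct V (Hom V II X) (\<lambda>_. II) X0 \<iota>"
    "c \<in> Hom V II (TT X0)" "Fm X0 X \<delta> \<cdot> c = b"
proof -
  obtain G where G: "V_functor V T T' G" "\<And>X. X \<in> P \<Longrightarrow> VOb G X = X" "\<And>X Y. X \<in> P \<Longrightarrow> Y \<in> P \<Longrightarrow> iso_arrow V (VAr G X Y)"
    "vfun_eq_on P (vfun_comp V G J) J'"
    using iso unfolding pretheory_iso_def by blast
  have G_Hom: "VAr G X Y \<in> Hom V (VHom T X Y) (Dom V (eqz X Y))" if "X \<in> P" "Y \<in> P" for X Y
    using V_functorD(5)[OF G(1), of X Y] G(2) that by simp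
  have G_comp: "VAr G X Z \<cdot> VCmp T X Y Z = VCmp T' X Y Z \<cdot> (VAr G Y Z \<odot> VAr G X Y)" if "X \<in> P" "Y \<in> P" "Z \<in> P" for X Y Z
    using V_functorD(6)[OF G(1), of X Y Z] G(2) that by simp
  have GJ: "VAr G X Y \<cdot> VAr J X Y = VAr J' X Y" if "X \<in> P" "Y \<in> P" for X Y
    using G(4) that unfolding vfun_eq_on_def by (simp add: vfun_comp_def)
  have X' [simp]: "X \<in> Obj V" using X by simp
  have I: "II \<in> P" by (rule One_P)
  \<comment> \<open>A point of \<open>TT X\<close> is the same as a homomorphism from the free
    algebra on the unit. In this guise it becomes a point \<open>w\<close> of the hom-object from
    \<open>II\<close> to \<open>X\<close> in \<open>T'\<close>.\<close>
  define b' where "b' = ep (Fo X) \<cdot> Fm II (TT X) b"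
  have b': "ahom (Fo II) (Fo X) b'" "b' \<cdot> et II = b"
    using free_extension[OF Fo_alg[OF X'] b] by (simp_all add: b'_def)
  note b's = ahom_simps[OF b'(1)]
  have "\<exists>!w. w \<in> Hom V II (Dom V (eqz II X)) \<and> eqz II X \<cdot> w = name_of V (TT II) (TT X) b'"
  proof (rule eqz(4)[where S = "{Idn V II}"])
    show "p = q" if "p \<in> Hom V II Z" "q \<in> Hom V II Z" "\<And>w. w \<in> {Idn V II} \<Longrightarrow> p \<cdot> w = q \<cdot> w" for Z p q
      using that(1,2) that(3)[of "Idn V II"] by simp
    fix w assume "w \<in> {Idn V II}"
    thus "unname V (TT II) (TT X) (name_of V (TT II) (TT X) b' \<cdot> w) \<cdot> ep (Fo II)
      = ep (Fo X) \<cdot> Fm (TT II) (TT X) (unname V (TT II) (TT X) (name_of V (TT II) (TT X) b' \<cdot> w))"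
      using b's ep_natural[OF _ _ b'(1)] by simp
  qed (use b's in simp_all)
  then obtain w where w: "w \<in> Hom V II (Dom V (eqz II X))" "eqz II X \<cdot> w = name_of V (TT II) (TT X) b'" by blast
  \<comment> \<open>Moved back along the isomorphism of pretheories, \<open>w\<close> is an arrow
    from \<open>II\<close> to \<open>X\<close> of the theory itself, to which discreteness
    applies.\<close>
  define g where "g = inverse_of V (VAr G II X) \<cdot> w"
  note inv = inverse_of_simps[OF G(3)[OF I X]]
  have g: "g \<in> Hom V II (VHom T II X)" unfolding g_def using inv G_Hom[OF I X] w by simp
  have Gg: "VAr G II X \<cdot> g = w"
  proof -
    have "VAr G II X \<cdot> g = Idn V (Cod V (VAr G II X)) \<cdot> w"
      unfolding g_def by (rule Cmp_reduce[OF inv(6)]) (use inv G_Hom[OF I X] w in simp_all)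
    thus ?thesis using G_Hom[OF I X] w by simp
  qed
  obtain X0 \<iota> \<delta> f where X0: "X0 \<in> P" "\<delta> \<in> Hom V X0 X" "is_coproduct V (Hom V II X) (\<lambda>_. II) X0 \<iota>"
    and f: "f \<in> Hom V II (VHom T II X0)" "g = elem_comp V T II X0 X (VAr J X0 X \<cdot> name_of V X0 X \<delta>) f"
    using discrete X g unfolding discrete_theory_def by metis
  have X0' [simp]: "X0 \<in> Obj V" using X0 by simp
  let ?d = "name_of V X0 X \<delta>"
  note e = eqz(1,2)[OF One_Obj X'] eqz(1,2)[OF One_Obj X0'] eqz(1,2)[OF X0' X']
  \<comment> \<open>The arrow named by the image of the factor \<open>f\<close> in
    \<open>T'\<close>. What follows transports the factorization of \<open>g\<close> through the
    functor \<open>G\<close> and the equalizers into a factorization of \<open>b'\<close>.\<close>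
  define h where "h = unname V (TT II) (TT X0) (eqz II X0 \<cdot> (VAr G II X0 \<cdot> f))"
  have h: "h \<in> Hom V (TT II) (TT X0)" unfolding h_def using e f(1) G_Hom[OF I X0(1)] by simp
  note G0 = G_Hom[OF I X0(1)] and G1 = G_Hom[OF X0(1) X] and G2 = G_Hom[OF I X]
  have "w = VAr G II X \<cdot> (VCmp T II X0 X \<cdot> pr (VAr J X0 X \<cdot> ?d) f)" using Gg f(2) by (simp add: elem_comp_pr)
  also have "\<dots> = (VCmp T' II X0 X \<cdot> (VAr G X0 X \<odot> VAr G II X0)) \<cdot> pr (VAr J X0 X \<cdot> ?d) f"
    by (rule Cmp_reduce[OF G_comp[OF I X0(1) X]]) (use I X0 X f(1) G2 in simp_all)
  also have "\<dots> = VCmp T' II X0 X \<cdot> pr (VAr G X0 X \<cdot> (VAr J X0 X \<cdot> ?d)) (VAr G II X0 \<cdot> f)"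
    using I X0 X f(1) G0 G1 T'_VCmp(1)[OF One_Obj X0' X'] by simp
  also have "VAr G X0 X \<cdot> (VAr J X0 X \<cdot> ?d) = VAr J' X0 X \<cdot> ?d"
    by (rule Cmp_reduce[OF GJ[OF X0(1) X]]) (use X0 X G1 in simp_all)
  finally have w': "w = VCmp T' II X0 X \<cdot> pr (VAr J' X0 X \<cdot> ?d) (VAr G II X0 \<cdot> f)" .
  note Jd = J'(1)[OF X0' X']
  have "name_of V (TT II) (TT X) b' = eqz II X \<cdot> (VCmp T' II X0 X \<cdot> pr (VAr J' X0 X \<cdot> ?d) (VAr G II X0 \<cdot> f))"
    using w(2) w' by simp
  also have "\<dots> = (VCmp (self_vcat V) (TT II) (TT X0) (TT X) \<cdot> (eqz X0 X \<odot> eqz II X0)) \<cdot> pr (VAr J' X0 X \<cdot> ?d) (VAr G II X0 \<cdot> f)"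
    by (rule Cmp_reduce[OF T'_VCmp(2)[OF One_Obj X0' X']]) (use T'_VCmp(1)[OF One_Obj X0' X'] e Jd X0(2) G0 f(1) in simp_all)
  also have "\<dots> = VCmp (self_vcat V) (TT II) (TT X0) (TT X) \<cdot> pr (eqz X0 X \<cdot> (VAr J' X0 X \<cdot> ?d)) (eqz II X0 \<cdot> (VAr G II X0 \<cdot> f))"
    using e Jd X0(2) G0 f(1) by simp
  also have "eqz X0 X \<cdot> (VAr J' X0 X \<cdot> ?d) = VAr (MFun M) X0 X \<cdot> ?d"
    by (rule Cmp_reduce[OF J'(2)[OF X0' X']]) (use e Jd X0(2) in simp_all)
  also have "\<dots> = name_of V (TT X0) (TT X) (Fm X0 X \<delta>)" by (rule VAr_M_name[OF X0(2)])
  finally have "name_of V (TT II) (TT X) b' = VCmp (self_vcat V) (TT II) (TT X0) (TT X) \<cdot> pr (name_of V (TT X0) (TT X) (Fm X0 X \<delta>)) (eqz II X0 \<cdot> (VAr G II X0 \<cdot> f))" .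
  hence "unname V (TT II) (TT X) (name_of V (TT II) (TT X) b') = unname V (TT II) (TT X) (VCmp (self_vcat V) (TT II) (TT X0) (TT X) \<cdot> pr (name_of V (TT X0) (TT X) (Fm X0 X \<delta>)) (eqz II X0 \<cdot> (VAr G II X0 \<cdot> f)))"
    by simp
  hence "b' = Fm X0 X \<delta> \<cdot> h" using b's e G0 f(1) X0(2) by (simp add: h_def)
  hence "Fm X0 X \<delta> \<cdot> (h \<cdot> et II) = b" using b'(2) h X0(2) by simp
  moreover have "h \<cdot> et II \<in> Hom V II (TT X0)" using h by simp
  ultimately show ?thesis using that[OF X0' X0(2,3)] by blast
qed

end

section \<open>Surjections are preserved by the monad\<close>

locale discrete_base = adjunction_base V \<kappa> \<X> P T J F \<eta> \<epsilon>
  for V :: "('o, 'a) smc" (structure) and \<kappa> :: "'a rel" and \<X> :: "'o set" and P :: "'o set"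
    and T :: "('o, 'o, 'a) vcat" and J :: "('o, 'o, 'a) vfun"
    and F :: "('o, ('o, 'a) alg, 'a) vfun" and \<eta> :: "'o \<Rightarrow> 'a" and \<epsilon> :: "('o, 'a) alg \<Rightarrow> 'a" +
  fixes lam :: "'l rel"
  assumes lam: "regular_cardinal lam"
    and gen_pres: "Z \<in> \<X> \<Longrightarrow> presentable_object \<kappa> lam V Z"
    and P_pres: "X \<in> P \<Longrightarrow> presentable_object \<kappa> lam V X"
    and P_rep: "presentable_object \<kappa> lam V X \<Longrightarrow> \<exists>Y \<in> P. isomorphic V X Y"
    and tensor_pres: "presentable_object \<kappa> lam V X \<Longrightarrow> presentable_object \<kappa> lam V Y \<Longrightarrow> presentable_object \<kappa> lam V (X \<otimes> Y)"
    and gen_directed: "A \<in> Obj V \<Longrightarrow> \<exists>(R :: 'a rel) F \<iota>. directed_poset \<kappa> lam R \<and> is_functor (poset_cat R) V F \<and>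
           (\<forall>j \<in> Field R. FOb F j \<in> \<X>) \<and> is_colimit V (poset_cat R) F A \<iota>"
    and theory_iso: "pretheory_iso V P T J (monad_pretheory_cat V P (adjunction_monad V F (forget V P T) \<eta> \<epsilon>))
          (monad_pretheory_fun V (adjunction_monad V F (forget V P T) \<eta> \<epsilon>))"
    and discrete: "discrete_theory V P T J"
begin

section \<open>Directed colimits over presentable arities\<close>

lemma directed_colimit_exists:
  assumes "directed_poset \<kappa> \<rho> R" "is_functor (poset_cat R) V G"
  obtains Q \<iota> where "is_colimit V (poset_cat R) G Q \<iota>"
proof -
  have "small \<kappa> (Field R)" by (rule directed_posetD(3)[OF assms(1)])
  moreover have "small \<kappa> R"
    by (rule small_mono[OF small_Sigma[OF inacc calculation calculation]]) (auto simp: Field_def)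
  ultimately show ?thesis using cocomplete_small[OF inacc cocomplete _ _ assms(2)] that by auto
qed

lemma presentable_factor:
  assumes "presentable_object \<kappa> lam V X" "directed_poset \<kappa> lam R" "is_functor (poset_cat R) V G"
    "is_colimit V (poset_cat R) G Q \<iota>" "u \<in> Hom V X Q"
  obtains j v where "j \<in> Field R" "v \<in> Hom V X (FOb G j)" "\<iota> j \<cdot> v = u"
proof -
  have "preserves_colimits_of V (Set_cat \<kappa>) (hom_functor V X) (poset_cat R) G"
    using assms unfolding presentable_object_def by blast
  from hom_colimit_factor[OF this assms(4,3,5)] that show ?thesis by auto
qed

lemma presentable_eventually:
  assumes "presentable_object \<kappa> lam V X" "directed_poset \<kappa> lam R" "is_functor (poset_cat R) V G"
    "is_colimit V (poset_cat R) G Q \<iota>" "j \<in> Field R" "u \<in> Hom V X (FOb G j)" "v \<in> Hom V X (FOb G j)" "\<iota> j \<cdot> u = \<iota> j \<cdot> v"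
  obtains k where "(j, k) \<in> R" "FAr G (j, k) \<cdot> u = FAr G (j, k) \<cdot> v"
proof -
  have "preserves_colimits_of V (Set_cat \<kappa>) (hom_functor V X) (poset_cat R) G"
    using assms unfolding presentable_object_def by blast
  from hom_colimit_eventually_eq[OF this assms(4,3,2) lam assms(5-8)] that show ?thesis by blast
qed

lemma eval_pst:
  assumes "X \<in> Obj V" "f \<in> Hom V A B" "y \<in> Hom V Z (ihom V X A)"
  shows "eval_arrow V X B \<cdot> ((pst X f \<cdot> y) \<odot> Idn V X) = f \<cdot> (eval_arrow V X A \<cdot> (y \<odot> Idn V X))"
proof -
  have o: "A \<in> Obj V" "B \<in> Obj V" "Z \<in> Obj V" using Hom_Obj[OF assms(2)] Hom_Obj[OF assms(3)] by auto
  have e: "eval_arrow V X B \<cdot> (pst X f \<odot> Idn V X) = f \<cdot> eval_arrow V X A"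
    using curry_arrow(2)[of "f \<cdot> eval_arrow V X A" "ihom V X A" X B] assms o by (simp add: pst_def)
  have "eval_arrow V X B \<cdot> ((pst X f \<cdot> y) \<odot> Idn V X) = eval_arrow V X B \<cdot> ((pst X f \<odot> Idn V X) \<cdot> (y \<odot> Idn V X))"
    using assms o by simp
  also have "\<dots> = (f \<cdot> eval_arrow V X A) \<cdot> (y \<odot> Idn V X)"
    by (rule Cmp_reduce[OF e]) (use assms o in simp_all)
  finally show ?thesis using assms o by simp
qed

lemma pst_comp:
  assumes "X \<in> Obj V" "f \<in> Hom V A B" "g \<in> Hom V B C"
  shows "pst X (g \<cdot> f) = pst X g \<cdot> pst X f"
proof -
  have o: "A \<in> Obj V" "B \<in> Obj V" "C \<in> Obj V" using Hom_Obj[OF assms(2)] Hom_Obj[OF assms(3)] by auto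
  show ?thesis
  proof (rule pt_ext[of _ "ihom V X A" "ihom V X C"])
    fix u assume u: "u \<in> Hom V II (ihom V X A)"
    show "pst X (g \<cdot> f) \<cdot> u = (pst X g \<cdot> pst X f) \<cdot> u"
      by (rule unname_inject[of _ X C]) (use assms o u in simp_all)
  qed (use assms o in simp_all)
qed

lemma pst_Idn:
  assumes "X \<in> Obj V" "A \<in> Obj V"
  shows "pst X (Idn V A) = Idn V (ihom V X A)"
proof (rule pt_ext[of _ "ihom V X A" "ihom V X A"])
  fix u assume u: "u \<in> Hom V II (ihom V X A)"
  show "pst X (Idn V A) \<cdot> u = Idn V (ihom V X A) \<cdot> u"
    by (rule unname_inject[of _ X A]) (use assms u in simp_all)
qed (use assms in simp_all)

text \<open>The functor [X, -] preserves this colimit. Arrows from \<open>Z\<close> to [X, Q]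
  correspond to arrows from \<open>Z \<otimes> X\<close> to \<open>Q\<close>, and
  \<open>Z \<otimes> X\<close> is presentable for a generator \<open>Z\<close>; so the comparison
  \<open>k\<close> is bijective on arrows from generators and hence invertible. The statement is the
  resulting extension of cocones.\<close>

lemma ihom_colimit:
  assumes X: "presentable_object \<kappa> lam V X" and R: "directed_poset \<kappa> lam R" and G: "is_functor (poset_cat R) V G"
    and Q: "is_colimit V (poset_cat R) G Q c"
    and \<theta>: "\<And>i. i \<in> Field R \<Longrightarrow> \<theta> i \<in> Hom V (ihom V X (FOb G i)) W"
    and \<theta>_nat: "\<And>i j. (i, j) \<in> R \<Longrightarrow> \<theta> j \<cdot> pst X (FAr G (i, j)) = \<theta> i" and W: "W \<in> Obj V"
  obtains \<theta>' where "\<theta>' \<in> Hom V (ihom V X Q) W" "\<And>i. i \<in> Field R \<Longrightarrow> \<theta>' \<cdot> pst X (c i) = \<theta> i"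
proof -
  have XO [simp]: "X \<in> Obj V" using X by (simp add: presentable_object_def)
  have QO [simp]: "Q \<in> Obj V" by (rule colimit_Obj[OF Q])
  note G' = functorD[OF G, simplified]
  have GO [simp]: "FOb G i \<in> Obj V" if "i \<in> Field R" for i using G'(3)[OF that] .
  have GA: "FAr G (i, j) \<in> Hom V (FOb G i) (FOb G j)" if "(i, j) \<in> R" for i j using G'(5)[OF that] by simp
  have RF: "i \<in> Field R" "j \<in> Field R" if "(i, j) \<in> R" for i j using that by (auto intro: FieldI1 FieldI2)
  have c: "c i \<in> Hom V (FOb G i) Q" if "i \<in> Field R" for i using colimit_in[OF Q] that by simp
  have c_nat: "c j \<cdot> FAr G (i, j) = c i" if "(i, j) \<in> R" for i j using colimit_nat[OF Q, of "(i, j)"] that by simp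
  define H where "H = \<lparr>FOb = (\<lambda>i. ihom V X (FOb G i)), FAr = (\<lambda>f. pst X (FAr G f))\<rparr>"
  have H: "is_functor (poset_cat R) V H"
    unfolding is_functor_def
  proof (intro conjI ballI impI)
    fix f assume f: "f \<in> Arr (poset_cat R)"
    show "FAr H f \<in> Hom V (FOb H (Dom (poset_cat R) f)) (FOb H (Cod (poset_cat R) f))"
      using GA[of "fst f" "snd f"] RF[of "fst f" "snd f"] f by (simp add: H_def)
    fix g assume g: "g \<in> Arr (poset_cat R)" "Dom (poset_cat R) g = Cod (poset_cat R) f"
    have "FAr G (g \<cdot>\<^bsub>poset_cat R\<^esub> f) = FAr G g \<cdot> FAr G f" using functorD(6)[OF G f g] .
    moreover have "pst X (FAr G g \<cdot> FAr G f) = pst X (FAr G g) \<cdot> pst X (FAr G f)"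
      using functorD(5)[OF G f] functorD(5)[OF G g(1)] g(2) by (intro pst_comp) auto
    ultimately show "FAr H (g \<cdot>\<^bsub>poset_cat R\<^esub> f) = FAr H g \<cdot> FAr H f" by (simp only: H_def func.select_convs)
  qed (use directed_poset_category[OF R] category_axioms G'(4) in \<open>simp_all add: H_def pst_Idn\<close>)
  obtain K \<kappa>' where K: "is_colimit V (poset_cat R) H K \<kappa>'" using directed_colimit_exists[OF R H] .
  have KO [simp]: "K \<in> Obj V" by (rule colimit_Obj[OF K])
  have k': "\<kappa>' i \<in> Hom V (ihom V X (FOb G i)) K" if "i \<in> Field R" for i using colimit_in[OF K, of i] that by (simp add: H_def)
  have k'_nat: "\<kappa>' j \<cdot> pst X (FAr G (i, j)) = \<kappa>' i" if "(i, j) \<in> R" for i j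
    using colimit_nat[OF K, of "(i, j)"] that by (simp add: H_def)
  have "cocone V (poset_cat R) H (ihom V X Q) (\<lambda>i. pst X (c i))"
    unfolding cocone_def
  proof (intro conjI ballI)
    fix f assume "f \<in> Arr (poset_cat R)"
    then obtain i j where f: "f = (i, j)" "(i, j) \<in> R" by (cases f) simp
    have "pst X (c j \<cdot> FAr G (i, j)) = pst X (c j) \<cdot> pst X (FAr G (i, j))"
      by (rule pst_comp[OF XO GA[OF f(2)] c[OF RF(2)[OF f(2)]]])
    thus "pst X (c (Cod (poset_cat R) f)) \<cdot> FAr H f = pst X (c (Dom (poset_cat R) f))"
      using c_nat[OF f(2)] by (simp add: H_def f)
  qed (use c in \<open>simp_all add: H_def\<close>)
  from colimit_ex[OF K this] obtain k where k: "k \<in> Hom V K (ihom V X Q)" "\<And>i. i \<in> Field R \<Longrightarrow> k \<cdot> \<kappa>' i = pst X (c i)" by auto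
  have "iso_arrow V k"
  proof (rule iso_if_bij_on_gen[OF k(1)])
    fix Z u v assume Z: "Z \<in> \<X>" and u: "u \<in> Hom V Z K" and v: "v \<in> Hom V Z K" and uv: "k \<cdot> u = k \<cdot> v"
    note Zp = gen_pres[OF Z]
    have ZO [simp]: "Z \<in> Obj V" using Zp by (simp add: presentable_object_def)
    obtain i u1 where i: "i \<in> Field R" "u1 \<in> Hom V Z (ihom V X (FOb G i))" "\<kappa>' i \<cdot> u1 = u"
      using presentable_factor[OF Zp R H K u] by (auto simp: H_def)
    obtain j v1 where j: "j \<in> Field R" "v1 \<in> Hom V Z (ihom V X (FOb G j))" "\<kappa>' j \<cdot> v1 = v"
      using presentable_factor[OF Zp R H K v] by (auto simp: H_def)
    obtain l where l: "l \<in> Field R" "(i, l) \<in> R" "(j, l) \<in> R" using directed_poset_bound[OF R lam i(1) j(1)] .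
    define u2 v2 where "u2 = pst X (FAr G (i, l)) \<cdot> u1" and "v2 = pst X (FAr G (j, l)) \<cdot> v1"
    have u2: "u2 \<in> Hom V Z (ihom V X (FOb G l))" "\<kappa>' l \<cdot> u2 = u"
      and v2: "v2 \<in> Hom V Z (ihom V X (FOb G l))" "\<kappa>' l \<cdot> v2 = v"
    proof -
      show "u2 \<in> Hom V Z (ihom V X (FOb G l))" "v2 \<in> Hom V Z (ihom V X (FOb G l))"
        using i j GA[OF l(2)] GA[OF l(3)] by (simp_all add: u2_def v2_def)
      have "\<kappa>' l \<cdot> u2 = \<kappa>' i \<cdot> u1" unfolding u2_def
        by (rule Cmp_reduce[OF k'_nat[OF l(2)]]) (use i k'[OF l(1)] GA[OF l(2)] in simp_all)
      thus "\<kappa>' l \<cdot> u2 = u" using i by simp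
      have "\<kappa>' l \<cdot> v2 = \<kappa>' j \<cdot> v1" unfolding v2_def
        by (rule Cmp_reduce[OF k'_nat[OF l(3)]]) (use j k'[OF l(1)] GA[OF l(3)] in simp_all)
      thus "\<kappa>' l \<cdot> v2 = v" using j by simp
    qed
    have "pst X (c l) \<cdot> u2 = k \<cdot> (\<kappa>' l \<cdot> u2)" "pst X (c l) \<cdot> v2 = k \<cdot> (\<kappa>' l \<cdot> v2)"
      by (rule Cmp_reduce[OF k(2)[OF l(1)], symmetric]; use k(1) k'[OF l(1)] u2(1) v2(1) in simp)+
    hence "pst X (c l) \<cdot> u2 = pst X (c l) \<cdot> v2" using uv u2(2) v2(2) by simp
    hence ev: "c l \<cdot> (eval_arrow V X (FOb G l) \<cdot> (u2 \<odot> Idn V X)) = c l \<cdot> (eval_arrow V X (FOb G l) \<cdot> (v2 \<odot> Idn V X))"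
      using eval_pst[OF XO c[OF l(1)] u2(1)] eval_pst[OF XO c[OF l(1)] v2(1)] by simp
    have e2: "eval_arrow V X (FOb G l) \<cdot> (u2 \<odot> Idn V X) \<in> Hom V (Z \<otimes> X) (FOb G l)"
      "eval_arrow V X (FOb G l) \<cdot> (v2 \<odot> Idn V X) \<in> Hom V (Z \<otimes> X) (FOb G l)"
      using u2(1) v2(1) l(1) by simp_all
    obtain m where m: "(l, m) \<in> R" "FAr G (l, m) \<cdot> (eval_arrow V X (FOb G l) \<cdot> (u2 \<odot> Idn V X)) = FAr G (l, m) \<cdot> (eval_arrow V X (FOb G l) \<cdot> (v2 \<odot> Idn V X))"
      using presentable_eventually[OF tensor_pres[OF Zp X] R G Q l(1) e2 ev] .
    have mF: "m \<in> Field R" using RF[OF m(1)] by simp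
    have "pst X (FAr G (l, m)) \<cdot> u2 = pst X (FAr G (l, m)) \<cdot> v2"
    proof (rule ihom_cancel[of _ Z X "FOb G m"])
      show "eval_arrow V X (FOb G m) \<cdot> ((pst X (FAr G (l, m)) \<cdot> u2) \<odot> Idn V X) = eval_arrow V X (FOb G m) \<cdot> ((pst X (FAr G (l, m)) \<cdot> v2) \<odot> Idn V X)"
        using eval_pst[OF XO GA[OF m(1)] u2(1)] eval_pst[OF XO GA[OF m(1)] v2(1)] m(2) by simp
    qed (use u2(1) v2(1) GA[OF m(1)] mF in simp_all)
    moreover have "\<kappa>' m \<cdot> (pst X (FAr G (l, m)) \<cdot> u2) = \<kappa>' l \<cdot> u2" "\<kappa>' m \<cdot> (pst X (FAr G (l, m)) \<cdot> v2) = \<kappa>' l \<cdot> v2"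
      by (rule Cmp_reduce[OF k'_nat[OF m(1)]]; use k'[OF mF] GA[OF m(1)] u2(1) v2(1) in simp)+
    ultimately show "u = v" using u2(2) v2(2) by simp
  next
    fix Z v assume Z: "Z \<in> \<X>" and v: "v \<in> Hom V Z (ihom V X Q)"
    note Zp = gen_pres[OF Z]
    have ZO [simp]: "Z \<in> Obj V" using Zp by (simp add: presentable_object_def)
    have "eval_arrow V X Q \<cdot> (v \<odot> Idn V X) \<in> Hom V (Z \<otimes> X) Q" using v by simp
    from presentable_factor[OF tensor_pres[OF Zp X] R G Q this]
    obtain i w where i: "i \<in> Field R" "w \<in> Hom V (Z \<otimes> X) (FOb G i)" "c i \<cdot> w = eval_arrow V X Q \<cdot> (v \<odot> Idn V X)" .
    define y where "y = curry_arrow V Z X (FOb G i) w"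
    have y: "y \<in> Hom V Z (ihom V X (FOb G i))" "eval_arrow V X (FOb G i) \<cdot> (y \<odot> Idn V X) = w"
      unfolding y_def using curry_arrow[OF i(2)] by simp_all
    have "pst X (c i) \<cdot> y = v"
    proof (rule ihom_cancel[of _ Z X Q])
      show "eval_arrow V X Q \<cdot> ((pst X (c i) \<cdot> y) \<odot> Idn V X) = eval_arrow V X Q \<cdot> (v \<odot> Idn V X)"
        using eval_pst[OF XO c[OF i(1)] y(1)] y(2) i(3) by simp
    qed (use y v c[OF i(1)] in simp_all)
    moreover have "k \<cdot> (\<kappa>' i \<cdot> y) = pst X (c i) \<cdot> y"
      by (rule Cmp_reduce[OF k(2)[OF i(1)]]) (use k(1) k'[OF i(1)] y(1) in simp_all)
    moreover have "\<kappa>' i \<cdot> y \<in> Hom V Z K" using k'[OF i(1)] y(1) by simp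
    ultimately show "\<exists>u \<in> Hom V Z K. k \<cdot> u = v" by (metis)
  qed
  note inv = inverse_of_simps[OF this]
  have "cocone V (poset_cat R) H W \<theta>"
    unfolding cocone_def using \<theta> \<theta>_nat W by (auto simp: H_def)
  from colimit_ex[OF K this] obtain s where s: "s \<in> Hom V K W" "\<And>i. i \<in> Field R \<Longrightarrow> s \<cdot> \<kappa>' i = \<theta> i" by auto
  show ?thesis
  proof (rule that[of "s \<cdot> inverse_of V k"])
    show "s \<cdot> inverse_of V k \<in> Hom V (ihom V X Q) W" using s(1) inv k(1) by simp
    fix i assume i: "i \<in> Field R"
    have "(s \<cdot> inverse_of V k) \<cdot> pst X (c i) = s \<cdot> (inverse_of V k \<cdot> (k \<cdot> \<kappa>' i))"
      using s(1) inv k c[OF i] i by simp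
    also have "inverse_of V k \<cdot> (k \<cdot> \<kappa>' i) = Idn V (Dom V k) \<cdot> \<kappa>' i"
      by (rule Cmp_reduce[OF inv(5)]) (use inv k(1) k'[OF i] in simp_all)
    finally show "(s \<cdot> inverse_of V k) \<cdot> pst X (c i) = \<theta> i" using k(1) k'[OF i] s(2)[OF i] by simp
  qed
qed

text \<open>The arities in \<open>P\<close> are presentable: an element of \<open>Q\<close> comes
  from a stage, and two representatives of it become equal at a later one. Operations can therefore
  be computed at a stage. That arrows of \<open>V\<close> represent them needs [X, -] to preserve
  the colimit, through \<open>ihom_colimit\<close>.\<close>

lemma colimit_of_algebras:
  assumes R: "directed_poset \<kappa> lam R" and G: "is_functor (poset_cat R) V G"
    and Q: "is_colimit V (poset_cat R) G Q c"
    and E: "\<And>i. i \<in> Field R \<Longrightarrow> alg (E i)" "\<And>i. i \<in> Field R \<Longrightarrow> FOb G i = fst (E i)"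
    and E_hom: "\<And>i j. (i, j) \<in> R \<Longrightarrow> ahom (E i) (E j) (FAr G (i, j))"
  obtains H where "alg (Q, H)" "\<And>i. i \<in> Field R \<Longrightarrow> ahom (E i) (Q, H) (c i)"
proof -
  have QO [simp]: "Q \<in> Obj V" by (rule colimit_Obj[OF Q])
  have EO [simp]: "fst (E i) \<in> Obj V" if "i \<in> Field R" for i using E(1)[OF that] by simp
  have GA: "FAr G (i, j) \<in> Hom V (fst (E i)) (fst (E j))" if "(i, j) \<in> R" for i j using ahom_Hom[OF E_hom[OF that]] .
  have RF: "i \<in> Field R" "j \<in> Field R" if "(i, j) \<in> R" for i j using that by (auto intro: FieldI1 FieldI2)
  have c: "c i \<in> Hom V (fst (E i)) Q" if "i \<in> Field R" for i using colimit_in[OF Q, of i] that E(2)[OF that] by simp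
  have c_nat: "c j \<cdot> FAr G (i, j) = c i" if "(i, j) \<in> R" for i j using colimit_nat[OF Q, of "(i, j)"] that by simp
  have factor: "\<exists>i a'. i \<in> Field R \<and> a' \<in> Hom V X (fst (E i)) \<and> c i \<cdot> a' = a" if X: "X \<in> P" and a: "a \<in> Hom V X Q" for X a
  proof -
    obtain j v where "j \<in> Field R" "v \<in> Hom V X (FOb G j)" "c j \<cdot> v = a"
      by (rule presentable_factor[OF P_pres[OF X] R G Q a])
    thus ?thesis using E(2) by metis
  qed
  have move: "c j \<cdot> ap (E j) X Y t (FAr G (i, j) \<cdot> a) = c i \<cdot> ap (E i) X Y t a"
    if ij: "(i, j) \<in> R" and X: "X \<in> P" and Y: "Y \<in> P" and t: "t \<in> Hom V II (VHom T Y X)" and a: "a \<in> Hom V X (fst (E i))" for i j X Y t a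
  proof -
    note F = RF[OF ij]
    have "c j \<cdot> ap (E j) X Y t (FAr G (i, j) \<cdot> a) = c j \<cdot> (FAr G (i, j) \<cdot> ap (E i) X Y t a)"
      using ahom_ap[OF E_hom[OF ij] X Y t a] by simp
    also have "\<dots> = c i \<cdot> ap (E i) X Y t a"
      by (rule Cmp_reduce[OF c_nat[OF ij]]) (use GA[OF ij] c[OF F(2)] X Y t a E(1)[OF F(1)] in simp_all)
    finally show ?thesis .
  qed
  have move_c: "c j \<cdot> (FAr G (i, j) \<cdot> a) = c i \<cdot> a" if ij: "(i, j) \<in> R" and a: "a \<in> Hom V X (fst (E i))" for i j X a
    by (rule Cmp_reduce[OF c_nat[OF ij]]) (use GA[OF ij] c[OF RF(2)[OF ij]] a in simp_all)
  have unamb: "c i \<cdot> ap (E i) X Y t a = c j \<cdot> ap (E j) X Y t b"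
    if i: "i \<in> Field R" and j: "j \<in> Field R" and X: "X \<in> P" and Y: "Y \<in> P" and t: "t \<in> Hom V II (VHom T Y X)"
      and a: "a \<in> Hom V X (fst (E i))" and b: "b \<in> Hom V X (fst (E j))" and ab: "c i \<cdot> a = c j \<cdot> b" for i j X Y t a b
  proof -
    obtain l where l: "l \<in> Field R" "(i, l) \<in> R" "(j, l) \<in> R" using directed_poset_bound[OF R lam i j] .
    define a' b' where "a' = FAr G (i, l) \<cdot> a" and "b' = FAr G (j, l) \<cdot> b"
    have a': "a' \<in> Hom V X (fst (E l))" and b': "b' \<in> Hom V X (fst (E l))"
      using a b GA[OF l(2)] GA[OF l(3)] by (simp_all add: a'_def b'_def)
    have a'F: "a' \<in> Hom V X (FOb G l)" and b'F: "b' \<in> Hom V X (FOb G l)" using a' b' E(2)[OF l(1)] by simp_all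
    have "c l \<cdot> a' = c l \<cdot> b'" unfolding a'_def b'_def move_c[OF l(2) a] move_c[OF l(3) b] by (rule ab)
    from presentable_eventually[OF P_pres[OF X] R G Q l(1) a'F b'F this]
    obtain m where m: "(l, m) \<in> R" "FAr G (l, m) \<cdot> a' = FAr G (l, m) \<cdot> b'" .
    have "c i \<cdot> ap (E i) X Y t a = c l \<cdot> ap (E l) X Y t a'" unfolding a'_def move[OF l(2) X Y t a] ..
    also have "\<dots> = c m \<cdot> ap (E m) X Y t (FAr G (l, m) \<cdot> a')" unfolding move[OF m(1) X Y t a'] ..
    also have "\<dots> = c l \<cdot> ap (E l) X Y t b'" unfolding m(2) move[OF m(1) X Y t b'] ..
    also have "\<dots> = c j \<cdot> ap (E j) X Y t b" unfolding b'_def move[OF l(3) X Y t b] ..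
    finally show ?thesis .
  qed
  \<comment> \<open>An arbitrary stage and representative; \<open>unamb\<close> makes the value of
    \<open>op\<close> independent of the choice.\<close>
  define sel where "sel X a = (SOME x. fst x \<in> Field R \<and> snd x \<in> Hom V X (fst (E (fst x))) \<and> c (fst x) \<cdot> snd x = a)" for X a
  have sel: "fst (sel X a) \<in> Field R \<and> snd (sel X a) \<in> Hom V X (fst (E (fst (sel X a)))) \<and> c (fst (sel X a)) \<cdot> snd (sel X a) = a"
    if "X \<in> P" "a \<in> Hom V X Q" for X a
  proof -
    have "\<exists>x. fst x \<in> Field R \<and> snd x \<in> Hom V X (fst (E (fst x))) \<and> c (fst x) \<cdot> snd x = a"
      using factor[OF that] by (metis fst_conv snd_conv)
    from someI_ex[OF this] show ?thesis unfolding sel_def .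
  qed
  define op where "op X Y t a = c (fst (sel X a)) \<cdot> ap (E (fst (sel X a))) X Y t (snd (sel X a))" for X Y t a
  have op: "op X Y t (c i \<cdot> a) = c i \<cdot> ap (E i) X Y t a"
    if i: "i \<in> Field R" and X: "X \<in> P" and Y: "Y \<in> P" and t: "t \<in> Hom V II (VHom T Y X)" and a: "a \<in> Hom V X (fst (E i))" for i X Y t a
  proof -
    have ca: "c i \<cdot> a \<in> Hom V X Q" using c[OF i] a by simp
    note s = sel[OF X ca]
    show ?thesis unfolding op_def by (rule unamb) (use s i X Y t a in blast)+
  qed
  have beta: "\<exists>\<beta>. \<beta> \<in> Hom V ((VHom T Y X \<otimes> ihom V X Q) \<otimes> Y) Q \<and>
      (\<forall>t \<in> Hom V II (VHom T Y X). \<forall>a \<in> Hom V X Q. \<forall>y \<in> Hom V II Y. \<beta> \<cdot> pr (pr t (name_of V X Q a)) y = op X Y t a \<cdot> y)"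
    if X: "X \<in> P" and Y: "Y \<in> P" for X Y
  proof -
    have o [simp]: "X \<in> Obj V" "Y \<in> Obj V" "VHom T Y X \<in> Obj V" using X Y by simp_all
    let ?S = "VHom T Y X" and ?H = "\<lambda>i. ihom V X (fst (E i))" and ?K = "ihom V X Q"
    \<comment> \<open>The factor that varies with \<open>i\<close> is \<open>?H i\<close>. The
      symmetry puts it in front, so that currying the other two factors away leaves an arrow out of
      \<open>?H i\<close> alone, which can be glued by \<open>ihom_colimit\<close>.\<close>
    define w where "w i = c i \<cdot> (ap_arrow (E i) X Y \<cdot> (symm V (?H i) ?S \<odot> Idn V Y))" for i
    have w: "w i \<in> Hom V ((?H i \<otimes> ?S) \<otimes> Y) Q" if "i \<in> Field R" for i
      unfolding w_def using c[OF that] E(1)[OF that] X Y that by simp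
    define \<theta> where "\<theta> i = curry_arrow V (?H i) ?S (ihom V Y Q) (curry_arrow V (?H i \<otimes> ?S) Y Q (w i))" for i
    have \<theta>: "\<theta> i \<in> Hom V (?H i) (ihom V ?S (ihom V Y Q))" if "i \<in> Field R" for i
      unfolding \<theta>_def using w[OF that] that by simp
    have \<theta>_pt: "unname V Y Q (unname V ?S (ihom V Y Q) (\<theta> i \<cdot> name_of V X (fst (E i)) a) \<cdot> t) \<cdot> y = c i \<cdot> (ap (E i) X Y t a \<cdot> y)"
      if i: "i \<in> Field R" and a: "a \<in> Hom V X (fst (E i))" and t: "t \<in> Hom V II ?S" and y: "y \<in> Hom V II Y" for i a t y
    proof -
      have na: "name_of V X (fst (E i)) a \<in> Hom V II (?H i)" using a by simp
      have "unname V Y Q (unname V ?S (ihom V Y Q) (\<theta> i \<cdot> name_of V X (fst (E i)) a) \<cdot> t) \<cdot> y = w i \<cdot> pr (pr (name_of V X (fst (E i)) a) t) y"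
        unfolding \<theta>_def using w[OF i] i na t y by simp
      also have "\<dots> = c i \<cdot> (ap_arrow (E i) X Y \<cdot> pr (pr t (name_of V X (fst (E i)) a)) y)"
        unfolding w_def using c[OF i] E(1)[OF i] X Y i na t y symm_pr[OF na t] by simp
      finally show ?thesis using ap_arrow_pr[OF E(1)[OF i] X Y t a y] by simp
    qed
    have \<theta>_nat: "\<theta> j \<cdot> pst X (FAr G (i, j)) = \<theta> i" if ij: "(i, j) \<in> R" for i j
    proof -
      note F = RF[OF ij]
      show ?thesis
      proof (rule pt_ext[of _ "?H i" "ihom V ?S (ihom V Y Q)"])
        fix u assume u: "u \<in> Hom V II (?H i)"
        define a where "a = unname V X (fst (E i)) u"
        have a: "a \<in> Hom V X (fst (E i))" and u': "u = name_of V X (fst (E i)) a" using u F by (simp_all add: a_def)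
        have b: "FAr G (i, j) \<cdot> a \<in> Hom V X (fst (E j))" using a GA[OF ij] by simp
        have p: "pst X (FAr G (i, j)) \<cdot> u = name_of V X (fst (E j)) (FAr G (i, j) \<cdot> a)"
          by (rule unname_inject[of _ X "fst (E j)"]) (use u a b GA[OF ij] F in \<open>simp_all add: u'\<close>)
        have "\<theta> j \<cdot> name_of V X (fst (E j)) (FAr G (i, j) \<cdot> a) = \<theta> i \<cdot> name_of V X (fst (E i)) a"
        proof (rule ihom_pt_ext[of _ ?S "ihom V Y Q"])
          fix t assume t: "t \<in> Hom V II ?S"
          show "unname V ?S (ihom V Y Q) (\<theta> j \<cdot> name_of V X (fst (E j)) (FAr G (i, j) \<cdot> a)) \<cdot> t
            = unname V ?S (ihom V Y Q) (\<theta> i \<cdot> name_of V X (fst (E i)) a) \<cdot> t"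
          proof (rule ihom_pt_ext[of _ Y Q])
            fix y assume y: "y \<in> Hom V II Y"
            have "c j \<cdot> (ap (E j) X Y t (FAr G (i, j) \<cdot> a) \<cdot> y) = (c j \<cdot> ap (E j) X Y t (FAr G (i, j) \<cdot> a)) \<cdot> y"
              using c[OF F(2)] E(1)[OF F(2)] X Y t b y by simp
            also have "\<dots> = c i \<cdot> (ap (E i) X Y t a \<cdot> y)"
              unfolding move[OF ij X Y t a] using c[OF F(1)] E(1)[OF F(1)] X Y t a y by simp
            finally show "unname V Y Q (unname V ?S (ihom V Y Q) (\<theta> j \<cdot> name_of V X (fst (E j)) (FAr G (i, j) \<cdot> a)) \<cdot> t) \<cdot> y
              = unname V Y Q (unname V ?S (ihom V Y Q) (\<theta> i \<cdot> name_of V X (fst (E i)) a) \<cdot> t) \<cdot> y"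
              unfolding \<theta>_pt[OF F(1) a t y] \<theta>_pt[OF F(2) b t y] .
          qed (use \<theta>[OF F(1)] \<theta>[OF F(2)] a b t in simp_all)
        qed (use \<theta>[OF F(1)] \<theta>[OF F(2)] a b in simp_all)
        moreover have "(\<theta> j \<cdot> pst X (FAr G (i, j))) \<cdot> u = \<theta> j \<cdot> (pst X (FAr G (i, j)) \<cdot> u)"
          using \<theta>[OF F(2)] GA[OF ij] u by simp
        ultimately show "(\<theta> j \<cdot> pst X (FAr G (i, j))) \<cdot> u = \<theta> i \<cdot> u" unfolding p by (simp add: u')
      qed (use \<theta>[OF F(1)] \<theta>[OF F(2)] GA[OF ij] in simp_all)
    qed
    obtain \<theta>' where th: "\<theta>' \<in> Hom V ?K (ihom V ?S (ihom V Y Q))" "\<And>i. i \<in> Field R \<Longrightarrow> \<theta>' \<cdot> pst X (c i) = \<theta> i"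
    proof (rule ihom_colimit[OF P_pres[OF X] R G Q, of \<theta> "ihom V ?S (ihom V Y Q)"])
      show "\<theta> i \<in> Hom V (ihom V X (FOb G i)) (ihom V ?S (ihom V Y Q))" if "i \<in> Field R" for i
        using \<theta>[OF that] E(2)[OF that] by simp
      show "\<theta> j \<cdot> pst X (FAr G (i, j)) = \<theta> i" if "(i, j) \<in> R" for i j by (rule \<theta>_nat[OF that])
    qed simp_all
    \<comment> \<open>The glued arrow is uncurried twice and the symmetry is undone.\<close>
    define \<beta> where "\<beta> = eval_arrow V Y Q \<cdot> ((eval_arrow V ?S (ihom V Y Q) \<cdot> ((\<theta>' \<odot> Idn V ?S) \<cdot> symm V ?S ?K)) \<odot> Idn V Y)"
    have \<beta>: "\<beta> \<in> Hom V ((?S \<otimes> ?K) \<otimes> Y) Q" unfolding \<beta>_def using th(1) by simp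
    moreover have "\<beta> \<cdot> pr (pr t (name_of V X Q a)) y = op X Y t a \<cdot> y"
      if t: "t \<in> Hom V II ?S" and a: "a \<in> Hom V X Q" and y: "y \<in> Hom V II Y" for t a y
    proof -
      obtain i a' where i: "i \<in> Field R" "a' \<in> Hom V X (fst (E i))" "c i \<cdot> a' = a" using factor[OF X a] by blast
      have na: "name_of V X Q a \<in> Hom V II ?K" using a by simp
      have p: "pst X (c i) \<cdot> name_of V X (fst (E i)) a' = name_of V X Q a"
        by (rule unname_inject[of _ X Q]) (use a i(1,2) c[OF i(1)] in \<open>simp_all add: i(3)\<close>)
      have "\<beta> \<cdot> pr (pr t (name_of V X Q a)) y = unname V Y Q (unname V ?S (ihom V Y Q) (\<theta>' \<cdot> name_of V X Q a) \<cdot> t) \<cdot> y"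
        unfolding \<beta>_def using th(1) na t y symm_pr[OF t na] by simp
      also have "\<theta>' \<cdot> name_of V X Q a = \<theta> i \<cdot> name_of V X (fst (E i)) a'"
        unfolding p[symmetric] by (rule Cmp_reduce[OF th(2)[OF i(1)]]) (use th(1) c[OF i(1)] i in simp_all)
      also have "unname V Y Q (unname V ?S (ihom V Y Q) (\<theta> i \<cdot> name_of V X (fst (E i)) a') \<cdot> t) \<cdot> y = c i \<cdot> (ap (E i) X Y t a' \<cdot> y)"
        by (rule \<theta>_pt[OF i(1,2) t y])
      also have "\<dots> = op X Y t (c i \<cdot> a') \<cdot> y"
        unfolding op[OF i(1) X Y t i(2)] using c[OF i(1)] E(1)[OF i(1)] X Y t i(2) y by simp
      finally show ?thesis unfolding i(3) .
    qed
    ultimately show ?thesis by blast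
  qed
  then obtain \<beta> where \<beta>: "\<And>X Y. X \<in> P \<Longrightarrow> Y \<in> P \<Longrightarrow> \<beta> X Y \<in> Hom V ((VHom T Y X \<otimes> ihom V X Q) \<otimes> Y) Q"
    "\<And>X Y t a y. X \<in> P \<Longrightarrow> Y \<in> P \<Longrightarrow> t \<in> Hom V II (VHom T Y X) \<Longrightarrow> a \<in> Hom V X Q \<Longrightarrow> y \<in> Hom V II Y \<Longrightarrow>
      \<beta> X Y \<cdot> pr (pr t (name_of V X Q a)) y = op X Y t a \<cdot> y"
    by metis
  have opH: "op X Y t a \<in> Hom V Y Q" if XY: "X \<in> P" "Y \<in> P" and t: "t \<in> Hom V II (VHom T Y X)" and a: "a \<in> Hom V X Q" for X Y t a
  proof -
    obtain i a' where i: "i \<in> Field R" "a' \<in> Hom V X (fst (E i))" "c i \<cdot> a' = a" using factor[OF XY(1) a] by blast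
    show ?thesis using op[OF i(1) XY t i(2)] i(3) c[OF i(1)] E(1)[OF i(1)] XY t i(2) by simp
  qed
  obtain H where H: "alg (Q, H)"
    "\<And>X Y t a. X \<in> P \<Longrightarrow> Y \<in> P \<Longrightarrow> t \<in> Hom V II (VHom T Y X) \<Longrightarrow> a \<in> Hom V X Q \<Longrightarrow> ap (Q, H) X Y t a = op X Y t a"
  proof (rule mk_algebra[OF QO \<beta>(1) opH \<beta>(2)])
    fix X a assume X: "X \<in> P" and a: "a \<in> Hom V X Q"
    obtain i a' where i: "i \<in> Field R" "a' \<in> Hom V X (fst (E i))" "c i \<cdot> a' = a" using factor[OF X a] by blast
    have t: "VIdn T X \<in> Hom V II (VHom T X X)" using X by simp
    show "op X X (VIdn T X) a = a" using op[OF i(1) X X t i(2)] ap_unit[OF E(1)[OF i(1)] X i(2)] i(3) by simp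
  next
    fix X Y Z t s a assume P: "X \<in> P" "Y \<in> P" "Z \<in> P" and t: "t \<in> Hom V II (VHom T Y X)" and s: "s \<in> Hom V II (VHom T Z Y)" and a: "a \<in> Hom V X Q"
    obtain i a' where i: "i \<in> Field R" "a' \<in> Hom V X (fst (E i))" "c i \<cdot> a' = a" using factor[OF P(1) a] by blast
    have ts: "VCmp T Z Y X \<cdot> pr t s \<in> Hom V II (VHom T Z X)" using P t s by simp
    have b: "ap (E i) X Y t a' \<in> Hom V Y (fst (E i))" using P t i E(1) by simp
    show "op X Z (VCmp T Z Y X \<cdot> pr t s) a = op Y Z s (op X Y t a)"
      using op[OF i(1) P(1,3) ts i(2)] op[OF i(1) P(1,2) t i(2)] op[OF i(1) P(2,3) s b]
        ap_comp[OF E(1)[OF i(1)] P t s i(2)] i(3) by simp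
  next
    fix X Y x a assume P: "X \<in> P" "Y \<in> P" and x: "x \<in> Hom V Y X" and a: "a \<in> Hom V X Q"
    obtain i a' where i: "i \<in> Field R" "a' \<in> Hom V X (fst (E i))" "c i \<cdot> a' = a" using factor[OF P(1) a] by blast
    have t: "VAr J Y X \<cdot> name_of V Y X x \<in> Hom V II (VHom T Y X)" using P x by simp
    have "op X Y (VAr J Y X \<cdot> name_of V Y X x) (c i \<cdot> a') = c i \<cdot> (a' \<cdot> x)"
      using op[OF i(1) P t i(2)] ap_J[OF E(1)[OF i(1)] P x i(2)] by simp
    also have "\<dots> = (c i \<cdot> a') \<cdot> x" using c[OF i(1)] i(2) x by simp
    finally show "op X Y (VAr J Y X \<cdot> name_of V Y X x) a = a \<cdot> x" unfolding i(3) .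
  next
    fix H assume H: "alg (Q, H)"
      "\<And>X Y t a. X \<in> P \<Longrightarrow> Y \<in> P \<Longrightarrow> t \<in> Hom V II (VHom T Y X) \<Longrightarrow> a \<in> Hom V X Q \<Longrightarrow> ap (Q, H) X Y t a = op X Y t a"
    show thesis by (rule that[OF H(1)]) (rule H(2))
  qed
  show ?thesis
  proof (rule that[OF H(1)])
    fix i assume i: "i \<in> Field R"
    show "ahom (E i) (Q, H) (c i)"
      unfolding ahom_def
    proof (intro conjI ballI)
      show "c i \<in> Hom V (fst (E i)) (fst (Q, H))" using c[OF i] by simp
      fix X Y t a assume *: "X \<in> P" "Y \<in> P" "t \<in> Hom V II (VHom T Y X)" "a \<in> Hom V X (fst (E i))"
      have "c i \<cdot> a \<in> Hom V X Q" using * c[OF i] by simp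
      from H(2)[OF *(1-3) this] show "c i \<cdot> ap (E i) X Y t a = ap (Q, H) X Y t (c i \<cdot> a)"
        unfolding op[OF i *] by simp
    qed
  qed
qed

text \<open>The colimit of the free algebras on the presentable pieces \<open>Z\<^sub>i\<close> of \<open>B\<close> receives a homomorphism from
  the free algebra on \<open>B\<close>, and this is a section of the comparison map; hence points of the latter come from some \<open>Z\<^sub>i\<close>.\<close>

lemma point_factor:
  assumes B: "B \<in> Obj V" and b: "b \<in> Hom V II (TT B)"
  obtains Z z x where "Z \<in> \<X>" "z \<in> Hom V Z B" "x \<in> Hom V II (TT Z)" "Fm Z B z \<cdot> x = b"
proof -
  obtain R :: "'a rel" and G z where R: "directed_poset \<kappa> lam R" and G: "is_functor (poset_cat R) V G"
    and GX: "\<And>j. j \<in> Field R \<Longrightarrow> FOb G j \<in> \<X>" and col: "is_colimit V (poset_cat R) G B z" using gen_directed[OF B] by metis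
  note G' = functorD[OF G, simplified]
  have GO [simp]: "FOb G i \<in> Obj V" if "i \<in> Field R" for i using G'(3)[OF that] .
  have GA: "FAr G (i, j) \<in> Hom V (FOb G i) (FOb G j)" if "(i, j) \<in> R" for i j using G'(5)[OF that] by simp
  have RF: "i \<in> Field R" "j \<in> Field R" if "(i, j) \<in> R" for i j using that by (auto intro: FieldI1 FieldI2)
  have z: "z i \<in> Hom V (FOb G i) B" if "i \<in> Field R" for i using colimit_in[OF col] that by simp
  have z_nat: "z j \<cdot> FAr G (i, j) = z i" if "(i, j) \<in> R" for i j using colimit_nat[OF col, of "(i, j)"] that by simp
  define H where "H = \<lparr>FOb = (\<lambda>i. TT (FOb G i)), FAr = (\<lambda>f. Fm (FOb G (fst f)) (FOb G (snd f)) (FAr G f))\<rparr>"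
  have Fm_Idn: "Fm X X (Idn V X) = Idn V (TT X)" if X: "X \<in> Obj V" for X
  proof (rule free_unique[OF Fo_alg[OF X] X])
    show "ahom (Fo X) (Fo X) (Fm X X (Idn V X))" by (rule Fm_ahom) (use X in simp)
    show "ahom (Fo X) (Fo X) (Idn V (TT X))" by (rule ahom_Idn) (use X in simp)
    show "Fm X X (Idn V X) \<cdot> et X = Idn V (TT X) \<cdot> et X" using et_natural[of "Idn V X" X X] X by simp
  qed
  have H: "is_functor (poset_cat R) V H"
    unfolding is_functor_def
  proof (intro conjI ballI impI)
    fix f assume f: "f \<in> Arr (poset_cat R)"
    hence f': "f = (fst f, snd f)" "(fst f, snd f) \<in> R" by simp_all
    show "FAr H f \<in> Hom V (FOb H (Dom (poset_cat R) f)) (FOb H (Cod (poset_cat R) f))"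
      using GA[OF f'(2)] by (simp add: H_def)
    fix g assume g: "g \<in> Arr (poset_cat R)" "Dom (poset_cat R) g = Cod (poset_cat R) f"
    hence g': "(snd f, snd g) \<in> R" "g = (snd f, snd g)" by (cases g; simp)+
    have Gg: "FAr G g \<in> Hom V (FOb G (snd f)) (FOb G (snd g))" using GA[OF g'(1)] g'(2) by simp
    have Gf: "FAr G f \<in> Hom V (FOb G (fst f)) (FOb G (snd f))" using GA[OF f'(2)] by simp
    have "FAr G (fst f, snd g) = FAr G g \<cdot> FAr G f" using functorD(6)[OF G f g] by simp
    thus "FAr H (g \<cdot>\<^bsub>poset_cat R\<^esub> f) = FAr H g \<cdot> FAr H f"
      using Fm_comp[OF Gf Gg] g(2) by (simp add: H_def)
  qed (use directed_poset_category[OF R] category_axioms G'(4) Fm_Idn in \<open>simp_all add: H_def\<close>)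
  obtain C c where C: "is_colimit V (poset_cat R) H C c" using directed_colimit_exists[OF R H] .
  obtain \<CC> where CC: "alg \<CC>" "fst \<CC> = C" "\<And>i. i \<in> Field R \<Longrightarrow> ahom (Fo (FOb G i)) \<CC> (c i)"
  proof -
    obtain K where "alg (C, K)" "\<And>i. i \<in> Field R \<Longrightarrow> ahom (Fo (FOb G i)) (C, K) (c i)"
    proof (rule colimit_of_algebras[OF R H C, of "\<lambda>i. Fo (FOb G i)"])
      show "ahom (Fo (FOb G i)) (Fo (FOb G j)) (FAr H (i, j))" if "(i, j) \<in> R" for i j
        using Fm_ahom[OF GA[OF that]] by (simp add: H_def)
    qed (simp_all add: H_def)
    thus ?thesis using that[of "(C, K)"] by simp
  qed
  note cs = ahom_simps[OF CC(3)]
  have "cocone V (poset_cat R) G C (\<lambda>i. c i \<cdot> et (FOb G i))"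
    unfolding cocone_def
  proof (intro conjI ballI)
    show "C \<in> Obj V" by (rule colimit_Obj[OF C])
    show "c j \<cdot> et (FOb G j) \<in> Hom V (FOb G j) C" if "j \<in> Obj (poset_cat R)" for j using cs that CC(2) by simp
    fix f assume "f \<in> Arr (poset_cat R)"
    then obtain i j where f: "f = (i, j)" "(i, j) \<in> R" by (cases f) simp
    note F = RF[OF f(2)] and g = GA[OF f(2)]
    have "(c j \<cdot> et (FOb G j)) \<cdot> FAr G (i, j) = c j \<cdot> (Fm (FOb G i) (FOb G j) (FAr G (i, j)) \<cdot> et (FOb G i))"
      using et_natural[OF g] cs F g by simp
    also have "\<dots> = c i \<cdot> et (FOb G i)"
      by (rule Cmp_reduce) (use colimit_nat[OF C, of "(i, j)"] f F g cs in \<open>simp_all add: H_def\<close>)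
    finally show "(c (Cod (poset_cat R) f) \<cdot> et (FOb G (Cod (poset_cat R) f))) \<cdot> FAr G f = c (Dom (poset_cat R) f) \<cdot> et (FOb G (Dom (poset_cat R) f))"
      by (simp add: f)
  qed
  from colimit_ex[OF col this] obtain r where r: "r \<in> Hom V B C" "\<And>i. i \<in> Field R \<Longrightarrow> r \<cdot> z i = c i \<cdot> et (FOb G i)" by auto
  define r' where "r' = ep \<CC> \<cdot> Fm B (fst \<CC>) r"
  have r': "ahom (Fo B) \<CC> r'" "r' \<cdot> et B = r" unfolding r'_def
    by (rule free_extension[OF CC(1)]; use r(1) CC(2) in simp)+
  have "cocone V (poset_cat R) H (TT B) (\<lambda>i. Fm (FOb G i) B (z i))"
    unfolding cocone_def
  proof (intro conjI ballI)
    show "TT B \<in> Obj V" using B by simp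
    show "Fm (FOb G j) B (z j) \<in> Hom V (FOb H j) (TT B)" if "j \<in> Obj (poset_cat R)" for j using z that by (simp add: H_def)
    fix f assume "f \<in> Arr (poset_cat R)"
    then obtain i j where f: "f = (i, j)" "(i, j) \<in> R" by (cases f) simp
    show "Fm (FOb G (Cod (poset_cat R) f)) B (z (Cod (poset_cat R) f)) \<cdot> FAr H f = Fm (FOb G (Dom (poset_cat R) f)) B (z (Dom (poset_cat R) f))"
      using Fm_comp[OF GA[OF f(2)] z[OF RF(2)[OF f(2)]]] z_nat[OF f(2)] by (simp add: H_def f)
  qed
  from colimit_ex[OF C this] obtain s where s: "s \<in> Hom V C (TT B)" "\<And>i. i \<in> Field R \<Longrightarrow> s \<cdot> c i = Fm (FOb G i) B (z i)" by auto
  \<comment> \<open>\<open>s\<close> is obtained from the colimit in \<open>V\<close>. It respects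
    operations because an element of shape \<open>X\<close> in \<open>P\<close> lies in a stage, and
    on that stage \<open>s\<close> restricts to the homomorphism induced by
    \<open>z i\<close>.\<close>
  have s_hom: "ahom \<CC> (Fo B) s"
    unfolding ahom_def
  proof (intro conjI ballI)
    show "s \<in> Hom V (fst \<CC>) (TT B)" using s(1) CC(2) by simp
    fix X Y t a assume X: "X \<in> P" and Y: "Y \<in> P" and t: "t \<in> Hom V II (VHom T Y X)" and a: "a \<in> Hom V X (fst \<CC>)"
    obtain i a' where i: "i \<in> Field R" "a' \<in> Hom V X (TT (FOb G i))" "c i \<cdot> a' = a"
      using presentable_factor[OF P_pres[OF X] R H C] a CC(2) by (auto simp: H_def)
    have zi: "Fm (FOb G i) B (z i) \<in> Hom V (TT (FOb G i)) (TT B)" using z[OF i(1)] by simp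
    have "s \<cdot> ap \<CC> X Y t a = s \<cdot> (c i \<cdot> ap (Fo (FOb G i)) X Y t a')"
      using ahom_ap[OF CC(3)[OF i(1)] X Y t i(2)] i(3) by simp
    also have "\<dots> = Fm (FOb G i) B (z i) \<cdot> ap (Fo (FOb G i)) X Y t a'"
      by (rule Cmp_reduce[OF s(2)[OF i(1)]]) (use s(1) CC(2) cs(1,2,3)[OF i(1)] X Y t i in simp_all)
    also have "\<dots> = ap (Fo B) X Y t (Fm (FOb G i) B (z i) \<cdot> a')"
      by (rule ahom_ap[OF Fm_ahom[OF z[OF i(1)]] X Y t i(2)])
    also have "Fm (FOb G i) B (z i) \<cdot> a' = s \<cdot> (c i \<cdot> a')"
      by (rule Cmp_reduce[OF s(2)[OF i(1)], symmetric]) (use s(1) CC(2) cs(1,2,3)[OF i(1)] i in simp_all)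
    finally show "s \<cdot> ap \<CC> X Y t a = ap (Fo B) X Y t (s \<cdot> a)" unfolding i(3) .
  qed
  have "s \<cdot> r' = Idn V (TT B)"
  proof (rule free_unique[OF Fo_alg[OF B] B])
    show "ahom (Fo B) (Fo B) (s \<cdot> r')" by (rule ahom_comp[OF r'(1) s_hom Fo_alg[OF B]])
    show "ahom (Fo B) (Fo B) (Idn V (TT B))" by (rule ahom_Idn[OF Fo_alg[OF B]])
    show "(s \<cdot> r') \<cdot> et B = Idn V (TT B) \<cdot> et B"
    proof (rule colimit_ext[OF col _ _ G])
      fix i assume "i \<in> Obj (poset_cat R)" hence i: "i \<in> Field R" by simp
      have "((s \<cdot> r') \<cdot> et B) \<cdot> z i = s \<cdot> ((r' \<cdot> et B) \<cdot> z i)"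
        using s(1) CC(2) ahom_simps[OF r'(1)] B z[OF i] by simp
      also have "\<dots> = s \<cdot> (c i \<cdot> et (FOb G i))" unfolding r'(2) using r(2)[OF i] by simp
      also have "\<dots> = Fm (FOb G i) B (z i) \<cdot> et (FOb G i)"
        by (rule Cmp_reduce[OF s(2)[OF i]]) (use s(1) CC(2) cs(1,2,3)[OF i] i in simp_all)
      also have "\<dots> = et B \<cdot> z i" by (rule et_natural[OF z[OF i]])
      finally show "((s \<cdot> r') \<cdot> et B) \<cdot> z i = (Idn V (TT B) \<cdot> et B) \<cdot> z i" using B by simp
    qed (use s(1) CC(2) ahom_simps[OF r'(1)] B in simp_all)
  qed
  hence sr: "s \<cdot> (r' \<cdot> b) = b"
    using Cmp_reduce[of s r' "Idn V (TT B)" b] s(1) CC(2) ahom_simps[OF r'(1)] b by simp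
  \<comment> \<open>The unit is presentable, so this point lies in a stage; applying
    \<open>s\<close> there gives back \<open>b\<close>.\<close>
  have "r' \<cdot> b \<in> Hom V II C" using ahom_simps[OF r'(1)] CC(2) b by simp
  moreover have "presentable_object \<kappa> lam V II" by (rule P_pres[OF One_P])
  ultimately obtain i x where i: "i \<in> Field R" "x \<in> Hom V II (TT (FOb G i))" "c i \<cdot> x = r' \<cdot> b"
    using presentable_factor[OF _ R H C, of II "r' \<cdot> b"] by (auto simp: H_def)
  have "Fm (FOb G i) B (z i) \<cdot> x = s \<cdot> (c i \<cdot> x)"
    by (rule Cmp_reduce[OF s(2)[OF i(1)], symmetric]) (use s(1) CC(2) cs(1,2,3)[OF i(1)] i in simp_all)
  hence "Fm (FOb G i) B (z i) \<cdot> x = b" unfolding i(3) sr .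
  with that[OF GX[OF i(1)] z[OF i(1)] i(2)] show ?thesis by blast
qed

text \<open>A point of \<open>TT B\<close> comes from the free algebra on a generator by
  \<open>point_factor\<close>, and from there, by discreteness, from the free algebra on a coproduct
  \<open>X0\<close> of copies of the unit, along some \<open>h : X0 \<rightarrow> B\<close>. Each
  copy of the unit contributes a point of \<open>B\<close>, which lifts along \<open>e\<close>; the
  lifts assemble to an arrow from \<open>X0\<close> to \<open>A\<close>.\<close>

lemma Fm_Surj:
  assumes e: "e \<in> Surj V" "e \<in> Hom V A B"
  shows "Fm A B e \<in> Surj V"
proof -
  have o: "A \<in> Obj V" "B \<in> Obj V" using Hom_Obj[OF e(2)] by auto
  have "\<exists>a \<in> Hom V II (TT A). Fm A B e \<cdot> a = b" if b: "b \<in> Hom V II (TT B)" for b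
  proof -
    obtain Z z x where Z: "Z \<in> \<X>" "z \<in> Hom V Z B" "x \<in> Hom V II (TT Z)" "Fm Z B z \<cdot> x = b"
      using point_factor[OF o(2) b] .
    obtain X i where X: "X \<in> P" "i \<in> Hom V Z X" "iso_arrow V i"
      using P_rep[OF gen_pres[OF Z(1)]] unfolding isomorphic_def by blast
    note inv = inverse_of_simps[OF X(3)]
    have j: "inverse_of V i \<in> Hom V X Z" using inv X(2) by simp
    have y: "Fm Z X i \<cdot> x \<in> Hom V II (TT X)" using X(2) Z(3) by simp
    obtain X0 \<iota> \<delta> c where X0: "X0 \<in> Obj V" "\<delta> \<in> Hom V X0 X" "is_coproduct V (Hom V II X) (\<lambda>_. II) X0 \<iota>"
      "c \<in> Hom V II (TT X0)" "Fm X0 X \<delta> \<cdot> c = Fm Z X i \<cdot> x"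
      using discrete_point[OF theory_iso discrete X(1) y] .
    define h where "h = z \<cdot> (inverse_of V i \<cdot> \<delta>)"
    have h: "h \<in> Hom V X0 B" unfolding h_def using Z(2) j X0(2) by simp
    have \<iota>: "\<iota> k \<in> Hom V II X0" if "k \<in> Hom V II X" for k using X0(3) that unfolding is_coproduct_def by blast
    have "\<forall>k \<in> Hom V II X. \<exists>a. a \<in> Hom V II A \<and> e \<cdot> a = h \<cdot> \<iota> k"
    proof
      fix k assume k: "k \<in> Hom V II X"
      have "h \<cdot> \<iota> k \<in> Hom V II (Cod V e)" using h \<iota>[OF k] e(2) by simp
      moreover have "\<forall>b \<in> Hom V II (Cod V e). \<exists>a \<in> Hom V II (Dom V e). e \<cdot> a = b"
        using e(1) unfolding Surj_def by blast
      ultimately obtain a where "a \<in> Hom V II (Dom V e)" "e \<cdot> a = h \<cdot> \<iota> k" by blast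
      thus "\<exists>a. a \<in> Hom V II A \<and> e \<cdot> a = h \<cdot> \<iota> k" using e(2) by auto
    qed
    then obtain l where l: "\<And>k. k \<in> Hom V II X \<Longrightarrow> l k \<in> Hom V II A" "\<And>k. k \<in> Hom V II X \<Longrightarrow> e \<cdot> l k = h \<cdot> \<iota> k" by metis
    have "\<exists>!g. g \<in> Hom V X0 A \<and> (\<forall>k \<in> Hom V II X. g \<cdot> \<iota> k = l k)"
      using X0(3) l(1) o(1) unfolding is_coproduct_def by blast
    then obtain g where g: "g \<in> Hom V X0 A" "\<And>k. k \<in> Hom V II X \<Longrightarrow> g \<cdot> \<iota> k = l k" by blast
    have eg: "e \<cdot> g = h"
    proof -
      have "\<exists>!f. f \<in> Hom V X0 B \<and> (\<forall>k \<in> Hom V II X. f \<cdot> \<iota> k = h \<cdot> \<iota> k)"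
      proof -
        have "h \<cdot> \<iota> k \<in> Hom V II B" if "k \<in> Hom V II X" for k by (rule Cmp_Hom[OF \<iota>[OF that] h])
        with X0(3)[unfolded is_coproduct_def, THEN conjunct2, THEN conjunct2, rule_format, of B "\<lambda>k. h \<cdot> \<iota> k"] o(2)
        show ?thesis by blast
      qed
      moreover have "(e \<cdot> g) \<cdot> \<iota> k = h \<cdot> \<iota> k" if k: "k \<in> Hom V II X" for k
        using g(1) g(2)[OF k] \<iota>[OF k] e(2) l(2)[OF k] by simp
      moreover have "e \<cdot> g \<in> Hom V X0 B" using e(2) g(1) by simp
      ultimately show ?thesis using h by metis
    qed
    have "Fm A B e \<cdot> (Fm X0 A g \<cdot> c) = Fm X0 B h \<cdot> c"
      by (rule Cmp_reduce) (use Fm_comp[OF g(1) e(2)] eg g(1) e(2) X0(4) in simp_all)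
    also have "Fm X0 B h = Fm Z B z \<cdot> (Fm X Z (inverse_of V i) \<cdot> Fm X0 X \<delta>)"
    proof -
      have "inverse_of V i \<cdot> \<delta> \<in> Hom V X0 Z" using j X0(2) by simp
      from Fm_comp[OF this Z(2)] show ?thesis unfolding h_def Fm_comp[OF X0(2) j] .
    qed
    also have "(Fm Z B z \<cdot> (Fm X Z (inverse_of V i) \<cdot> Fm X0 X \<delta>)) \<cdot> c = Fm Z B z \<cdot> (Fm X Z (inverse_of V i) \<cdot> (Fm X0 X \<delta> \<cdot> c))"
      using Z(2) j X0(2,4) by simp
    also have "Fm X Z (inverse_of V i) \<cdot> (Fm X0 X \<delta> \<cdot> c) = Fm Z Z (inverse_of V i \<cdot> i) \<cdot> x"
      unfolding X0(5) by (rule Cmp_reduce[OF Fm_comp[OF X(2) j, symmetric]]) (use X(2) j Z(3) in simp_all)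
    also have "Fm Z B z \<cdot> (Fm Z Z (inverse_of V i \<cdot> i) \<cdot> x) = Fm Z B (z \<cdot> (inverse_of V i \<cdot> i)) \<cdot> x"
      by (rule Cmp_reduce[OF Fm_comp[symmetric]]) (use X(2) j Z(2,3) in simp_all)
    also have "z \<cdot> (inverse_of V i \<cdot> i) = z" using inv(5) X(2) Z(2) by simp
    finally have "Fm A B e \<cdot> (Fm X0 A g \<cdot> c) = b" using Z(4) by simp
    moreover have "Fm X0 A g \<cdot> c \<in> Hom V II (TT A)" using g(1) X0(4) by simp
    ultimately show ?thesis by blast
  qed
  thus ?thesis using e(2) unfolding Surj_def by simp
qed

end

section \<open>Products, images and directed colimits of algebras\<close>

locale convenient_base = discrete_base V \<kappa> \<X> P T J F \<eta> \<epsilon> lam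
  for V :: "('o, 'a) smc" (structure) and \<kappa> :: "'a rel" and \<X> :: "'o set" and P :: "'o set"
    and T :: "('o, 'o, 'a) vcat" and J :: "('o, 'o, 'a) vfun"
    and F :: "('o, ('o, 'a) alg, 'a) vfun" and \<eta> :: "'o \<Rightarrow> 'a" and \<epsilon> :: "('o, 'a) alg \<Rightarrow> 'a" and lam :: "'l rel" +
  fixes \<mu> :: "'m rel"
  assumes factorization: "factorization_system V (Surj V) (Inj V)" and proper: "proper_system V (Surj V) (Inj V)"
    and convenient: "convenient_system \<kappa> \<mu> V (Surj V) (Inj V)"
begin

section \<open>Surjections, injections and homomorphisms\<close>

lemma Surj_epi: "e \<in> Surj V \<Longrightarrow> epi_arrow V e"
  and Inj_mono: "m \<in> Inj V \<Longrightarrow> mono_arrow V m"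
  using proper by (auto simp: proper_system_def)

lemma Surj_Arr: "e \<in> Surj V \<Longrightarrow> e \<in> Arr V" and Inj_Arr: "m \<in> Inj V \<Longrightarrow> m \<in> Arr V"
  by (auto simp: Surj_def Inj_def)

lemma Surj_cancel:
  "e \<in> Surj V \<Longrightarrow> u \<cdot> e = v \<cdot> e \<Longrightarrow> u \<in> Hom V (Cod V e) W \<Longrightarrow> v \<in> Hom V (Cod V e) W \<Longrightarrow> u = v"
  by (rule epi_arrow_cancel[OF Surj_epi])

lemma Inj_cancel:
  "m \<in> Inj V \<Longrightarrow> m \<cdot> u = m \<cdot> v \<Longrightarrow> u \<in> Hom V W (Dom V m) \<Longrightarrow> v \<in> Hom V W (Dom V m) \<Longrightarrow> u = v"
  by (rule mono_arrow_cancel[OF Inj_mono])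

lemma factorize:
  assumes "f \<in> Hom V A B"
  obtains W e m where "e \<in> Surj V" "m \<in> Inj V" "e \<in> Hom V A W" "m \<in> Hom V W B" "f = m \<cdot> e"
proof -
  have "\<exists>e \<in> Surj V. \<exists>m \<in> Inj V. Dom V e = Dom V f \<and> Cod V e = Dom V m \<and> Cod V m = Cod V f \<and> f = m \<cdot> e"
    using factorization assms unfolding factorization_system_def by auto
  then obtain e m where "e \<in> Surj V" "m \<in> Inj V" "Dom V e = Dom V f" "Cod V e = Dom V m" "Cod V m = Cod V f" "f = m \<cdot> e" by blast
  thus ?thesis using that[of e m "Dom V m"] Surj_Arr Inj_Arr assms by simp
qed

lemma lifting:
  assumes "e \<in> Surj V" "m \<in> Inj V" "u \<in> Hom V (Dom V e) (Dom V m)" "v \<in> Hom V (Cod V e) (Cod V m)" "m \<cdot> u = v \<cdot> e"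
  obtains d where "d \<in> Hom V (Cod V e) (Dom V m)" "d \<cdot> e = u" "m \<cdot> d = v"
proof -
  have "unique_lifting V e m" using assms(1,2) by (simp add: Inj_def)
  hence "\<exists>!d. d \<in> Hom V (Cod V e) (Dom V m) \<and> d \<cdot> e = u \<and> m \<cdot> d = v"
    using assms(3-5) unfolding unique_lifting_def by blast
  thus ?thesis using that by blast
qed

text \<open>The diagonal of a square is \<open>r \<cdot> v\<close>. That it is a lift of
  \<open>v\<close> is checked after composition with the epimorphism \<open>e\<close>.\<close>

lemma Inj_split:
  assumes "m \<in> Hom V A B" "r \<in> Hom V B A" "r \<cdot> m = Idn V A"
  shows "m \<in> Inj V"
proof -
  have A: "A \<in> Obj V" using Hom_Obj(1)[OF assms(1)] .
  have "unique_lifting V e m" if e: "e \<in> Surj V" for e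
    unfolding unique_lifting_def
  proof (intro ballI impI)
    note eA = Surj_Arr[OF e]
    fix u v assume u: "u \<in> Hom V (Dom V e) (Dom V m)" and v: "v \<in> Hom V (Cod V e) (Cod V m)" and uv: "m \<cdot> u = v \<cdot> e"
    have rm: "r \<cdot> (m \<cdot> x) = x" if "x \<in> Arr V" "Cod V x = A" for x
      using Cmp_reduce[OF assms(3), of x] that assms(1,2) by simp
    have de: "(r \<cdot> v) \<cdot> e = u"
    proof -
      have "(r \<cdot> v) \<cdot> e = r \<cdot> (m \<cdot> u)" unfolding uv using assms v eA by simp
      thus ?thesis using rm u assms(1) by simp
    qed
    have "m \<cdot> (r \<cdot> v) = v"
    proof (rule Surj_cancel[OF e])
      have "(m \<cdot> (r \<cdot> v)) \<cdot> e = m \<cdot> ((r \<cdot> v) \<cdot> e)" using assms v eA by simp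
      thus "(m \<cdot> (r \<cdot> v)) \<cdot> e = v \<cdot> e" unfolding de uv .
    qed (use assms v in simp_all)
    with de show "\<exists>!d. d \<in> Hom V (Cod V e) (Dom V m) \<and> d \<cdot> e = u \<and> m \<cdot> d = v"
    proof (intro ex1I[of _ "r \<cdot> v"])
      fix d assume d: "d \<in> Hom V (Cod V e) (Dom V m) \<and> d \<cdot> e = u \<and> m \<cdot> d = v"
      hence "r \<cdot> (m \<cdot> d) = r \<cdot> v" by blast
      moreover have "r \<cdot> (m \<cdot> d) = d" using rm[of d] d assms(1) by simp
      ultimately show "d = r \<cdot> v" by simp
    qed (use assms v in simp_all)
  qed
  thus ?thesis using assms(1) by (simp add: Inj_def)
qed

text \<open>A diagonal for the composite \<open>m \<cdot> d\<close> is also one for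
  \<open>d\<close>, because \<open>m\<close> is monic.\<close>

lemma Inj_cancel_right:
  assumes "d \<in> Hom V A B" "m \<in> Inj V" "m \<in> Hom V B C" "m \<cdot> d \<in> Inj V"
  shows "d \<in> Inj V"
proof -
  have "unique_lifting V e d" if e: "e \<in> Surj V" for e
    unfolding unique_lifting_def
  proof (intro ballI impI)
    note eA = Surj_Arr[OF e]
    fix u v assume u: "u \<in> Hom V (Dom V e) (Dom V d)" and v: "v \<in> Hom V (Cod V e) (Cod V d)" and uv: "d \<cdot> u = v \<cdot> e"
    have "(m \<cdot> d) \<cdot> u = m \<cdot> (d \<cdot> u)" "m \<cdot> (v \<cdot> e) = (m \<cdot> v) \<cdot> e" using assms u v eA by simp_all
    hence eq: "(m \<cdot> d) \<cdot> u = (m \<cdot> v) \<cdot> e" using uv by simp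
    obtain w where w: "w \<in> Hom V (Cod V e) (Dom V (m \<cdot> d))" "w \<cdot> e = u" "(m \<cdot> d) \<cdot> w = m \<cdot> v"
      by (rule lifting[OF e assms(4) _ _ eq]) (use assms u v in simp_all)
    have dw: "d \<cdot> w = v"
      by (rule Inj_cancel[OF assms(2), of _ _ "Cod V e"]) (use w assms v in simp_all)
    show "\<exists>!w. w \<in> Hom V (Cod V e) (Dom V d) \<and> w \<cdot> e = u \<and> d \<cdot> w = v"
    proof (rule ex1I[of _ w])
      show "w \<in> Hom V (Cod V e) (Dom V d) \<and> w \<cdot> e = u \<and> d \<cdot> w = v" using w dw assms by simp
      fix w' assume w': "w' \<in> Hom V (Cod V e) (Dom V d) \<and> w' \<cdot> e = u \<and> d \<cdot> w' = v"
      show "w' = w" by (rule Surj_cancel[OF e]) (use w w' assms in simp_all)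
    qed
  qed
  thus ?thesis using assms(1) by (simp add: Inj_def)
qed

text \<open>Homomorphisms are the morphisms of Eilenberg-Moore algebras: an element of an algebra is
  the value under \<open>ep\<close> of its image under \<open>et\<close>, and operations on it can
  be carried out in the free algebra. In this form the condition can be cancelled along
  surjections.\<close>

lemma ahom_iff_ep:
  assumes A: "alg \<AA>" and B: "alg \<BB>" and f: "f \<in> Hom V (fst \<AA>) (fst \<BB>)"
  shows "ahom \<AA> \<BB> f \<longleftrightarrow> f \<cdot> ep \<AA> = ep \<BB> \<cdot> Fm (fst \<AA>) (fst \<BB>) f"
proof
  assume "ahom \<AA> \<BB> f" thus "f \<cdot> ep \<AA> = ep \<BB> \<cdot> Fm (fst \<AA>) (fst \<BB>) f" using ep_natural[OF A B] by simp
next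
  assume eq: "f \<cdot> ep \<AA> = ep \<BB> \<cdot> Fm (fst \<AA>) (fst \<BB>) f"
  show "ahom \<AA> \<BB> f"
    unfolding ahom_def
  proof (intro conjI ballI)
    fix X Y t a assume *: "X \<in> P" "Y \<in> P" "t \<in> Hom V II (VHom T Y X)" and a: "a \<in> Hom V X (fst \<AA>)"
    have ea: "et (fst \<AA>) \<cdot> a \<in> Hom V X (TT (fst \<AA>))" using a A by simp
    have fea: "Fm (fst \<AA>) (fst \<BB>) f \<cdot> (et (fst \<AA>) \<cdot> a) \<in> Hom V X (TT (fst \<BB>))" using ea f by simp
    have a': "ep \<AA> \<cdot> (et (fst \<AA>) \<cdot> a) = a"
      using Cmp_reduce[OF ep_et[OF A], of a] a A by simp
    have fa: "ep \<BB> \<cdot> (Fm (fst \<AA>) (fst \<BB>) f \<cdot> (et (fst \<AA>) \<cdot> a)) = f \<cdot> a"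
    proof -
      have "ep \<BB> \<cdot> (Fm (fst \<AA>) (fst \<BB>) f \<cdot> (et (fst \<AA>) \<cdot> a)) = (f \<cdot> ep \<AA>) \<cdot> (et (fst \<AA>) \<cdot> a)"
        unfolding eq using f a A B by simp
      also have "\<dots> = f \<cdot> (ep \<AA> \<cdot> (et (fst \<AA>) \<cdot> a))" using f a A by simp
      finally show ?thesis unfolding a' .
    qed
    have "f \<cdot> ap \<AA> X Y t a = f \<cdot> (ep \<AA> \<cdot> ap (Fo (fst \<AA>)) X Y t (et (fst \<AA>) \<cdot> a))"
      using ahom_ap[OF ep_ahom[OF A] * ea] a' by simp
    also have "\<dots> = (ep \<BB> \<cdot> Fm (fst \<AA>) (fst \<BB>) f) \<cdot> ap (Fo (fst \<AA>)) X Y t (et (fst \<AA>) \<cdot> a)"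
      by (rule Cmp_reduce[OF eq]) (use f A * ea in simp_all)
    also have "\<dots> = ep \<BB> \<cdot> (Fm (fst \<AA>) (fst \<BB>) f \<cdot> ap (Fo (fst \<AA>)) X Y t (et (fst \<AA>) \<cdot> a))"
      using f A B * ea by simp
    also have "\<dots> = ap \<BB> X Y t (f \<cdot> a)"
      using ahom_ap[OF Fm_ahom[OF f] * ea] ahom_ap[OF ep_ahom[OF B] * fea] fa by simp
    finally show "f \<cdot> ap \<AA> X Y t a = ap \<BB> X Y t (f \<cdot> a)" .
  qed (use f in simp)
qed

text \<open>The square for \<open>k\<close> is tested after
  \<open>Fm (fst \<AA>) (fst \<BB>) e\<close>, which is an epimorphism since the monad preserves
  surjections.\<close>

lemma ahom_cancel_Surj:
  assumes "alg \<AA>" "alg \<BB>" "alg \<CC>" "ahom \<AA> \<BB> e" "e \<in> Surj V" "k \<in> Hom V (fst \<BB>) (fst \<CC>)" "ahom \<AA> \<CC> (k \<cdot> e)"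
  shows "ahom \<BB> \<CC> k"
  unfolding ahom_iff_ep[OF assms(2,3,6)]
proof -
  note eH = ahom_Hom[OF assms(4)]
  have TE: "Fm (fst \<AA>) (fst \<BB>) e \<in> Surj V" by (rule Fm_Surj[OF assms(5) eH])
  show "k \<cdot> ep \<BB> = ep \<CC> \<cdot> Fm (fst \<BB>) (fst \<CC>) k"
  proof (rule Surj_cancel[OF TE])
    have "(k \<cdot> ep \<BB>) \<cdot> Fm (fst \<AA>) (fst \<BB>) e = k \<cdot> (e \<cdot> ep \<AA>)"
      using ep_natural[OF assms(1,2,4)] eH assms by simp
    also have "\<dots> = ep \<CC> \<cdot> Fm (fst \<AA>) (fst \<CC>) (k \<cdot> e)"
      using ep_natural[OF assms(1,3,7)] eH assms by simp
    also have "\<dots> = (ep \<CC> \<cdot> Fm (fst \<BB>) (fst \<CC>) k) \<cdot> Fm (fst \<AA>) (fst \<BB>) e"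
      using Fm_comp[OF eH assms(6)] eH assms by simp
    finally show "(k \<cdot> ep \<BB>) \<cdot> Fm (fst \<AA>) (fst \<BB>) e = (ep \<CC> \<cdot> Fm (fst \<BB>) (fst \<CC>) k) \<cdot> Fm (fst \<AA>) (fst \<BB>) e" .
  qed (use eH assms in simp_all)
qed

lemma ahom_joint_mono:
  assumes "alg \<AA>" "alg \<BB>" "\<And>i. i \<in> I \<Longrightarrow> alg (E i)" "\<And>i. i \<in> I \<Longrightarrow> ahom \<BB> (E i) (p i)"
    "\<And>W u v. u \<in> Hom V W (fst \<BB>) \<Longrightarrow> v \<in> Hom V W (fst \<BB>) \<Longrightarrow> (\<And>i. i \<in> I \<Longrightarrow> p i \<cdot> u = p i \<cdot> v) \<Longrightarrow> u = v"
    "f \<in> Hom V (fst \<AA>) (fst \<BB>)" "\<And>i. i \<in> I \<Longrightarrow> ahom \<AA> (E i) (p i \<cdot> f)"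
  shows "ahom \<AA> \<BB> f"
  unfolding ahom_def
proof (intro conjI ballI)
  fix X Y t a assume *: "X \<in> P" "Y \<in> P" "t \<in> Hom V II (VHom T Y X)" and a: "a \<in> Hom V X (fst \<AA>)"
  have fa: "f \<cdot> a \<in> Hom V X (fst \<BB>)" using a assms(6) by simp
  show "f \<cdot> ap \<AA> X Y t a = ap \<BB> X Y t (f \<cdot> a)"
  proof (rule assms(5)[of _ Y])
    fix i assume i: "i \<in> I"
    note m = ahom_simps[OF assms(4)[OF i]]
    show "p i \<cdot> (f \<cdot> ap \<AA> X Y t a) = p i \<cdot> ap \<BB> X Y t (f \<cdot> a)"
      using ahom_ap[OF assms(7)[OF i] * a] ahom_ap[OF assms(4)[OF i] * fa] * a assms(1,6) m by simp
  qed (use * a fa assms(1,2,6) in simp_all)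
qed fact

section \<open>Products and images of algebras\<close>

lemma product_ext:
  assumes "is_product V I A Q p" "u \<in> Hom V W Q" "v \<in> Hom V W Q" "\<And>i. i \<in> I \<Longrightarrow> p i \<cdot> u = p i \<cdot> v"
  shows "u = v"
proof -
  have p: "\<And>i. i \<in> I \<Longrightarrow> p i \<in> Hom V Q (A i)" using assms(1) by (simp add: is_product_def)
  have "\<forall>i\<in>I. p i \<cdot> u \<in> Hom V W (A i)" using Cmp_Hom[OF assms(2) p] by blast
  hence "\<exists>!h. h \<in> Hom V W Q \<and> (\<forall>i\<in>I. p i \<cdot> h = p i \<cdot> u)"
    using assms(1)[unfolded is_product_def, THEN conjunct2, THEN conjunct2, rule_format, of W "\<lambda>i. p i \<cdot> u"] Hom_Obj(1)[OF assms(2)] by blast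
  thus ?thesis using assms(2-4) by metis
qed

lemma product_ex:
  assumes "is_product V I A Q p" "W \<in> Obj V" "\<And>i. i \<in> I \<Longrightarrow> f i \<in> Hom V W (A i)"
  obtains h where "h \<in> Hom V W Q" "\<And>i. i \<in> I \<Longrightarrow> p i \<cdot> h = f i"
proof -
  have "\<exists>!h. h \<in> Hom V W Q \<and> (\<forall>i\<in>I. p i \<cdot> h = f i)"
    using assms(1)[unfolded is_product_def, THEN conjunct2, THEN conjunct2, rule_format, of W f] assms(2,3) by blast
  thus ?thesis using that by blast
qed

text \<open>Operations act on each coordinate, and the arrow that represents them is paired from the
  arrows \<open>ap_arrow\<close> of the factors.\<close>

lemma product_algebra:
  assumes I: "small \<kappa> I" and E: "\<And>i. i \<in> I \<Longrightarrow> alg (E i)"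
  obtains \<QQ> p where "alg \<QQ>" "is_product V I (\<lambda>i. fst (E i)) (fst \<QQ>) p" "\<And>i. i \<in> I \<Longrightarrow> ahom \<QQ> (E i) (p i)"
proof -
  obtain Q p where Q: "is_product V I (\<lambda>i. fst (E i)) Q p"
    using product[OF I, of "\<lambda>i. fst (E i)"] E by (metis alg_Obj)
  have QO [simp]: "Q \<in> Obj V" and p: "p i \<in> Hom V Q (fst (E i))" if "i \<in> I" for i using Q that by (auto simp: is_product_def)
  have QO [simp]: "Q \<in> Obj V" using Q by (simp add: is_product_def)
  define op where "op X Y t a = (THE h. h \<in> Hom V Y Q \<and> (\<forall>i\<in>I. p i \<cdot> h = ap (E i) X Y t (p i \<cdot> a)))" for X Y t a
  have op: "op X Y t a \<in> Hom V Y Q \<and> (\<forall>i\<in>I. p i \<cdot> op X Y t a = ap (E i) X Y t (p i \<cdot> a))"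
    if XY: "X \<in> P" "Y \<in> P" and t: "t \<in> Hom V II (VHom T Y X)" and a: "a \<in> Hom V X Q" for X Y t a
  proof -
    have apH: "ap (E i) X Y t (p i \<cdot> a) \<in> Hom V Y (fst (E i))" if "i \<in> I" for i
      using XY t a p[OF that] E[OF that] by simp
    hence "\<exists>!h. h \<in> Hom V Y Q \<and> (\<forall>i\<in>I. p i \<cdot> h = ap (E i) X Y t (p i \<cdot> a))"
      using Q[unfolded is_product_def, THEN conjunct2, THEN conjunct2, rule_format, of Y "\<lambda>i. ap (E i) X Y t (p i \<cdot> a)"] P_Obj'[OF XY(2)] by blast
    from theI'[OF this] show ?thesis unfolding op_def .
  qed
  have beta: "\<exists>\<beta>. \<beta> \<in> Hom V ((VHom T Y X \<otimes> ihom V X Q) \<otimes> Y) Q \<and>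
      (\<forall>t \<in> Hom V II (VHom T Y X). \<forall>a \<in> Hom V X Q. \<forall>y \<in> Hom V II Y. \<beta> \<cdot> pr (pr t (name_of V X Q a)) y = op X Y t a \<cdot> y)"
    if X: "X \<in> P" and Y: "Y \<in> P" for X Y
  proof -
    let ?W = "(VHom T Y X \<otimes> ihom V X Q) \<otimes> Y"
    have o [simp]: "X \<in> Obj V" "Y \<in> Obj V" "VHom T Y X \<in> Obj V" using X Y by simp_all
    define b where "b i = ap_arrow (E i) X Y \<cdot> ((Idn V (VHom T Y X) \<odot> pst X (p i)) \<odot> Idn V Y)" for i
    have b: "b i \<in> Hom V ?W (fst (E i))" if "i \<in> I" for i unfolding b_def using E[OF that] p[OF that] X Y by simp
    obtain \<beta> where \<beta>: "\<beta> \<in> Hom V ?W Q" "\<And>i. i \<in> I \<Longrightarrow> p i \<cdot> \<beta> = b i"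
      by (rule product_ex[OF Q, of ?W b]) (use b in simp_all)
    have "\<beta> \<cdot> pr (pr t (name_of V X Q a)) y = op X Y t a \<cdot> y"
      if t: "t \<in> Hom V II (VHom T Y X)" and a: "a \<in> Hom V X Q" and y: "y \<in> Hom V II Y" for t a y
    proof (rule product_ext[OF Q])
      note o = op[OF X Y t a]
      show "\<beta> \<cdot> pr (pr t (name_of V X Q a)) y \<in> Hom V II Q" using \<beta>(1) t a y by simp
      show "op X Y t a \<cdot> y \<in> Hom V II Q" using o y by simp
      fix i assume i: "i \<in> I"
      have pa: "p i \<cdot> a \<in> Hom V X (fst (E i))" using p[OF i] a by simp
      have n: "pst X (p i) \<cdot> name_of V X Q a = name_of V X (fst (E i)) (p i \<cdot> a)"
        by (rule unname_inject[of _ X "fst (E i)"]) (use p[OF i] a pa E[OF i] in simp_all)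
      have "p i \<cdot> (\<beta> \<cdot> pr (pr t (name_of V X Q a)) y) = b i \<cdot> pr (pr t (name_of V X Q a)) y"
        by (rule Cmp_reduce[OF \<beta>(2)[OF i]]) (use \<beta>(1) p[OF i] t a y in simp_all)
      also have "\<dots> = ap_arrow (E i) X Y \<cdot> pr (pr t (name_of V X (fst (E i)) (p i \<cdot> a))) y"
        unfolding b_def using E[OF i] p[OF i] X Y t a y n by simp
      also have "\<dots> = ap (E i) X Y t (p i \<cdot> a) \<cdot> y" by (rule ap_arrow_pr[OF E[OF i] X Y t pa y])
      also have "\<dots> = (p i \<cdot> op X Y t a) \<cdot> y" using o i by simp
      finally show "p i \<cdot> (\<beta> \<cdot> pr (pr t (name_of V X Q a)) y) = p i \<cdot> (op X Y t a \<cdot> y)"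
        using o p[OF i] y by simp
    qed
    with \<beta>(1) show ?thesis by blast
  qed
  then obtain \<beta> where \<beta>: "\<And>X Y. X \<in> P \<Longrightarrow> Y \<in> P \<Longrightarrow> \<beta> X Y \<in> Hom V ((VHom T Y X \<otimes> ihom V X Q) \<otimes> Y) Q"
    "\<And>X Y t a y. X \<in> P \<Longrightarrow> Y \<in> P \<Longrightarrow> t \<in> Hom V II (VHom T Y X) \<Longrightarrow> a \<in> Hom V X Q \<Longrightarrow> y \<in> Hom V II Y \<Longrightarrow>
      \<beta> X Y \<cdot> pr (pr t (name_of V X Q a)) y = op X Y t a \<cdot> y"
    by metis
  have op1: "op X Y t a \<in> Hom V Y Q" if "X \<in> P" "Y \<in> P" "t \<in> Hom V II (VHom T Y X)" "a \<in> Hom V X Q" for X Y t a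
    using op[OF that] by blast
  show ?thesis
  proof (rule mk_algebra[OF QO \<beta>(1) op1 \<beta>(2)])
    fix X a assume X: "X \<in> P" and a: "a \<in> Hom V X Q"
    have t: "VIdn T X \<in> Hom V II (VHom T X X)" using X by simp
    show "op X X (VIdn T X) a = a"
    proof (rule product_ext[OF Q])
      fix i assume i: "i \<in> I"
      have "p i \<cdot> a \<in> Hom V X (fst (E i))" using p[OF i] a by simp
      from ap_unit[OF E[OF i] X this] show "p i \<cdot> op X X (VIdn T X) a = p i \<cdot> a" using op[OF X X t a] i by simp
    qed (use op1[OF X X t a] a in simp_all)
  next
    fix X Y Z t s a assume PP: "X \<in> P" "Y \<in> P" "Z \<in> P" and t: "t \<in> Hom V II (VHom T Y X)" and s: "s \<in> Hom V II (VHom T Z Y)" and a: "a \<in> Hom V X Q"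
    have ts: "VCmp T Z Y X \<cdot> pr t s \<in> Hom V II (VHom T Z X)" using PP t s by simp
    have b: "op X Y t a \<in> Hom V Y Q" by (rule op1[OF PP(1,2) t a])
    show "op X Z (VCmp T Z Y X \<cdot> pr t s) a = op Y Z s (op X Y t a)"
    proof (rule product_ext[OF Q])
      fix i assume i: "i \<in> I"
      have pa: "p i \<cdot> a \<in> Hom V X (fst (E i))" using p[OF i] a by simp
      show "p i \<cdot> op X Z (VCmp T Z Y X \<cdot> pr t s) a = p i \<cdot> op Y Z s (op X Y t a)"
        using op[OF PP(1,3) ts a] op[OF PP(2,3) s b] op[OF PP(1,2) t a] ap_comp[OF E[OF i] PP t s pa] i by simp
    qed (use op1[OF PP(1,3) ts a] op1[OF PP(2,3) s b] in simp_all)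
  next
    fix X Y x a assume PP: "X \<in> P" "Y \<in> P" and x: "x \<in> Hom V Y X" and a: "a \<in> Hom V X Q"
    have t: "VAr J Y X \<cdot> name_of V Y X x \<in> Hom V II (VHom T Y X)" using PP x by simp
    show "op X Y (VAr J Y X \<cdot> name_of V Y X x) a = a \<cdot> x"
    proof (rule product_ext[OF Q])
      fix i assume i: "i \<in> I"
      have pa: "p i \<cdot> a \<in> Hom V X (fst (E i))" using p[OF i] a by simp
      show "p i \<cdot> op X Y (VAr J Y X \<cdot> name_of V Y X x) a = p i \<cdot> (a \<cdot> x)"
        using op[OF PP t a] ap_J[OF E[OF i] PP x pa] i p[OF i] a x by simp
    qed (use op1[OF PP t a] a x in simp_all)
  next
    fix H assume H: "alg (Q, H)"
      "\<And>X Y t a. X \<in> P \<Longrightarrow> Y \<in> P \<Longrightarrow> t \<in> Hom V II (VHom T Y X) \<Longrightarrow> a \<in> Hom V X Q \<Longrightarrow> ap (Q, H) X Y t a = op X Y t a"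
    show thesis
    proof (rule that[OF H(1)])
      show "is_product V I (\<lambda>i. fst (E i)) (fst (Q, H)) p" using Q by simp
      show "ahom (Q, H) (E i) (p i)" if i: "i \<in> I" for i
        unfolding ahom_def
      proof (intro conjI ballI)
        show "p i \<in> Hom V (fst (Q, H)) (fst (E i))" using p[OF i] by simp
        fix X Y t a assume *: "X \<in> P" "Y \<in> P" "t \<in> Hom V II (VHom T Y X)" "a \<in> Hom V X (fst (Q, H))"
        hence a: "a \<in> Hom V X Q" by simp
        show "p i \<cdot> ap (Q, H) X Y t a = ap (E i) X Y t (p i \<cdot> a)"
          unfolding H(2)[OF *(1-3) a] using op[OF *(1-3) a] i by blast
      qed
    qed
  qed
qed

lemma product_ahom:
  assumes "alg \<QQ>" "is_product V I (\<lambda>i. fst (E i)) (fst \<QQ>) p" "\<And>i. i \<in> I \<Longrightarrow> ahom \<QQ> (E i) (p i)"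
    "\<And>i. i \<in> I \<Longrightarrow> alg (E i)" "alg \<CC>" "\<And>i. i \<in> I \<Longrightarrow> ahom \<CC> (E i) (f i)"
  obtains h where "ahom \<CC> \<QQ> h" "\<And>i. i \<in> I \<Longrightarrow> p i \<cdot> h = f i"
proof -
  have CO: "fst \<CC> \<in> Obj V" using assms(5) by simp
  show ?thesis
  proof (rule product_ex[OF assms(2) CO ahom_Hom[OF assms(6)]])
    fix h assume h: "h \<in> Hom V (fst \<CC>) (fst \<QQ>)" "\<And>i. i \<in> I \<Longrightarrow> p i \<cdot> h = f i"
    have "ahom \<CC> \<QQ> h"
    proof (rule ahom_joint_mono[where E = E and I = I and p = p])
      show "u = v" if "u \<in> Hom V W (fst \<QQ>)" "v \<in> Hom V W (fst \<QQ>)" "\<And>i. i \<in> I \<Longrightarrow> p i \<cdot> u = p i \<cdot> v" for W u v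
        by (rule product_ext[OF assms(2) that])
      show "ahom \<CC> (E i) (p i \<cdot> h)" if "i \<in> I" for i unfolding h(2)[OF that] by (rule assms(6)[OF that])
    qed (fact assms h)+
    thus thesis by (rule that[OF _ h(2)])
  qed
qed

text \<open>The structure map of the image of a homomorphism is a diagonal filler, as the monad preserves surjections.\<close>

lemma image_algebra:
  assumes A: "alg \<AA>" and E: "alg \<EE>" and f: "ahom \<AA> \<EE> (m \<cdot> e)"
    and e: "e \<in> Surj V" "e \<in> Hom V (fst \<AA>) W" and m: "m \<in> Inj V" "m \<in> Hom V W (fst \<EE>)"
  obtains \<WW> where "alg \<WW>" "fst \<WW> = W" "ahom \<AA> \<WW> e" "ahom \<WW> \<EE> m"
proof -
  let ?A = "fst \<AA>" and ?E = "fst \<EE>"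
  have o [simp]: "W \<in> Obj V" "?A \<in> Obj V" "?E \<in> Obj V" using Hom_Obj[OF e(2)] Hom_Obj[OF m(2)] by auto
  note Te = Fm_Surj[OF e]
  have sq: "m \<cdot> (e \<cdot> ep \<AA>) = (ep \<EE> \<cdot> Fm W ?E m) \<cdot> Fm ?A W e"
    using ep_natural[OF A E f] Fm_comp[OF e(2) m(2)] e(2) m(2) A E by simp
  obtain d where d: "d \<in> Hom V (Cod V (Fm ?A W e)) (Dom V m)" "d \<cdot> Fm ?A W e = e \<cdot> ep \<AA>" "m \<cdot> d = ep \<EE> \<cdot> Fm W ?E m"
    by (rule lifting[OF Te m(1) _ _ sq]) (use e(2) m(2) A E in simp_all)
  have dH: "d \<in> Hom V (TT W) W" using d(1) e(2) m(2) by simp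
  \<comment> \<open>An element of \<open>W\<close> is taken into the free algebra on
    \<open>W\<close>, operated on there, and brought back by \<open>d\<close>.\<close>
  define op where "op X Y t a = d \<cdot> ap (Fo W) X Y t (et W \<cdot> a)" for X Y t a
  have ea: "et W \<cdot> a \<in> Hom V X (TT W)" if "a \<in> Hom V X W" for a X using that by simp
  have op1: "op X Y t a \<in> Hom V Y W" if "X \<in> P" "Y \<in> P" "t \<in> Hom V II (VHom T Y X)" "a \<in> Hom V X W" for X Y t a
    unfolding op_def using that ea[OF that(4)] dH by simp
  \<comment> \<open>The operations on \<open>W\<close> agree with those of \<EE> along
    \<open>m\<close>; as \<open>m\<close> is monic, the algebra laws are inherited.\<close>
  have m_op: "m \<cdot> op X Y t a = ap \<EE> X Y t (m \<cdot> a)"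
    if X: "X \<in> P" and Y: "Y \<in> P" and t: "t \<in> Hom V II (VHom T Y X)" and a: "a \<in> Hom V X W" for X Y t a
  proof -
    have b: "Fm W ?E m \<cdot> (et W \<cdot> a) \<in> Hom V X (TT ?E)" using ea[OF a] m(2) by simp
    have "m \<cdot> op X Y t a = (ep \<EE> \<cdot> Fm W ?E m) \<cdot> ap (Fo W) X Y t (et W \<cdot> a)"
      unfolding op_def by (rule Cmp_reduce[OF d(3)]) (use X Y t ea[OF a] dH m(2) in simp_all)
    also have "\<dots> = ep \<EE> \<cdot> (Fm W ?E m \<cdot> ap (Fo W) X Y t (et W \<cdot> a))"
      using X Y t ea[OF a] m(2) E by simp
    also have "\<dots> = ap \<EE> X Y t (ep \<EE> \<cdot> (Fm W ?E m \<cdot> (et W \<cdot> a)))"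
      using ahom_ap[OF Fm_ahom[OF m(2)] X Y t ea[OF a]] ahom_ap[OF ep_ahom[OF E] X Y t b] by simp
    also have "Fm W ?E m \<cdot> (et W \<cdot> a) = (et ?E \<cdot> m) \<cdot> a"
      by (rule Cmp_reduce[OF et_natural[OF m(2)]]) (use a m(2) in simp_all)
    also have "ep \<EE> \<cdot> ((et ?E \<cdot> m) \<cdot> a) = m \<cdot> a"
      using Cmp_reduce[OF ep_et[OF E], of "m \<cdot> a"] a m(2) E by simp
    finally show ?thesis .
  qed
  have beta: "\<exists>\<beta>. \<beta> \<in> Hom V ((VHom T Y X \<otimes> ihom V X W) \<otimes> Y) W \<and>
      (\<forall>t \<in> Hom V II (VHom T Y X). \<forall>a \<in> Hom V X W. \<forall>y \<in> Hom V II Y. \<beta> \<cdot> pr (pr t (name_of V X W a)) y = op X Y t a \<cdot> y)"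
    if X: "X \<in> P" and Y: "Y \<in> P" for X Y
  proof -
    have o' [simp]: "X \<in> Obj V" "Y \<in> Obj V" "VHom T Y X \<in> Obj V" using X Y by simp_all
    define \<beta> where "\<beta> = d \<cdot> (ap_arrow (Fo W) X Y \<cdot> ((Idn V (VHom T Y X) \<odot> pst X (et W)) \<odot> Idn V Y))"
    have "\<beta> \<in> Hom V ((VHom T Y X \<otimes> ihom V X W) \<otimes> Y) W" unfolding \<beta>_def using dH X Y by simp
    moreover have "\<beta> \<cdot> pr (pr t (name_of V X W a)) y = op X Y t a \<cdot> y"
      if t: "t \<in> Hom V II (VHom T Y X)" and a: "a \<in> Hom V X W" and y: "y \<in> Hom V II Y" for t a y
    proof -
      have n: "pst X (et W) \<cdot> name_of V X W a = name_of V X (TT W) (et W \<cdot> a)"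
        by (rule unname_inject[of _ X "TT W"]) (use a in simp_all)
      have "\<beta> \<cdot> pr (pr t (name_of V X W a)) y = d \<cdot> (ap_arrow (Fo W) X Y \<cdot> pr (pr t (name_of V X (TT W) (et W \<cdot> a))) y)"
        unfolding \<beta>_def using dH X Y t a y n by simp
      also have "ap_arrow (Fo W) X Y \<cdot> pr (pr t (name_of V X (TT W) (et W \<cdot> a))) y = ap (Fo W) X Y t (et W \<cdot> a) \<cdot> y"
        by (rule ap_arrow_pr) (use X Y t ea[OF a] y in simp_all)
      finally show ?thesis unfolding op_def using dH X Y t ea[OF a] y by simp
    qed
    ultimately show ?thesis by blast
  qed
  then obtain \<beta> where \<beta>: "\<And>X Y. X \<in> P \<Longrightarrow> Y \<in> P \<Longrightarrow> \<beta> X Y \<in> Hom V ((VHom T Y X \<otimes> ihom V X W) \<otimes> Y) W"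
    "\<And>X Y t a y. X \<in> P \<Longrightarrow> Y \<in> P \<Longrightarrow> t \<in> Hom V II (VHom T Y X) \<Longrightarrow> a \<in> Hom V X W \<Longrightarrow> y \<in> Hom V II Y \<Longrightarrow>
      \<beta> X Y \<cdot> pr (pr t (name_of V X W a)) y = op X Y t a \<cdot> y"
    by metis
  have ma: "m \<cdot> a \<in> Hom V X ?E" if "a \<in> Hom V X W" for a X using that m(2) by simp
  have mcancel: "u = v" if "m \<cdot> u = m \<cdot> v" "u \<in> Hom V Y W" "v \<in> Hom V Y W" for u v Y
    by (rule Inj_cancel[OF m(1) that(1), of Y]) (use that m(2) in simp_all)
  show ?thesis
  proof (rule mk_algebra[OF o(1) \<beta>(1) op1 \<beta>(2)])
    fix X a assume X: "X \<in> P" and a: "a \<in> Hom V X W"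
    have t: "VIdn T X \<in> Hom V II (VHom T X X)" using X by simp
    show "op X X (VIdn T X) a = a"
      by (rule mcancel[OF _ op1[OF X X t a] a]) (simp add: m_op[OF X X t a] ap_unit[OF E X ma[OF a]])
  next
    fix X Y Z t s a assume PP: "X \<in> P" "Y \<in> P" "Z \<in> P" and t: "t \<in> Hom V II (VHom T Y X)" and s: "s \<in> Hom V II (VHom T Z Y)" and a: "a \<in> Hom V X W"
    have ts: "VCmp T Z Y X \<cdot> pr t s \<in> Hom V II (VHom T Z X)" using PP t s by simp
    have b: "op X Y t a \<in> Hom V Y W" by (rule op1[OF PP(1,2) t a])
    show "op X Z (VCmp T Z Y X \<cdot> pr t s) a = op Y Z s (op X Y t a)"
      by (rule mcancel[OF _ op1[OF PP(1,3) ts a] op1[OF PP(2,3) s b]])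
        (simp add: m_op[OF PP(1,3) ts a] m_op[OF PP(2,3) s b] m_op[OF PP(1,2) t a] ap_comp[OF E PP t s ma[OF a]])
  next
    fix X Y x a assume PP: "X \<in> P" "Y \<in> P" and x: "x \<in> Hom V Y X" and a: "a \<in> Hom V X W"
    have t: "VAr J Y X \<cdot> name_of V Y X x \<in> Hom V II (VHom T Y X)" using PP x by simp
    have "m \<cdot> op X Y (VAr J Y X \<cdot> name_of V Y X x) a = (m \<cdot> a) \<cdot> x"
      by (simp add: m_op[OF PP t a] ap_J[OF E PP x ma[OF a]])
    hence "m \<cdot> op X Y (VAr J Y X \<cdot> name_of V Y X x) a = m \<cdot> (a \<cdot> x)" using m(2) a x by simp
    thus "op X Y (VAr J Y X \<cdot> name_of V Y X x) a = a \<cdot> x"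
      by (rule mcancel[OF _ op1[OF PP t a]]) (use a x in simp)
  next
    fix H assume H: "alg (W, H)"
      "\<And>X Y t a. X \<in> P \<Longrightarrow> Y \<in> P \<Longrightarrow> t \<in> Hom V II (VHom T Y X) \<Longrightarrow> a \<in> Hom V X W \<Longrightarrow> ap (W, H) X Y t a = op X Y t a"
    have mh: "ahom (W, H) \<EE> m"
      unfolding ahom_def
    proof (intro conjI ballI)
      show "m \<in> Hom V (fst (W, H)) (fst \<EE>)" using m(2) by simp
      fix X Y t a assume *: "X \<in> P" "Y \<in> P" "t \<in> Hom V II (VHom T Y X)" "a \<in> Hom V X (fst (W, H))"
      hence a: "a \<in> Hom V X W" by simp
      show "m \<cdot> ap (W, H) X Y t a = ap \<EE> X Y t (m \<cdot> a)" unfolding H(2)[OF *(1-3) a] by (rule m_op[OF *(1-3) a])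
    qed
    have eh: "ahom \<AA> (W, H) e"
      by (rule ahom_cancel_mono[OF A H(1) E mh Inj_mono[OF m(1)] _ f]) (use e(2) in simp)
    show thesis by (rule that[OF H(1) _ eh mh]) simp
  qed
qed

lemma ahom_factorize:
  assumes A: "alg \<AA>" and E: "alg \<EE>" and f: "ahom \<AA> \<EE> f"
  obtains \<WW> e m where "alg \<WW>" "ahom \<AA> \<WW> e" "ahom \<WW> \<EE> m" "e \<in> Surj V" "m \<in> Inj V" "f = m \<cdot> e"
proof -
  obtain W e m where w: "e \<in> Surj V" "m \<in> Inj V" "e \<in> Hom V (fst \<AA>) W" "m \<in> Hom V W (fst \<EE>)" "f = m \<cdot> e"
    using factorize[OF ahom_Hom[OF f]] .
  obtain \<WW> where "alg \<WW>" "fst \<WW> = W" "ahom \<AA> \<WW> e" "ahom \<WW> \<EE> m"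
    by (rule image_algebra[OF A E f[unfolded w(5)] w(1,3,2,4)])
  thus ?thesis using that[OF _ _ _ w(1,2,5)] by blast
qed

text \<open>Up to isomorphism, the surjective quotients that satisfy \<open>\<Psi>\<close> form a small family; \<open>e\<close> is the image of the
  induced homomorphism to its product.\<close>

lemma quotient_refinement:
  fixes \<Psi> :: "('o, 'a) alg \<Rightarrow> 'a \<Rightarrow> bool"
  assumes X: "X \<in> Obj V"
  obtains I :: "'a set" and Bs es \<QQ> p \<BB> e m where "small \<kappa> I"
    "\<And>i. i \<in> I \<Longrightarrow> alg (Bs i)" "\<And>i. i \<in> I \<Longrightarrow> \<Psi> (Bs i) (es i)"
    "alg \<QQ>" "is_product V I (\<lambda>i. fst (Bs i)) (fst \<QQ>) p" "\<And>i. i \<in> I \<Longrightarrow> ahom \<QQ> (Bs i) (p i)"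
    "alg \<BB>" "ahom (Fo X) \<BB> e" "e \<in> Surj V" "ahom \<BB> \<QQ> m" "m \<in> Inj V" "\<And>i. i \<in> I \<Longrightarrow> p i \<cdot> (m \<cdot> e) = es i"
    "\<And>\<CC> c. alg \<CC> \<Longrightarrow> ahom (Fo X) \<CC> c \<Longrightarrow> c \<in> Surj V \<Longrightarrow> \<Psi> \<CC> c \<Longrightarrow> \<exists>j. ahom \<BB> \<CC> j \<and> j \<cdot> e = c"
proof -
  let ?ok = "\<lambda>\<CC> c. alg \<CC> \<and> ahom (Fo X) \<CC> c \<and> c \<in> Surj V \<and> \<Psi> \<CC> c"
  have TX: "TT X \<in> Obj V" using X by simp
  obtain S where S: "small \<kappa> S" "S \<subseteq> {e \<in> Surj V. Dom V e = TT X}"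
    "\<forall>e \<in> Surj V. Dom V e = TT X \<longrightarrow> (\<exists>e' \<in> S. \<exists>i \<in> Hom V (Cod V e) (Cod V e'). iso_arrow V i \<and> i \<cdot> e = e')"
    using convenient[unfolded convenient_system_def] TX by blast
  \<comment> \<open>The indices are representatives in \<open>S\<close>, hence arrows of
    \<open>V\<close>: this keeps the index set small and inside the type for which closure under
    products is stated. Each index carries an arbitrary algebra; this is harmless, as the comparison
    between two quotients that agree in \<open>V\<close> is a homomorphism by
    \<open>ahom_cancel_Surj\<close>.\<close>
  let ?rel = "\<lambda>e' x. ?ok (fst x) (snd x) \<and> (\<exists>i \<in> Hom V (fst (fst x)) (Cod V e'). iso_arrow V i \<and> i \<cdot> snd x = e')"
  define I where "I = {e' \<in> S. \<exists>x. ?rel e' x}"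
  define rep where "rep e' = (SOME x. ?rel e' x)" for e'
  have rep: "?rel e' (rep e')" if "e' \<in> I" for e'
  proof -
    have "\<exists>x. ?rel e' x" using that by (simp add: I_def)
    from someI_ex[OF this] show ?thesis unfolding rep_def .
  qed
  have rep1: "alg (fst (rep i))" "ahom (Fo X) (fst (rep i)) (snd (rep i))" "snd (rep i) \<in> Surj V" "\<Psi> (fst (rep i)) (snd (rep i))" if "i \<in> I" for i
    using rep[OF that] by simp_all
  have sI: "small \<kappa> I" by (rule small_mono[OF S(1)]) (auto simp: I_def)
  obtain \<QQ> p where Q: "alg \<QQ>" "is_product V I (\<lambda>i. fst (fst (rep i))) (fst \<QQ>) p" "\<And>i. i \<in> I \<Longrightarrow> ahom \<QQ> (fst (rep i)) (p i)"
  proof (rule product_algebra[OF sI rep1(1)])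
    note o_that = that
    show thesis if "alg \<QQ>" "is_product V I (\<lambda>i. fst (fst (rep i))) (fst \<QQ>) p" "\<And>i. i \<in> I \<Longrightarrow> ahom \<QQ> (fst (rep i)) (p i)" for \<QQ> p
      by (rule o_that[OF that])
  qed
  have es: "snd (rep i) \<in> Hom V (TT X) (fst (fst (rep i)))" if "i \<in> I" for i
    using ahom_Hom[OF rep1(2)[OF that]] by simp
  obtain q where q: "ahom (Fo X) \<QQ> q" "\<And>i. i \<in> I \<Longrightarrow> p i \<cdot> q = snd (rep i)"
  proof (rule product_ahom[OF Q rep1(1) Fo_alg[OF X] rep1(2)])
    note o_that = that
    show thesis if "ahom (Fo X) \<QQ> h" "\<And>i. i \<in> I \<Longrightarrow> p i \<cdot> h = snd (rep i)" for h
      by (rule o_that[OF that])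
  qed
  obtain \<BB> e m where B: "alg \<BB>" "ahom (Fo X) \<BB> e" "ahom \<BB> \<QQ> m" "e \<in> Surj V" "m \<in> Inj V" "q = m \<cdot> e"
    by (rule ahom_factorize[OF Fo_alg[OF X] Q(1) q(1)])
  show ?thesis
  proof (rule that[OF sI rep1(1) rep1(4) Q(1) Q(2) Q(3) B(1,2,4,3,5)])
    show "\<And>i. i \<in> I \<Longrightarrow> p i \<cdot> (m \<cdot> e) = snd (rep i)" using q(2) B(6) by simp
    fix \<CC> c assume c: "alg \<CC>" "ahom (Fo X) \<CC> c" "c \<in> Surj V" "\<Psi> \<CC> c"
    note cH = ahom_simps[OF c(2)]
    have "Dom V c = TT X" and Cc: "Cod V c = fst \<CC>" using cH by simp_all
    from S(3)[rule_format, OF c(3) this(1), unfolded Cc]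
    obtain e' i where e': "e' \<in> S" "i \<in> Hom V (fst \<CC>) (Cod V e')" "iso_arrow V i" "i \<cdot> c = e'" by blast
    have "?rel e' (\<CC>, c)" unfolding fst_conv snd_conv using c e'(2-4) by blast
    hence "\<exists>x. ?rel e' x" by (rule exI)
    hence eI: "e' \<in> I" using e'(1) by (simp add: I_def)
    from rep[OF eI] obtain i' where i': "i' \<in> Hom V (fst (fst (rep e'))) (Cod V e')" "iso_arrow V i'" "i' \<cdot> snd (rep e') = e'" by blast
    note inv = inverse_of_simps[OF e'(3)]
    define k where "k = inverse_of V i \<cdot> i'"
    have k: "k \<in> Hom V (fst (fst (rep e'))) (fst \<CC>)" unfolding k_def using inv e'(2) i'(1) by simp
    have "k \<cdot> snd (rep e') = inverse_of V i \<cdot> (i \<cdot> c)"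
      unfolding k_def e'(4) using inv e'(2) i' es[OF eI] by simp
    also have "\<dots> = Idn V (Dom V i) \<cdot> c" by (rule Cmp_reduce[OF inv(5)]) (use inv e'(2) cH in simp_all)
    finally have kc: "k \<cdot> snd (rep e') = c" using e'(2) cH by simp
    have kh: "ahom (fst (rep e')) \<CC> k"
      by (rule ahom_cancel_Surj[OF Fo_alg[OF X] rep1(1)[OF eI] c(1) rep1(2,3)[OF eI] k]) (simp add: kc c(2))
    have "ahom \<BB> \<CC> (k \<cdot> (p e' \<cdot> m))"
      by (rule ahom_comp[OF ahom_comp[OF B(3) Q(3)[OF eI] B(1)] kh B(1)])
    moreover have "(k \<cdot> (p e' \<cdot> m)) \<cdot> e = c"
      using q(2)[OF eI] kc B(6) ahom_simps[OF B(2)] ahom_simps[OF B(3)] ahom_simps[OF Q(3)[OF eI]] k by simp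
    ultimately show "\<exists>j. ahom \<BB> \<CC> j \<and> j \<cdot> e = c" by blast
  qed
qed

text \<open>The colimit is a quotient of the free algebra on the coproduct of the carriers, namely
  the one through which every surjective quotient factors that turns the coproduct injections into
  compatible homomorphisms. This condition is \<open>?\<Psi>\<close>; it passes to the image \<BB>
  because \<open>m\<close> followed by the projections \<open>p\<close> is jointly monic.\<close>

lemma algebra_colimit:
  assumes R: "directed_poset \<kappa> \<rho> R" and E: "\<And>i. i \<in> Field R \<Longrightarrow> alg (E i)"
    and d: "\<And>i j. (i, j) \<in> R \<Longrightarrow> ahom (E i) (E j) (d i j)"
  obtains \<CC> c where "alg \<CC>" "\<And>i. i \<in> Field R \<Longrightarrow> ahom (E i) \<CC> (c i)" "\<And>i j. (i, j) \<in> R \<Longrightarrow> c j \<cdot> d i j = c i"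
    "\<And>\<QQ> q. alg \<QQ> \<Longrightarrow> (\<And>i. i \<in> Field R \<Longrightarrow> ahom (E i) \<QQ> (q i)) \<Longrightarrow> (\<And>i j. (i, j) \<in> R \<Longrightarrow> q j \<cdot> d i j = q i) \<Longrightarrow>
       \<exists>!h. ahom \<CC> \<QQ> h \<and> (\<forall>i \<in> Field R. h \<cdot> c i = q i)"
proof -
  have RF: "i \<in> Field R" "j \<in> Field R" if "(i, j) \<in> R" for i j using that by (auto intro: FieldI1 FieldI2)
  have EO: "fst (E i) \<in> Obj V" if "i \<in> Field R" for i using E[OF that] by simp
  obtain X inn where X: "X \<in> Obj V" and inn: "\<And>i. i \<in> Field R \<Longrightarrow> inn i \<in> Hom V (fst (E i)) X"
    and X_ex: "\<And>Q' \<iota>'. Q' \<in> Obj V \<Longrightarrow> (\<And>i. i \<in> Field R \<Longrightarrow> \<iota>' i \<in> Hom V (fst (E i)) Q') \<Longrightarrow> \<exists>h. h \<in> Hom V X Q' \<and> (\<forall>i\<in>Field R. h \<cdot> inn i = \<iota>' i)"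
    and X_ext: "\<And>W u v. u \<in> Hom V X W \<Longrightarrow> v \<in> Hom V X W \<Longrightarrow> (\<And>i. i \<in> Field R \<Longrightarrow> u \<cdot> inn i = v \<cdot> inn i) \<Longrightarrow> u = v"
  proof (rule coproduct[OF directed_posetD(3)[OF R], of "\<lambda>i. fst (E i)"])
    fix Q \<iota> assume *: "Q \<in> Obj V" "\<And>i. i \<in> Field R \<Longrightarrow> \<iota> i \<in> Hom V (fst (E i)) Q"
      "\<And>Q' \<iota>'. Q' \<in> Obj V \<Longrightarrow> (\<And>i. i \<in> Field R \<Longrightarrow> \<iota>' i \<in> Hom V (fst (E i)) Q') \<Longrightarrow> \<exists>h. h \<in> Hom V Q Q' \<and> (\<forall>i\<in>Field R. h \<cdot> \<iota> i = \<iota>' i)"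
      "\<And>W u v. u \<in> Hom V Q W \<Longrightarrow> v \<in> Hom V Q W \<Longrightarrow> (\<And>i. i \<in> Field R \<Longrightarrow> u \<cdot> \<iota> i = v \<cdot> \<iota> i) \<Longrightarrow> u = v"
    show thesis by (rule that[OF *])
  qed (rule EO)
  let ?in = "\<lambda>e i. e \<cdot> (et X \<cdot> inn i)"
  let ?\<Psi> = "\<lambda>\<CC> e. (\<forall>i \<in> Field R. ahom (E i) \<CC> (?in e i)) \<and> (\<forall>(i, j) \<in> R. ?in e j \<cdot> d i j = ?in e i)"
  have eti: "et X \<cdot> inn i \<in> Hom V (fst (E i)) (TT X)" if "i \<in> Field R" for i using inn[OF that] X by simp
  show ?thesis
  proof (rule quotient_refinement[OF X, of ?\<Psi>])
    fix I :: "'a set" and Bs es \<QQ> p \<BB> e m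
    assume I: "small \<kappa> I" and Bs: "\<And>i. i \<in> I \<Longrightarrow> alg (Bs i)" "\<And>i. i \<in> I \<Longrightarrow> ?\<Psi> (Bs i) (es i)"
      and Q: "alg \<QQ>" "is_product V I (\<lambda>i. fst (Bs i)) (fst \<QQ>) p" "\<And>i. i \<in> I \<Longrightarrow> ahom \<QQ> (Bs i) (p i)"
      and B: "alg \<BB>" "ahom (Fo X) \<BB> e" "e \<in> Surj V" "ahom \<BB> \<QQ> m" "m \<in> Inj V" and pme: "\<And>i. i \<in> I \<Longrightarrow> p i \<cdot> (m \<cdot> e) = es i"
      and univ: "\<And>\<CC> c. alg \<CC> \<Longrightarrow> ahom (Fo X) \<CC> c \<Longrightarrow> c \<in> Surj V \<Longrightarrow> ?\<Psi> \<CC> c \<Longrightarrow> \<exists>j. ahom \<BB> \<CC> j \<and> j \<cdot> e = c"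
    note eH = ahom_simps[OF B(2)] and mH = ahom_simps[OF B(4)]
    have c_Hom: "?in e i \<in> Hom V (fst (E i)) (fst \<BB>)" if "i \<in> Field R" for i using eti[OF that] eH by simp
    have pm: "p s \<cdot> (m \<cdot> ?in e i) = ?in (es s) i" if "s \<in> I" "i \<in> Field R" for s i
      using ahom_simps[OF Q(3)[OF that(1)]] mH eH eti[OF that(2)] by (simp flip: pme[OF that(1)])
    have m_in: "ahom (E i) \<QQ> (m \<cdot> ?in e i)" if i: "i \<in> Field R" for i
    proof (rule ahom_joint_mono[where E = Bs and I = I and p = p])
      show "u = v" if "u \<in> Hom V W (fst \<QQ>)" "v \<in> Hom V W (fst \<QQ>)" "\<And>i. i \<in> I \<Longrightarrow> p i \<cdot> u = p i \<cdot> v" for W u v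
        by (rule product_ext[OF Q(2) that])
      show "ahom (E i) (Bs s) (p s \<cdot> (m \<cdot> ?in e i))" if "s \<in> I" for s unfolding pm[OF that i] using Bs(2)[OF that] i by blast
      show "m \<cdot> ?in e i \<in> Hom V (fst (E i)) (fst \<QQ>)" using c_Hom[OF i] mH by simp
    qed (use E[OF i] Q Bs in auto)
    have c_hom: "ahom (E i) \<BB> (?in e i)" if i: "i \<in> Field R" for i
      by (rule ahom_cancel_mono[OF E[OF i] B(1) Q(1) B(4) Inj_mono[OF B(5)] c_Hom[OF i] m_in[OF i]])
    have c_nat: "?in e j \<cdot> d i j = ?in e i" if ij: "(i, j) \<in> R" for i j
    proof -
      note F = RF[OF ij] and dH = ahom_simps[OF d[OF ij]]
      have "m \<cdot> (?in e j \<cdot> d i j) = m \<cdot> ?in e i"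
      proof (rule product_ext[OF Q(2)])
        fix s assume s: "s \<in> I"
        have "p s \<cdot> (m \<cdot> (?in e j \<cdot> d i j)) = (p s \<cdot> (m \<cdot> ?in e j)) \<cdot> d i j"
          using ahom_simps[OF Q(3)[OF s]] mH c_Hom[OF F(2)] dH eH eti[OF F(2)] by simp
        also have "\<dots> = ?in (es s) i" unfolding pm[OF s F(2)] using Bs(2)[OF s] ij by blast
        finally show "p s \<cdot> (m \<cdot> (?in e j \<cdot> d i j)) = p s \<cdot> (m \<cdot> ?in e i)" unfolding pm[OF s F(1)] .
      next
        show "m \<cdot> (?in e j \<cdot> d i j) \<in> Hom V (fst (E i)) (fst \<QQ>)" using mH c_Hom[OF F(2)] dH by simp
        show "m \<cdot> ?in e i \<in> Hom V (fst (E i)) (fst \<QQ>)" using mH c_Hom[OF F(1)] by simp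
      qed
      thus ?thesis
        by (rule Inj_cancel[OF B(5), of _ _ "fst (E i)"]) (use mH c_Hom[OF F(1)] c_Hom[OF F(2)] dH in simp_all)
    qed
    show thesis
    proof (rule that[OF B(1) c_hom c_nat])
      fix \<QQ>' q assume Q': "alg \<QQ>'" and q: "\<And>i. i \<in> Field R \<Longrightarrow> ahom (E i) \<QQ>' (q i)" and q_nat: "\<And>i j. (i, j) \<in> R \<Longrightarrow> q j \<cdot> d i j = q i"
      have qH: "q i \<in> Hom V (fst (E i)) (fst \<QQ>')" if "i \<in> Field R" for i by (rule ahom_Hom[OF q[OF that]])
      obtain g where g: "g \<in> Hom V X (fst \<QQ>')" "\<And>i. i \<in> Field R \<Longrightarrow> g \<cdot> inn i = q i"
        using X_ex[OF alg_Obj[OF Q'] qH] by blast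
      define g' where "g' = ep \<QQ>' \<cdot> Fm X (fst \<QQ>') g"
      have g': "ahom (Fo X) \<QQ>' g'" "g' \<cdot> et X = g" unfolding g'_def by (rule free_extension[OF Q' g(1)])+
      \<comment> \<open>The universal property of \<BB> concerns surjections, so the target is
        replaced by the image of \<open>g'\<close>.\<close>
      obtain \<WW> e' m' where W: "alg \<WW>" "ahom (Fo X) \<WW> e'" "ahom \<WW> \<QQ>' m'" "e' \<in> Surj V" "m' \<in> Inj V" "g' = m' \<cdot> e'"
        by (rule ahom_factorize[OF Fo_alg[OF X] Q' g'(1)])
      note e'H = ahom_simps[OF W(2)] and m'H = ahom_simps[OF W(3)]
      have m'in: "m' \<cdot> ?in e' i = q i" if i: "i \<in> Field R" for i
      proof -
        have "m' \<cdot> ?in e' i = (g' \<cdot> et X) \<cdot> inn i" unfolding W(6) using m'H e'H inn[OF i] X by simp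
        thus ?thesis unfolding g'(2) g(2)[OF i] .
      qed
      have in'H: "?in e' i \<in> Hom V (fst (E i)) (fst \<WW>)" if "i \<in> Field R" for i using eti[OF that] e'H by simp
      have psi1: "ahom (E i) \<WW> (?in e' i)" if i: "i \<in> Field R" for i
        by (rule ahom_cancel_mono[OF E[OF i] W(1) Q' W(3) Inj_mono[OF W(5)] in'H[OF i]]) (unfold m'in[OF i], rule q[OF i])
      have psi2: "?in e' j \<cdot> d i j = ?in e' i" if ij: "(i, j) \<in> R" for i j
      proof -
        note F = RF[OF ij] and dH = ahom_simps[OF d[OF ij]]
        have "m' \<cdot> (?in e' j \<cdot> d i j) = q j \<cdot> d i j"
          by (rule Cmp_reduce[OF m'in[OF F(2)]]) (use m'H in'H[OF F(2)] dH in simp_all)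
        hence "m' \<cdot> (?in e' j \<cdot> d i j) = m' \<cdot> ?in e' i" unfolding q_nat[OF ij] m'in[OF F(1)] .
        thus ?thesis
          by (rule Inj_cancel[OF W(5), of _ _ "fst (E i)"]) (use m'H in'H[OF F(1)] in'H[OF F(2)] dH in simp_all)
      qed
      have psi: "?\<Psi> \<WW> e'"
      proof (intro conjI ballI)
        fix ij assume "ij \<in> R"
        thus "case ij of (i, j) \<Rightarrow> ?in e' j \<cdot> d i j = ?in e' i" using psi2 by (cases ij) simp
      qed (rule psi1)
      obtain j where j: "ahom \<BB> \<WW> j" "j \<cdot> e = e'" using univ[OF W(1,2,4) psi] by blast
      note jH = ahom_simps[OF j(1)]
      have hc: "(m' \<cdot> j) \<cdot> ?in e i = q i" if i: "i \<in> Field R" for i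
      proof -
        have "(m' \<cdot> j) \<cdot> ?in e i = m' \<cdot> ((j \<cdot> e) \<cdot> (et X \<cdot> inn i))" using m'H jH eH eti[OF i] by simp
        thus ?thesis unfolding j(2) m'in[OF i] .
      qed
      show "\<exists>!h. ahom \<BB> \<QQ>' h \<and> (\<forall>i \<in> Field R. h \<cdot> ?in e i = q i)"
      proof (rule ex1I[of _ "m' \<cdot> j"])
        show "ahom \<BB> \<QQ>' (m' \<cdot> j) \<and> (\<forall>i \<in> Field R. (m' \<cdot> j) \<cdot> ?in e i = q i)"
          using ahom_comp[OF j(1) W(3) B(1)] hc by blast
        fix h assume h: "ahom \<BB> \<QQ>' h \<and> (\<forall>i \<in> Field R. h \<cdot> ?in e i = q i)"
        hence h1: "ahom \<BB> \<QQ>' h" and h2: "\<And>i. i \<in> Field R \<Longrightarrow> h \<cdot> ?in e i = q i" by blast+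
        note hH = ahom_simps[OF h1]
        have "h \<cdot> e = (m' \<cdot> j) \<cdot> e"
        proof (rule free_unique[OF Q' X])
          show "ahom (Fo X) \<QQ>' (h \<cdot> e)" by (rule ahom_comp[OF B(2) h1 Fo_alg[OF X]])
          show "ahom (Fo X) \<QQ>' ((m' \<cdot> j) \<cdot> e)" by (rule ahom_comp[OF B(2) ahom_comp[OF j(1) W(3) B(1)] Fo_alg[OF X]])
          show "(h \<cdot> e) \<cdot> et X = ((m' \<cdot> j) \<cdot> e) \<cdot> et X"
          proof (rule X_ext)
            fix i assume i: "i \<in> Field R"
            have "((h \<cdot> e) \<cdot> et X) \<cdot> inn i = h \<cdot> ?in e i" using hH eH inn[OF i] X by simp
            moreover have "(((m' \<cdot> j) \<cdot> e) \<cdot> et X) \<cdot> inn i = (m' \<cdot> j) \<cdot> ?in e i" using m'H jH eH inn[OF i] X by simp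
            ultimately show "((h \<cdot> e) \<cdot> et X) \<cdot> inn i = (((m' \<cdot> j) \<cdot> e) \<cdot> et X) \<cdot> inn i" using h2[OF i] hc[OF i] by simp
          qed (use hH eH m'H jH X in simp_all)
        qed
        thus "h = m' \<cdot> j" by (rule Surj_cancel[OF B(3)]) (use hH eH m'H jH in simp_all)
      qed
    qed
  qed
qed

end

section \<open>Classes of algebras closed under products, subalgebras and pure quotients\<close>

context pretheory_base
begin

definition "arr_of \<AA> \<BB> f = (THE \<phi>. \<phi> \<in> Hom \<A> \<AA> \<BB> \<and> U \<phi> = f)"

lemma arr_of:
  assumes "alg \<AA>" "alg \<BB>" "ahom \<AA> \<BB> f"
  shows "arr_of \<AA> \<BB> f \<in> Hom \<A> \<AA> \<BB>" "U (arr_of \<AA> \<BB> f) = f"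
proof -
  obtain \<phi> where "\<phi> \<in> Hom \<A> \<AA> \<BB>" "U \<phi> = f" by (rule U_full[OF assms])
  hence "\<exists>!\<phi>. \<phi> \<in> Hom \<A> \<AA> \<BB> \<and> U \<phi> = f" using U_faithful by (intro ex1I[of _ \<phi>]) auto
  from theI'[OF this] show "arr_of \<AA> \<BB> f \<in> Hom \<A> \<AA> \<BB>" "U (arr_of \<AA> \<BB> f) = f" unfolding arr_of_def by blast+
qed

end

context convenient_base
begin

lemma algebra_pairing:
  assumes "alg \<AA>" "alg \<BB>" "alg \<CC>" "ahom \<CC> \<AA> f" "ahom \<CC> \<BB> g"
  obtains \<QQ> p q h where "alg \<QQ>" "ahom \<QQ> \<AA> p" "ahom \<QQ> \<BB> q" "ahom \<CC> \<QQ> h" "p \<cdot> h = f" "q \<cdot> h = g"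
    "\<And>W u v. u \<in> Hom V W (fst \<QQ>) \<Longrightarrow> v \<in> Hom V W (fst \<QQ>) \<Longrightarrow> p \<cdot> u = p \<cdot> v \<Longrightarrow> q \<cdot> u = q \<cdot> v \<Longrightarrow> u = v"
proof -
  let ?E = "\<lambda>b. if b then \<AA> else \<BB>" and ?I = "UNIV :: bool set"
  have sI: "small \<kappa> ?I" by (rule small_finite[OF inacc]) simp
  have E: "alg (?E b)" for b using assms by simp
  have fg: "ahom \<CC> (?E b) (if b then f else g)" for b using assms by simp
  show ?thesis
  proof (rule product_algebra[OF sI E])
    fix \<QQ> p assume Q: "alg \<QQ>" "is_product V ?I (\<lambda>b. fst (?E b)) (fst \<QQ>) p" "\<And>b. b \<in> ?I \<Longrightarrow> ahom \<QQ> (?E b) (p b)"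
    have ext: "u = v" if "u \<in> Hom V W (fst \<QQ>)" "v \<in> Hom V W (fst \<QQ>)" "p True \<cdot> u = p True \<cdot> v" "p False \<cdot> u = p False \<cdot> v" for W u v
    proof (rule product_ext[OF Q(2) that(1,2)])
      show "p b \<cdot> u = p b \<cdot> v" for b using that(3,4) by (cases b) simp_all
    qed
    show thesis
    proof (rule product_ahom[OF Q E assms(3) fg])
      fix h assume h: "ahom \<CC> \<QQ> h" "\<And>b. b \<in> ?I \<Longrightarrow> p b \<cdot> h = (if b then f else g)"
      show thesis
        by (intro that[OF Q(1) _ _ _ _ _ ext, of "p True" "p False" h])
          (use Q(3)[of True] Q(3)[of False] h(1) h(2)[of True] h(2)[of False] in simp_all)
    qed
  qed
qed

text \<open>\<open>pres\<close> speaks of diagrams and colimits in the category \<A>, whereas the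
  data here are homomorphisms as arrows of \<open>V\<close>. The bijection between the arrows of
  \<A> and homomorphisms, given by \<open>U\<close> and \<open>arr_of\<close>, translates in both
  directions.\<close>

lemma forget_directed_colimit:
  assumes pres: "forget_preserves_colimits_of_injections \<kappa> \<mu> V P T J"
    and R: "directed_poset \<kappa> \<mu> R" and E: "\<And>i. i \<in> Field R \<Longrightarrow> alg (E i)"
    and d: "\<And>i j. (i, j) \<in> R \<Longrightarrow> ahom (E i) (E j) (d i j)" and dI: "\<And>i j. (i, j) \<in> R \<Longrightarrow> d i j \<in> Inj V"
    and d_id: "\<And>i. i \<in> Field R \<Longrightarrow> d i i = Idn V (fst (E i))"
    and d_comp: "\<And>i j k. (i, j) \<in> R \<Longrightarrow> (j, k) \<in> R \<Longrightarrow> d j k \<cdot> d i j = d i k"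
    and C: "alg \<CC>" and c: "\<And>i. i \<in> Field R \<Longrightarrow> ahom (E i) \<CC> (c i)" and c_nat: "\<And>i j. (i, j) \<in> R \<Longrightarrow> c j \<cdot> d i j = c i"
    and univ: "\<And>\<QQ> q. alg \<QQ> \<Longrightarrow> (\<And>i. i \<in> Field R \<Longrightarrow> ahom (E i) \<QQ> (q i)) \<Longrightarrow> (\<And>i j. (i, j) \<in> R \<Longrightarrow> q j \<cdot> d i j = q i) \<Longrightarrow>
       \<exists>!h. ahom \<CC> \<QQ> h \<and> (\<forall>i \<in> Field R. h \<cdot> c i = q i)"
  shows "is_functor (poset_cat R) V \<lparr>FOb = (\<lambda>i. fst (E i)), FAr = (\<lambda>x. d (fst x) (snd x))\<rparr>"
    and "is_colimit V (poset_cat R) \<lparr>FOb = (\<lambda>i. fst (E i)), FAr = (\<lambda>x. d (fst x) (snd x))\<rparr> (fst \<CC>) c"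
proof -
  let ?D = "\<lparr>FOb = (\<lambda>i. fst (E i)), FAr = (\<lambda>x. d (fst x) (snd x))\<rparr>"
  define \<delta> where "\<delta> x = arr_of (E (fst x)) (E (snd x)) (d (fst x) (snd x))" for x
  let ?G = "\<lparr>FOb = E, FAr = \<delta>\<rparr>"
  have RF: "fst x \<in> Field R" "snd x \<in> Field R" if "x \<in> R" for x using Field_pair[OF that] by blast+
  have del: "\<delta> x \<in> Hom \<A> (E (fst x)) (E (snd x))" "U (\<delta> x) = d (fst x) (snd x)" if "x \<in> R" for x
    unfolding \<delta>_def using arr_of[OF E[OF RF(1)[OF that]] E[OF RF(2)[OF that]] d] that by (cases x; simp)+
  have G: "is_functor (poset_cat R) \<A> ?G"
    unfolding is_functor_def
  proof (intro conjI ballI impI)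
    show "category (poset_cat R)" by (rule directed_poset_category[OF R])
    show "category \<A>" by (rule category_A)
    fix i assume "i \<in> Obj (poset_cat R)"
    hence i: "i \<in> Field R" by simp
    show "FOb ?G i \<in> Obj \<A>" using E[OF i] by simp
    have ii: "(i, i) \<in> R" by (rule directed_posetD(1)[OF R i])
    have "\<delta> (i, i) = Idn \<A> (E i)"
      by (rule U_faithful[OF _ Idn_A(1)[OF E[OF i]]]) (use del[OF ii] Idn_A(2)[OF E[OF i]] d_id[OF i] in \<open>simp_all del: Hom_iff\<close>)
    thus "FAr ?G (Idn (poset_cat R) i) = Idn \<A> (FOb ?G i)" by simp
  next
    fix x assume "x \<in> Arr (poset_cat R)"
    thus "FAr ?G x \<in> Hom \<A> (FOb ?G (Dom (poset_cat R) x)) (FOb ?G (Cod (poset_cat R) x))"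
      using del(1)[of x] by (simp del: Hom_iff)
  next
    fix x y assume "x \<in> Arr (poset_cat R)" "y \<in> Arr (poset_cat R)" "Dom (poset_cat R) y = Cod (poset_cat R) x"
    then obtain i j k where xy: "x = (i, j)" "y = (j, k)" "(i, j) \<in> R" "(j, k) \<in> R" by (cases x; cases y; simp)
    have ik: "(i, k) \<in> R" by (rule directed_posetD(2)[OF R xy(3,4)])
    have h1: "\<delta> (i, j) \<in> Hom \<A> (E i) (E j)" "\<delta> (j, k) \<in> Hom \<A> (E j) (E k)" "\<delta> (i, k) \<in> Hom \<A> (E i) (E k)"
      using del(1)[OF xy(3)] del(1)[OF xy(4)] del(1)[OF ik] by (simp_all del: Hom_iff)
    have "\<delta> (i, k) = \<delta> (j, k) \<cdot>\<^bsub>\<A>\<^esub> \<delta> (i, j)"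
    proof (rule U_faithful[OF h1(3) Cmp_A(1)[OF h1(1,2)]])
      show "U (\<delta> (i, k)) = U (\<delta> (j, k) \<cdot>\<^bsub>\<A>\<^esub> \<delta> (i, j))"
        unfolding Cmp_A(2)[OF h1(1,2)] del(2)[OF xy(3)] del(2)[OF xy(4)] del(2)[OF ik] using d_comp[OF xy(3,4)] by simp
    qed
    thus "FAr ?G (y \<cdot>\<^bsub>poset_cat R\<^esub> x) = FAr ?G y \<cdot>\<^bsub>\<A>\<^esub> FAr ?G x" by (simp add: xy)
  qed
  define \<gamma> where "\<gamma> i = arr_of (E i) \<CC> (c i)" for i
  have gam: "\<gamma> i \<in> Hom \<A> (E i) \<CC>" "U (\<gamma> i) = c i" if "i \<in> Field R" for i
    unfolding \<gamma>_def by (rule arr_of[OF E[OF that] C c[OF that]])+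
  have col: "is_colimit \<A> (poset_cat R) ?G \<CC> \<gamma>"
    unfolding is_colimit_def
  proof (intro conjI allI impI)
    show "cocone \<A> (poset_cat R) ?G \<CC> \<gamma>"
      unfolding cocone_def
    proof (intro conjI ballI)
      show "\<CC> \<in> Obj \<A>" using C by simp
      show "\<gamma> i \<in> Hom \<A> (FOb ?G i) \<CC>" if "i \<in> Obj (poset_cat R)" for i using gam(1)[of i] that by (simp del: Hom_iff)
      fix x assume "x \<in> Arr (poset_cat R)"
      hence x: "x \<in> R" by simp
      have "\<gamma> (snd x) \<cdot>\<^bsub>\<A>\<^esub> \<delta> x = \<gamma> (fst x)"
        by (rule U_faithful[OF Cmp_A(1)[OF del(1)[OF x] gam(1)[OF RF(2)[OF x]]] gam(1)[OF RF(1)[OF x]]])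
          (use Cmp_A(2)[OF del(1)[OF x] gam(1)[OF RF(2)[OF x]]] gam(2)[OF RF(1)[OF x]] gam(2)[OF RF(2)[OF x]] del(2)[OF x] c_nat[of "fst x" "snd x"] x in simp)
      thus "\<gamma> (Cod (poset_cat R) x) \<cdot>\<^bsub>\<A>\<^esub> FAr ?G x = \<gamma> (Dom (poset_cat R) x)" by simp
    qed
    fix \<QQ> \<theta> assume co: "cocone \<A> (poset_cat R) ?G \<QQ> \<theta>"
    have Q: "alg \<QQ>" and th: "\<And>i. i \<in> Field R \<Longrightarrow> \<theta> i \<in> Hom \<A> (E i) \<QQ>"
      and th_nat: "\<And>x. x \<in> R \<Longrightarrow> \<theta> (snd x) \<cdot>\<^bsub>\<A>\<^esub> \<delta> x = \<theta> (fst x)"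
      using co unfolding cocone_def by (simp_all del: Hom_iff)
    have Uth: "U (\<theta> j) \<cdot> d i j = U (\<theta> i)" if ij: "(i, j) \<in> R" for i j
      using Cmp_A(2)[OF del(1)[OF ij] th[of "snd (i, j)"]] th_nat[OF ij] del(2)[OF ij] RF[OF ij] by simp
    have "\<exists>!h. ahom \<CC> \<QQ> h \<and> (\<forall>i \<in> Field R. h \<cdot> c i = U (\<theta> i))"
      by (rule univ[OF Q U_ahom[OF th] Uth])
    then obtain h where h: "ahom \<CC> \<QQ> h" "\<And>i. i \<in> Field R \<Longrightarrow> h \<cdot> c i = U (\<theta> i)"
      and h_uniq: "\<And>h'. ahom \<CC> \<QQ> h' \<Longrightarrow> (\<And>i. i \<in> Field R \<Longrightarrow> h' \<cdot> c i = U (\<theta> i)) \<Longrightarrow> h' = h" by blast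
    note H = arr_of[OF C Q h(1)]
    show "\<exists>!h. h \<in> Hom \<A> \<CC> \<QQ> \<and> (\<forall>j \<in> Obj (poset_cat R). h \<cdot>\<^bsub>\<A>\<^esub> \<gamma> j = \<theta> j)"
    proof (rule ex1I[of _ "arr_of \<CC> \<QQ> h"], intro conjI ballI)
      show "arr_of \<CC> \<QQ> h \<in> Hom \<A> \<CC> \<QQ>" by (rule H(1))
      fix j assume "j \<in> Obj (poset_cat R)"
      hence j: "j \<in> Field R" by simp
      show "arr_of \<CC> \<QQ> h \<cdot>\<^bsub>\<A>\<^esub> \<gamma> j = \<theta> j"
        by (rule U_faithful[OF Cmp_A(1)[OF gam(1)[OF j] H(1)] th[OF j]])
          (simp only: Cmp_A(2)[OF gam(1)[OF j] H(1)] H(2) gam(2)[OF j] h(2)[OF j])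
    next
      fix k assume k: "k \<in> Hom \<A> \<CC> \<QQ> \<and> (\<forall>j \<in> Obj (poset_cat R). k \<cdot>\<^bsub>\<A>\<^esub> \<gamma> j = \<theta> j)"
      hence kH: "k \<in> Hom \<A> \<CC> \<QQ>" by blast
      have "U k = h"
      proof (rule h_uniq[OF U_ahom[OF kH]])
        fix i assume i: "i \<in> Field R"
        have "k \<cdot>\<^bsub>\<A>\<^esub> \<gamma> i = \<theta> i" using k i by (simp del: Hom_iff)
        thus "U k \<cdot> c i = U (\<theta> i)" using Cmp_A(2)[OF gam(1)[OF i] kH] gam(2)[OF i] by simp
      qed
      thus "k = arr_of \<CC> \<QQ> h" by (intro U_faithful[OF kH H(1)]) (simp only: H(2))
    qed
  qed
  have "\<delta> x \<in> {f \<in> Arr \<A>. U f \<in> Inj V}" if "x \<in> R" for x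
    using del[OF that] dI[of "fst x" "snd x"] that by simp
  hence "directed_diagram_in \<kappa> \<mu> \<A> {f \<in> Arr \<A>. U f \<in> Inj V} R ?G"
    unfolding directed_diagram_in_def using R G by simp
  from pres[unfolded forget_preserves_colimits_of_injections_def, rule_format, OF this] col
  have img: "is_colimit V (poset_cat R) (func_comp (forget\<^sub>0 V P T) ?G) (fst \<CC>) (\<lambda>j. U (\<gamma> j))"
    unfolding preserves_colimits_of_def FOb_U by blast
  have agree: "FOb (func_comp (forget\<^sub>0 V P T) ?G) i = FOb ?D i" "x \<in> R \<Longrightarrow> FAr (func_comp (forget\<^sub>0 V P T) ?G) x = FAr ?D x" for i x
    by (simp_all add: func_comp_def del(2))
  show "is_functor (poset_cat R) V ?D"
    unfolding is_functor_def
  proof (intro conjI ballI impI)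
    show "category (poset_cat R)" by (rule directed_poset_category[OF R])
    show "category V" by (rule category_axioms)
    show "FOb ?D i \<in> Obj V" "FAr ?D (Idn (poset_cat R) i) = Idn V (FOb ?D i)" if "i \<in> Obj (poset_cat R)" for i
      using that E d_id by simp_all
    show "FAr ?D x \<in> Hom V (FOb ?D (Dom (poset_cat R) x)) (FOb ?D (Cod (poset_cat R) x))" if "x \<in> Arr (poset_cat R)" for x
      using ahom_Hom[OF d, of "fst x" "snd x"] that by simp
    show "FAr ?D (y \<cdot>\<^bsub>poset_cat R\<^esub> x) = FAr ?D y \<cdot> FAr ?D x"
      if "x \<in> Arr (poset_cat R)" "y \<in> Arr (poset_cat R)" "Dom (poset_cat R) y = Cod (poset_cat R) x" for x y
      using that d_comp[of "fst x" "snd x" "snd y"] by (cases x; cases y; simp)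
  qed
  have coc: "cocone V (poset_cat R) (func_comp (forget\<^sub>0 V P T) ?G) Q' \<iota>' = cocone V (poset_cat R) ?D Q' \<iota>'" for Q' \<iota>'
    unfolding cocone_def using agree by (simp del: Hom_iff)
  have "cocone V (poset_cat R) ?D (fst \<CC>) c"
    unfolding cocone_def using C ahom_Hom[OF c] c_nat by (simp del: Hom_iff)
  moreover have "\<exists>!h. h \<in> Hom V (fst \<CC>) Q' \<and> (\<forall>j \<in> Obj (poset_cat R). h \<cdot> c j = \<iota>' j)" if "cocone V (poset_cat R) ?D Q' \<iota>'" for Q' \<iota>'
    using img that coc gam(2) unfolding is_colimit_def by (simp del: Hom_iff)
  ultimately show "is_colimit V (poset_cat R) ?D (fst \<CC>) c" unfolding is_colimit_def by blast
qed

end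

text \<open>\<open>G\<close> and \<open>ut\<close> are the free algebras of the adjunction in which
  equations are written, and are kept apart from those of the adjunction that exhibits the theory.
  The closure conditions on \<open>L\<close> are phrased through underlying arrows of
  \<open>V\<close>.\<close>

locale birkhoff_class = convenient_base V \<kappa> \<X> P T J F \<eta> \<epsilon> lam \<mu>
  for V :: "('o, 'a) smc" (structure) and \<kappa> :: "'a rel" and \<X> :: "'o set" and P :: "'o set"
    and T :: "('o, 'o, 'a) vcat" and J :: "('o, 'o, 'a) vfun"
    and F :: "('o, ('o, 'a) alg, 'a) vfun" and \<eta> :: "'o \<Rightarrow> 'a" and \<epsilon> :: "('o, 'a) alg \<Rightarrow> 'a" and lam :: "'l rel"
    and \<mu> :: "'m rel" +
  fixes G :: "'o \<Rightarrow> ('o, 'a) alg" and ut :: "'o \<Rightarrow> 'a" and L :: "('o, 'a) alg set"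
  assumes G_alg: "X \<in> Obj V \<Longrightarrow> alg (G X)" and ut: "X \<in> Obj V \<Longrightarrow> ut X \<in> Hom V X (fst (G X))"
    and G_ex: "alg \<AA> \<Longrightarrow> f \<in> Hom V X (fst \<AA>) \<Longrightarrow> \<exists>h. ahom (G X) \<AA> h \<and> h \<cdot> ut X = f"
    and G_unique: "alg \<AA> \<Longrightarrow> X \<in> Obj V \<Longrightarrow> ahom (G X) \<AA> h \<Longrightarrow> ahom (G X) \<AA> k \<Longrightarrow> h \<cdot> ut X = k \<cdot> ut X \<Longrightarrow> h = k"
    and L_alg: "\<BB> \<in> L \<Longrightarrow> alg \<BB>"
    and L_prod: "small \<kappa> (I :: 'a set) \<Longrightarrow> (\<And>i. i \<in> I \<Longrightarrow> E i \<in> L) \<Longrightarrow> alg \<QQ> \<Longrightarrow>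
      is_product V I (\<lambda>i. fst (E i)) (fst \<QQ>) p \<Longrightarrow> (\<And>i. i \<in> I \<Longrightarrow> ahom \<QQ> (E i) (p i)) \<Longrightarrow> \<QQ> \<in> L"
    and L_sub: "alg \<AA> \<Longrightarrow> \<BB> \<in> L \<Longrightarrow> ahom \<AA> \<BB> m \<Longrightarrow> mono_arrow V m \<Longrightarrow> \<AA> \<in> L"
begin

text \<open>\<BB> is the largest quotient in \<open>L\<close> of the free algebra on
  \<open>X\<close>, and \<open>b\<close> is the image of the generators. The last clause goes beyond
  a reflection into \<open>L\<close>: the target \<AA> is an arbitrary algebra, and \<open>h\<close>
  is only required to identify the pairs of points that all homomorphisms into \<open>L\<close>
  identify.\<close>

definition reflection :: "'o \<Rightarrow> ('o, 'a) alg \<Rightarrow> 'a \<Rightarrow> bool" where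
  "reflection X \<BB> b \<longleftrightarrow> \<BB> \<in> L \<and> b \<in> Hom V X (fst \<BB>) \<and>
    (\<forall>\<AA> f g. alg \<AA> \<longrightarrow> ahom \<BB> \<AA> f \<longrightarrow> ahom \<BB> \<AA> g \<longrightarrow> f \<cdot> b = g \<cdot> b \<longrightarrow> f = g) \<and>
    (\<forall>\<AA> h. alg \<AA> \<longrightarrow> ahom (G X) \<AA> h \<longrightarrow>
      (\<forall>u \<in> Hom V II (fst (G X)). \<forall>v \<in> Hom V II (fst (G X)).
        (\<forall>\<BB>' \<in> L. \<forall>h'. ahom (G X) \<BB>' h' \<longrightarrow> h' \<cdot> u = h' \<cdot> v) \<longrightarrow> h \<cdot> u = h \<cdot> v) \<longrightarrow>
      (\<exists>k. ahom \<BB> \<AA> k \<and> k \<cdot> b = h \<cdot> ut X))"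

text \<open>\<BB> is the image of the free algebra in the product of its quotients in
  \<open>L\<close>, so closure under products and subalgebras puts it in \<open>L\<close>. The
  delicate clause is the last one, where an inclusion of kernels has to produce a
  homomorphism.\<close>

lemma reflection_exists:
  assumes X: "X \<in> Obj V"
  shows "\<exists>\<BB> b. reflection X \<BB> b"
proof (rule quotient_refinement[OF X, of "\<lambda>\<BB> e. \<BB> \<in> L"])
  fix I :: "'a set" and Bs es \<QQ> p \<BB> e m
  assume I: "small \<kappa> I" and Bs: "\<And>i. i \<in> I \<Longrightarrow> alg (Bs i)" "\<And>i. i \<in> I \<Longrightarrow> Bs i \<in> L"
    and Q: "alg \<QQ>" "is_product V I (\<lambda>i. fst (Bs i)) (fst \<QQ>) p" "\<And>i. i \<in> I \<Longrightarrow> ahom \<QQ> (Bs i) (p i)"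
    and B: "alg \<BB>" "ahom (Fo X) \<BB> e" "e \<in> Surj V" "ahom \<BB> \<QQ> m" "m \<in> Inj V" and pme: "\<And>i. i \<in> I \<Longrightarrow> p i \<cdot> (m \<cdot> e) = es i"
    and univ: "\<And>\<CC> c. alg \<CC> \<Longrightarrow> ahom (Fo X) \<CC> c \<Longrightarrow> c \<in> Surj V \<Longrightarrow> \<CC> \<in> L \<Longrightarrow> \<exists>j. ahom \<BB> \<CC> j \<and> j \<cdot> e = c"
  note eH = ahom_simps[OF B(2)] and FX = Fo_alg[OF X] and GX = G_alg[OF X]
  have BL: "\<BB> \<in> L" by (rule L_sub[OF B(1) L_prod[OF I Bs(2) Q] B(4) Inj_mono[OF B(5)]])
  \<comment> \<open>The comparison of the two free algebras on \<open>X\<close>: quotients are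
    formed of \<open>Fo X\<close>, while the pairs of points in \<open>reflection\<close> belong to
    \<open>G X\<close>.\<close>
  obtain \<psi> where psi: "ahom (Fo X) (G X) \<psi>" "\<psi> \<cdot> et X = ut X" using free_extension[OF GX ut[OF X]] by blast
  note psiH = ahom_simps[OF psi(1)]
  \<comment> \<open>A homomorphism from \<open>G X\<close> into a member of \<open>L\<close>,
    composed with \<psi>, has its image in \<open>L\<close> and so factors through \<open>e\<close>.
    Hence points identified by \<open>e\<close> are identified by every such homomorphism, and then
    by \<open>h\<close> after \<psi>.\<close>
  have kernel: "(h \<cdot> \<psi>) \<cdot> u = (h \<cdot> \<psi>) \<cdot> v"
    if A: "alg \<AA>" and h: "ahom (G X) \<AA> h"
      and valid: "\<forall>u \<in> Hom V II (fst (G X)). \<forall>v \<in> Hom V II (fst (G X)).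
        (\<forall>\<BB>' \<in> L. \<forall>h'. ahom (G X) \<BB>' h' \<longrightarrow> h' \<cdot> u = h' \<cdot> v) \<longrightarrow> h \<cdot> u = h \<cdot> v"
      and u: "u \<in> Hom V II (TT X)" and v: "v \<in> Hom V II (TT X)" and uv: "e \<cdot> u = e \<cdot> v" for \<AA> h u v
  proof -
    have "h' \<cdot> (\<psi> \<cdot> u) = h' \<cdot> (\<psi> \<cdot> v)" if B': "\<BB>' \<in> L" and h': "ahom (G X) \<BB>' h'" for \<BB>' h'
    proof -
      note AB' = L_alg[OF B'] and h'H = ahom_simps[OF h']
      have hp: "ahom (Fo X) \<BB>' (h' \<cdot> \<psi>)" by (rule ahom_comp[OF psi(1) h' FX])
      obtain \<WW> e' m' where W: "alg \<WW>" "ahom (Fo X) \<WW> e'" "ahom \<WW> \<BB>' m'" "e' \<in> Surj V" "m' \<in> Inj V" "h' \<cdot> \<psi> = m' \<cdot> e'"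
        by (rule ahom_factorize[OF FX AB' hp])
      have "\<WW> \<in> L" by (rule L_sub[OF W(1) B' W(3) Inj_mono[OF W(5)]])
      then obtain j where j: "ahom \<BB> \<WW> j" "j \<cdot> e = e'" using univ[OF W(1,2,4)] by blast
      have *: "h' \<cdot> (\<psi> \<cdot> w) = m' \<cdot> (j \<cdot> (e \<cdot> w))" if "w \<in> Hom V II (TT X)" for w
      proof -
        have "h' \<cdot> (\<psi> \<cdot> w) = (m' \<cdot> e') \<cdot> w" by (rule Cmp_reduce[OF W(6)]) (use that h'H psiH in simp_all)
        also have "\<dots> = m' \<cdot> ((j \<cdot> e) \<cdot> w)" unfolding j(2) using ahom_simps[OF W(2)] ahom_simps[OF W(3)] that by simp
        finally show ?thesis using ahom_simps[OF j(1)] eH that by simp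
      qed
      show ?thesis unfolding *[OF u] *[OF v] uv ..
    qed
    hence "h \<cdot> (\<psi> \<cdot> u) = h \<cdot> (\<psi> \<cdot> v)"
      using valid[rule_format, of "\<psi> \<cdot> u" "\<psi> \<cdot> v"] u v psiH by simp
    thus ?thesis using ahom_simps[OF h] psiH u v by simp
  qed
  have ext: "f = g" if "alg \<AA>" "ahom \<BB> \<AA> f" "ahom \<BB> \<AA> g" "f \<cdot> (e \<cdot> et X) = g \<cdot> (e \<cdot> et X)" for \<AA> f g
  proof (rule Surj_cancel[OF B(3)])
    note fH = ahom_simps[OF that(2)] and gH = ahom_simps[OF that(3)]
    show "f \<cdot> e = g \<cdot> e"
      by (rule free_unique[OF that(1) X ahom_comp[OF B(2) that(2) FX] ahom_comp[OF B(2) that(3) FX]])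
        (use that(4) fH gH eH X in simp)
    show "f \<in> Hom V (Cod V e) (fst \<AA>)" "g \<in> Hom V (Cod V e) (fst \<AA>)" using fH gH eH by simp_all
  qed
  have fac: "\<exists>k. ahom \<BB> \<AA> k \<and> k \<cdot> (e \<cdot> et X) = h \<cdot> ut X"
    if A: "alg \<AA>" and h: "ahom (G X) \<AA> h"
      and valid: "\<forall>u \<in> Hom V II (fst (G X)). \<forall>v \<in> Hom V II (fst (G X)).
        (\<forall>\<BB>' \<in> L. \<forall>h'. ahom (G X) \<BB>' h' \<longrightarrow> h' \<cdot> u = h' \<cdot> v) \<longrightarrow> h \<cdot> u = h \<cdot> v" for \<AA> h
  proof -
    note hH = ahom_simps[OF h]
    have hp: "ahom (Fo X) \<AA> (h \<cdot> \<psi>)" by (rule ahom_comp[OF psi(1) h FX])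
    show ?thesis
    proof (rule algebra_pairing[OF B(1) A FX B(2) hp])
      fix \<RR> r q h1 assume R: "alg \<RR>" "ahom \<RR> \<BB> r" "ahom \<RR> \<AA> q" "ahom (Fo X) \<RR> h1" "r \<cdot> h1 = e" "q \<cdot> h1 = h \<cdot> \<psi>"
        and R_ext: "\<And>W u v. u \<in> Hom V W (fst \<RR>) \<Longrightarrow> v \<in> Hom V W (fst \<RR>) \<Longrightarrow> r \<cdot> u = r \<cdot> v \<Longrightarrow> q \<cdot> u = q \<cdot> v \<Longrightarrow> u = v"
      note rH = ahom_simps[OF R(2)] and qH = ahom_simps[OF R(3)] and h1H = ahom_simps[OF R(4)]
      obtain \<CC> c n where C: "alg \<CC>" "ahom (Fo X) \<CC> c" "ahom \<CC> \<RR> n" "c \<in> Surj V" "n \<in> Inj V" "h1 = n \<cdot> c"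
        by (rule ahom_factorize[OF FX R(1,4)])
      note cH = ahom_simps[OF C(2)] and nH = ahom_simps[OF C(3)]
      have rnc: "r \<cdot> (n \<cdot> (c \<cdot> a)) = e \<cdot> a" "q \<cdot> (n \<cdot> (c \<cdot> a)) = (h \<cdot> \<psi>) \<cdot> a" "n \<cdot> (c \<cdot> a) = h1 \<cdot> a" if "a \<in> Hom V W (TT X)" for a W
      proof -
        show na: "n \<cdot> (c \<cdot> a) = h1 \<cdot> a" by (rule Cmp_reduce[OF C(6)[symmetric]]) (use that cH nH in simp_all)
        show "r \<cdot> (n \<cdot> (c \<cdot> a)) = e \<cdot> a" unfolding na by (rule Cmp_reduce[OF R(5)]) (use that rH h1H in simp_all)
        show "q \<cdot> (n \<cdot> (c \<cdot> a)) = (h \<cdot> \<psi>) \<cdot> a" unfolding na by (rule Cmp_reduce[OF R(6)]) (use that qH h1H in simp_all)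
      qed
      have lift: "\<exists>a \<in> Hom V II (TT X). c \<cdot> a = w" if "w \<in> Hom V II (fst \<CC>)" for w
        using C(4) cH that unfolding Surj_def by simp
      \<comment> \<open>Points of \<CC> lift along the surjection \<open>c\<close> to the free
        algebra, where \<open>kernel\<close> applies: equal coordinates in \<BB> force equal
        coordinates in \<AA>.\<close>
      have pts: "w = w'" if w: "w \<in> Hom V II (fst \<CC>)" "w' \<in> Hom V II (fst \<CC>)" and eq: "r \<cdot> (n \<cdot> w) = r \<cdot> (n \<cdot> w')" for w w'
      proof -
        obtain a where a: "a \<in> Hom V II (TT X)" "c \<cdot> a = w" using lift[OF w(1)] by blast
        obtain a' where a': "a' \<in> Hom V II (TT X)" "c \<cdot> a' = w'" using lift[OF w(2)] by blast
        have ea: "e \<cdot> a = e \<cdot> a'" using rnc(1)[OF a(1)] rnc(1)[OF a'(1)] eq unfolding a(2) a'(2) by simp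
        have "q \<cdot> (n \<cdot> w) = q \<cdot> (n \<cdot> w')"
          using rnc(2)[OF a(1)] rnc(2)[OF a'(1)] kernel[OF A h valid a(1) a'(1) ea] unfolding a(2) a'(2) by simp
        hence "n \<cdot> w = n \<cdot> w'" by (intro R_ext[OF _ _ eq, of II]) (use w nH in simp_all)
        thus ?thesis by (rule Inj_cancel[OF C(5), of _ _ II]) (use w nH in simp_all)
      qed
      have mono: "mono_arrow V (r \<cdot> n)"
        unfolding mono_arrow_def
      proof (intro conjI allI ballI impI)
        show "r \<cdot> n \<in> Arr V" using rH nH by simp
        fix W u v assume uv: "u \<in> Hom V W (Dom V (r \<cdot> n))" "v \<in> Hom V W (Dom V (r \<cdot> n))" and eq: "(r \<cdot> n) \<cdot> u = (r \<cdot> n) \<cdot> v"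
        have uH: "u \<in> Hom V W (fst \<CC>)" "v \<in> Hom V W (fst \<CC>)" using uv rH nH by simp_all
        show "u = v"
        proof (rule pt_ext[OF uH])
          fix x assume x: "x \<in> Hom V II W"
          show "u \<cdot> x = v \<cdot> x"
          proof (rule pts)
            have "r \<cdot> (n \<cdot> (u \<cdot> x)) = ((r \<cdot> n) \<cdot> u) \<cdot> x" "r \<cdot> (n \<cdot> (v \<cdot> x)) = ((r \<cdot> n) \<cdot> v) \<cdot> x" using rH nH uH x by simp_all
            thus "r \<cdot> (n \<cdot> (u \<cdot> x)) = r \<cdot> (n \<cdot> (v \<cdot> x))" unfolding eq by simp
          qed (use uH x in simp_all)
        qed
      qed
      \<comment> \<open>As a quotient of the free algebra that lies in \<open>L\<close>, \<CC>
        receives a homomorphism from \<BB>; followed by the projection to \<AA> this is the required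
        factorization.\<close>
      have "\<CC> \<in> L" by (rule L_sub[OF C(1) BL ahom_comp[OF C(3) R(2) C(1)] mono])
      then obtain j where j: "ahom \<BB> \<CC> j" "j \<cdot> e = c" using univ[OF C(1,2,4)] by blast
      note jH = ahom_simps[OF j(1)]
      have et_H: "et X \<in> Hom V X (TT X)" by (rule et_Hom[OF X])
      have "(q \<cdot> (n \<cdot> j)) \<cdot> (e \<cdot> et X) = q \<cdot> (n \<cdot> ((j \<cdot> e) \<cdot> et X))" using qH nH jH eH X by simp
      also have "\<dots> = (h \<cdot> \<psi>) \<cdot> et X" unfolding j(2) by (rule rnc(2)[OF et_H])
      also have "\<dots> = h \<cdot> (\<psi> \<cdot> et X)" using hH psiH X by simp
      finally have "(q \<cdot> (n \<cdot> j)) \<cdot> (e \<cdot> et X) = h \<cdot> ut X" unfolding psi(2) .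
      moreover have "ahom \<BB> \<AA> (q \<cdot> (n \<cdot> j))" by (rule ahom_comp[OF ahom_comp[OF j(1) C(3) B(1)] R(3) B(1)])
      ultimately show ?thesis by blast
    qed
  qed
  have "reflection X \<BB> (e \<cdot> et X)"
    unfolding reflection_def
  proof (intro conjI allI impI)
    show "e \<cdot> et X \<in> Hom V X (fst \<BB>)" using eH X by simp
  qed (fact BL ext fac)+
  thus ?thesis by blast
qed

lemma reflection_ext:
  assumes "reflection X \<BB> b" "alg \<AA>" "ahom \<BB> \<AA> f" "ahom \<BB> \<AA> g" "f \<cdot> b = g \<cdot> b"
  shows "f = g"
  using assms unfolding reflection_def by blast

lemma reflection_into_class:
  assumes "X \<in> Obj V" "reflection X \<BB> b" "\<CC> \<in> L" "f \<in> Hom V X (fst \<CC>)"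
  obtains k where "ahom \<BB> \<CC> k" "k \<cdot> b = f"
proof -
  note C = L_alg[OF assms(3)]
  obtain h where h: "ahom (G X) \<CC> h" "h \<cdot> ut X = f" using G_ex[OF C assms(4)] by blast
  have "\<exists>k. ahom \<BB> \<CC> k \<and> k \<cdot> b = h \<cdot> ut X"
    by (rule assms(2)[unfolded reflection_def, THEN conjunct2, THEN conjunct2, THEN conjunct2, rule_format, OF C h(1)])
      (use assms(3) h(1) in blast)
  thus ?thesis using that h(2) by auto
qed

text \<open>The algebras \<open>\<BB> i\<close> need not be connected by injections. Replacing \<open>\<BB> i\<close> by the product \<open>\<DD> i\<close> of
  itself with all \<open>\<BB> k\<close> such that not \<open>i \<le> k\<close> makes every \<open>\<DD> i\<close> a retract of the product of the whole family.\<close>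

lemma colimit_of_products:
  assumes pres: "forget_preserves_colimits_of_injections \<kappa> \<mu> V P T J"
    and R: "directed_poset \<kappa> \<mu> R" and BL: "\<And>i. i \<in> Field R \<Longrightarrow> \<BB> i \<in> L"
    and \<delta>: "\<And>i j. (i, j) \<in> R \<Longrightarrow> ahom (\<BB> i) (\<BB> j) (\<delta> i j)" and \<delta>_id: "\<And>i. i \<in> Field R \<Longrightarrow> \<delta> i i = Idn V (fst (\<BB> i))"
    and \<delta>_comp: "\<And>i j k. (i, j) \<in> R \<Longrightarrow> (j, k) \<in> R \<Longrightarrow> \<delta> j k \<cdot> \<delta> i j = \<delta> i k"
    and A: "alg \<AA>" and \<beta>: "\<And>i. i \<in> Field R \<Longrightarrow> ahom (\<BB> i) \<AA> (\<beta> i)" and \<beta>_nat: "\<And>i j. (i, j) \<in> R \<Longrightarrow> \<beta> j \<cdot> \<delta> i j = \<beta> i"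
    and conn: "\<And>i k. i \<in> Field R \<Longrightarrow> k \<in> Field R \<Longrightarrow> Hom V (fst (\<BB> i)) (fst (\<BB> k)) \<noteq> {}"
  obtains \<CC> g \<sigma> where "\<CC> \<in> L" "ahom \<CC> \<AA> g" "\<And>i. i \<in> Field R \<Longrightarrow> \<sigma> i \<in> Hom V (fst (\<BB> i)) (fst \<CC>)"
    "\<And>i. i \<in> Field R \<Longrightarrow> g \<cdot> \<sigma> i = \<beta> i"
proof -
  \<comment> \<open>The index \<open>i\<close> satisfies \<open>(i, i) \<in> R\<close>, so it has to
    be added explicitly.\<close>
  define S where "S i = {k \<in> Field R. k = i \<or> (i, k) \<notin> R}" for i
  note sR = directed_posetD(3)[OF R]
  have RF: "i \<in> Field R" "j \<in> Field R" if "(i, j) \<in> R" for i j using that by (auto intro: FieldI1 FieldI2)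
  have Balg: "alg (\<BB> i)" if "i \<in> Field R" for i by (rule L_alg[OF BL[OF that]])
  have SS: "k \<in> Field R" if "k \<in> S i" for i k using that by (simp add: S_def)
  have Si: "i \<in> S i" if "i \<in> Field R" for i using that by (simp add: S_def)
  let ?prod = "\<lambda>I Q p. alg Q \<and> is_product V I (\<lambda>k. fst (\<BB> k)) (fst Q) p \<and> (\<forall>k \<in> I. ahom Q (\<BB> k) (p k))"
  have prods: "\<exists>Q p. ?prod I Q p" if "I \<subseteq> Field R" for I
  proof (rule product_algebra[of I \<BB>])
    show "small \<kappa> I" by (rule small_mono[OF sR that])
    show "\<And>i. i \<in> I \<Longrightarrow> alg (\<BB> i)" using Balg that by blast
  qed blast
  have prod_L: "Q \<in> L" if "?prod I Q p" "I \<subseteq> Field R" for I Q p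
    by (rule L_prod[OF small_mono[OF sR that(2)], of \<BB> Q p]) (use that BL in blast)+
  obtain Q q where Q: "?prod (Field R) Q q" using prods[of "Field R"] by blast
  note QL = prod_L[OF Q order.refl]
  have "\<forall>i. \<exists>x. ?prod (S i) (fst x) (snd x)"
  proof
    fix i
    have "S i \<subseteq> Field R" using SS by blast
    from prods[OF this] obtain D p where "?prod (S i) D p" by blast
    thus "\<exists>x. ?prod (S i) (fst x) (snd x)" by (intro exI[of _ "(D, p)"]) (unfold fst_conv snd_conv)
  qed
  then obtain x where x: "\<forall>i. ?prod (S i) (fst (x i)) (snd (x i))" by (rule choice[THEN exE])
  define D p where "D i = fst (x i)" and "p i = snd (x i)" for i
  have Dp: "alg (D i)" "is_product V (S i) (\<lambda>k. fst (\<BB> k)) (fst (D i)) (p i)" "k \<in> S i \<Longrightarrow> ahom (D i) (\<BB> k) (p i k)" for i k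
    using x[rule_format, of i] unfolding D_def p_def by blast+
  have qh: "ahom Q (\<BB> k) (q k)" if "k \<in> Field R" for k using Q that by blast
  have Qa: "alg Q" and Qp: "is_product V (Field R) (\<lambda>k. fst (\<BB> k)) (fst Q) q" using Q by blast+
  have pii: "ahom (D i) (\<BB> i) (p i i)" if "i \<in> Field R" for i by (rule Dp(3)[OF Si[OF that]])
  have "\<exists>r. ahom Q (D i) r \<and> (\<forall>k \<in> S i. p i k \<cdot> r = q k)" if "i \<in> Field R" for i
    by (rule product_ahom[OF Dp(1)[of i] Dp(2)[of i] Dp(3) Balg[OF SS] Qa qh[OF SS]]) blast+
  then obtain r where r: "\<And>i. i \<in> Field R \<Longrightarrow> ahom Q (D i) (r i)" "\<And>i k. i \<in> Field R \<Longrightarrow> k \<in> S i \<Longrightarrow> p i k \<cdot> r i = q k"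
    by metis
  \<comment> \<open>The coordinates of an embedding of \<open>D i\<close> into the full product
    \<open>Q\<close>: those above \<open>i\<close> are computed from the coordinate at
    \<open>i\<close> by the transition homomorphisms, the others are already present in
    \<open>D i\<close>.\<close>
  have coord: "ahom (D i) (\<BB> k) (if (i, k) \<in> R then \<delta> i k \<cdot> p i i else p i k)" if i: "i \<in> Field R" and k: "k \<in> Field R" for i k
  proof (cases "(i, k) \<in> R")
    case True
    show ?thesis using ahom_comp[OF pii[OF i] \<delta>[OF True] Dp(1)] True by simp
  next
    case False
    hence "k \<in> S i" using k by (simp add: S_def)
    from Dp(3)[OF this] show ?thesis using False by simp
  qed
  have "\<exists>m. ahom (D i) Q m \<and> (\<forall>k \<in> Field R. q k \<cdot> m = (if (i, k) \<in> R then \<delta> i k \<cdot> p i i else p i k))" if "i \<in> Field R" for i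
    by (rule product_ahom[OF Qa Qp qh Balg Dp(1)[of i] coord[OF that]]) blast+
  then obtain m where m: "\<And>i. i \<in> Field R \<Longrightarrow> ahom (D i) Q (m i)"
    and qm: "\<And>i k. i \<in> Field R \<Longrightarrow> k \<in> Field R \<Longrightarrow> q k \<cdot> m i = (if (i, k) \<in> R then \<delta> i k \<cdot> p i i else p i k)"
    by metis
  have mH: "m i \<in> Hom V (fst (D i)) (fst Q)" and rH: "r i \<in> Hom V (fst Q) (fst (D i))" if "i \<in> Field R" for i
    using ahom_Hom[OF m[OF that]] ahom_Hom[OF r(1)[OF that]] by blast+
  have pr: "p i k \<in> Hom V (fst (D i)) (fst (\<BB> k))" if "k \<in> S i" for i k by (rule ahom_Hom[OF Dp(3)[OF that]])
  have prm: "p j k \<cdot> (r j \<cdot> m i) = (if (i, k) \<in> R then \<delta> i k \<cdot> p i i else p i k)" if "i \<in> Field R" "j \<in> Field R" "k \<in> S j" for i j k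
    using Cmp_reduce[OF r(2)[OF that(2,3)], of "m i"] qm[OF that(1) SS[OF that(3)]] pr[OF that(3)] rH[OF that(2)] mH[OF that(1)] by simp
  have rm: "r i \<cdot> m i = Idn V (fst (D i))" if i: "i \<in> Field R" for i
  proof (rule product_ext[OF Dp(2)])
    show "r i \<cdot> m i \<in> Hom V (fst (D i)) (fst (D i))" using rH[OF i] mH[OF i] by simp
    show "Idn V (fst (D i)) \<in> Hom V (fst (D i)) (fst (D i))" using Dp(1)[of i] by simp
    fix k assume k: "k \<in> S i"
    have "(if (i, k) \<in> R then \<delta> i k \<cdot> p i i else p i k) = p i k"
      using k \<delta>_id[OF i] pr[OF Si[OF i]] by (auto simp: S_def)
    thus "p i k \<cdot> (r i \<cdot> m i) = p i k \<cdot> Idn V (fst (D i))" using prm[OF i i k] pr[OF k] by simp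
  qed
  \<comment> \<open>Embed into \<open>Q\<close>, then project. The equation
    \<open>m j \<cdot> d i j = m i\<close> proved below, with all \<open>m i\<close> split
    monomorphisms, makes these arrows injections and functorial in \<open>i\<close> and
    \<open>j\<close>.\<close>
  define d where "d i j = r j \<cdot> m i" for i j
  have dh: "ahom (D i) (D j) (d i j)" if "(i, j) \<in> R" for i j
    unfolding d_def by (rule ahom_comp[OF m[OF RF(1)[OF that]] r(1)[OF RF(2)[OF that]] Dp(1)])
  have dH: "d i j \<in> Hom V (fst (D i)) (fst (D j))" if "(i, j) \<in> R" for i j by (rule ahom_Hom[OF dh[OF that]])
  have pjd: "p j j \<cdot> d i j = \<delta> i j \<cdot> p i i" if "(i, j) \<in> R" for i j
    unfolding d_def using prm[OF RF(1)[OF that] RF(2)[OF that] Si[OF RF(2)[OF that]]] that by simp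
  have md: "m j \<cdot> d i j = m i" if ij: "(i, j) \<in> R" for i j
  proof (rule product_ext[OF Qp])
    note F = RF[OF ij]
    show "m j \<cdot> d i j \<in> Hom V (fst (D i)) (fst Q)" using mH[OF F(2)] dH[OF ij] by simp
    show "m i \<in> Hom V (fst (D i)) (fst Q)" by (rule mH[OF F(1)])
    fix k assume k: "k \<in> Field R"
    have red: "q k \<cdot> (m j \<cdot> d i j) = (if (j, k) \<in> R then \<delta> j k \<cdot> p j j else p j k) \<cdot> d i j"
      by (rule Cmp_reduce[OF qm[OF F(2) k]]) (use mH[OF F(2)] dH[OF ij] ahom_Hom[OF qh[OF k]] in simp_all)
    show "q k \<cdot> (m j \<cdot> d i j) = q k \<cdot> m i"
    proof (cases "(j, k) \<in> R")
      case True
      have ik: "(i, k) \<in> R" by (rule directed_posetD(2)[OF R ij True])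
      have "q k \<cdot> (m j \<cdot> d i j) = \<delta> j k \<cdot> (\<delta> i j \<cdot> p i i)"
        using red True pjd[OF ij] ahom_Hom[OF \<delta>[OF True]] pr[OF Si[OF F(2)]] dH[OF ij] by simp
      also have "\<dots> = \<delta> i k \<cdot> p i i"
        by (rule Cmp_reduce[OF \<delta>_comp[OF ij True]]) (use ahom_Hom[OF \<delta>[OF True]] ahom_Hom[OF \<delta>[OF ij]] pr[OF Si[OF F(1)]] in simp_all)
      finally show ?thesis using qm[OF F(1) k] ik by simp
    next
      case False
      hence "k \<in> S j" using k by (simp add: S_def)
      from prm[OF F(1,2) this] show ?thesis using red False qm[OF F(1) k] by (simp add: d_def)
    qed
  qed
  have mI: "m i \<in> Inj V" if "i \<in> Field R" for i by (rule Inj_split[OF mH[OF that] rH[OF that] rm[OF that]])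
  have dI: "d i j \<in> Inj V" if ij: "(i, j) \<in> R" for i j
    by (rule Inj_cancel_right[OF dH[OF ij] mI[OF RF(2)[OF ij]] mH[OF RF(2)[OF ij]]]) (use md[OF ij] mI[OF RF(1)[OF ij]] in simp)
  have d_id: "d i i = Idn V (fst (D i))" if "i \<in> Field R" for i unfolding d_def by (rule rm[OF that])
  have d_comp: "d j k \<cdot> d i j = d i k" if "(i, j) \<in> R" "(j, k) \<in> R" for i j k
    using md[OF that(1)] rH[OF RF(2)[OF that(2)]] mH[OF RF(1)[OF that(2)]] dH[OF that(1)]
    unfolding d_def[of j k] d_def[of i k] by simp
  show ?thesis
  proof (rule algebra_colimit[OF R Dp(1) dh])
    fix \<CC> c assume C: "alg \<CC>" and c: "\<And>i. i \<in> Field R \<Longrightarrow> ahom (D i) \<CC> (c i)" and c_nat: "\<And>i j. (i, j) \<in> R \<Longrightarrow> c j \<cdot> d i j = c i"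
      and univ: "\<And>\<QQ> q. alg \<QQ> \<Longrightarrow> (\<And>i. i \<in> Field R \<Longrightarrow> ahom (D i) \<QQ> (q i)) \<Longrightarrow> (\<And>i j. (i, j) \<in> R \<Longrightarrow> q j \<cdot> d i j = q i) \<Longrightarrow>
         \<exists>!h. ahom \<CC> \<QQ> h \<and> (\<forall>i \<in> Field R. h \<cdot> c i = q i)"
    let ?D = "\<lparr>FOb = (\<lambda>i. fst (D i)), FAr = (\<lambda>x. d (fst x) (snd x))\<rparr>"
    have col: "is_functor (poset_cat R) V ?D" "is_colimit V (poset_cat R) ?D (fst \<CC>) c"
      by (rule forget_directed_colimit[OF pres R Dp(1) dh dI d_id d_comp C c c_nat univ]; assumption)+
    \<comment> \<open>The \<open>m i\<close> form a cocone of injections under the diagram, and by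
      \<open>forget_directed_colimit\<close> the carrier of \<CC> is its colimit in
      \<open>V\<close>. Convenience then makes the induced arrow an injection, so \<CC> is a
      subalgebra of \<open>Q\<close>.\<close>
    have "\<exists>h. ahom \<CC> Q h \<and> (\<forall>i \<in> Field R. h \<cdot> c i = m i)"
      by (rule ex1_implies_ex, rule univ[OF Qa]) (erule m, erule md)
    then obtain h where h: "ahom \<CC> Q h" "\<forall>i \<in> Field R. h \<cdot> c i = m i" by (elim exE conjE)
    have diag: "directed_diagram_in \<kappa> \<mu> V (Inj V) R ?D"
      unfolding directed_diagram_in_def using R col(1) dI by simp
    have coc: "cocone V (poset_cat R) ?D (fst Q) m"
      unfolding cocone_def using Qa mH md by (simp del: Hom_iff)
    have "directed_diagram_in \<kappa> \<mu> V (Inj V) R ?D \<and> is_colimit V (poset_cat R) ?D (fst \<CC>) c" using diag col(2) by (rule conjI)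
    from convenient[unfolded convenient_system_def, THEN conjunct2, THEN spec, THEN spec, THEN spec, THEN spec, THEN mp, OF this,
        THEN conjunct2, THEN spec[of _ "fst Q"], THEN spec[of _ m], THEN spec[of _ h], THEN mp]
    have "h \<in> Inj V" using coc mI ahom_Hom[OF h(1)] h(2) by (simp del: Hom_iff)
    hence CL: "\<CC> \<in> L" by (rule L_sub[OF C QL h(1) Inj_mono])
    have \<rho>: "ahom (D i) \<AA> (\<beta> i \<cdot> p i i)" if "i \<in> Field R" for i by (rule ahom_comp[OF pii[OF that] \<beta>[OF that] Dp(1)])
    have \<rho>_nat: "(\<beta> j \<cdot> p j j) \<cdot> d i j = \<beta> i \<cdot> p i i" if ij: "(i, j) \<in> R" for i j
    proof -
      note F = RF[OF ij] and bH = ahom_simps[OF \<beta>[OF RF(2)[OF ij]]]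
      have "(\<beta> j \<cdot> p j j) \<cdot> d i j = \<beta> j \<cdot> (\<delta> i j \<cdot> p i i)"
        using pjd[OF ij] bH pr[OF Si[OF F(2)]] dH[OF ij] by simp
      also have "\<dots> = \<beta> i \<cdot> p i i"
        by (rule Cmp_reduce[OF \<beta>_nat[OF ij]]) (use bH ahom_Hom[OF \<delta>[OF ij]] pr[OF Si[OF F(1)]] in simp_all)
      finally show ?thesis .
    qed
    have "\<exists>g. ahom \<CC> \<AA> g \<and> (\<forall>i \<in> Field R. g \<cdot> c i = \<beta> i \<cdot> p i i)"
      by (rule ex1_implies_ex, rule univ[OF A]) (erule \<rho>, erule \<rho>_nat)
    then obtain g where g: "ahom \<CC> \<AA> g" "\<forall>i \<in> Field R. g \<cdot> c i = \<beta> i \<cdot> p i i" by (elim exE conjE)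
    \<comment> \<open>\<open>conn\<close> fills the coordinates other than \<open>i\<close> with
      arbitrary arrows of \<open>V\<close>. The section is therefore a morphism of the base and need
      not be a homomorphism.\<close>
    have ex_s: "\<exists>s. s \<in> Hom V (fst (\<BB> i)) (fst (D i)) \<and> p i i \<cdot> s = Idn V (fst (\<BB> i))" if i: "i \<in> Field R" for i
    proof -
      define t where "t k = (if k = i then Idn V (fst (\<BB> i)) else SOME t. t \<in> Hom V (fst (\<BB> i)) (fst (\<BB> k)))" for k
      have t: "t k \<in> Hom V (fst (\<BB> i)) (fst (\<BB> k))" if "k \<in> S i" for k
      proof (cases "k = i")
        case True thus ?thesis unfolding t_def using Balg[OF i] by simp
      next
        case False
        have "\<exists>t. t \<in> Hom V (fst (\<BB> i)) (fst (\<BB> k))" using conn[OF i SS[OF that]] by blast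
        from someI_ex[OF this] show ?thesis unfolding t_def using False by simp
      qed
      show ?thesis
      proof (rule product_ex[OF Dp(2) _ t])
        show "fst (\<BB> i) \<in> Obj V" using Balg[OF i] by simp
        fix s assume s: "s \<in> Hom V (fst (\<BB> i)) (fst (D i))" "\<And>k. k \<in> S i \<Longrightarrow> p i k \<cdot> s = t k"
        show ?thesis using s(1) s(2)[OF Si[OF i]] by (auto simp: t_def simp del: Hom_iff)
      qed
    qed
    define s where "s i = (SOME s. s \<in> Hom V (fst (\<BB> i)) (fst (D i)) \<and> p i i \<cdot> s = Idn V (fst (\<BB> i)))" for i
    have s: "s i \<in> Hom V (fst (\<BB> i)) (fst (D i))" "p i i \<cdot> s i = Idn V (fst (\<BB> i))" if "i \<in> Field R" for i
      using someI_ex[OF ex_s[OF that]] unfolding s_def by blast+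
    show thesis
    proof (rule that[OF CL g(1), of "\<lambda>i. c i \<cdot> s i"])
      fix i assume i: "i \<in> Field R"
      note cH = ahom_simps[OF c[OF i]] and gH = ahom_simps[OF g(1)] and bH = ahom_simps[OF \<beta>[OF i]]
      show "c i \<cdot> s i \<in> Hom V (fst (\<BB> i)) (fst \<CC>)" using cH s(1)[OF i] by simp
      have "g \<cdot> (c i \<cdot> s i) = (\<beta> i \<cdot> p i i) \<cdot> s i"
        by (rule Cmp_reduce[OF g(2)[rule_format, OF i]]) (use cH gH s(1)[OF i] in simp_all)
      also have "\<dots> = \<beta> i \<cdot> (p i i \<cdot> s i)" using bH pr[OF Si[OF i]] s(1)[OF i] by simp
      finally show "g \<cdot> (c i \<cdot> s i) = \<beta> i" unfolding s(2)[OF i] using bH by simp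
    qed
  qed
qed

text \<open>An equation has a free algebra on a generator as its domain, while a point has the unit.
  The unit is a colimit of generators, so points are compared after each coprojection
  \<open>y j\<close>; there \<open>u\<close> and \<open>v\<close> become arrows out of a generator
  \<open>?Y\<close> into \<open>G X\<close>, that is, homomorphisms \<open>p\<close> and
  \<open>q\<close> out of \<open>G ?Y\<close>.\<close>

lemma equations_determine_points:
  assumes gen_Obj: "\<And>Y. Y \<in> \<Y> \<Longrightarrow> Y \<in> Obj V"
    and gen_col: "\<And>A. A \<in> Obj V \<Longrightarrow> \<exists>R D \<iota>. directed_diagram_in \<kappa> \<mu> V (Inj V) R D \<and> (\<forall>j \<in> Field R. FOb D j \<in> \<Y>) \<and>
      is_colimit V (poset_cat R) D A \<iota>"
    and A: "alg \<AA>"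
    and sat: "\<And>X Y p q h. X \<in> \<Y> \<Longrightarrow> Y \<in> \<Y> \<Longrightarrow> ahom (G Y) (G X) p \<Longrightarrow> ahom (G Y) (G X) q \<Longrightarrow>
      (\<And>\<BB> k. \<BB> \<in> L \<Longrightarrow> ahom (G X) \<BB> k \<Longrightarrow> k \<cdot> p = k \<cdot> q) \<Longrightarrow> ahom (G X) \<AA> h \<Longrightarrow> h \<cdot> p = h \<cdot> q"
    and X: "X \<in> \<Y>" and h: "ahom (G X) \<AA> h" and u: "u \<in> Hom V II (fst (G X))" and v: "v \<in> Hom V II (fst (G X))"
    and valid: "\<And>\<BB> k. \<BB> \<in> L \<Longrightarrow> ahom (G X) \<BB> k \<Longrightarrow> k \<cdot> u = k \<cdot> v"
  shows "h \<cdot> u = h \<cdot> v"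
proof -
  have XO: "X \<in> Obj V" by (rule gen_Obj[OF X])
  note GX = G_alg[OF XO]
  have IIO: "II \<in> Obj V" using One_Obj .
  obtain R D y where D: "directed_diagram_in \<kappa> \<mu> V (Inj V) R D" "\<forall>j \<in> Field R. FOb D j \<in> \<Y>" "is_colimit V (poset_cat R) D II y"
    using gen_col[OF IIO] by (elim exE conjE)
  have fD: "is_functor (poset_cat R) V D" using D(1) by (simp add: directed_diagram_in_def)
  have hu: "h \<cdot> u \<in> Hom V II (fst \<AA>)" "h \<cdot> v \<in> Hom V II (fst \<AA>)" using ahom_simps[OF h] u v by simp_all
  show ?thesis
  proof (rule colimit_ext[OF D(3) hu fD])
    fix j assume "j \<in> Obj (poset_cat R)"
    hence j: "j \<in> Field R" by simp
    let ?Y = "FOb D j"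
    have Y: "?Y \<in> \<Y>" using D(2) j by blast
    have YO: "?Y \<in> Obj V" by (rule gen_Obj[OF Y])
    have yj: "y j \<in> Hom V ?Y II" using colimit_in[OF D(3), of j] j by simp
    have uy: "u \<cdot> y j \<in> Hom V ?Y (fst (G X))" "v \<cdot> y j \<in> Hom V ?Y (fst (G X))" using u v yj by simp_all
    obtain p where p: "ahom (G ?Y) (G X) p" "p \<cdot> ut ?Y = u \<cdot> y j" using G_ex[OF GX uy(1)] by blast
    obtain q where q: "ahom (G ?Y) (G X) q" "q \<cdot> ut ?Y = v \<cdot> y j" using G_ex[OF GX uy(2)] by blast
    note pH = ahom_simps[OF p(1)] and qH = ahom_simps[OF q(1)] and utH = ut[OF YO]
    have ku: "(k \<cdot> p) \<cdot> ut ?Y = (k \<cdot> u) \<cdot> y j" "(k \<cdot> q) \<cdot> ut ?Y = (k \<cdot> v) \<cdot> y j" if "ahom (G X) \<BB> k" for \<BB> k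
    proof -
      note kH = ahom_simps[OF that]
      have "(k \<cdot> p) \<cdot> ut ?Y = k \<cdot> (p \<cdot> ut ?Y)" "(k \<cdot> q) \<cdot> ut ?Y = k \<cdot> (q \<cdot> ut ?Y)" using kH pH qH utH by simp_all
      thus "(k \<cdot> p) \<cdot> ut ?Y = (k \<cdot> u) \<cdot> y j" "(k \<cdot> q) \<cdot> ut ?Y = (k \<cdot> v) \<cdot> y j"
        unfolding p(2) q(2) using kH u v yj by simp_all
    qed
    have "h \<cdot> p = h \<cdot> q"
    proof (rule sat[OF X Y p(1) q(1) _ h])
      fix \<BB> k assume B: "\<BB> \<in> L" and k: "ahom (G X) \<BB> k"
      show "k \<cdot> p = k \<cdot> q"
        by (rule G_unique[OF L_alg[OF B] YO ahom_comp[OF p(1) k G_alg[OF YO]] ahom_comp[OF q(1) k G_alg[OF YO]]])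
          (simp only: ku[OF k] valid[OF B k])
    qed
    hence "(h \<cdot> u) \<cdot> y j = (h \<cdot> v) \<cdot> y j" using ku[OF h] by simp
    thus "(h \<cdot> u) \<cdot> y j = (h \<cdot> v) \<cdot> y j" .
  qed
qed

text \<open>An upper bound in \<open>R\<close> can be raised above \<open>k0\<close> by
  directedness, so the part above \<open>k0\<close> is again directed. It serves to retain the
  stages whose carriers are connected by arrows.\<close>

lemma directed_poset_above:
  assumes R: "directed_poset \<kappa> \<mu> R" and mu: "regular_cardinal \<mu>" and k0: "k0 \<in> Field R"
  defines "R' \<equiv> {(i, j) \<in> R. (k0, i) \<in> R}"
  shows "directed_poset \<kappa> \<mu> R'" "Field R' = {i \<in> Field R. (k0, i) \<in> R}"
proof -
  note tr = directed_posetD(2)[OF R] and rf = directed_posetD(1)[OF R]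
  have RF: "i \<in> Field R" "j \<in> Field R" if "(i, j) \<in> R" for i j using that by (auto intro: FieldI1 FieldI2)
  show F: "Field R' = {i \<in> Field R. (k0, i) \<in> R}"
  proof (intro set_eqI iffI)
    fix i assume "i \<in> Field R'"
    then obtain j where "(i, j) \<in> R' \<or> (j, i) \<in> R'" by (auto simp: Field_def)
    thus "i \<in> {i \<in> Field R. (k0, i) \<in> R}" using RF tr unfolding R'_def by blast
  next
    fix i assume "i \<in> {i \<in> Field R. (k0, i) \<in> R}"
    hence "(i, i) \<in> R'" using rf unfolding R'_def by blast
    thus "i \<in> Field R'" by (rule FieldI1)
  qed
  have "Partial_order R'"
    unfolding partial_order_on_def preorder_on_def
  proof (intro conjI)
    show "R' \<subseteq> Field R' \<times> Field R'" by (auto intro: FieldI1 FieldI2)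
    show "refl_on (Field R') R'" unfolding F refl_on_def using rf unfolding R'_def by blast
    show "trans R'" unfolding trans_def R'_def using tr by blast
    show "antisym R'" unfolding antisym_def R'_def using directed_posetD(4)[OF R] by blast
  qed
  moreover have "small \<kappa> (Field R')" by (rule small_mono[OF directed_posetD(3)[OF R]]) (simp add: F)
  moreover have "\<exists>b \<in> Field R'. \<forall>s \<in> S. (s, b) \<in> R'" if S: "S \<subseteq> Field R'" "|S| <o \<mu>" for S
  proof -
    have "S \<subseteq> Field R" using S(1) F by blast
    then obtain b where b: "b \<in> Field R" "\<forall>s \<in> S. (s, b) \<in> R"
      using R S(2) unfolding directed_poset_def by blast
    obtain c where c: "c \<in> Field R" "(b, c) \<in> R" "(k0, c) \<in> R" by (rule directed_poset_bound[OF R mu b(1) k0])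
    have "c \<in> Field R'" using c F by blast
    moreover have "(s, c) \<in> R'" if "s \<in> S" for s
      using that b(2) tr[OF _ c(2)] S(1) F unfolding R'_def by blast
    ultimately show ?thesis by blast
  qed
  ultimately show "directed_poset \<kappa> \<mu> R'" unfolding directed_poset_def by blast
qed

text \<open>Equations are required only between members of \<Y>, although purity is tested against
  all generated objects: a morphism from a generated object into \<AA> factors through a stage, and
  the stages belong to \<Y>.\<close>

lemma in_class_if_equations:
  assumes mu: "regular_cardinal \<mu>" and connected: "strongly_connected V"
    and pres: "forget_preserves_colimits_of_injections \<kappa> \<mu> V P T J"
    and L_pure: "\<And>\<AA> \<BB> f. \<AA> \<in> L \<Longrightarrow> alg \<BB> \<Longrightarrow> ahom \<AA> \<BB> f \<Longrightarrow> pure_epi \<kappa> \<mu> V (Inj V) f \<Longrightarrow> \<BB> \<in> L"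
    and gen: "\<And>Y. Y \<in> \<Y> \<Longrightarrow> Y \<in> Obj V"
    and gen_col: "\<And>A. A \<in> Obj V \<Longrightarrow> \<exists>R D \<iota>. directed_diagram_in \<kappa> \<mu> V (Inj V) R D \<and> (\<forall>j \<in> Field R. FOb D j \<in> \<Y>) \<and>
      is_colimit V (poset_cat R) D A \<iota>"
    and A: "alg \<AA>"
    and sat: "\<And>X Y p q h. X \<in> \<Y> \<Longrightarrow> Y \<in> \<Y> \<Longrightarrow> ahom (G Y) (G X) p \<Longrightarrow> ahom (G Y) (G X) q \<Longrightarrow>
      (\<And>\<BB> k. \<BB> \<in> L \<Longrightarrow> ahom (G X) \<BB> k \<Longrightarrow> k \<cdot> p = k \<cdot> q) \<Longrightarrow> ahom (G X) \<AA> h \<Longrightarrow> h \<cdot> p = h \<cdot> q"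
  shows "\<AA> \<in> L"
proof -
  have AO: "fst \<AA> \<in> Obj V" using A by simp
  obtain R D x where D: "directed_diagram_in \<kappa> \<mu> V (Inj V) R D" "\<forall>j \<in> Field R. FOb D j \<in> \<Y>" "is_colimit V (poset_cat R) D (fst \<AA>) x"
    using gen_col[OF AO] by (elim exE conjE)
  have fD: "is_functor (poset_cat R) V D" and R: "directed_poset \<kappa> \<mu> R" using D(1) by (simp_all add: directed_diagram_in_def)
  note tr = directed_posetD(2)[OF R]
  have RF: "i \<in> Field R" "j \<in> Field R" if "(i, j) \<in> R" for i j using that by (auto intro: FieldI1 FieldI2)
  define X f where "X i = FOb D i" and "f i j = FAr D (i, j)" for i j
  have XY: "X i \<in> \<Y>" if "i \<in> Field R" for i using D(2) that by (simp add: X_def)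
  have XO: "X i \<in> Obj V" if "i \<in> Field R" for i by (rule gen[OF XY[OF that]])
  have xH: "x i \<in> Hom V (X i) (fst \<AA>)" if "i \<in> Field R" for i using colimit_in[OF D(3), of i] that by (simp add: X_def)
  have fH: "f i j \<in> Hom V (X i) (X j)" if "(i, j) \<in> R" for i j
    using functorD(5)[OF fD, of "(i, j)"] that by (simp add: X_def f_def)
  have f_id: "f i i = Idn V (X i)" if "i \<in> Field R" for i using functorD(4)[OF fD, of i] that by (simp add: X_def f_def)
  have f_comp: "f j k \<cdot> f i j = f i k" if "(i, j) \<in> R" "(j, k) \<in> R" for i j k
    using functorD(6)[OF fD, of "(i, j)" "(j, k)"] that by (simp add: f_def)
  have x_nat: "x j \<cdot> f i j = x i" if "(i, j) \<in> R" for i j using colimit_nat[OF D(3), of "(i, j)"] that by (simp add: f_def)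
  define rf where "rf i = (SOME y. reflection (X i) (fst y) (snd y))" for i
  define \<BB> b where "\<BB> i = fst (rf i)" and "b i = snd (rf i)" for i
  have refl: "reflection (X i) (\<BB> i) (b i)" if i: "i \<in> Field R" for i
  proof -
    obtain B c where "reflection (X i) B c" using reflection_exists[OF XO[OF i]] by blast
    hence "reflection (X i) (fst (B, c)) (snd (B, c))" by simp
    from someI[of "\<lambda>y. reflection (X i) (fst y) (snd y)", OF this] show ?thesis unfolding \<BB>_def b_def rf_def .
  qed
  have BL: "\<BB> i \<in> L" and bH: "b i \<in> Hom V (X i) (fst (\<BB> i))" if "i \<in> Field R" for i
    using refl[OF that] unfolding reflection_def by blast+
  have Balg: "alg (\<BB> i)" if "i \<in> Field R" for i by (rule L_alg[OF BL[OF that]])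
  have ext: "g = h" if "i \<in> Field R" "alg \<CC>" "ahom (\<BB> i) \<CC> g" "ahom (\<BB> i) \<CC> h" "g \<cdot> b i = h \<cdot> b i" for i \<CC> g h
    by (rule reflection_ext[OF refl[OF that(1)] that(2-5)])
  \<comment> \<open>Homomorphisms out of \<open>\<BB> i\<close> are determined by their composite
    with \<open>b i\<close>, so the choice is unique, and functoriality follows from that of
    \<open>f\<close>.\<close>
  define \<delta> where "\<delta> i j = (SOME k. ahom (\<BB> i) (\<BB> j) k \<and> k \<cdot> b i = b j \<cdot> f i j)" for i j
  have \<delta>: "ahom (\<BB> i) (\<BB> j) (\<delta> i j)" "\<delta> i j \<cdot> b i = b j \<cdot> f i j" if ij: "(i, j) \<in> R" for i j
  proof -
    note F = RF[OF ij]
    have bf: "b j \<cdot> f i j \<in> Hom V (X i) (fst (\<BB> j))" using bH[OF F(2)] fH[OF ij] by simp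
    obtain k where "ahom (\<BB> i) (\<BB> j) k" "k \<cdot> b i = b j \<cdot> f i j"
      by (rule reflection_into_class[OF XO[OF F(1)] refl[OF F(1)] BL[OF F(2)] bf])
    hence "\<exists>k. ahom (\<BB> i) (\<BB> j) k \<and> k \<cdot> b i = b j \<cdot> f i j" by blast
    from someI_ex[OF this] show "ahom (\<BB> i) (\<BB> j) (\<delta> i j)" "\<delta> i j \<cdot> b i = b j \<cdot> f i j" unfolding \<delta>_def by blast+
  qed
  have \<delta>_id: "\<delta> i i = Idn V (fst (\<BB> i))" if i: "i \<in> Field R" for i
    by (rule ext[OF i Balg[OF i] \<delta>(1)[OF directed_posetD(1)[OF R i]] ahom_Idn[OF Balg[OF i]]])
      (use \<delta>(2)[OF directed_posetD(1)[OF R i]] f_id[OF i] bH[OF i] in simp)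
  have \<delta>_comp: "\<delta> j k \<cdot> \<delta> i j = \<delta> i k" if ij: "(i, j) \<in> R" and jk: "(j, k) \<in> R" for i j k
  proof (rule ext[OF RF(1)[OF ij] Balg[OF RF(2)[OF jk]] ahom_comp[OF \<delta>(1)[OF ij] \<delta>(1)[OF jk] Balg[OF RF(1)[OF ij]]] \<delta>(1)[OF tr[OF ij jk]]])
    note F = RF[OF ij] and K = RF[OF jk]
    note H = ahom_Hom[OF \<delta>(1)[OF ij]] ahom_Hom[OF \<delta>(1)[OF jk]] bH[OF F(1)] bH[OF F(2)] bH[OF K(2)] fH[OF ij] fH[OF jk]
    have "(\<delta> j k \<cdot> \<delta> i j) \<cdot> b i = \<delta> j k \<cdot> (b j \<cdot> f i j)" using H \<delta>(2)[OF ij] by simp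
    also have "\<dots> = (b k \<cdot> f j k) \<cdot> f i j" by (rule Cmp_reduce[OF \<delta>(2)[OF jk]]) (use H in simp_all)
    also have "\<dots> = b k \<cdot> f i k" using f_comp[OF ij jk] H by simp
    finally show "(\<delta> j k \<cdot> \<delta> i j) \<cdot> b i = \<delta> i k \<cdot> b i" using \<delta>(2)[OF tr[OF ij jk]] by simp
  qed
  define \<beta> where "\<beta> i = (SOME k. ahom (\<BB> i) \<AA> k \<and> k \<cdot> b i = x i)" for i
  have \<beta>: "ahom (\<BB> i) \<AA> (\<beta> i)" "\<beta> i \<cdot> b i = x i" if i: "i \<in> Field R" for i
  proof -
    obtain h where h: "ahom (G (X i)) \<AA> h" "h \<cdot> ut (X i) = x i" using G_ex[OF A xH[OF i]] by blast
    \<comment> \<open>\<AA> is not yet known to belong to \<open>L\<close>. This is where the last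
      clause of \<open>reflection\<close> is needed, and the satisfied equations provide its premise
      through \<open>equations_determine_points\<close>.\<close>
    have "\<exists>k. ahom (\<BB> i) \<AA> k \<and> k \<cdot> b i = h \<cdot> ut (X i)"
    proof (rule refl[OF i, unfolded reflection_def, THEN conjunct2, THEN conjunct2, THEN conjunct2, rule_format, OF A h(1)])
      fix u v assume u: "u \<in> Hom V II (fst (G (X i)))" and v: "v \<in> Hom V II (fst (G (X i)))"
        and valid: "\<And>\<BB>' h'. \<BB>' \<in> L \<Longrightarrow> ahom (G (X i)) \<BB>' h' \<Longrightarrow> h' \<cdot> u = h' \<cdot> v"
      show "h \<cdot> u = h \<cdot> v"
        by (rule equations_determine_points[OF gen gen_col A sat XY[OF i] h(1) u v valid])
    qed
    from someI_ex[OF this] show "ahom (\<BB> i) \<AA> (\<beta> i)" "\<beta> i \<cdot> b i = x i" unfolding \<beta>_def h(2) by blast+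
  qed
  have \<beta>_nat: "\<beta> j \<cdot> \<delta> i j = \<beta> i" if ij: "(i, j) \<in> R" for i j
  proof (rule ext[OF RF(1)[OF ij] A ahom_comp[OF \<delta>(1)[OF ij] \<beta>(1)[OF RF(2)[OF ij]] Balg[OF RF(1)[OF ij]]] \<beta>(1)[OF RF(1)[OF ij]]])
    note F = RF[OF ij]
    note H = ahom_Hom[OF \<delta>(1)[OF ij]] ahom_Hom[OF \<beta>(1)[OF F(2)]] bH[OF F(1)] bH[OF F(2)] fH[OF ij]
    have "(\<beta> j \<cdot> \<delta> i j) \<cdot> b i = \<beta> j \<cdot> (b j \<cdot> f i j)" using H \<delta>(2)[OF ij] by simp
    also have "\<dots> = x j \<cdot> f i j" by (rule Cmp_reduce[OF \<beta>(2)[OF F(2)]]) (use H in simp_all)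
    finally show "(\<beta> j \<cdot> \<delta> i j) \<cdot> b i = \<beta> i \<cdot> b i" unfolding x_nat[OF ij] \<beta>(2)[OF F(1)] .
  qed
  \<comment> \<open>Strong connectedness yields arrows into objects that are not initial. If some
    carrier is not initial, arrows into it continue to all later stages; if all carriers are
    initial, arrows out of them exist in any case.\<close>
  have "\<exists>k0 \<in> Field R. \<forall>i \<in> Field R. \<forall>k. (k0, k) \<in> R \<longrightarrow> Hom V (fst (\<BB> i)) (fst (\<BB> k)) \<noteq> {}"
  proof (cases "\<exists>k0 \<in> Field R. \<not> initial_object V (fst (\<BB> k0))")
    case True
    then obtain k0 where k0: "k0 \<in> Field R" "\<not> initial_object V (fst (\<BB> k0))" by blast
    have "Hom V (fst (\<BB> i)) (fst (\<BB> k)) \<noteq> {}" if i: "i \<in> Field R" and k: "(k0, k) \<in> R" for i k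
    proof -
      have "Hom V (fst (\<BB> i)) (fst (\<BB> k0)) \<noteq> {}"
        using connected Balg[OF i] Balg[OF k0(1)] k0(2) unfolding strongly_connected_def by (simp del: Hom_iff)
      then obtain t where "t \<in> Hom V (fst (\<BB> i)) (fst (\<BB> k0))" by blast
      from Cmp_Hom[OF this ahom_Hom[OF \<delta>(1)[OF k]]] show ?thesis by blast
    qed
    thus ?thesis using k0(1) by blast
  next
    case False
    obtain k0 where k0: "k0 \<in> Field R" using directed_poset_nonempty[OF R mu] by blast
    have "Hom V (fst (\<BB> i)) (fst (\<BB> k)) \<noteq> {}" if i: "i \<in> Field R" and k: "(k0, k) \<in> R" for i k
    proof -
      have "initial_object V (fst (\<BB> i))" using False i by blast
      moreover have "fst (\<BB> k) \<in> Obj V" using Balg[OF RF(2)[OF k]] by simp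
      ultimately have "\<exists>!t. t \<in> Hom V (fst (\<BB> i)) (fst (\<BB> k))" unfolding initial_object_def by blast
      thus ?thesis by blast
    qed
    thus ?thesis using k0 by blast
  qed
  then obtain k0 where k0: "k0 \<in> Field R" "\<forall>i \<in> Field R. \<forall>k. (k0, k) \<in> R \<longrightarrow> Hom V (fst (\<BB> i)) (fst (\<BB> k)) \<noteq> {}" by blast
  define R' where "R' = {(i, j) \<in> R. (k0, i) \<in> R}"
  note R' = directed_poset_above[OF R mu k0(1), folded R'_def]
  have RR: "(i, j) \<in> R" if "(i, j) \<in> R'" for i j using that by (simp add: R'_def)
  have FR: "i \<in> Field R" "(k0, i) \<in> R" if "i \<in> Field R'" for i using that unfolding R'(2) by blast+
  show ?thesis
  proof (rule colimit_of_products[OF pres R'(1) BL[OF FR(1)] \<delta>(1)[OF RR] \<delta>_id[OF FR(1)] \<delta>_comp[OF RR RR] A \<beta>(1)[OF FR(1)] \<beta>_nat[OF RR]])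
    show "Hom V (fst (\<BB> i)) (fst (\<BB> k)) \<noteq> {}" if "i \<in> Field R'" "k \<in> Field R'" for i k
      using k0(2) FR(1)[OF that(1)] FR(2)[OF that(2)] by blast
  next
    fix \<CC> g \<sigma> assume C: "\<CC> \<in> L" and g: "ahom \<CC> \<AA> g" and \<sigma>: "\<And>i. i \<in> Field R' \<Longrightarrow> \<sigma> i \<in> Hom V (fst (\<BB> i)) (fst \<CC>)"
      and g\<sigma>: "\<And>i. i \<in> Field R' \<Longrightarrow> g \<cdot> \<sigma> i = \<beta> i"
    note gH = ahom_simps[OF g]
    \<comment> \<open>A morphism \<open>y\<close> from a generated object factors through some
      \<open>X j\<close>. It is moved to a stage \<open>k\<close> above both \<open>j\<close> and
      \<open>k0\<close>, and the lift is its composite with \<open>b k\<close> and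
      \<open>\<sigma> k\<close>.\<close>
    have "pure_epi \<kappa> \<mu> V (Inj V) g"
      unfolding pure_epi_def
    proof (intro conjI allI impI ballI)
      show "g \<in> Arr V" by (rule gH(1))
      fix Z y assume Z: "generated_object \<kappa> \<mu> V (Inj V) Z" and "y \<in> Hom V Z (Cod V g)"
      hence y: "y \<in> Hom V Z (fst \<AA>)" using gH by simp
      have pc: "preserves_colimits_of V (Set_cat \<kappa>) (hom_functor V Z) (poset_cat R) D"
        using Z D(1) unfolding generated_object_def by blast
      obtain j v where "j \<in> Obj (poset_cat R)" "v \<in> Hom V Z (FOb D j)" "x j \<cdot> v = y"
        by (rule hom_colimit_factor[OF pc D(3) fD y])
      hence j: "j \<in> Field R" and v: "v \<in> Hom V Z (X j)" "x j \<cdot> v = y" by (simp_all add: X_def)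
      obtain k where k: "k \<in> Field R" "(j, k) \<in> R" "(k0, k) \<in> R" by (rule directed_poset_bound[OF R mu j k0(1)])
      have kR': "k \<in> Field R'" unfolding R'(2) using k by blast
      let ?w = "b k \<cdot> (f j k \<cdot> v)"
      note H = \<sigma>[OF kR'] bH[OF k(1)] fH[OF k(2)] v(1) ahom_Hom[OF \<beta>(1)[OF k(1)]] xH[OF k(1)]
      have "g \<cdot> (\<sigma> k \<cdot> ?w) = \<beta> k \<cdot> ?w" by (rule Cmp_reduce[OF g\<sigma>[OF kR']]) (use H gH in simp_all)
      also have "\<dots> = x k \<cdot> (f j k \<cdot> v)" by (rule Cmp_reduce[OF \<beta>(2)[OF k(1)]]) (use H in simp_all)
      also have "\<dots> = x j \<cdot> v" by (rule Cmp_reduce[OF x_nat[OF k(2)]]) (use H in simp_all)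
      finally have "g \<cdot> (\<sigma> k \<cdot> ?w) = y" unfolding v(2) .
      moreover have "\<sigma> k \<cdot> ?w \<in> Hom V Z (Dom V g)" using H gH by simp
      ultimately show "\<exists>h \<in> Hom V Z (Dom V g). g \<cdot> h = y" by blast
    qed
    from L_pure[OF C A g this] show ?thesis .
  qed
qed

end

section \<open>The Birkhoff theorem\<close>

context adjunction_base
begin

lemma free_arrow:
  assumes "alg \<AA>" "f \<in> Hom V X (fst \<AA>)"
  obtains h where "h \<in> Hom \<A> (Fo X) \<AA>" "U h \<cdot> et X = f"
proof -
  note e = free_extension[OF assms]
  have X: "X \<in> Obj V" by (rule Hom_Obj(1)[OF assms(2)])
  note a = arr_of[OF Fo_alg[OF X] assms(1) e(1)]
  show ?thesis by (rule that[OF a(1)]) (simp only: a(2) e(2))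
qed

lemma free_arrow_unique:
  assumes "X \<in> Obj V" "h \<in> Hom \<A> (Fo X) \<AA>" "k \<in> Hom \<A> (Fo X) \<AA>" "U h \<cdot> et X = U k \<cdot> et X"
  shows "h = k"
  by (rule U_faithful[OF assms(2,3)],
      rule free_unique[OF Hom_A_alg(2)[OF assms(2)] assms(1) U_ahom[OF assms(2)] U_ahom[OF assms(3)] assms(4)])

lemma equational_class_iff:
  "\<AA> \<in> equational_class V P T J F E \<longleftrightarrow> alg \<AA> \<and>
    (\<forall>Y X p q. (Y, X, p, q) \<in> E \<longrightarrow> (\<forall>h \<in> Hom \<A> (Fo X) \<AA>. h \<cdot>\<^bsub>\<A>\<^esub> p = h \<cdot>\<^bsub>\<A>\<^esub> q))"
  unfolding equational_class_def by fastforce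

text \<open>Two principles cover all closure conditions: an equation can be checked after a jointly
  monic family of homomorphisms, and a homomorphism from \<open>Fo X\<close> lifts along
  \<open>f\<close> as soon as its restriction to \<open>X\<close> lifts along \<open>U f\<close>.
  For pure quotients the second one rests on \<open>X\<close> being generated.\<close>

lemma mu_birkhoff_equational_class:
  assumes E: "equational_theory \<kappa> V P T J F E"
    and gen: "\<forall>(Y, X, p, q) \<in> E. generated_object \<kappa> \<mu> V (Inj V) X \<and> generated_object \<kappa> \<mu> V (Inj V) Y"
    and replete: "full_replete \<A> (equational_class V P T J F E)"
  shows "mu_birkhoff_subcategory \<kappa> \<mu> V P T J (equational_class V P T J F E)"
proof -
  let ?L = "equational_class V P T J F E"
  interpret A: category \<A> by (rule category_A)
  have eqD: "X \<in> Obj V" "Y \<in> Obj V" "p \<in> Hom \<A> (Fo Y) (Fo X)" "q \<in> Hom \<A> (Fo Y) (Fo X)" "generated_object \<kappa> \<mu> V (Inj V) X"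
    if "(Y, X, p, q) \<in> E" for Y X p q
    using E[unfolded equational_theory_def, THEN conjunct2, THEN bspec, OF that] bspec[OF gen that] by (simp_all del: Hom_iff)
  have sat: "h \<cdot>\<^bsub>\<A>\<^esub> p = h \<cdot>\<^bsub>\<A>\<^esub> q" if "\<AA> \<in> ?L" "(Y, X, p, q) \<in> E" "h \<in> Hom \<A> (Fo X) \<AA>" for \<AA> Y X p q h
    using that unfolding equational_class_iff by blast
  have after: "f \<cdot>\<^bsub>\<A>\<^esub> (h \<cdot>\<^bsub>\<A>\<^esub> p) = f \<cdot>\<^bsub>\<A>\<^esub> (h \<cdot>\<^bsub>\<A>\<^esub> q)"
    if "\<BB> \<in> ?L" "(Y, X, p, q) \<in> E" "h \<in> Hom \<A> (Fo X) \<AA>" "f \<in> Hom \<A> \<AA> \<BB>" for f h \<AA> \<BB> Y X p q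
    using sat[OF that(1,2) A.Cmp_Hom[OF that(3,4)]]
    unfolding A.Cmp_assoc[OF eqD(3)[OF that(2)] that(3,4)] A.Cmp_assoc[OF eqD(4)[OF that(2)] that(3,4)] .
  \<comment> \<open>Common to split and pure quotients: a homomorphism \<open>h\<close> from
    \<open>Fo X\<close> to \<BB> is lifted to \<AA>, where the equation holds, and the equation is
    then pushed forward along \<open>f\<close>.\<close>
  have quotient: "\<BB> \<in> ?L"
    if f: "f \<in> Hom \<A> \<AA> \<BB>" and A: "\<AA> \<in> ?L"
      and lift: "\<And>X y. generated_object \<kappa> \<mu> V (Inj V) X \<Longrightarrow> y \<in> Hom V X (fst \<BB>) \<Longrightarrow> \<exists>s \<in> Hom V X (fst \<AA>). U f \<cdot> s = y"
    for f \<AA> \<BB>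
    unfolding equational_class_iff
  proof (intro conjI allI impI ballI)
    show "alg \<BB>" by (rule Hom_A_alg(2)[OF f])
    fix Y X p q h assume e: "(Y, X, p, q) \<in> E" and h: "h \<in> Hom \<A> (Fo X) \<BB>"
    note XO = eqD(1)[OF e]
    have "U h \<cdot> et X \<in> Hom V X (fst \<BB>)" using U_Hom[OF h] XO by simp
    from lift[OF eqD(5)[OF e] this] obtain s where s: "s \<in> Hom V X (fst \<AA>)" "U f \<cdot> s = U h \<cdot> et X" by blast
    obtain k where k: "k \<in> Hom \<A> (Fo X) \<AA>" "U k \<cdot> et X = s" by (rule free_arrow[OF Hom_A_alg(1)[OF f] s(1)])
    have "f \<cdot>\<^bsub>\<A>\<^esub> k = h"
    proof (rule free_arrow_unique[OF XO A.Cmp_Hom[OF k(1) f] h])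
      have "U (f \<cdot>\<^bsub>\<A>\<^esub> k) \<cdot> et X = U f \<cdot> (U k \<cdot> et X)"
        unfolding Cmp_A(2)[OF k(1) f] using U_Hom[OF k(1)] U_Hom[OF f] XO by simp
      thus "U (f \<cdot>\<^bsub>\<A>\<^esub> k) \<cdot> et X = U h \<cdot> et X" unfolding k(2) s(2) .
    qed
    moreover have "(f \<cdot>\<^bsub>\<A>\<^esub> k) \<cdot>\<^bsub>\<A>\<^esub> p = (f \<cdot>\<^bsub>\<A>\<^esub> k) \<cdot>\<^bsub>\<A>\<^esub> q"
      unfolding A.Cmp_assoc[OF eqD(3)[OF e] k(1) f] A.Cmp_assoc[OF eqD(4)[OF e] k(1) f] sat[OF A e k(1)] ..
    ultimately show "h \<cdot>\<^bsub>\<A>\<^esub> p = h \<cdot>\<^bsub>\<A>\<^esub> q" by simp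
  qed
  have prod: "\<QQ> \<in> ?L" if A: "\<forall>i \<in> I. D i \<in> ?L" and Q: "is_product \<A> I D \<QQ> \<pi>" for I :: "'a set" and D \<QQ> \<pi>
    unfolding equational_class_iff
  proof (intro conjI allI impI ballI)
    show "alg \<QQ>" using Q by (simp add: is_product_def del: Hom_iff)
    have \<pi>: "\<pi> i \<in> Hom \<A> \<QQ> (D i)" if "i \<in> I" for i using Q that by (simp add: is_product_def del: Hom_iff)
    fix Y X p q h assume e: "(Y, X, p, q) \<in> E" and h: "h \<in> Hom \<A> (Fo X) \<QQ>"
    have hp: "h \<cdot>\<^bsub>\<A>\<^esub> p \<in> Hom \<A> (Fo Y) \<QQ>" "h \<cdot>\<^bsub>\<A>\<^esub> q \<in> Hom \<A> (Fo Y) \<QQ>"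
      by (rule A.Cmp_Hom[OF eqD(3)[OF e] h], rule A.Cmp_Hom[OF eqD(4)[OF e] h])
    have "Fo Y \<in> Obj \<A>" using Fo_alg[OF eqD(2)[OF e]] by simp
    moreover have "\<forall>i \<in> I. \<pi> i \<cdot>\<^bsub>\<A>\<^esub> (h \<cdot>\<^bsub>\<A>\<^esub> p) \<in> Hom \<A> (Fo Y) (D i)" using A.Cmp_Hom[OF hp(1) \<pi>] by blast
    ultimately have ex1: "\<exists>!k. k \<in> Hom \<A> (Fo Y) \<QQ> \<and> (\<forall>i \<in> I. \<pi> i \<cdot>\<^bsub>\<A>\<^esub> k = \<pi> i \<cdot>\<^bsub>\<A>\<^esub> (h \<cdot>\<^bsub>\<A>\<^esub> p))"
      using Q[unfolded is_product_def, THEN conjunct2, THEN conjunct2, THEN bspec, THEN spec[of _ "\<lambda>i. \<pi> i \<cdot>\<^bsub>\<A>\<^esub> (h \<cdot>\<^bsub>\<A>\<^esub> p)"], THEN mp]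
      by (simp del: Hom_iff)
    have hq: "\<pi> i \<cdot>\<^bsub>\<A>\<^esub> (h \<cdot>\<^bsub>\<A>\<^esub> q) = \<pi> i \<cdot>\<^bsub>\<A>\<^esub> (h \<cdot>\<^bsub>\<A>\<^esub> p)" if "i \<in> I" for i
      using after[OF bspec[OF A that] e h \<pi>[OF that]] by (rule sym)
    show "h \<cdot>\<^bsub>\<A>\<^esub> p = h \<cdot>\<^bsub>\<A>\<^esub> q"
      by (rule trans[OF the1_equality[OF ex1, symmetric] the1_equality[OF ex1]]) (use hp hq in \<open>simp_all del: Hom_iff\<close>)
  qed
  have sub: "\<AA> \<in> ?L" if m: "m \<in> Hom \<A> \<AA> \<BB>" "mono_arrow \<A> m" and B: "\<BB> \<in> ?L" for m \<AA> \<BB>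
    unfolding equational_class_iff
  proof (intro conjI allI impI ballI)
    show "alg \<AA>" by (rule Hom_A_alg(1)[OF m(1)])
    have Dm: "Dom \<A> m = \<AA>" using m(1) by (simp add: Hom_def)
    fix Y X p q h assume e: "(Y, X, p, q) \<in> E" and h: "h \<in> Hom \<A> (Fo X) \<AA>"
    show "h \<cdot>\<^bsub>\<A>\<^esub> p = h \<cdot>\<^bsub>\<A>\<^esub> q"
      by (rule A.mono_arrow_cancel[OF m(2) after[OF B e h m(1)], unfolded Dm, OF A.Cmp_Hom[OF eqD(3)[OF e] h] A.Cmp_Hom[OF eqD(4)[OF e] h]])
  qed
  have split: "\<BB> \<in> ?L" if f: "f \<in> Hom \<A> \<AA> \<BB>" and s: "split_epi V (U f)" and A: "\<AA> \<in> ?L" for f \<AA> \<BB>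
  proof (rule quotient[OF f A])
    fix X y assume y: "y \<in> Hom V X (fst \<BB>)"
    obtain s where s: "s \<in> Hom V (fst \<BB>) (fst \<AA>)" "U f \<cdot> s = Idn V (fst \<BB>)"
      using s U_Hom[OF f] unfolding split_epi_def by auto
    have "U f \<cdot> (s \<cdot> y) = y" using Cmp_reduce[OF s(2), of y] s(1) y U_Hom[OF f] by simp
    moreover have "s \<cdot> y \<in> Hom V X (fst \<AA>)" using s(1) y by simp
    ultimately show "\<exists>s \<in> Hom V X (fst \<AA>). U f \<cdot> s = y" by blast
  qed
  have pure: "\<BB> \<in> ?L" if f: "f \<in> Hom \<A> \<AA> \<BB>" and s: "pure_epi \<kappa> \<mu> V (Inj V) (U f)" and A: "\<AA> \<in> ?L" for f \<AA> \<BB>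
  proof (rule quotient[OF f A])
    fix X y assume X: "generated_object \<kappa> \<mu> V (Inj V) X" and y: "y \<in> Hom V X (fst \<BB>)"
    have "Dom V (U f) = fst \<AA>" "Cod V (U f) = fst \<BB>" using U_Hom[OF f] by simp_all
    thus "\<exists>s \<in> Hom V X (fst \<AA>). U f \<cdot> s = y" using s X y unfolding pure_epi_def by (simp del: Hom_iff)
  qed
  show ?thesis
    unfolding mu_birkhoff_subcategory_def birkhoff_subcategory_def 
  proof (intro conjI allI impI ballI)
    show "\<QQ> \<in> ?L" if "small \<kappa> I \<and> (\<forall>i \<in> I. D i \<in> ?L) \<and> is_product \<A> I D \<QQ> \<pi>" for I :: "'a set" and D \<QQ> \<pi>
      by (rule prod[of I D \<QQ> \<pi>]) (use that in simp_all)
    show "\<AA> \<in> ?L" if "m \<in> Hom \<A> \<AA> \<BB>" "mono_arrow \<A> m \<and> \<BB> \<in> ?L" for m \<AA> \<BB>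
      by (rule sub[OF that(1)]) (use that(2) in simp_all)
    show "\<BB> \<in> ?L" if "f \<in> Hom \<A> \<AA> \<BB>" "split_epi V (U f) \<and> \<AA> \<in> ?L" for f \<AA> \<BB>
      by (rule split[OF that(1)]) (use that(2) in simp_all)
    show "\<BB> \<in> ?L" if "f \<in> Hom \<A> \<AA> \<BB>" "pure_epi \<kappa> \<mu> V (Inj V) (U f) \<and> \<AA> \<in> ?L" for f \<AA> \<BB>
      by (rule pure[OF that(1)]) (use that(2) in simp_all)
  qed (fact replete)
qed

end

section \<open>Passage from underlying arrows to the category of algebras\<close>

context convenient_base
begin

lemma small_Hom_A: "small \<kappa> (Hom \<A> \<AA> \<BB>)"
proof (rule small_inj_on[OF small_Hom[of "fst \<AA>" "fst \<BB>"], of U])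
  show "inj_on U (Hom \<A> \<AA> \<BB>)" by (rule inj_onI) (rule U_faithful)
  show "U ` Hom \<A> \<AA> \<BB> \<subseteq> Hom V (fst \<AA>) (fst \<BB>)" using U_Hom by blast
qed

lemma is_product_algebras:
  assumes E: "\<And>i. i \<in> I \<Longrightarrow> alg (E i)" and Q: "alg \<QQ>" "is_product V I (\<lambda>i. fst (E i)) (fst \<QQ>) p"
    and p: "\<And>i. i \<in> I \<Longrightarrow> ahom \<QQ> (E i) (p i)"
  shows "is_product \<A> I E \<QQ> (\<lambda>i. arr_of \<QQ> (E i) (p i))"
  unfolding is_product_def
proof (intro conjI ballI allI impI)
  show "\<QQ> \<in> Obj \<A>" using Q(1) by simp
  note a = arr_of[OF Q(1) E p]
  show "arr_of \<QQ> (E i) (p i) \<in> Hom \<A> \<QQ> (E i)" if "i \<in> I" for i by (rule a(1)[OF that that])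
  fix \<CC> f assume "\<CC> \<in> Obj \<A>" and f: "\<forall>i \<in> I. f i \<in> Hom \<A> \<CC> (E i)"
  hence C: "alg \<CC>" by simp
  have fh: "ahom \<CC> (E i) (U (f i))" if "i \<in> I" for i by (rule U_ahom) (use f that in blast)
  show "\<exists>!h. h \<in> Hom \<A> \<CC> \<QQ> \<and> (\<forall>i \<in> I. arr_of \<QQ> (E i) (p i) \<cdot>\<^bsub>\<A>\<^esub> h = f i)"
  proof (rule product_ahom[OF Q p E C fh])
    fix h assume h: "ahom \<CC> \<QQ> h" "\<And>i. i \<in> I \<Longrightarrow> p i \<cdot> h = U (f i)"
    note H = arr_of[OF C Q(1) h(1)]
    have comp: "arr_of \<QQ> (E i) (p i) \<cdot>\<^bsub>\<A>\<^esub> k = f i \<longleftrightarrow> p i \<cdot> U k = U (f i)" if k: "k \<in> Hom \<A> \<CC> \<QQ>" and i: "i \<in> I" for k i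
    proof -
      note c = Cmp_A[OF k a(1)[OF i i]]
      show ?thesis using U_faithful[OF c(1) bspec[OF f i]] c(2) a(2)[OF i i] by auto
    qed
    show ?thesis
    proof (rule ex1I[of _ "arr_of \<CC> \<QQ> h"], intro conjI ballI)
      show "arr_of \<CC> \<QQ> h \<in> Hom \<A> \<CC> \<QQ>" by (rule H(1))
      show "arr_of \<QQ> (E i) (p i) \<cdot>\<^bsub>\<A>\<^esub> arr_of \<CC> \<QQ> h = f i" if "i \<in> I" for i
        using comp[OF H(1) that] H(2) h(2)[OF that] by simp
      fix k assume k: "k \<in> Hom \<A> \<CC> \<QQ> \<and> (\<forall>i \<in> I. arr_of \<QQ> (E i) (p i) \<cdot>\<^bsub>\<A>\<^esub> k = f i)"
      hence kH: "k \<in> Hom \<A> \<CC> \<QQ>" by blast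
      have "U k = h"
        by (rule product_ext[OF Q(2) U_Hom[OF kH] ahom_Hom[OF h(1)]]) (use k comp[OF kH] h(2) in simp)
      thus "k = arr_of \<CC> \<QQ> h" by (intro U_faithful[OF kH H(1)]) (simp only: H(2))
    qed
  qed assumption+
qed

lemma mono_arrow_algebras:
  assumes "f \<in> Hom \<A> \<AA> \<BB>" "mono_arrow V (U f)"
  shows "mono_arrow \<A> f"
  unfolding mono_arrow_def
proof (intro conjI allI ballI impI)
  have D: "f \<in> Arr \<A>" "Dom \<A> f = \<AA>" using assms(1) by (simp_all add: Hom_def)
  show "f \<in> Arr \<A>" by (rule D(1))
  fix \<WW> u v assume "u \<in> Hom \<A> \<WW> (Dom \<A> f)" "v \<in> Hom \<A> \<WW> (Dom \<A> f)" and eq: "f \<cdot>\<^bsub>\<A>\<^esub> u = f \<cdot>\<^bsub>\<A>\<^esub> v"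
  hence uv: "u \<in> Hom \<A> \<WW> \<AA>" "v \<in> Hom \<A> \<WW> \<AA>" unfolding D(2) by blast+
  have Uf: "Dom V (U f) = fst \<AA>" using U_Hom[OF assms(1)] by simp
  have "U f \<cdot> U u = U f \<cdot> U v" using eq Cmp_A(2)[OF uv(1) assms(1)] Cmp_A(2)[OF uv(2) assms(1)] by simp
  hence "U u = U v" by (rule mono_arrow_cancel[OF assms(2)]) (use U_Hom[OF uv(1)] U_Hom[OF uv(2)] Uf in simp_all)
  thus "u = v" by (rule U_faithful[OF uv])
qed

end

text \<open>The canonical arrow \<delta> from the coproduct of all points of \<open>X\<close>
  reaches every point, hence is epic by assumption. The lemma is stated over a plain cocomplete
  category because it is what establishes the extensionality assumption of
  \<open>pointed_smc\<close>.\<close>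

lemma (in cocomplete_category) points_jointly_epic:
  fixes I\<^sub>0 :: 'o
  assumes epi: "\<And>e. e \<in> Arr C \<Longrightarrow> (\<And>b. b \<in> Hom C I\<^sub>0 (Cod C e) \<Longrightarrow> \<exists>a \<in> Hom C I\<^sub>0 (Dom C e). e \<cdot> a = b) \<Longrightarrow> epi_arrow C e"
    and I0: "I\<^sub>0 \<in> Obj C" and fg: "f \<in> Hom C X Y" "g \<in> Hom C X Y" and eq: "\<And>x. x \<in> Hom C I\<^sub>0 X \<Longrightarrow> f \<cdot> x = g \<cdot> x"
  shows "f = g"
proof (rule coproduct[OF small_Hom[of I\<^sub>0 X], of "\<lambda>_. I\<^sub>0"])
  show "I\<^sub>0 \<in> Obj C" by (rule I0)
  fix Q \<iota> assume Q: "Q \<in> Obj C" and \<iota>: "\<And>i. i \<in> Hom C I\<^sub>0 X \<Longrightarrow> \<iota> i \<in> Hom C I\<^sub>0 Q"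
    and ex: "\<And>Q' \<iota>'. Q' \<in> Obj C \<Longrightarrow> (\<And>i. i \<in> Hom C I\<^sub>0 X \<Longrightarrow> \<iota>' i \<in> Hom C I\<^sub>0 Q') \<Longrightarrow>
      \<exists>h. h \<in> Hom C Q Q' \<and> (\<forall>i \<in> Hom C I\<^sub>0 X. h \<cdot> \<iota> i = \<iota>' i)"
    and ext: "\<And>W u v. u \<in> Hom C Q W \<Longrightarrow> v \<in> Hom C Q W \<Longrightarrow> (\<And>i. i \<in> Hom C I\<^sub>0 X \<Longrightarrow> u \<cdot> \<iota> i = v \<cdot> \<iota> i) \<Longrightarrow> u = v"
  have X: "X \<in> Obj C" by (rule Hom_Obj(1)[OF fg(1)])
  obtain \<delta> where \<delta>: "\<delta> \<in> Hom C Q X" "\<forall>i \<in> Hom C I\<^sub>0 X. \<delta> \<cdot> \<iota> i = i" using ex[OF X, of "\<lambda>i. i"] by blast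
  have epi: "epi_arrow C \<delta>"
  proof (rule epi)
    show "\<delta> \<in> Arr C" using \<delta>(1) by simp
    fix b assume "b \<in> Hom C I\<^sub>0 (Cod C \<delta>)"
    hence "b \<in> Hom C I\<^sub>0 X" using \<delta>(1) by simp
    thus "\<exists>a \<in> Hom C I\<^sub>0 (Dom C \<delta>). \<delta> \<cdot> a = b" using \<delta> \<iota> by (auto simp: Hom_iff intro!: bexI[of _ "\<iota> b"])
  qed
  have "f \<cdot> \<delta> = g \<cdot> \<delta>"
  proof (rule ext)
    show "f \<cdot> \<delta> \<in> Hom C Q Y" "g \<cdot> \<delta> \<in> Hom C Q Y" by (rule Cmp_Hom[OF \<delta>(1) fg(1)], rule Cmp_Hom[OF \<delta>(1) fg(2)])
    fix i assume i: "i \<in> Hom C I\<^sub>0 X"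
    show "(f \<cdot> \<delta>) \<cdot> \<iota> i = (g \<cdot> \<delta>) \<cdot> \<iota> i"
      unfolding Cmp_assoc[OF \<iota>[OF i] \<delta>(1) fg(1)] Cmp_assoc[OF \<iota>[OF i] \<delta>(1) fg(2)] using \<delta>(2) i eq[OF i] by simp
  qed
  thus "f = g" by (rule epi_arrow_cancel[OF epi]) (use fg \<delta>(1) in \<open>simp_all add: Hom_iff\<close>)
qed

theorem theorem5p15:
  fixes \<kappa> :: "'a rel" and \<mu> :: "'m rel" and lam :: "'l rel"
    and V :: "('o, 'a) smc"
    and P :: "'o set"
    and T :: "('o, 'o, 'a) vcat" and J :: "('o, 'o, 'a) vfun"
    and F :: "('o, ('o, 'a) alg, 'a) vfun" and \<eta> :: "'o \<Rightarrow> 'a" and \<epsilon> :: "('o, 'a) alg \<Rightarrow> 'a"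
    and L :: "('o, 'a) alg set"
  assumes universe: "inaccessible \<kappa>"
    and "regular_cardinal \<mu>" and "regular_cardinal lam" and "\<mu> \<le>o lam" and "lam <o \<kappa>"
    and "locally_presentable_smc \<kappa> lam V"
    and "preserves_presentable \<kappa> lam V (Set_cat \<kappa> :: ('a set, 'a set_arrow) cat)
           (hom_functor V (One V))"
    and "presentable_representatives \<kappa> lam V P"
    and "lambda_ary_theory V P T J" and "discrete_theory V P T J"
    and "factorization_system V (Surj V) (Inj V)"
    and "proper_system V (Surj V) (Inj V)"
    and "convenient_system \<kappa> \<mu> V (Surj V) (Inj V)"
    and "locally_generated \<kappa> \<mu> V (Inj V)"
    and "strongly_connected V"
    and "forget_preserves_colimits_of_injections \<kappa> \<mu> V P T J"
    and "V_adjunction V (self_vcat V) (Alg V P T J) F (forget V P T) \<eta> \<epsilon>"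
    and "full_replete (Alg\<^sub>0 V P T J) L"
  shows "mu_birkhoff_subcategory \<kappa> \<mu> V P T J L \<longleftrightarrow>
    (\<exists>E. equational_theory \<kappa> V P T J F E \<and>
       (\<forall>(Y, X, p, q) \<in> E. generated_object \<kappa> \<mu> V (Inj V) X \<and> generated_object \<kappa> \<mu> V (Inj V) Y) \<and>
       L = equational_class V P T J F E)"
proof -
  have smc: "sym_monoidal_closed V" and lp: "locally_presentable \<kappa> lam V"
    and tensor_pres: "\<And>X Y. presentable_object \<kappa> lam V X \<Longrightarrow> presentable_object \<kappa> lam V Y \<Longrightarrow> presentable_object \<kappa> lam V (X \<otimes>\<^bsub>V\<^esub> Y)"
    using assms(6) unfolding locally_presentable_smc_def by blast+
  have loc_small: "locally_small \<kappa> V" and cocomplete: "cocomplete \<kappa> V"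
    using lp unfolding locally_presentable_def by blast+
  obtain \<X> where \<X>: "small \<kappa> \<X>" "\<forall>X \<in> \<X>. presentable_object \<kappa> lam V X"
    "\<forall>A \<in> Obj V. \<exists>R F \<iota>. directed_poset \<kappa> lam R \<and> is_functor (poset_cat R) V F \<and>
           (\<forall>j \<in> Field R. FOb F j \<in> \<X>) \<and> is_colimit V (poset_cat R) F A \<iota>"
    using lp unfolding locally_presentable_def by (elim conjE exE)
  have presD: "presentable_object \<kappa> lam V X \<Longrightarrow> X \<in> Obj V" for X by (simp add: presentable_object_def)
  have P: "small \<kappa> P" "One V \<in> P" "\<And>X. X \<in> P \<Longrightarrow> presentable_object \<kappa> lam V X"
    "\<And>X. presentable_object \<kappa> lam V X \<Longrightarrow> \<exists>Y \<in> P. isomorphic V X Y"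
    using assms(8) unfolding presentable_representatives_def by blast+
  obtain \<Y> where \<Y>: "small \<kappa> \<Y>" "\<forall>X \<in> \<Y>. generated_object \<kappa> \<mu> V (Inj V) X"
    "\<forall>A \<in> Obj V. \<exists>R F \<iota>. directed_diagram_in \<kappa> \<mu> V (Inj V) R F \<and>
           (\<forall>j \<in> Field R. FOb F j \<in> \<Y>) \<and> is_colimit V (poset_cat R) F A \<iota>"
    using assms(14) unfolding locally_generated_def by (elim conjE exE)
  have pretheory: "pretheory V P T J" using assms(9) by (simp add: lambda_ary_theory_def)
  \<comment> \<open>The adjunction that exhibits \<open>\<T>\<close> as a \<open>\<lambda>\<close>-ary theory need not be the one used to write equations.\<close>
  obtain F' \<eta>' \<epsilon>' where adj': "V_adjunction V (self_vcat V) (Alg V P T J) F' (forget V P T) \<eta>' \<epsilon>'"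
    and iso: "pretheory_iso V P T J (monad_pretheory_cat V P (adjunction_monad V F' (forget V P T) \<eta>' \<epsilon>'))
          (monad_pretheory_fun V (adjunction_monad V F' (forget V P T) \<eta>' \<epsilon>'))"
    using assms(9) unfolding lambda_ary_theory_def Let_def by blast
  interpret sym_monoidal_closed V by (rule smc)
  interpret cocomplete_category V \<kappa> by unfold_locales (fact universe cocomplete loc_small)+
  have pt_ext: "f = g" if "f \<in> Hom V X Y" "g \<in> Hom V X Y" "\<And>x. x \<in> Hom V (One V) X \<Longrightarrow> f \<cdot>\<^bsub>V\<^esub> x = g \<cdot>\<^bsub>V\<^esub> x" for f g X Y
  proof (rule points_jointly_epic[OF _ One_Obj that])
    fix e assume "e \<in> Arr V" "\<And>b. b \<in> Hom V (One V) (Cod V e) \<Longrightarrow> \<exists>a \<in> Hom V (One V) (Dom V e). e \<cdot>\<^bsub>V\<^esub> a = b"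
    hence "e \<in> Surj V" by (simp add: Surj_def)
    thus "epi_arrow V e" using assms(12) by (simp add: proper_system_def)
  qed
  have functors: "V_functor V (self_vcat V) (Alg V P T J) F'" "V_functor V (Alg V P T J) (self_vcat V) (forget V P T)"
    using adj' by (simp_all add: V_adjunction_def)
  have self_cat: "V_category V (self_vcat V)" using functors(1) by (simp add: V_functor_def)
  \<comment> \<open>Every algebra contains a \<open>V\<close>-functor on the opposite theory, and
    with it the fact that the opposite theory is a \<open>V\<close>-category. The free algebra on
    the unit serves as the algebra.\<close>
  have "VOb F' (One V) \<in> VObj (Alg V P T J)"
    using functors(1) One_Obj by (simp add: V_functor_def self_vcat_def)
  hence "is_algebra V P T J (VOb F' (One V))" by (simp add: Alg_def concrete_vcat_def)
  hence T_op: "V_category V (vcat_op V T)" by (auto simp: is_algebra_def V_functor_def split: prod.splits)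
  have P_Obj: "P \<subseteq> Obj V" using P(3) presD by blast
  have \<X>_Obj: "\<X> \<subseteq> Obj V" using \<X>(2) presD by blast
  have \<X>_colimit: "\<exists>(R :: 'a rel) F \<iota>. is_functor (poset_cat R) V F \<and> (\<forall>j \<in> Field R. FOb F j \<in> \<X>) \<and> is_colimit V (poset_cat R) F A \<iota>"
    if "A \<in> Obj V" for A using \<X>(3) that by blast
  interpret T_op: V_category V "vcat_op V T" by (rule T_op)
  interpret self: V_category V "self_vcat V" by (rule self_cat)
  interpret pretheory_base V \<kappa> \<X> P T J
    by unfold_locales (fact pt_ext \<X>(1) \<X>_Obj \<X>_colimit P_Obj P(1,2) pretheory functors(2))+
  \<comment> \<open>\<open>Fr\<close> refers to the adjunction of the statement, in which equations
    are written; the facts without prefix below belong to the adjunction given by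
    \<open>F'\<close>.\<close>
  interpret Fr: adjunction_base V \<kappa> \<X> P T J F \<eta> \<epsilon> by unfold_locales (rule assms(17))
  show ?thesis
  proof
    assume "\<exists>E. equational_theory \<kappa> V P T J F E \<and>
       (\<forall>(Y, X, p, q) \<in> E. generated_object \<kappa> \<mu> V (Inj V) X \<and> generated_object \<kappa> \<mu> V (Inj V) Y) \<and>
       L = equational_class V P T J F E"
    then obtain E where E: "equational_theory \<kappa> V P T J F E"
      "\<forall>(Y, X, p, q) \<in> E. generated_object \<kappa> \<mu> V (Inj V) X \<and> generated_object \<kappa> \<mu> V (Inj V) Y" "L = equational_class V P T J F E"
      by (elim exE conjE)
    show "mu_birkhoff_subcategory \<kappa> \<mu> V P T J L"
      unfolding E(3) by (rule Fr.mu_birkhoff_equational_class[OF E(1,2)]) (use assms(18) E(3) in simp)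
  next
    assume "mu_birkhoff_subcategory \<kappa> \<mu> V P T J L"
    hence prod: "\<And>(I :: 'a set) A Q p. small \<kappa> I \<Longrightarrow> \<forall>i \<in> I. A i \<in> L \<Longrightarrow> is_product \<A> I A Q p \<Longrightarrow> Q \<in> L"
      and sub: "\<And>A B f. f \<in> Hom \<A> A B \<Longrightarrow> mono_arrow \<A> f \<Longrightarrow> B \<in> L \<Longrightarrow> A \<in> L"
      and pure: "\<And>A B f. f \<in> Hom \<A> A B \<Longrightarrow> pure_epi \<kappa> \<mu> V (Inj V) (U f) \<Longrightarrow> A \<in> L \<Longrightarrow> B \<in> L"
      unfolding mu_birkhoff_subcategory_def birkhoff_subcategory_def by blast+
    interpret convenient_base V \<kappa> \<X> P T J F' \<eta>' \<epsilon>' lam \<mu>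
      by unfold_locales (fact adj' assms(3) bspec[OF \<X>(2)] P(3,4) tensor_pres bspec[OF \<X>(3)] iso assms(10-13))+
    have L_alg: "alg \<BB>" if "\<BB> \<in> L" for \<BB> using assms(18) that by (auto simp: full_replete_def)
    interpret birkhoff_class V \<kappa> \<X> P T J F' \<eta>' \<epsilon>' lam \<mu> "VOb F" Fr.et L
    proof unfold_locales
      show "alg (VOb F X)" if "X \<in> Obj V" for X by (rule Fr.Fo_alg[OF that])
      show "Fr.et X \<in> Hom V X (fst (VOb F X))" if "X \<in> Obj V" for X by (rule Fr.et_Hom[OF that])
      show "\<exists>h. ahom (VOb F X) \<AA> h \<and> h \<cdot>\<^bsub>V\<^esub> Fr.et X = f" if "alg \<AA>" "f \<in> Hom V X (fst \<AA>)" for \<AA> f X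
        using Fr.free_extension[OF that] by blast
      show "h = k" if "alg \<AA>" "X \<in> Obj V" "ahom (VOb F X) \<AA> h" "ahom (VOb F X) \<AA> k" "h \<cdot>\<^bsub>V\<^esub> Fr.et X = k \<cdot>\<^bsub>V\<^esub> Fr.et X" for \<AA> X h k
        by (rule Fr.free_unique[OF that])
      show "alg \<BB>" if "\<BB> \<in> L" for \<BB> by (rule L_alg[OF that])
      show "\<QQ> \<in> L" if "small \<kappa> (I :: 'a set)" "\<And>i. i \<in> I \<Longrightarrow> E i \<in> L" "alg \<QQ>" "is_product V I (\<lambda>i. fst (E i)) (fst \<QQ>) p"
        "\<And>i. i \<in> I \<Longrightarrow> ahom \<QQ> (E i) (p i)" for I E \<QQ> p
        by (rule prod[OF that(1) _ is_product_algebras[OF L_alg[OF that(2)] that(3-5)]]) (use that(2) in blast)+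
      show "\<AA> \<in> L" if "alg \<AA>" "\<BB> \<in> L" "ahom \<AA> \<BB> m" "mono_arrow V m" for \<AA> \<BB> m
      proof -
        note a = arr_of[OF that(1) L_alg[OF that(2)] that(3)]
        show ?thesis by (rule sub[OF a(1) mono_arrow_algebras[OF a(1)] that(2)]) (use a(2) that(4) in simp)
      qed
    qed
    \<comment> \<open>All equations between members of \<Y> that hold in \<open>L\<close>. Taking
      the small set \<Y> in place of all generated objects makes \<open>E\<close> small.\<close>
    define E where "E = {(Y, X, p, q). Y \<in> \<Y> \<and> X \<in> \<Y> \<and> p \<in> Hom \<A> (VOb F Y) (VOb F X) \<and> q \<in> Hom \<A> (VOb F Y) (VOb F X) \<and>
      (\<forall>B \<in> L. \<forall>h \<in> Hom \<A> (VOb F X) B. h \<cdot>\<^bsub>\<A>\<^esub> p = h \<cdot>\<^bsub>\<A>\<^esub> q)}"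
    have \<Y>_Obj: "Y \<in> Obj V" if "Y \<in> \<Y>" for Y using \<Y>(2) that by (simp add: generated_object_def)
    have "E \<subseteq> Sigma \<Y> (\<lambda>Y. Sigma \<Y> (\<lambda>X. Hom \<A> (VOb F Y) (VOb F X) \<times> Hom \<A> (VOb F Y) (VOb F X)))"
      unfolding E_def by (auto simp del: Hom_iff)
    hence "small \<kappa> E" by (rule small_mono[rotated]) (intro small_Sigma[OF universe] \<Y>(1) small_Hom_A)
    hence "equational_theory \<kappa> V P T J F E"
      unfolding equational_theory_def using \<Y>_Obj by (auto simp: E_def simp del: Hom_iff)
    moreover have "\<forall>(Y, X, p, q) \<in> E. generated_object \<kappa> \<mu> V (Inj V) X \<and> generated_object \<kappa> \<mu> V (Inj V) Y"
      using \<Y>(2) by (auto simp: E_def simp del: Hom_iff)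
    moreover have "L = equational_class V P T J F E"
    proof (intro subset_antisym subsetI)
      fix \<BB> assume B: "\<BB> \<in> L"
      show "\<BB> \<in> equational_class V P T J F E"
        unfolding Fr.equational_class_iff using L_alg[OF B] B by (auto simp: E_def simp del: Hom_iff)
    next
      fix \<AA> assume A: "\<AA> \<in> equational_class V P T J F E"
      hence Aa: "alg \<AA>" unfolding Fr.equational_class_iff by blast
      have A_eq: "h \<cdot>\<^bsub>\<A>\<^esub> p = h \<cdot>\<^bsub>\<A>\<^esub> q" if "(Y, X, p, q) \<in> E" "h \<in> Hom \<A> (VOb F X) \<AA>" for Y X p q h
        using A that unfolding Fr.equational_class_iff by blast
      show "\<AA> \<in> L"
      proof (rule in_class_if_equations[OF assms(2,15,16) _ \<Y>_Obj bspec[OF \<Y>(3)] Aa])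
        show "\<BB> \<in> L" if "\<CC> \<in> L" "alg \<BB>" "ahom \<CC> \<BB> f" "pure_epi \<kappa> \<mu> V (Inj V) f" for \<CC> \<BB> f
        proof -
          note a = arr_of[OF L_alg[OF that(1)] that(2,3)]
          show ?thesis by (rule pure[OF a(1) _ that(1)]) (simp only: a(2) that(4))
        qed
        fix X Y p q h assume XY: "X \<in> \<Y>" "Y \<in> \<Y>" and p: "ahom (VOb F Y) (VOb F X) p" and q: "ahom (VOb F Y) (VOb F X) q"
          and eq: "\<And>\<BB> k. \<BB> \<in> L \<Longrightarrow> ahom (VOb F X) \<BB> k \<Longrightarrow> k \<cdot>\<^bsub>V\<^esub> p = k \<cdot>\<^bsub>V\<^esub> q" and h: "ahom (VOb F X) \<AA> h"
        note FX = Fr.Fo_alg[OF \<Y>_Obj[OF XY(1)]] and FY = Fr.Fo_alg[OF \<Y>_Obj[OF XY(2)]]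
        note ap = arr_of[OF FY FX p] and aq = arr_of[OF FY FX q] and ah = arr_of[OF FX Aa h]
        have "k \<cdot>\<^bsub>\<A>\<^esub> arr_of (VOb F Y) (VOb F X) p = k \<cdot>\<^bsub>\<A>\<^esub> arr_of (VOb F Y) (VOb F X) q"
          if "\<BB> \<in> L" "k \<in> Hom \<A> (VOb F X) \<BB>" for \<BB> k
          by (rule U_faithful[OF Cmp_A(1)[OF ap(1) that(2)] Cmp_A(1)[OF aq(1) that(2)]])
            (simp only: Cmp_A(2)[OF ap(1) that(2)] Cmp_A(2)[OF aq(1) that(2)] ap(2) aq(2) eq[OF that(1) U_ahom[OF that(2)]])
        hence "(Y, X, arr_of (VOb F Y) (VOb F X) p, arr_of (VOb F Y) (VOb F X) q) \<in> E"
          unfolding E_def using XY ap(1) aq(1) by (simp del: Hom_iff)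
        from arg_cong[OF A_eq[OF this ah(1)], of U]
        show "h \<cdot>\<^bsub>V\<^esub> p = h \<cdot>\<^bsub>V\<^esub> q"
          unfolding Cmp_A(2)[OF ap(1) ah(1)] Cmp_A(2)[OF aq(1) ah(1)] ap(2) aq(2) ah(2) .
      qed
    qed
    ultimately show "\<exists>E. equational_theory \<kappa> V P T J F E \<and>
       (\<forall>(Y, X, p, q) \<in> E. generated_object \<kappa> \<mu> V (Inj V) X \<and> generated_object \<kappa> \<mu> V (Inj V) Y) \<and>
       L = equational_class V P T J F E" by blast
  qed
qed

end
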